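(* Let $S$ be a set and let $r\in F(S)'\setminus\{e\}$ be cyclically reduced. Then $$\|G_r\|=\inf_{\mathcal D\in\Delta(r),\ n(\mathcal D)\neq0}\frac{-2\cdot\chi^-(\Sigma_{\mathcal D})}{|n(\mathcal D)|}.$$
   Context: For a set $S$, $F(S)$ is the free group on $S$, $F(S)'$ its commutator subgroup and $e$ the neutral element. For $r\in F(S)'\setminus\{e\}$ let $G_r:=\langle S\mid r\rangle$. Let $P_r$ be the presentation complex (one vertex, one $1$-cell for each element of $S$, one $2$-cell attached along $r$) and let $X_r$ be a classifying space of $G_r$ obtained from $P_r$ by attaching cells of dimension $\ge 3$, with inclusion $c_r\colon P_r\to X_r$. Since $r\in F(S)'$, the $2$-cell of $P_r$ defines a class $\widetilde\alpha_r\in H_2(P_r;\mathbb Z)$; the fundamental class is $\alpha_r:=H_2(c_r;\mathbb Z)(\widetilde\alpha_r)\in H_2(X_r;\mathbb Z)=H_2(G_r;\mathbb Z)$ (this group is infinite cyclic, generated by $\alpha_r$), and $\alpha_{r,\mathbb R}\in H_2(G_r;\mathbb R)$ is its image under change of coefficients. The simplicial volume of $G_r$ is $\|G_r\|:=\|\alpha_{r,\mathbb R}\|_1$, where $\|\alpha\|_1$ is the infimum of the $\ell^1$-norms (with respect to the basis of singular simplices) of all real singular cycles representing $\alpha$. Van Kampen diagrams: a van Kampen diagram $\mathcal D$ for $r$ is a decomposition of an oriented closed surface $\Sigma_{\mathcal D}$ into finitely many polygons ("disks") glued along their edges, whose edges are labelled by non-empty words over $S^{\pm}$, such that the boundary of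 each disk, read counterclockwise (with respect to the orientation of $\Sigma_{\mathcal D}$), is labelled in a reduced way by the cyclic word $r$ or $r^{-1}$, and such that the labels of an edge as seen from its two adjacent sides are mutually inverse. The sign of a disk labelled by $r^{\epsilon}$ is $\epsilon\in\{+1,-1\}$; the degree $n(\mathcal D)$ is the sum of the signs of all disks. (It equals the degree $n(f_{\mathcal D},\Sigma_{\mathcal D})$ of the induced map $f_{\mathcal D}\colon\Sigma_{\mathcal D}\to P_r$ that maps edges according to labels and disks to the $2$-cell, i.e., the integer with $[\Sigma_{\mathcal D}]\mapsto n(f_{\mathcal D},\Sigma_{\mathcal D})\cdot\alpha_r$ in $H_2(G_r;\mathbb Z)$.) $\Delta(r)$ denotes the collection of all van Kampen diagrams for $r$. For a closed surface $\Sigma=\bigsqcup_{i=1}^n\Sigma_i$ with connected components $\Sigma_i$, $\chi^-(\Sigma):=\sum_{i=1}^n\min(0,\chi(\Sigma_i))$. *)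

theory Defs
  imports "HOL-Analysis.Analysis" "HOL-Homology.Homology" "HOL-Algebra.Generated_Groups" "HOL-Algebra.Coset"
begin

section \<open>Free groups and one-relator groups\<close>

text \<open>The letter \<open>(s, True)\<close> is the generator \<open>s\<close> and \<open>(s, False)\<close> is its formal inverse.
  Elements of the free group are the reduced words.\<close>

type_synonym 'a letter = "'a \<times> bool"
type_synonym 'a word = "'a letter list"

definition inverse_letter :: "'a letter \<Rightarrow> 'a letter" where
  "inverse_letter x = (fst x, \<not> snd x)"

definition inverse_word :: "'a word \<Rightarrow> 'a word" where
  "inverse_word w = rev (map inverse_letter w)"

definition reduced :: "'a word \<Rightarrow> bool" where
  "reduced = successively (\<lambda>x y. y \<noteq> inverse_letter x)"

definition cyclically_reduced :: "'a word \<Rightarrow> bool" where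
  "cyclically_reduced w \<longleftrightarrow> reduced w \<and> (w \<noteq> [] \<longrightarrow> hd w \<noteq> inverse_letter (last w))"

definition cons_letter :: "'a letter \<Rightarrow> 'a word \<Rightarrow> 'a word" where
  "cons_letter x w = (if w \<noteq> [] \<and> hd w = inverse_letter x then tl w else x # w)"

definition reduce_word :: "'a word \<Rightarrow> 'a word" where
  "reduce_word w = foldr cons_letter w []"

definition free_group :: "'a set \<Rightarrow> 'a word monoid" where
  "free_group S =
     \<lparr>carrier = {w. fst ` set w \<subseteq> S \<and> reduced w},
      mult = (\<lambda>u v. reduce_word (u @ v)),
      one = []\<rparr>"

definition one_relator_group :: "'a set \<Rightarrow> 'a word \<Rightarrow> 'a word set monoid" where
  "one_relator_group S r =
     free_group S Mod
       generate (free_group S)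
         ((\<lambda>g. g \<otimes>\<^bsub>free_group S\<^esub> r \<otimes>\<^bsub>free_group S\<^esub> inv\<^bsub>free_group S\<^esub> g)
            ` carrier (free_group S))"

lemma inverse_letter_inverse_letter [simp]: "inverse_letter (inverse_letter x) = x"
  by (simp add: inverse_letter_def)

lemma fst_inverse_letter [simp]: "fst (inverse_letter x) = fst x"
  by (simp add: inverse_letter_def)

lemma inverse_letter_swap: "y = inverse_letter x \<longleftrightarrow> x = inverse_letter y"
  by (auto simp: inverse_letter_def prod_eq_iff)

lemma reduced_Nil [simp]: "reduced []"
  by (simp add: reduced_def)

lemma reduced_Cons:
  "reduced (x # w) \<longleftrightarrow> reduced w \<and> (w \<noteq> [] \<longrightarrow> hd w \<noteq> inverse_letter x)"
  unfolding reduced_def by (cases w) auto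

lemma reduced_cons_letter: "reduced w \<Longrightarrow> reduced (cons_letter x w)"
  by (cases w) (auto simp: cons_letter_def reduced_Cons)

lemma reduced_foldr: "reduced w \<Longrightarrow> reduced (foldr cons_letter u w)"
  by (induction u) (auto simp: reduced_cons_letter)

lemma letters_cons_letter: "fst ` set (cons_letter x w) \<subseteq> insert (fst x) (fst ` set w)"
  by (cases w) (auto simp: cons_letter_def)

lemma letters_foldr: "fst ` set (foldr cons_letter u w) \<subseteq> fst ` set u \<union> fst ` set w"
proof (induction u)
  case (Cons x u)
  then show ?case
    using subset_trans[OF letters_cons_letter[of x "foldr cons_letter u w"]
      insert_mono[OF Cons.IH]]
    by simp
qed auto

lemma foldr_reduced: "reduced w \<Longrightarrow> foldr cons_letter w [] = w"
  by (induction w) (auto simp: reduced_Cons cons_letter_def)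

lemma cons_letter_cancel:
  "reduced w \<Longrightarrow> cons_letter x (cons_letter (inverse_letter x) w) = w"
  by (cases w) (auto simp: cons_letter_def reduced_Cons)

lemma foldr_cons_letter:
  assumes "reduced w" "reduced u"
  shows "foldr cons_letter (cons_letter x u) w = cons_letter x (foldr cons_letter u w)"
proof (cases "u \<noteq> [] \<and> hd u = inverse_letter x")
  case True
  then obtain u' where u: "u = inverse_letter x # u'"
    by (cases u) auto
  then show ?thesis
    using cons_letter_cancel[OF reduced_foldr[OF assms(1)], of x u']
    by (simp add: cons_letter_def)
next
  case False
  then have "cons_letter x u = x # u"
    by (auto simp: cons_letter_def)
  then show ?thesis
    by simp
qed

lemma foldr_foldr:
  assumes "reduced w" "reduced v"
  shows "foldr cons_letter (foldr cons_letter u v) w = foldr cons_letter u (foldr cons_letter v w)"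
  by (induction u) (simp_all add: foldr_cons_letter assms reduced_foldr)

lemma foldr_inverse:
  "reduced w \<Longrightarrow> foldr cons_letter (inverse_word u) (foldr cons_letter u w) = w"
proof (induction u)
  case (Cons x u)
  then show ?case
    using cons_letter_cancel[OF reduced_foldr[OF Cons.prems], of "inverse_letter x" u]
    by (simp add: inverse_word_def)
qed (simp add: inverse_word_def)

lemma reduced_rev_inverse: "reduced w \<Longrightarrow> reduced (inverse_word w)"
  unfolding reduced_def inverse_word_def rev_map[symmetric] successively_map successively_rev
  by (erule successively_mono) (metis inverse_letter_swap)

lemma mult_free_group:
  "reduced v \<Longrightarrow> u \<otimes>\<^bsub>free_group S\<^esub> v = foldr cons_letter u v"
  by (simp add: free_group_def reduce_word_def foldr_reduced)

lemma group_free_group: "group (free_group S)"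
proof (rule groupI)
  fix u v assume u: "u \<in> carrier (free_group S)" and v: "v \<in> carrier (free_group S)"
  then have "fst ` set (foldr cons_letter u v) \<subseteq> S"
    using subset_trans[OF letters_foldr[of u v]] by (simp add: free_group_def)
  moreover have "reduced v"
    using v by (simp add: free_group_def)
  ultimately have "foldr cons_letter u v \<in> carrier (free_group S)"
    by (simp add: free_group_def reduced_foldr)
  then show "u \<otimes>\<^bsub>free_group S\<^esub> v \<in> carrier (free_group S)"
    by (simp add: mult_free_group \<open>reduced v\<close>)
next
  show "\<one>\<^bsub>free_group S\<^esub> \<in> carrier (free_group S)"
    by (simp add: free_group_def)
next
  fix u v w
  assume "u \<in> carrier (free_group S)" "v \<in> carrier (free_group S)" "w \<in> carrier (free_group S)"
  then have "reduced u" "reduced v" "reduced w"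
    by (auto simp: free_group_def)
  then show "u \<otimes>\<^bsub>free_group S\<^esub> v \<otimes>\<^bsub>free_group S\<^esub> w = u \<otimes>\<^bsub>free_group S\<^esub> (v \<otimes>\<^bsub>free_group S\<^esub> w)"
    by (simp add: mult_free_group reduced_foldr foldr_foldr)
next
  fix u assume "u \<in> carrier (free_group S)"
  then show "\<one>\<^bsub>free_group S\<^esub> \<otimes>\<^bsub>free_group S\<^esub> u = u"
    by (simp add: free_group_def reduce_word_def foldr_reduced)
next
  fix u assume u: "u \<in> carrier (free_group S)"
  then have "inverse_word u \<otimes>\<^bsub>free_group S\<^esub> u = \<one>\<^bsub>free_group S\<^esub>"
    using foldr_inverse[of "[]" u] by (simp add: free_group_def reduce_word_def foldr_reduced)
  moreover have "inverse_word u \<in> carrier (free_group S)"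
    using u reduced_rev_inverse[of u]
    by (simp add: free_group_def inverse_word_def image_subset_iff)
  ultimately show "\<exists>v\<in>carrier (free_group S). v \<otimes>\<^bsub>free_group S\<^esub> u = \<one>\<^bsub>free_group S\<^esub>"
    by blast
qed


section \<open>Attaching cells\<close>

text \<open>The space obtained from \<open>A\<close> by attaching one copy of the cell \<open>D\<close> for every \<open>i \<in> I\<close>,
  presented through its characteristic maps \<open>\<Phi> i\<close>. Under \<open>characteristic_maps\<close>, where \<open>B\<close> is the
  boundary of \<open>D\<close>, this is the pushout of \<open>A\<close> and \<open>I \<times> D\<close> along the attaching maps
  \<open>\<Phi> i\<close> restricted to \<open>B\<close>.\<close>

definition characteristic_maps ::
  "'x topology \<Rightarrow> 'd topology \<Rightarrow> 'd set \<Rightarrow> 'i set \<Rightarrow> ('i \<Rightarrow> 'd \<Rightarrow> 'x) \<Rightarrow> bool" where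
  "characteristic_maps A D B I \<Phi> \<longleftrightarrow>
     (\<forall>i\<in>I. continuous_map (subtopology D B) A (\<Phi> i)) \<and>
     inj_on (\<lambda>(i, z). \<Phi> i z) (I \<times> (topspace D - B)) \<and>
     (\<forall>i\<in>I. \<forall>z\<in>topspace D - B. \<Phi> i z \<notin> topspace A)"

definition attach_cells ::
  "'x topology \<Rightarrow> 'd topology \<Rightarrow> 'i set \<Rightarrow> ('i \<Rightarrow> 'd \<Rightarrow> 'x) \<Rightarrow> 'x topology" where
  "attach_cells A D I \<Phi> = topology (\<lambda>U.
     U \<subseteq> topspace A \<union> (\<Union>i\<in>I. \<Phi> i ` topspace D) \<and>
     openin A (U \<inter> topspace A) \<and>
     (\<forall>i\<in>I. openin D {z \<in> topspace D. \<Phi> i z \<in> U}))"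

lemma openin_attach_cells:
  "openin (attach_cells A D I \<Phi>) U \<longleftrightarrow>
     U \<subseteq> topspace A \<union> (\<Union>i\<in>I. \<Phi> i ` topspace D) \<and>
     openin A (U \<inter> topspace A) \<and>
     (\<forall>i\<in>I. openin D {z \<in> topspace D. \<Phi> i z \<in> U})"
proof -
  let ?C = "topspace A \<union> (\<Union>i\<in>I. \<Phi> i ` topspace D)"
  let ?L = "\<lambda>U. U \<subseteq> ?C \<and> openin A (U \<inter> topspace A) \<and>
     (\<forall>i\<in>I. openin D {z \<in> topspace D. \<Phi> i z \<in> U})"
  have "istopology ?L"
    unfolding istopology_def
  proof (intro conjI allI impI)
    fix U V assume U: "?L U" and V: "?L V"
    have "(U \<inter> V) \<inter> topspace A = (U \<inter> topspace A) \<inter> (V \<inter> topspace A)"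
      and "\<And>i. {z \<in> topspace D. \<Phi> i z \<in> U \<inter> V} =
        {z \<in> topspace D. \<Phi> i z \<in> U} \<inter> {z \<in> topspace D. \<Phi> i z \<in> V}"
      by auto
    then show "U \<inter> V \<subseteq> ?C" "openin A ((U \<inter> V) \<inter> topspace A)"
      "\<forall>i\<in>I. openin D {z \<in> topspace D. \<Phi> i z \<in> U \<inter> V}"
      using U V by auto
  next
    fix \<U> assume *: "\<forall>U\<in>\<U>. ?L U"
    have "\<Union>\<U> \<inter> topspace A = (\<Union>U\<in>\<U>. U \<inter> topspace A)"
      and "\<And>i. {z \<in> topspace D. \<Phi> i z \<in> \<Union>\<U>} = (\<Union>U\<in>\<U>. {z \<in> topspace D. \<Phi> i z \<in> U})"
      by auto
    then show "\<Union>\<U> \<subseteq> ?C" "openin A (\<Union>\<U> \<inter> topspace A)"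
      "\<forall>i\<in>I. openin D {z \<in> topspace D. \<Phi> i z \<in> \<Union>\<U>}"
      using * by (auto intro!: openin_Union simp del: UN_simps)
  qed
  then show ?thesis
    unfolding attach_cells_def by (simp add: topology_inverse')
qed

definition ndisk :: "nat \<Rightarrow> (nat \<Rightarrow> real) topology" where
  "ndisk n = subtopology (Euclidean_space n) {x. (\<Sum>i<n. x i ^ 2) \<le> 1}"

text \<open>\<open>X\<close> arises from \<open>A\<close> by attaching, inductively over \<open>k > n\<close>, cells of dimension \<open>k\<close>:
  \<open>X\<close> is the colimit of the skeleta \<open>X\<^sub>n = A \<subseteq> X\<^sub>n\<^sub>+\<^sub>1 \<subseteq> \<dots>\<close>. Indexing the cells by points of \<open>X\<close>
  (such as their centres) is no restriction.\<close>

definition cells_attached_above :: "nat \<Rightarrow> 'x topology \<Rightarrow> 'x topology \<Rightarrow> bool" where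
  "cells_attached_above n A X \<longleftrightarrow>
     (\<exists>Xs. Xs n = A \<and>
        (\<forall>k\<ge>n. \<exists>(I :: 'x set) \<Phi>.
           characteristic_maps (Xs k) (ndisk (Suc k)) (topspace (nsphere k)) I \<Phi> \<and>
           Xs (Suc k) = attach_cells (Xs k) (ndisk (Suc k)) I \<Phi>) \<and>
        (\<forall>U. openin X U \<longleftrightarrow>
           U \<subseteq> (\<Union>k\<in>{n..}. topspace (Xs k)) \<and> (\<forall>k\<ge>n. openin (Xs k) (U \<inter> topspace (Xs k)))))"


section \<open>The presentation complex\<close>

datatype 'a cell_point = Vertex | Edge_Point 'a real | Face_Point complex

definition edge_map :: "'a \<Rightarrow> real \<Rightarrow> 'a cell_point" where
  "edge_map s t = (if 0 < t \<and> t < 1 then Edge_Point s t else Vertex)"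

definition rose :: "'a set \<Rightarrow> 'a cell_point topology" where
  "rose S = attach_cells (discrete_topology {Vertex}) (top_of_set {0..1::real}) S edge_map"

text \<open>The loop spelling \<open>r\<close> with constant speed over the parameter interval \<open>[0, 1)\<close>.\<close>

definition word_loop :: "'a word \<Rightarrow> real \<Rightarrow> 'a cell_point" where
  "word_loop r t =
     (let u = t * real (length r); (s, positive) = r ! nat \<lfloor>u\<rfloor>
      in edge_map s (if positive then frac u else 1 - frac u))"

definition face_map :: "'a word \<Rightarrow> complex \<Rightarrow> 'a cell_point" where
  "face_map r z = (if norm z < 1 then Face_Point z else word_loop r (Arg2pi z / (2 * pi)))"

definition presentation_complex :: "'a set \<Rightarrow> 'a word \<Rightarrow> 'a cell_point topology" where
  "presentation_complex S r =
     attach_cells (rose S) (top_of_set (cball 0 1 :: complex set)) {()} (\<lambda>_. face_map r)"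


section \<open>Classifying spaces\<close>

definition loops :: "'x topology \<Rightarrow> 'x \<Rightarrow> (real \<Rightarrow> 'x) set" where
  "loops X x = {g. pathin X g \<and> g 0 = x \<and> g 1 = x}"

definition loop_homotopy :: "'x topology \<Rightarrow> 'x \<Rightarrow> ((real \<Rightarrow> 'x) \<times> (real \<Rightarrow> 'x)) set" where
  "loop_homotopy X x =
     {(f, g). f \<in> loops X x \<and> g \<in> loops X x \<and>
        homotopic_with (\<lambda>h. h 0 = x \<and> h 1 = x) (top_of_set {0..1}) X f g}"

definition concat_loops :: "(real \<Rightarrow> 'x) \<Rightarrow> (real \<Rightarrow> 'x) \<Rightarrow> real \<Rightarrow> 'x" where
  "concat_loops f g t = (if t \<le> 1/2 then f (2 * t) else g (2 * t - 1))"

definition fundamental_group :: "'x topology \<Rightarrow> 'x \<Rightarrow> (real \<Rightarrow> 'x) set monoid" where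
  "fundamental_group X x =
     \<lparr>carrier = loops X x // loop_homotopy X x,
      mult = (\<lambda>F G. \<Union>f\<in>F. \<Union>g\<in>G. loop_homotopy X x `` {concat_loops f g}),
      one = loop_homotopy X x `` {\<lambda>_. x}\<rparr>"

text \<open>For the CW complexes considered below, this characterises the classifying spaces: the higher
  homotopy groups vanish if and only if all maps from spheres of dimension at least 2 are
  (freely) null-homotopic.\<close>

definition classifying_space :: "('g, 'm) monoid_scheme \<Rightarrow> 'x topology \<Rightarrow> bool" where
  "classifying_space G X \<longleftrightarrow>
     topspace X \<noteq> {} \<and> path_connected_space X \<and>
     (\<forall>x\<in>topspace X. fundamental_group X x \<cong> G) \<and>
     (\<forall>n\<ge>2. \<forall>f. continuous_map (nsphere n) X f \<longrightarrow>
        (\<exists>a. homotopic_with (\<lambda>_. True) (nsphere n) X f (\<lambda>_. a)))"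

definition classifying_extension ::
  "'a set \<Rightarrow> 'a word \<Rightarrow> 'x topology \<Rightarrow> ('a cell_point \<Rightarrow> 'x) \<Rightarrow> bool" where
  "classifying_extension S r X c \<longleftrightarrow>
     classifying_space (one_relator_group S r) X \<and>
     (\<exists>A. homeomorphic_map (presentation_complex S r) A c \<and> cells_attached_above 2 A X)"


section \<open>The fundamental class\<close>

text \<open>Radial homeomorphism from the standard 2-simplex to the unit disk, mapping the vertices to
  the third roots of unity in counterclockwise order. It represents the fundamental class of the
  disk relative to its boundary circle.\<close>

definition disk_simplex :: "(nat \<Rightarrow> real) \<Rightarrow> complex" where
  "disk_simplex = (\<lambda>x\<in>standard_simplex 2.
     of_real (1 - 3 * Min {x 0, x 1, x 2}) *
     sgn (\<Sum>j\<le>2. of_real (x j) * cis (2 * pi * real j / 3)))"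

definition disk_class :: "complex chain set" where
  "disk_class =
     homologous_rel_set 2 (top_of_set (cball 0 1)) (sphere 0 1) (frag_of disk_simplex)"

text \<open>The class defined by the 2-cell: its image relative to the 1-skeleton is the class of the
  characteristic map. As the 1-skeleton has no second homology, there is at most one such class;
  it exists because \<open>r\<close> has vanishing exponent sums.\<close>

definition two_cell_class :: "'a set \<Rightarrow> 'a word \<Rightarrow> 'a cell_point chain set" where
  "two_cell_class S r = (THE \<alpha>.
     \<alpha> \<in> carrier (homology_group 2 (presentation_complex S r)) \<and>
     hom_induced 2 (presentation_complex S r) {}
       (presentation_complex S r) (topspace (rose S)) id \<alpha> =
     hom_induced 2 (top_of_set (cball 0 1)) (sphere 0 1)
       (presentation_complex S r) (topspace (rose S)) (face_map r) disk_class)"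

definition fundamental_class ::
  "'a set \<Rightarrow> 'a word \<Rightarrow> 'x topology \<Rightarrow> ('a cell_point \<Rightarrow> 'x) \<Rightarrow> 'x chain set" where
  "fundamental_class S r X c =
     hom_induced 2 (presentation_complex S r) {} X {} c (two_cell_class S r)"


section \<open>Real singular homology and the \<open>\<ell>\<^sup>1\<close>-seminorm\<close>

type_synonym 'x real_chain = "((nat \<Rightarrow> real) \<Rightarrow> 'x) \<Rightarrow>\<^sub>0 real"

definition real_singular_chain :: "nat \<Rightarrow> 'x topology \<Rightarrow> 'x real_chain \<Rightarrow> bool" where
  "real_singular_chain p X c \<longleftrightarrow> Poly_Mapping.keys c \<subseteq> singular_simplex_set p X"

definition real_chain_boundary :: "nat \<Rightarrow> 'x real_chain \<Rightarrow> 'x real_chain" where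
  "real_chain_boundary p c =
     (if p = 0 then 0
      else \<Sum>\<sigma>\<in>Poly_Mapping.keys c. \<Sum>k\<le>p.
        Poly_Mapping.single (singular_face p k \<sigma>) ((-1) ^ k * Poly_Mapping.lookup c \<sigma>))"

definition real_singular_cycle :: "nat \<Rightarrow> 'x topology \<Rightarrow> 'x real_chain \<Rightarrow> bool" where
  "real_singular_cycle p X c \<longleftrightarrow> real_singular_chain p X c \<and> real_chain_boundary p c = 0"

definition real_homologous :: "nat \<Rightarrow> 'x topology \<Rightarrow> 'x real_chain \<Rightarrow> 'x real_chain \<Rightarrow> bool" where
  "real_homologous p X c d \<longleftrightarrow>
     (\<exists>e. real_singular_chain (Suc p) X e \<and> real_chain_boundary (Suc p) e = c - d)"

text \<open>As in the library, a homology class is the set of all cycles representing it.\<close>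

definition change_of_coefficients :: "nat \<Rightarrow> 'x topology \<Rightarrow> 'x chain set \<Rightarrow> 'x real_chain set" where
  "change_of_coefficients p X \<alpha> =
     {c. real_singular_cycle p X c \<and>
         (\<exists>z\<in>\<alpha>. real_homologous p X c (Poly_Mapping.map real_of_int z))}"

definition l1_norm :: "'x real_chain \<Rightarrow> real" where
  "l1_norm c = (\<Sum>\<sigma>\<in>Poly_Mapping.keys c. \<bar>Poly_Mapping.lookup c \<sigma>\<bar>)"

definition l1_seminorm :: "'x real_chain set \<Rightarrow> real" where
  "l1_seminorm \<alpha> = (INF c\<in>\<alpha>. l1_norm c)"

definition simplicial_volume ::
  "'a set \<Rightarrow> 'a word \<Rightarrow> 'x topology \<Rightarrow> ('a cell_point \<Rightarrow> 'x) \<Rightarrow> real" where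
  "simplicial_volume S r X c =
     l1_seminorm (change_of_coefficients 2 X (fundamental_class S r X c))"


section \<open>Van Kampen diagrams\<close>

text \<open>A decomposition of an oriented closed surface into polygons, given by its gluing data:
  \<open>disks\<close> lists for each polygon the labels of its sides in counterclockwise order, and \<open>glue\<close>
  pairs the sides (the \<open>j\<close>-th side of the \<open>i\<close>-th polygon being \<open>(i, j)\<close>), identifying paired sides
  by a homeomorphism that reverses their counterclockwise directions. Every fixed-point free
  pairing of all sides yields an oriented closed surface, possibly disconnected, and each
  decomposition arises in this way.\<close>

record 'a diagram =
  disks :: "'a word list list"
  glue :: "nat \<times> nat \<Rightarrow> nat \<times> nat"

definition sides :: "'a diagram \<Rightarrow> (nat \<times> nat) set" where
  "sides D = {(i, j). i < length (disks D) \<and> j < length (disks D ! i)}"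

definition side_label :: "'a diagram \<Rightarrow> nat \<times> nat \<Rightarrow> 'a word" where
  "side_label D = (\<lambda>(i, j). disks D ! i ! j)"

definition next_side :: "'a diagram \<Rightarrow> nat \<times> nat \<Rightarrow> nat \<times> nat" where
  "next_side D = (\<lambda>(i, j). (i, Suc j mod length (disks D ! i)))"

text \<open>Equality of cyclic words without any cancellation: the labels are read in a reduced way.\<close>

definition reads_cyclic_word :: "'a word list \<Rightarrow> 'a word \<Rightarrow> bool" where
  "reads_cyclic_word d w \<longleftrightarrow> (\<exists>n. concat d = rotate n w)"

definition van_kampen_diagrams :: "'a word \<Rightarrow> 'a diagram set" where
  "van_kampen_diagrams r = {D.
     (\<forall>d\<in>set (disks D). d \<noteq> [] \<and> [] \<notin> set d \<and>
        (reads_cyclic_word d r \<or> reads_cyclic_word d (inverse_word r))) \<and>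
     (\<forall>a\<in>sides D. glue D a \<in> sides D \<and> glue D a \<noteq> a \<and> glue D (glue D a) = a \<and>
        side_label D (glue D a) = inverse_word (side_label D a))}"

text \<open>A non-trivial \<open>r\<close> is not conjugate to its inverse, so the sign is unambiguous.\<close>

definition disk_sign :: "'a word \<Rightarrow> 'a word list \<Rightarrow> int" where
  "disk_sign r d = (if reads_cyclic_word d r then 1 else -1)"

definition diagram_degree :: "'a word \<Rightarrow> 'a diagram \<Rightarrow> int" where
  "diagram_degree r D = (\<Sum>d\<leftarrow>disks D. disk_sign r d)"

text \<open>Each side stands for its initial corner. Since gluing reverses directions, the initial corner
  of \<open>a\<close> is identified with the terminal corner of \<open>glue D a\<close>.\<close>

definition same_vertex :: "'a diagram \<Rightarrow> ((nat \<times> nat) \<times> (nat \<times> nat)) set" where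
  "same_vertex D =
     {(a, b). equivclp (\<lambda>a b. a \<in> sides D \<and> b = next_side D (glue D a)) a b}"

definition same_component :: "'a diagram \<Rightarrow> (nat \<times> nat) set" where
  "same_component D =
     {(i, j). equivclp (\<lambda>i j. \<exists>a\<in>sides D. i = fst a \<and> j = fst (glue D a)) i j}"

text \<open>A connected component of the surface is given by the set of its disks.\<close>

definition components :: "'a diagram \<Rightarrow> nat set set" where
  "components D = {..<length (disks D)} // same_component D"

definition sides_of :: "'a diagram \<Rightarrow> nat set \<Rightarrow> (nat \<times> nat) set" where
  "sides_of D K = {a \<in> sides D. fst a \<in> K}"

definition euler_characteristic :: "'a diagram \<Rightarrow> nat set \<Rightarrow> int" where
  "euler_characteristic D K =
     int (card (sides_of D K // same_vertex D))
     - int (card ((\<lambda>a. {a, glue D a}) ` sides_of D K))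
     + int (card K)"

definition chi_minus :: "'a diagram \<Rightarrow> int" where
  "chi_minus D = (\<Sum>K\<in>components D. min 0 (euler_characteristic D K))"

end

(* A relation of degree n is a product of conjugates of r and of its inverse with exponents adding up to n;
  the Magnus expansion shows that n depends only on the value of the product in the free group. If the product
  of k commutators is a relation of degree n, folding a polygon gives a diagram of genus k and degree n, and
  conversely. Such an equation also fills a fan of about 4 k triangles to a cycle that represents n times the
  class; taking d-th powers removes the additive constant, which bounds the norm from above. For the other
  bound, a real cycle is approximated by integral ones whose triangles are glued to a surface; a Z-valued
  central extension of G_r, glued from cocycles on the cells, reads off the degree. *)
theory Submission
 imports Defs "HOL-Analysis.Kronecker_Approximation_Theorem"
begin

section \<open>Free groups and relation degrees\<close>

text \<open>Both inequalities pass through one kind of data: a relation of degree n that is a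
  product of k commutators. A surface of genus k >= 1 has - 2 chi = 4 k - 4, so both sides of the
  theorem are compared with the infimum of max 0 (4 k - 4) / |n|. For the lower bound, the degree of
  a surface glued from singular triangles has to be read off in X. The extension in question is the
  free group modulo the relations of degree 0, in which \<open>r\<close> is central and of infinite
  order. Choosing a word for every element of the quotient turns each triangle into a relation, and
  its degree is the value of the extension cocycle. This requires a labelling of the paths of X by
  group elements with known values on the generators. An abstract isomorphism with the fundamental
  group does not supply it; hence nonabelian 1-cocycles are extended from the rose, cell by cell.
  The glued surface may be disconnected, but degrees and numbers of triangles add up over its
  components, so one component of nonzero degree has at most the ratio of the whole. A component of
  T triangles has chi >= 1 - T / 2, which bounds 4 k - 4 by T.\<close>

typedef 'a fg = "{w :: 'a word. reduced w}" by (rule exI[of _ "[]"]) simp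

definition ev :: "'a word => 'a fg" where
 "ev w = Abs_fg (reduce_word w)"

lemma reduced_reduce_word [simp]: "reduced (reduce_word w)" by (simp add: reduce_word_def reduced_foldr)

lemma reduced_Rep_fg [simp]: "reduced (Rep_fg x)" using Rep_fg by blast

lemma Rep_ev [simp]: "Rep_fg (ev w) = reduce_word w" by (simp add: ev_def Abs_fg_inverse)

lemma reduce_word_reduced [simp]: "reduced w ==> reduce_word w = w" by (simp add: reduce_word_def foldr_reduced)

lemma ev_Rep [simp]: "ev (Rep_fg x) = x" by (simp add: ev_def Rep_fg_inverse)

lemma ev_eq_iff: "ev u = ev v \<longleftrightarrow> reduce_word u = reduce_word v" by (metis Rep_ev ev_def)

lemma foldr_reduce_word: "reduced w ==> foldr cons_letter (reduce_word u) w = foldr cons_letter u w"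
 by (simp add: reduce_word_def foldr_foldr)

text \<open>The class \<open>group_add\<close> does not ask for commutativity; in additive notation
  boundary words are evaluated by \<open>sum_list\<close>.\<close>

instantiation fg :: (type) group_add
begin

definition "x + y = ev (Rep_fg x @ Rep_fg y)"
definition "0 = ev []"
definition "- x = ev (inverse_word (Rep_fg x))"
definition "x - y = x + - (y :: 'a fg)"

lemma Rep_plus_fg: "Rep_fg (x + y) = foldr cons_letter (Rep_fg x) (Rep_fg y)" by (simp add: plus_fg_def reduce_word_def foldr_reduced)

instance
proof
 fix a b c :: "'a fg"
 have "Rep_fg (a + b + c) = Rep_fg (a + (b + c))" by (simp add: Rep_plus_fg foldr_foldr)
 thus "a + b + c = a + (b + c)" by (simp add: Rep_fg_inject)
 show "0 + a = a" "a + 0 = a" by (simp_all add: plus_fg_def zero_fg_def)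
 show "- a + a = 0" using foldr_inverse[of "[]" "Rep_fg a"]
  by (simp add: plus_fg_def uminus_fg_def zero_fg_def ev_eq_iff reduce_word_def foldr_foldr
    foldr_reduced reduced_rev_inverse)
qed (simp add: minus_fg_def)

end

lemma ev_append [simp]: "ev (u @ v) = ev u + ev v"
proof -
 have "Rep_fg (ev (u @ v)) = Rep_fg (ev u + ev v)" by (simp add: Rep_plus_fg foldr_reduce_word) (simp add: reduce_word_def)
 thus ?thesis by (simp only: Rep_fg_inject)
qed

lemma ev_Nil [simp]: "ev [] = 0" by (simp add: zero_fg_def)

lemma Rep_zero_fg [simp]: "Rep_fg 0 = []" by (simp add: zero_fg_def reduce_word_def del: ev_Nil)

lemma ev_Cons: "w ~= [] ==> ev (x # w) = ev [x] + ev w" using ev_append[of "[x]" w] by simp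

lemma ev_inverse_word [simp]: "ev (inverse_word u) = - ev u"
proof -
 have "ev (inverse_word u @ u) = 0" using foldr_inverse[of "[]" u] by (simp only: zero_fg_def ev_eq_iff) (simp add: reduce_word_def)
 thus ?thesis by (simp add: eq_neg_iff_add_eq_0)
qed

lemma inverse_word_simps [simp]:
 "inverse_word [] = []" "inverse_word [x] = [inverse_letter x]"
 "inverse_word (u @ v) = inverse_word v @ inverse_word u" "inverse_word (inverse_word u) = u"
 by (simp_all add: inverse_word_def rev_map map_idI)

lemma ev_inverse_letter: "ev [inverse_letter x] = - ev [x]" by (metis ev_inverse_word inverse_word_simps(2))

text \<open>A cyclic word has a value only up to conjugation, and degrees of relations are invariant
  under conjugation (\<open>Rdeg_conj'\<close>).\<close>

lemma ev_rotate: "\<exists>u. ev (rotate n w) = - u + ev w + u"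
proof (intro exI)
 have "ev w = ev (take (n mod length w) w) + ev (drop (n mod length w) w)" by (metis append_take_drop_id ev_append)
 thus "ev (rotate n w) = - ev (take (n mod length w) w) + ev w + ev (take (n mod length w) w)"
  by (simp add: rotate_drop_take add.assoc[symmetric])
qed

text \<open>The degree is an index of the derivation, not a function of the element: that the
  element determines it is a theorem about free groups, \<open>Rdeg_unique\<close>. The elements of
  degree 0 form a normal subgroup, modulo which \<open>r\<close> is central.\<close>

inductive Rdeg :: "'g::group_add => 'g => int => bool" for r where
 zero: "Rdeg r 0 0"
| pos: "Rdeg r w n ==> Rdeg r (u + r - u + w) (n + 1)"
| neg: "Rdeg r w n ==> Rdeg r (u - r - u + w) (n - 1)"

lemma Rdeg_rel: "Rdeg r r 1" "Rdeg r (- r) (- 1)" using Rdeg.pos[OF Rdeg.zero, of r 0] Rdeg.neg[OF Rdeg.zero, of r 0] by simp_all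

lemma Rdeg_add: "Rdeg r v m ==> Rdeg r w n ==> Rdeg r (v + w) (m + n)"
proof (induction rule: Rdeg.induct)
 case (pos v m u)
 from Rdeg.pos[OF pos.IH[OF pos.prems], of u] show ?case by (simp add: add.assoc ac_simps)
next
 case (neg v m u)
 from Rdeg.neg[OF neg.IH[OF neg.prems], of u] show ?case by (simp add: add.assoc algebra_simps)
qed simp

lemma Rdeg_conj: "Rdeg r v m ==> Rdeg r (u + v - u) m"
proof (induction rule: Rdeg.induct)
 case (pos v m w)
 have "u + (w + r - w + v) - u = (u + w) + r - (u + w) + (u + v - u)"
  by (simp add: add.assoc diff_conv_add_uminus minus_add del: add_uminus_conv_diff)
 with Rdeg.pos[OF pos.IH, of "u + w"] show ?case by simp
next
 case (neg v m w)
 have "u + (w - r - w + v) - u = (u + w) - r - (u + w) + (u + v - u)"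
  by (simp add: add.assoc diff_conv_add_uminus minus_add del: add_uminus_conv_diff)
 with Rdeg.neg[OF neg.IH, of "u + w"] show ?case by simp
qed (simp add: Rdeg.zero)

lemma Rdeg_conj': "Rdeg r v m ==> Rdeg r (- u + v + u) m" using Rdeg_conj[of r v m "- u"] by simp

lemma Rdeg_uminus: "Rdeg r v m ==> Rdeg r (- v) (- m)"
proof (induction rule: Rdeg.induct)
 case (pos v m u)
 have "- (u + r - u + v) = - v + (u - r - u)" by (simp add: minus_add add.assoc diff_conv_add_uminus del: add_uminus_conv_diff)
 with Rdeg_add[OF pos.IH Rdeg_conj[OF Rdeg_rel(2), where u = u]] show ?case by simp
next
 case (neg v m u)
 have "- (u - r - u + v) = - v + (u + r - u)" by (simp only: minus_add add.assoc diff_conv_add_uminus minus_minus)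
 with Rdeg_add[OF neg.IH Rdeg_conj[OF Rdeg_rel(1), where u = u]] show ?case by simp
qed (simp add: Rdeg.zero)

lemma Rdeg_diff: "Rdeg r v m ==> Rdeg r w n ==> Rdeg r (v - w) (m - n)" using Rdeg_add[OF _ Rdeg_uminus] by fastforce

inductive Comm :: "nat => 'g::group_add => bool" where
 zero: "Comm 0 0"
| Suc: "Comm k w ==> Comm (Suc k) (a + b - a - b + w)"

lemma Comm_add: "Comm k v ==> Comm l w ==> Comm (k + l) (v + w)"
proof (induction rule: Comm.induct)
 case (Suc k v a b)
 thus ?case using Comm.Suc[of "k + l" "v + w" a b] by (simp add: add.assoc)
qed simp

lemma Comm_conj: "Comm k v ==> Comm k (u + v - u)"
proof (induction rule: Comm.induct)
 case (Suc k v a b)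
 have "u + (a + b - a - b + v) - u
   = (u + a - u) + (u + b - u) - (u + a - u) - (u + b - u) + (u + v - u)"
  by (simp add: add.assoc diff_conv_add_uminus minus_add del: add_uminus_conv_diff)
 with Comm.Suc[OF Suc.IH, of "u + a - u" "u + b - u"] show ?case by simp
qed (simp add: Comm.zero)

lemma Comm_commutator: "Comm 1 (a + b - a - b)" using Comm.Suc[OF Comm.zero, of a b] by simp

lemma Comm_uminus: "Comm k v ==> Comm k (- v)"
proof (induction rule: Comm.induct)
 case (Suc k v a b)
 have "- (a + b - a - b + v) = - v + (b + a - b - a)" by (simp add: minus_add add.assoc diff_conv_add_uminus del: add_uminus_conv_diff)
 with Comm_add[OF Suc.IH Comm_commutator[of b a]] show ?case by simp
qed (simp add: Comm.zero)

section \<open>The free group type and the group record \<open>free_group\<close>\<close>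

lemma mult_free_group_ev:
 "u : carrier (free_group S) ==> v : carrier (free_group S) ==> ev (u \<otimes>\<^bsub>free_group S\<^esub> v) = ev u + ev v"
 by (simp add: free_group_def ev_eq_iff flip: ev_append)

lemma inv_free_group_ev:
 assumes "u : carrier (free_group S)"
 shows "ev (inv\<^bsub>free_group S\<^esub> u) = - ev u"
proof -
 interpret group "free_group S" by (rule group_free_group)
 have "ev (inv\<^bsub>free_group S\<^esub> u \<otimes>\<^bsub>free_group S\<^esub> u) = ev []"
  using l_inv[OF assms] by (simp only:) (simp add: free_group_def)
 thus ?thesis using mult_free_group_ev[OF inv_closed[OF assms] assms] by (simp add: eq_neg_iff_add_eq_0)
qed

text \<open>The commutator expression obtained here is what closes the 2-cell to a cycle: it fills
  the loop of the relator by a fan of triangles in the rose.\<close>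

lemma derived_imp_Comm:
 assumes "r : derived (free_group S) (carrier (free_group S))"
 shows "\<exists>k. Comm k (ev r)"
proof -
 interpret group "free_group S" by (rule group_free_group)
 let ?F = "free_group S"
 let ?C = "\<Union>a\<in>carrier ?F. \<Union>b\<in>carrier ?F. {a \<otimes>\<^bsub>?F\<^esub> b \<otimes>\<^bsub>?F\<^esub> inv\<^bsub>?F\<^esub> a \<otimes>\<^bsub>?F\<^esub> inv\<^bsub>?F\<^esub> b}"
 have C: "?C <= carrier ?F" by auto
 have base: "\<exists>k. Comm k (ev h)" if "h : ?C" for h
 proof -
  from that obtain a b where ab: "a : carrier ?F" "b : carrier ?F"
   "h = a \<otimes>\<^bsub>?F\<^esub> b \<otimes>\<^bsub>?F\<^esub> inv\<^bsub>?F\<^esub> a \<otimes>\<^bsub>?F\<^esub> inv\<^bsub>?F\<^esub> b"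
   by blast
  hence "ev h = ev a + ev b - ev a - ev b" by (simp add: mult_free_group_ev inv_free_group_ev)
  thus ?thesis using Comm_commutator by metis
 qed
 have "r : generate ?F ?C" using assms unfolding derived_def .
 thus ?thesis
 proof (induction rule: generate.induct)
  case one
  have "ev \<one>\<^bsub>?F\<^esub> = 0" by (simp add: free_group_def)
  thus ?case using Comm.zero by metis
 next
  case (incl h)
  thus ?case by (rule base)
 next
  case (inv h)
  hence "h : carrier ?F" using C by (rule subsetD[rotated])
  hence "ev (inv\<^bsub>?F\<^esub> h) = - ev h" by (rule inv_free_group_ev)
  moreover obtain k where "Comm k (ev h)" using base[OF inv] by blast
  ultimately show ?case using Comm_uminus by metis
 next
  case (eng h1 h2)
  have "h1 : carrier ?F" "h2 : carrier ?F" by (rule generate_in_carrier[OF C eng.hyps(1)], rule generate_in_carrier[OF C eng.hyps(2)])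
  hence "ev (h1 \<otimes>\<^bsub>?F\<^esub> h2) = ev h1 + ev h2" by (rule mult_free_group_ev)
  moreover obtain k l where "Comm k (ev h1)" "Comm l (ev h2)" using eng.IH by blast
  ultimately show ?case using Comm_add by metis
 qed
qed

subsection \<open>The Magnus expansion\<close>

text \<open>A function on lists is a power series in noncommuting variables.
  \<open>pos_act s\<close> multiplies from the left by 1 + s, and \<open>neg_act s\<close> by the
  inverse series 1 - s + s^2 - ...\<close>

primrec pos_act :: "'a => ('a list => int) => 'a list => int" where
 "pos_act s f [] = f []"
| "pos_act s f (y # v) = f (y # v) + (if y = s then f v else 0)"

primrec neg_act :: "'a => ('a list => int) => 'a list => int" where
 "neg_act s f [] = f []"
| "neg_act s f (y # v) = f (y # v) - (if y = s then neg_act s f v else 0)"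

definition letter_act :: "'a letter => ('a list => int) => 'a list => int" where
 "letter_act x = (if snd x then pos_act (fst x) else neg_act (fst x))"

definition word_act :: "'a word => ('a list => int) => 'a list => int" where
 "word_act w f = foldr letter_act w f"

lemma neg_act_pos_act: "neg_act s (pos_act s f) u = f u" by (induction u) auto

lemma pos_act_neg_act: "pos_act s (neg_act s f) u = f u" by (cases u) auto

lemma letter_act_inverse: "letter_act x (letter_act (inverse_letter x) f) = f"
 by (auto simp: letter_act_def inverse_letter_def neg_act_pos_act pos_act_neg_act fun_eq_iff)

lemma word_act_cons_letter: "word_act (cons_letter x w) f = letter_act x (word_act w f)" using letter_act_inverse[of x]
 by (cases w) (auto simp: cons_letter_def word_act_def)

lemma word_act_foldr: "word_act (foldr cons_letter u v) f = word_act u (word_act v f)"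
 by (induction u) (simp_all add: word_act_cons_letter, simp_all add: word_act_def)

text \<open>The product of noncommutative power series, summed over all splittings of the list;
  \<open>delta\<close> is its unit.\<close>

primrec conv :: "('a list => int) => ('a list => int) => 'a list => int" where
 "conv f g [] = f [] * g []"
| "conv f g (y # v) = f [] * g (y # v) + conv (%v. f (y # v)) g v"

definition delta :: "'a list => int" where
 "delta u = (if u = [] then 1 else 0)"

lemma conv_add_left: "conv (%u. f u + f' u) g v = conv f g v + conv f' g v" by (induction v arbitrary: f f') (simp_all add: algebra_simps)

lemma conv_diff_left: "conv (%u. f u - f' u) g v = conv f g v - conv f' g v" by (induction v arbitrary: f f') (simp_all add: algebra_simps)

lemma conv_add_right: "conv f (%u. g u + g' u) v = conv f g v + conv f g' v" by (induction v arbitrary: f) (simp_all add: algebra_simps)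

lemma conv_zero [simp]: "conv (%_. 0) g v = 0" "conv f (%_. 0) v = 0" by (induction v arbitrary: f) simp_all

lemma conv_delta [simp]: "conv delta g v = g v" by (cases v) (simp_all add: delta_def)

lemma conv_delta_right [simp]: "conv g delta v = g v" by (induction v arbitrary: g) (simp_all add: delta_def)

lemma conv_pos_act: "pos_act s (conv f g) u = conv (pos_act s f) g u" by (cases u) (simp_all add: conv_add_left algebra_simps)

lemma conv_neg_act: "neg_act s (conv f g) u = conv (neg_act s f) g u" by (induction u) (simp_all add: conv_diff_left algebra_simps)

lemma conv_letter_act: "letter_act x (conv f g) = conv (letter_act x f) g"
 by (auto simp: letter_act_def conv_pos_act conv_neg_act fun_eq_iff)

lemma word_act_conv: "word_act w (conv f g) = conv (word_act w f) g" by (induction w) (simp_all add: word_act_def conv_letter_act)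

text \<open>Left multiplications commute with right multiplications, so the action of a word is
  multiplication by its value at the unit. Composing actions therefore multiplies series, which is
  \<open>magnus_add\<close>.\<close>

lemma word_act_delta: "word_act w g = conv (word_act w delta) g"
proof -
 have "g = conv delta g" by (simp add: fun_eq_iff)
 hence "word_act w g = word_act w (conv delta g)" by (rule arg_cong)
 thus ?thesis by (simp only: word_act_conv)
qed

definition magnus :: "'a fg => 'a list => int" where
 "magnus x = word_act (Rep_fg x) delta"

lemma magnus_add: "magnus (x + y) = conv (magnus x) (magnus y)" unfolding magnus_def Rep_plus_fg word_act_foldr by (rule word_act_delta)

lemma magnus_zero: "magnus 0 = delta" by (simp add: magnus_def word_act_def)

lemma magnus_Nil [simp]: "magnus x [] = 1"
proof -
 have "word_act w f [] = f []" for w and f :: "'a list => int" by (induction w) (simp_all add: word_act_def letter_act_def)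
 thus ?thesis by (simp add: magnus_def delta_def)
qed

text \<open>In every splitting of \<open>v\<close> the left part is shorter than \<open>k\<close> or
  the right part is shorter than \<open>l\<close>.\<close>

lemma conv_vanish:
 assumes "!!u. length u < k ==> a u = 0" "!!u. length u < l ==> b u = 0" "length v < k + l"
 shows "conv a b v = 0" using assms
proof (induction v arbitrary: a k)
 case Nil
 thus ?case by (cases k) auto
next
 case (Cons y v)
 show ?case
 proof (cases k)
  case 0
  hence "conv (%v. a (y # v)) b v = 0" using Cons.prems by (intro Cons.IH[of 0]) auto
  with 0 show ?thesis using Cons.prems by simp
 next
  case (Suc k')
  hence "conv (%v. a (y # v)) b v = 0" using Cons.prems by (intro Cons.IH[of k']) auto
  moreover have "a [] = 0" using Cons.prems(1)[of "[]"] Suc by simp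
  ultimately show ?thesis by simp
 qed
qed

text \<open>A series whose terms have length at least \<open>k\<close> meets, up to length
  \<open>k\<close>, only the constant term of the other factor.\<close>

lemma conv_low_left:
 assumes "!!u. length u < k ==> a u = 0" "length v <= k"
 shows "conv a b v = a v * b []"
proof -
 let ?c = "%u. b u - b [] * delta u"
 have "conv a ?c v = 0" using assms by (intro conv_vanish[of k _ 1]) (auto simp: delta_def)
 moreover have "b = (%u. b [] * delta u + ?c u)" by auto
 moreover have "conv a (%u. b [] * delta u) v = b [] * a v" for v by (induction v arbitrary: a) (simp_all add: delta_def)
 ultimately show ?thesis using conv_add_right[of a "%u. b [] * delta u" ?c v] by simp
qed

lemma conv_low_right:
 assumes "!!u. length u < k ==> b u = 0" "length v <= k"
 shows "conv a b v = a [] * b v"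
proof -
 let ?c = "%u. a u - a [] * delta u"
 have "conv ?c b v = 0" using assms by (intro conv_vanish[of 1 _ k]) (auto simp: delta_def)
 moreover have "a = (%u. a [] * delta u + ?c u)" by auto
 moreover have "conv (%u. a [] * delta u) b v = a [] * b v" for v by (cases v) (simp_all add: delta_def)
 ultimately show ?thesis using conv_add_left[of "%u. a [] * delta u" ?c b v] by simp
qed

text \<open>The lowest nonconstant homogeneous part of the Magnus expansion of \<open>r\<close>, in degree \<open>k\<close>,
  turns products of conjugates of \<open>r\<close> and its inverse into sums.\<close>

definition magnus_low :: "nat => ('a list => int) => 'a fg => int => bool" where
 "magnus_low k m x n \<longleftrightarrow>
   (\<forall>u. length u < k --> magnus x u = delta u) &
   (\<forall>u. length u = k --> magnus x u = delta u + n * m u)"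

text \<open>(1 + A) (1 + B) = (1 + B) + A (1 + B), and up to length \<open>k\<close> the last
  product is A because 1 + B has constant term 1.\<close>

lemma magnus_low_add:
 assumes "magnus_low k m x n" "magnus_low k m y n'" "k >= 1"
 shows "magnus_low k m (x + y) (n + n')"
proof -
 let ?a = "%u. magnus x u - delta u" and ?b = "%u. magnus y u - delta u"
 have a: "!!u. length u < k ==> ?a u = 0" and b: "!!u. length u < k ==> ?b u = 0" using assms by (auto simp: magnus_low_def)
 have "magnus (x + y) v = ?a v + magnus y v" if "length v <= k" for v
 proof -
  have "magnus (x + y) v = conv (%u. delta u + ?a u) (magnus y) v" by (simp add: magnus_add)
  also have "\<dots> = magnus y v + conv ?a (magnus y) v" by (simp only: conv_add_left conv_delta)
  also have "conv ?a (magnus y) v = ?a v" using conv_low_left[OF a that, where b = "magnus y"] by simp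
  finally show ?thesis by simp
 qed
 hence "magnus (x + y) v = magnus x v - delta v + magnus y v" if "length v <= k" for v using that by simp
 thus ?thesis using assms by (simp add: magnus_low_def distrib_right)
qed

text \<open>U (1 + A) U^-1 = 1 + U A U^-1, and the outer factors have constant term 1, so they do
  not change the terms of length at most \<open>k\<close>.\<close>

lemma magnus_low_conj:
 assumes "magnus_low k m x n"
 shows "magnus_low k m (u + x - u) n"
proof -
 let ?a = "%u. magnus x u - delta u"
 have a: "!!u. length u < k ==> ?a u = 0" using assms by (auto simp: magnus_low_def)
 have "magnus (u + x - u) v = ?a v + delta v" if "length v <= k" for v
 proof -
  have 1: "magnus (x - u) = (%w. magnus (- u) w + conv ?a (magnus (- u)) w)"
  proof
   fix w
   have "magnus (x - u) w = conv (%u. delta u + ?a u) (magnus (- u)) w" using magnus_add[of x "- u"] by simp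
   also have "\<dots> = magnus (- u) w + conv ?a (magnus (- u)) w" by (simp only: conv_add_left conv_delta)
   finally show "magnus (x - u) w = magnus (- u) w + conv ?a (magnus (- u)) w" .
  qed
  have low: "conv ?a (magnus (- u)) w = ?a w" if "length w <= k" for w using conv_low_left[OF a that, where b = "magnus (- u)"] by simp
  have low0: "conv ?a (magnus (- u)) w = 0" if "length w < k" for w using low[of w] a that by simp
  have "magnus (u + x - u) v = conv (magnus u) (magnus (x - u)) v" using magnus_add[of u "x - u"] by (simp add: add_diff_eq)
  also have "\<dots> = conv (magnus u) (magnus (- u)) v + conv (magnus u) (conv ?a (magnus (- u))) v" by (simp only: 1 conv_add_right)
  also have "conv (magnus u) (magnus (- u)) v = delta v" using magnus_add[of u "- u"] by (simp add: magnus_zero)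
  also have "conv (magnus u) (conv ?a (magnus (- u))) v = ?a v"
   using conv_low_right[OF low0 that, where a = "magnus u"] low[OF that] by simp
  finally show ?thesis by simp
 qed
 thus ?thesis using assms by (auto simp: magnus_low_def)
qed

lemma magnus_low_uminus:
 assumes "magnus_low k m x n"
 shows "magnus_low k m (- x) (- n)"
proof -
 let ?a = "%u. magnus x u - delta u"
 have a: "!!u. length u < k ==> ?a u = 0" using assms by (auto simp: magnus_low_def)
 have "magnus (- x) v = delta v - ?a v" if "length v <= k" for v
 proof -
  have "delta v = conv (%u. delta u + ?a u) (magnus (- x)) v" using magnus_add[of x "- x"] by (simp add: magnus_zero)
  also have "\<dots> = magnus (- x) v + conv ?a (magnus (- x)) v" by (simp only: conv_add_left conv_delta)
  also have "conv ?a (magnus (- x)) v = ?a v" using conv_low_left[OF a that, where b = "magnus (- x)"] by simp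
  finally show ?thesis by simp
 qed
 thus ?thesis using assms by (auto simp: magnus_low_def)
qed

text \<open>In the expansion of a reduced word with syllables \<open>s\<^sub>1\<^bsup>e\<^sub>1\<^esup> \<dots> s\<^sub>n\<^bsup>e\<^sub>n\<^esup>\<close>, the coefficient of
  \<open>s\<^sub>1 \<dots> s\<^sub>n\<close> is \<open>e\<^sub>1 \<dots> e\<^sub>n\<close>. The statement below also records which higher coefficients vanish.\<close>

lemma magnus_syllables:
 assumes "reduced w" "w ~= []"
 shows "\<exists>s u e. s = fst (hd w) & distinct_adj (s # u) & (if snd (hd w) then e > 0 else e < 0) &
   word_act w delta u ~= 0 & word_act w delta (s # u) = e * word_act w delta u &
   (\<forall>v. distinct_adj v --> length v > length u + 1 \<or> (length v = length u + 1 & hd v ~= s)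
    --> word_act w delta v = 0)" using assms
proof (induction w)
 case (Cons x w)
 define s where "s = fst x"
 show ?case
 proof (cases w)
  case Nil
  have "word_act (x # w) delta v = 0" if "distinct_adj v" and len: "length v > 1 \<or> (length v = 1 & hd v ~= s)" for v
  proof -
   obtain y v' where "v = y # v'" using len by (cases v) auto
   thus ?thesis using that by (cases v') (auto simp: Nil word_act_def letter_act_def s_def delta_def)
  qed
  thus ?thesis by (intro exI[of _ s] exI[of _ "[]"] exI[of _ "if snd x then 1 else - 1"])
    (simp, auto simp: Nil word_act_def letter_act_def s_def delta_def)
 next
  case (Cons y w')
  have w: "reduced w" "w ~= []" "hd w ~= inverse_letter x" using Cons.prems Cons by (auto simp: reduced_Cons)
  define t where "t = fst (hd w)"
  obtain u e where u: "distinct_adj (t # u)" "if snd (hd w) then e > 0 else e < 0"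
   "word_act w delta u ~= 0" "word_act w delta (t # u) = e * word_act w delta u"
   and van: "!!v. distinct_adj v ==> length v > length u + 1 \<or> (length v = length u + 1 & hd v ~= t)
    ==> word_act w delta v = 0"
  proof -
   from Cons.IH[OF w(1,2)] obtain s' u e where *: "s' = fst (hd w)" "distinct_adj (s' # u)"
    "if snd (hd w) then e > 0 else e < 0" "word_act w delta u ~= 0"
    "word_act w delta (s' # u) = e * word_act w delta u"
    "\<forall>v. distinct_adj v --> length v > length u + 1 \<or> (length v = length u + 1 & hd v ~= s')
     --> word_act w delta v = 0" by (elim exE conjE)
   show thesis by (rule that[of u e]) (use * in \<open>auto simp: t_def\<close>)
  qed
  have act: "word_act (x # w) delta = letter_act x (word_act w delta)" by (simp add: word_act_def)
  have other: "word_act (x # w) delta v = word_act w delta v" if "v = [] \<or> hd v ~= s" for v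
   using that unfolding act letter_act_def s_def by (cases v) auto
  have same: "word_act (x # w) delta (s # v)
    = word_act w delta (s # v) + (if snd x then word_act w delta v else - word_act w delta v)"
   if "v = [] \<or> hd v ~= s" for v using that unfolding act letter_act_def s_def by (cases v) auto
  show ?thesis
  proof (cases "t = s")
   case True
   \<comment> \<open>Adjacent letters with the same generator have the same sign in a reduced word,
     so the exponent moves away from 0 and cannot vanish.\<close>
   have sgn: "snd x = snd (hd w)" using w(3) True by (auto simp: inverse_letter_def t_def s_def prod_eq_iff)
   have hu: "u = [] \<or> hd u ~= s" using u(1) True by (cases u) auto
   have "word_act (x # w) delta v = 0"
    if v: "distinct_adj v" "length v > length u + 1 \<or> (length v = length u + 1 & hd v ~= s)" for v
   proof (cases "v = [] \<or> hd v ~= s")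
    case True
    thus ?thesis using other van[OF v(1)] v(2) \<open>t = s\<close> by auto
   next
    case False
    then obtain v' where v': "v = s # v'" by (cases v) auto
    hence h: "v' ~= [] ==> hd v' ~= s" "distinct_adj v'" using v(1) by (cases v'; auto)+
    have "length v' >= length u + 1" using v(2) v' by auto
    hence "word_act w delta v' = 0" "v' ~= []" using van[OF h(2)] h(1) \<open>t = s\<close> by force+
    moreover have "word_act w delta v = 0" using van[OF v(1)] v(2) \<open>t = s\<close> by auto
    ultimately show ?thesis using same h v' by auto
   qed
   moreover have "word_act (x # w) delta u = word_act w delta u" using other hu by blast
   moreover have "word_act (x # w) delta (s # u) = (if snd x then e + 1 else e - 1) * word_act w delta u"
    using same[OF hu] u(4) True by (simp add: algebra_simps)
   ultimately show ?thesis using u True sgn by (intro exI[of _ s] exI[of _ u] exI[of _ "if snd x then e + 1 else e - 1"]) (auto simp: s_def)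
  next
   case False
   \<comment> \<open>A new syllable starts, so the witness grows from \<open>u\<close> to
     \<open>t # u\<close> and the vanishing range moves up by one.\<close>
   have "word_act (x # w) delta v = 0"
    if v: "distinct_adj v" "length v > length u + 2 \<or> (length v = length u + 2 & hd v ~= s)" for v
   proof (cases "v = [] \<or> hd v ~= s")
    case True
    thus ?thesis using other van[OF v(1)] v(2) by auto
   next
    case False
    then obtain v' where v': "v = s # v'" by (cases v) auto
    hence h: "v' ~= [] ==> hd v' ~= s" "distinct_adj v'" using v(1) by (cases v'; auto)+
    have "word_act w delta v' = 0" "v' ~= []" using van[OF h(2)] v' v(2) by auto
    moreover have "word_act w delta v = 0" using van[OF v(1)] v(2) by auto
    ultimately show ?thesis using same h v' by auto
   qed
   moreover have "word_act (x # w) delta (t # u) = word_act w delta (t # u)" using other False by simp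
   moreover have "word_act w delta (s # t # u) = 0" using van[of "s # t # u"] u(1) False by auto
   hence "word_act (x # w) delta (s # t # u) = (if snd x then 1 else - 1) * word_act w delta (t # u)" using same[of "t # u"] False by simp
   moreover have "e ~= 0" using u(2) by (auto split: if_splits)
   ultimately show ?thesis using u False by (intro exI[of _ s] exI[of _ "t # u"] exI[of _ "if snd x then 1 else - 1"]) (auto simp: s_def)
  qed
 qed
qed simp

text \<open>Faithfulness of the expansion: the coefficient found is the nonzero exponent of the
  first syllable times a nonzero coefficient.\<close>

lemma magnus_nontrivial:
 assumes "x ~= 0"
 obtains u where "u ~= []" "magnus x u ~= 0"
proof -
 have "Rep_fg x ~= []" using assms by (metis ev_Nil ev_Rep)
 with magnus_syllables[OF reduced_Rep_fg this]
 obtain s u e where "word_act (Rep_fg x) delta u ~= 0" "if snd (hd (Rep_fg x)) then e > 0 else e < (0::int)"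
  "word_act (Rep_fg x) delta (s # u) = e * word_act (Rep_fg x) delta u" by metis
 hence "magnus x (s # u) ~= 0" by (auto simp: magnus_def split: if_splits)
 thus ?thesis using that by blast
qed

text \<open>The lowest nonconstant homogeneous part of \<open>r\<close> is nonzero, and a relation
  of degree n has n times this part. The topological counterpart is that the fundamental class has
  infinite order.\<close>

theorem Rdeg_unique:
 assumes "r ~= 0" "Rdeg r (w :: 'a fg) n" "Rdeg r w n'"
 shows "n = n'"
proof -
 define k where "k = (LEAST k. \<exists>u. u ~= [] & magnus r u ~= 0 & length u = k)"
 have ex: "\<exists>k u. u ~= [] & magnus r u ~= 0 & length u = k" using magnus_nontrivial[OF assms(1)] by metis
 obtain u0 where u0: "u0 ~= []" "magnus r u0 ~= 0" "length u0 = k" using LeastI_ex[OF ex] unfolding k_def by blast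
 have least: "magnus r u = delta u" if "length u < k" for u
  using not_less_Least[of "length u" "%k. \<exists>u. u ~= [] & magnus r u ~= 0 & length u = k"] that
  unfolding k_def[symmetric] by (cases "u = []") (auto simp: delta_def)
 let ?m = "%u. magnus r u - delta u"
 have k: "k >= 1" using u0 by (cases u0) auto
 have r: "magnus_low k ?m r 1" and mr: "magnus_low k ?m (- r) (- 1)"
  using least magnus_low_uminus[of k ?m r 1] by (auto simp: magnus_low_def)
 have *: "magnus_low k ?m w n" if "Rdeg r w n" for w n using that
 proof (induction rule: Rdeg.induct)
  case zero
  thus ?case by (simp add: magnus_low_def magnus_zero)
 next
  case (pos w n u)
  from magnus_low_add[OF magnus_low_conj[OF r] pos.IH k] show ?case by (simp add: ac_simps)
 next
  case (neg w n u)
  from magnus_low_add[OF magnus_low_conj[OF mr, of u] neg.IH k] show ?case by (simp add: add.commute[of n])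
 qed
 have "n * ?m u0 = n' * ?m u0" using *[OF assms(2)] *[OF assms(3)] u0 by (simp add: magnus_low_def)
 thus ?thesis using u0 by (simp add: delta_def)
qed

section \<open>Surfaces and commutators\<close>

lemma linked_pair:
 fixes a b :: "'g::group_add"
 shows "a + P + b + Q - a + R - b + S =
  (a + P - (R + Q + P)) + ((R + Q + P) + (b + Q + P) - (R + Q + P))
  - (a + P - (R + Q + P)) - ((R + Q + P) + (b + Q + P) - (R + Q + P)) + (R + Q + P + S)"
 by (simp only: diff_conv_add_uminus minus_add minus_minus add.assoc minus_add_cancel
   add_minus_cancel left_minus right_minus add_0_left add_0_right)

text \<open>A polygon whose sides are glued in pairs: its boundary word is a product of at most as many
  commutators as its genus. Cutting along two linked pairs of sides lowers the genus.\<close>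

lemma Comm_balanced:
 fixes e :: "'d => 'g::group_add"
 assumes "distinct W" and "!!a. a : set W ==> g a : set W & g a ~= a & g (g a) = a & e (g a) = - e a"
 shows "\<exists>k. Comm k (sum_list (map e W)) & 4 * k <= length W" using assms
proof (induction "length W" arbitrary: W rule: less_induct)
 case less
 show ?case
 proof (cases W)
  case Nil
  thus ?thesis using Comm.zero by auto
 next
  case (Cons a W1)
  hence "g a : set W1" using less.prems(2)[of a] by auto
  then obtain P T where W1: "W1 = P @ g a # T" by (meson split_list)
  have W: "W = a # P @ g a # T" using Cons W1 by simp
  have ea: "e (g a) = - e a" "g (g a) = a" using less.prems(2)[of a] W by auto
  show ?thesis
  \<comment> \<open>If no side between \<open>a\<close> and its partner is linked with
    \<open>a\<close>, both arcs are balanced on their own. Otherwise some \<open>b\<close> is linked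
    with \<open>a\<close>, and the rest \<open>?V\<close> below is the word R + Q + P + S that
    \<open>linked_pair\<close> leaves over, four sides shorter.\<close>
  proof (cases "\<forall>b\<in>set P. g b : set P")
   case True
   have T: "g b : set T" if "b : set T" for b
   proof -
    have b: "g b : set W" "g (g b) = b" using less.prems(2)[of b] that W by auto
    have "a ~: set T" "g a ~: set T" "set P Int set T = {}" using less.prems(1) W by auto
    hence "g b ~= a" "g b ~= g a" "g b ~: set P" using b(2) ea(2) True that by (metis, metis, metis disjoint_iff)
    thus ?thesis using b W by auto
   qed
   have "\<exists>k. Comm k (sum_list (map e P)) & 4 * k <= length P" using less.prems W True by (intro less.hyps) auto
   then obtain k where k: "Comm k (sum_list (map e P))" "4 * k <= length P" by blast
   have "\<exists>k. Comm k (sum_list (map e T)) & 4 * k <= length T" using less.prems W T by (intro less.hyps) auto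
   then obtain l where l: "Comm l (sum_list (map e T))" "4 * l <= length T" by blast
   have "sum_list (map e W) = (e a + sum_list (map e P) - e a) + sum_list (map e T)"
    by (simp add: W ea add.assoc diff_conv_add_uminus del: add_uminus_conv_diff)
   thus ?thesis using Comm_add[OF Comm_conj[OF k(1)] l(1)] k(2) l(2) W by (intro exI[of _ "k + l"]) auto
  next
   case False
   then obtain b where b: "b : set P" "g b ~: set P" by blast
   have gb: "g b : set W" "e (g b) = - e b" "g (g b) = b" using less.prems(2)[of b] b W by auto
   have "a ~: set P" "g a ~: set P" using less.prems(1) W by auto
   hence "g b ~= a" "g b ~= g a" using gb(3) ea(2) b(1) by metis+
   hence "g b : set T" using gb(1) b(2) W by simp
   then obtain T1 T2 where T: "T = T1 @ g b # T2" by (meson split_list)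
   obtain P1 P2 where P: "P = P1 @ b # P2" using b by (meson split_list)
   let ?V = "T1 @ P2 @ P1 @ T2"
   have dist: "distinct ?V" using less.prems(1) W T P by auto
   have setV: "set ?V = set W - {a, b, g a, g b}" using less.prems(1) W T P by auto
   have cl: "g c : set ?V & g c ~= c & g (g c) = c & e (g c) = - e c" if "c : set ?V" for c
   proof -
    have "c : set W" "c ~= a" "c ~= b" "c ~= g a" "c ~= g b" using that setV by blast+
    with less.prems(2)[of c] gb(3) ea(2) show ?thesis unfolding setV by auto
   qed
   have "\<exists>k. Comm k (sum_list (map e ?V)) & 4 * k <= length ?V" by (rule less.hyps[OF _ dist cl]) (auto simp: W T P)
   then obtain k where k: "Comm k (sum_list (map e ?V))" "4 * k <= length ?V" by blast
   have "sum_list (map e W) = e a + sum_list (map e P1) + e b + sum_list (map e P2) - e a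
     + sum_list (map e T1) - e b + sum_list (map e T2)" by (simp add: W T P ea gb add.assoc diff_conv_add_uminus del: add_uminus_conv_diff)
   hence "Comm (Suc k) (sum_list (map e W))" unfolding linked_pair
    using Comm.Suc[OF k(1), of "e a + sum_list (map e P1) - (sum_list (map e T1) + sum_list (map e P2) + sum_list (map e P1))"
      "(sum_list (map e T1) + sum_list (map e P2) + sum_list (map e P1)) + (e b + sum_list (map e P2) + sum_list (map e P1))
       - (sum_list (map e T1) + sum_list (map e P2) + sum_list (map e P1))"] by (simp add: add.assoc)
   thus ?thesis using k(2) W T P by (intro exI[of _ "Suc k"]) auto
  qed
 qed
qed

text \<open>\<open>v a\<close> is the initial vertex of the side \<open>a\<close>. Gluing reverses
  directions, so \<open>v (g a)\<close> is its terminal vertex, and the boundary of a polygon is a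
  closed walk.\<close>

fun walk :: "('d => 'v) => ('d => 'd) => 'v => 'd list => 'v => bool" where
 "walk v g p [] q \<longleftrightarrow> p = q"
| "walk v g p (a # W) q \<longleftrightarrow> v a = p & walk v g (v (g a)) W q"

lemma walk_append: "walk v g p (U @ W) q \<longleftrightarrow> (\<exists>m. walk v g p U m & walk v g m W q)"
 by (induction U arbitrary: p) auto

lemma walk_filter:
 "walk v g p W q ==> (!!x. x : set W ==> ~ P x ==> v x = v (g x)) ==> walk v g p (filter P W) q" by (induction W arbitrary: p) auto

lemma walk_map: "walk v g p W q ==> walk (f o v) g (f p) W (f q)" by (induction W arbitrary: p) auto

lemma walk_const: "walk v g p W q ==> (!!x. x : set W ==> v x = v (g x)) ==> v ` set W <= {p}" by (induction W arbitrary: p) auto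

text \<open>The values of the potential at interior vertices telescope, so only those at the two
  ends of the walk remain.\<close>

lemma walk_gauge:
 fixes e :: "'d => 'g::group_add"
 assumes "walk v g p W q"
 shows "sum_list (map (%b. \<phi> (v b) + e b - \<phi> (v (g b))) W) = \<phi> p + sum_list (map e W) - \<phi> q" using assms
proof (induction W arbitrary: p)
 case (Cons a W)
 have "sum_list (map (%b. \<phi> (v b) + e b - \<phi> (v (g b))) (a # W))
   = (\<phi> p + e a - \<phi> (v (g a))) + (\<phi> (v (g a)) + sum_list (map e W) - \<phi> q)" using Cons by simp
 thus ?case by (simp add: add.assoc diff_conv_add_uminus del: add_uminus_conv_diff)
qed simp

lemma walk_rotate:
 assumes "walk v g p (X @ a # Y) p"
 shows "walk v g (v a) (a # Y @ X) (v a)" using assms by (auto simp: walk_append)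

lemma Comm_rotate:
 assumes "Comm k (sum_list (map e (V @ U)))"
 shows "Comm k (sum_list (map e (U @ V)) :: 'g::group_add)"
proof -
 have "sum_list (map e (U @ V)) = sum_list (map e U) + sum_list (map e (V @ U)) - sum_list (map e U)"
  by (simp add: add.assoc diff_conv_add_uminus del: add_uminus_conv_diff)
 thus ?thesis using Comm_conj[OF assms] by simp
qed

text \<open>Contracting an edge between distinct vertices removes two sides from the polygon. On the level of
  labels this is a gauge transformation that makes the edge trivial.\<close>

lemma Comm_closed_walk:
 fixes e :: "'d => 'g::group_add"
 assumes "distinct W" and "!!a. a : set W ==> g a : set W & g a ~= a & g (g a) = a & e (g a) = - e a"
  and "walk v g p W p"
 shows "\<exists>k. Comm k (sum_list (map e W)) & 4 * k + 2 * card (insert p (v ` set W)) <= length W + 2" using assms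
\<comment> \<open>For a single polygon with V vertices and L sides, chi = V - L / 2 + 1, so the
  bound says 2 k <= 2 - chi.\<close>
proof (induction "length W" arbitrary: W v p e rule: less_induct)
 case less
 show ?case
 proof (cases "\<forall>a\<in>set W. v a = v (g a)")
  case True
  hence "v ` set W <= {p}" using walk_const less.prems(3) by metis
  hence "insert p (v ` set W) = {p}" by auto
  hence "card (insert p (v ` set W)) = 1" by (simp only: card.insert card.empty) simp
  moreover obtain k where "Comm k (sum_list (map e W))" "4 * k <= length W" using Comm_balanced[OF less.prems(1,2)] by blast
  ultimately show ?thesis by (intro exI[of _ k]) simp
 next
  case False
  then obtain a where a: "a : set W" "v a ~= v (g a)" by blast
  then obtain X Y where XY: "W = X @ a # Y" by (meson split_list)
  define W1 where "W1 = a # Y @ X"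
  have W1: "distinct W1" "set W1 = set W" "length W1 = length W" "walk v g (v a) W1 (v a)"
   using less.prems XY walk_rotate by (auto simp: W1_def)
  \<comment> \<open>The potential is carried by the far end of \<open>a\<close> and makes the new
    label of \<open>a\<close>, and with it that of \<open>g a\<close>, trivial; these two sides can
    then be dropped.\<close>
  define \<phi> where "\<phi> = (%x. if x = v (g a) then e a else 0)"
  define e' where "e' = (%b. \<phi> (v b) + e b - \<phi> (v (g b)))"
  define c where "c = (%x. if x = v (g a) then v a else x)"
  define W2 where "W2 = filter (%b. b ~= a & b ~= g a) W1"
  have ga: "g a : set W" "g (g a) = a" "g a ~= a" using less.prems(2)[OF a(1)] by auto
  have e'a: "e' a = 0" "e' (g a) = 0" using a less.prems(2)[OF a(1)] by (auto simp: e'_def \<phi>_def)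
  have sum1: "sum_list (map e' W1) = sum_list (map e W1)" using walk_gauge[OF W1(4), of \<phi> e] a by (simp add: e'_def \<phi>_def)
  have sum2: "sum_list (map e' W2) = sum_list (map e' W1)" using e'a unfolding W2_def by (intro sum_list_map_filter) auto
  have set2: "set W2 = set W - {a, g a}" by (auto simp: W2_def W1)
  have cl: "g b : set W2 & g b ~= b & g (g b) = b & e' (g b) = - e' b" if "b : set W2" for b
  proof -
   have b: "b : set W" "b ~= a" "b ~= g a" using that set2 by auto
   with less.prems(2)[OF b(1)] ga show ?thesis unfolding set2 by (auto simp: e'_def minus_add diff_conv_add_uminus add.assoc
      simp del: add_uminus_conv_diff)
  qed
  have len: "length W2 + 2 = length W"
  proof -
   have "length W2 = card (set W - {a, g a})" using W1(1) set2 distinct_card[of W2] by (simp add: W2_def)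
   also have "\<dots> = card (set W) - 2" using a(1) ga by (subst card_Diff_subset) auto
   also have "card (set W) = length W" using less.prems(1) by (rule distinct_card)
   moreover have "card {a, g a} <= card (set W)" using a(1) ga by (intro card_mono) auto
   ultimately show ?thesis using ga distinct_card[OF less.prems(1)] by simp
  qed
  have "walk (c o v) g (c (v a)) W1 (c (v a))" using walk_map[OF W1(4)] .
  hence walk2: "walk (c o v) g (c (v a)) W2 (c (v a))" unfolding W2_def by (rule walk_filter) (auto simp: c_def ga)
  obtain k where k: "Comm k (sum_list (map e' W2))"
   "4 * k + 2 * card (insert (c (v a)) ((c o v) ` set W2)) <= length W2 + 2"
   using less.hyps[OF _ _ cl walk2] len W1(1) by (auto simp: W2_def)
  have p: "p : v ` set W" using less.prems(3) a(1) by (cases W) auto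
  \<comment> \<open>Contraction loses two sides and at most the vertex \<open>v (g a)\<close>, which
    is just what the bound tolerates.\<close>
  have "insert p (v ` set W) <= insert (v (g a)) (insert (c (v a)) ((c o v) ` set W2))"
  proof
   fix x assume "x : insert p (v ` set W)"
   then obtain b where b: "b : set W" "x = v b" using p by auto
   show "x : insert (v (g a)) (insert (c (v a)) ((c o v) ` set W2))"
   proof (cases "b : {a, g a} \<or> v b = v (g a)")
    case True
    thus ?thesis using a b by (auto simp: c_def)
   next
    case False
    hence "b : set W2" "(c o v) b = x" using b set2 by (auto simp: c_def)
    thus ?thesis by blast
   qed
  qed
  hence "card (insert p (v ` set W)) <= card (insert (v (g a)) (insert (c (v a)) ((c o v) ` set W2)))" by (rule card_mono[rotated]) auto
  also have "\<dots> <= Suc (card (insert (c (v a)) ((c o v) ` set W2)))" by (rule card_insert_le_m1) auto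
  finally have "4 * k + 2 * card (insert p (v ` set W)) <= length W + 2" using k(2) len by simp
  moreover have "Comm k (sum_list (map e W))" using k(1) Comm_rotate[of k e "a # Y" X] unfolding sum2 sum1 by (simp add: W1_def XY)
  ultimately show ?thesis by blast
 qed
qed

text \<open>The conditions of \<open>van_kampen_diagrams\<close> on the pairing alone, with labels
  compared only as group elements. This admits empty labels and arbitrary polygons, as they occur in
  surfaces glued from singular triangles.\<close>

definition gluing :: "'a diagram => bool" where
 "gluing D \<longleftrightarrow> (\<forall>a\<in>sides D. glue D a : sides D & glue D a ~= a & glue D (glue D a) = a &
   ev (side_label D (glue D a)) = - ev (side_label D a))"

lemma finite_sides: "finite (sides D)"
proof -
 have "sides D = (\<Union>i\<in>{..<length (disks D)}. (%j. (i, j)) ` {..<length (disks D ! i)})" by (auto simp: sides_def)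
 thus ?thesis by simp
qed

definition vertex :: "'a diagram => nat \<times> nat => (nat \<times> nat) set" where
 "vertex D a = same_vertex D `` {a}"

lemma vertex_eqI: "(a, b) : same_vertex D ==> vertex D a = vertex D b" unfolding vertex_def same_vertex_def
 by (auto intro: equivclp_trans equivclp_sym)

lemma vertex_next:
 assumes "gluing D" "a : sides D"
 shows "vertex D (next_side D a) = vertex D (glue D a)"
proof -
 have "glue D a : sides D" "glue D (glue D a) = a" using assms by (auto simp: gluing_def)
 hence "equivclp (%a b. a : sides D & b = next_side D (glue D a)) (glue D a) (next_side D a)" by (intro r_into_equivclp) simp
 thus ?thesis by (intro vertex_eqI[symmetric]) (simp add: same_vertex_def)
qed

definition face :: "'a diagram => nat => (nat \<times> nat) list" where
 "face D i = map (Pair i) [0..<length (disks D ! i)]"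

lemma set_face: "i < length (disks D) ==> set (face D i) = sides_of D {i}" by (auto simp: face_def sides_of_def sides_def)

lemma ev_concat: "ev (concat ws) = sum_list (map ev ws)" by (induction ws) auto

lemma ev_face: "sum_list (map (%a. ev (side_label D a)) (face D i)) = ev (concat (disks D ! i))"
proof -
 have "map (%a. ev (side_label D a)) (face D i) = map ev (disks D ! i)" by (rule nth_equalityI) (auto simp: face_def side_label_def)
 thus ?thesis by (simp add: ev_concat)
qed

lemma walk_nth:
 assumes "!!i. i < length W ==> v (g (W ! i)) = (if Suc i < length W then v (W ! Suc i) else q)"
  and "p = (if W = [] then q else v (W ! 0))"
 shows "walk v g p W q" using assms
proof (induction W arbitrary: p)
 case (Cons a W)
 have "walk v g (v (g a)) W q"
 proof (rule Cons.IH)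
  show "v (g (W ! i)) = (if Suc i < length W then v (W ! Suc i) else q)" if "i < length W" for i
   using Cons.prems(1)[of "Suc i"] that by simp
  show "v (g a) = (if W = [] then q else v (W ! 0))" using Cons.prems(1)[of 0] by simp
 qed
 thus ?case using Cons.prems(2) by simp
qed simp

lemma walk_face:
 assumes "gluing D" "i < length (disks D)"
 shows "walk (vertex D) (glue D) (vertex D (i, 0)) (face D i) (vertex D (i, 0))"
proof (rule walk_nth)
 fix j assume j: "j < length (face D i)"
 hence s: "(i, j) : sides D" using assms(2) by (simp add: face_def sides_def)
 have "vertex D (glue D (i, j)) = vertex D (i, Suc j mod length (disks D ! i))"
  using vertex_next[OF assms(1) s] by (simp add: next_side_def)
 moreover have "Suc j mod length (disks D ! i) = (if Suc j < length (face D i) then Suc j else 0)"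
  using j by (auto simp: face_def) (metis Suc_lessI mod_self)
 ultimately show "vertex D (glue D (face D i ! j)) =
   (if Suc j < length (face D i) then vertex D (face D i ! Suc j) else vertex D (i, 0))" using j by (auto simp: face_def)
qed (auto simp: face_def)

lemma sides_of_insert: "sides_of D (insert i J) = sides_of D J Un sides_of D {i}" by (auto simp: sides_of_def)

lemma finite_sides_of [simp]: "finite (sides_of D J)" by (rule finite_subset[OF _ finite_sides[of D]]) (auto simp: sides_of_def)

section \<open>Components, and cutting them open to one polygon\<close>

lemma components_subset:
 assumes "gluing D" "K : components D"
 shows "K <= {..<length (disks D)}" "K ~= {}"
proof -
 obtain i where i: "i < length (disks D)" "K = same_component D `` {i}" using assms(2) by (auto simp: components_def quotient_def)
 have *: "j < length (disks D)"
  if "equivclp (%i j. \<exists>a\<in>sides D. i = fst a & j = fst (glue D a)) i j" for j using that i(1)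
 proof (induction rule: equivclp_induct)
  case (step y z)
  have fst: "fst b < length (disks D)" if "b : sides D" for b using that by (auto simp: sides_def)
  from step(2) obtain a where a: "a : sides D" "z = fst a \<or> z = fst (glue D a)" by blast
  have "glue D a : sides D" using assms(1) a(1) by (simp add: gluing_def)
  thus "z < length (disks D)" using fst[OF a(1)] fst[of "glue D a"] a(2) by auto
 qed
 thus "K <= {..<length (disks D)}" by (auto simp: i same_component_def)
 have "i : K" by (simp add: i same_component_def)
 thus "K ~= {}" by blast
qed

text \<open>Otherwise \<open>J\<close> would be closed under gluing and, being nonempty, exhaust the
  component.\<close>

lemma component_crossing:
 assumes "gluing D" "K : components D" "J <= K" "J ~= {}" "J ~= K"
 obtains a where "a : sides_of D J" "glue D a : sides_of D (K - J)"
proof (rule ccontr)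
 note crossing = that
 assume contr: "~ thesis"
 let ?R = "%i j. \<exists>a\<in>sides D. i = fst a & j = fst (glue D a)"
 obtain i where i: "K = same_component D `` {i}" using assms(2) by (auto simp: components_def quotient_def)
 have g: "glue D a : sides D" "glue D (glue D a) = a" if "a : sides D" for a using assms(1) that by (auto simp: gluing_def)
 obtain j where j: "j : J" using assms(4) by blast
 have "k : J" if "equivclp ?R j k" for k using that j
 proof (induction rule: equivclp_induct)
  case (step y z)
  hence y: "y : J" by simp
  from step(2) obtain a where a: "a : sides D" "fst a = y" "fst (glue D a) = z" using g by metis
  have ijk: "equivclp ?R i y" using y assms(3) i by (auto simp: same_component_def)
  have "equivclp ?R y z" using a by (intro r_into_equivclp) auto
  hence "z : K" using equivclp_trans[OF ijk] by (simp add: i same_component_def)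
  thus "z : J" using crossing[of a] contr a y g by (auto simp: sides_of_def)
 qed
 moreover have "equivclp ?R j k" if "k : K" for k
  using that j assms(3) i by (auto simp: same_component_def intro: equivclp_trans equivclp_sym)
 ultimately show False using assms(3,5) by blast
qed

lemma card_edges:
 assumes "gluing D" "!!a. a : A ==> glue D a : A" "A <= sides D"
 shows "2 * card ((%a. {a, glue D a}) ` A) = card A"
proof -
 have fin: "finite A" using finite_subset[OF assms(3) finite_sides] .
 let ?E = "(%a. {a, glue D a}) ` A"
 have g: "glue D a ~= a" "glue D (glue D a) = a" if "a : A" for a using assms that by (auto simp: gluing_def)
 have "card (\<Union>?E) = (\<Sum>X\<in>?E. card X)"
 proof (rule card_Union_disjoint)
  show "pairwise disjnt ?E"
  proof (rule pairwiseI)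
   fix X Y assume "X : ?E" "Y : ?E" and ne: "X ~= Y"
   then obtain a b where a: "a : A" "X = {a, glue D a}" and b: "b : A" "Y = {b, glue D b}" by blast
   have "~ (b = a \<or> b = glue D a \<or> glue D b = a \<or> glue D b = glue D a)"
    using g[OF a(1)] g[OF b(1)] ne a b by (metis insert_commute)
   thus "disjnt X Y" by (auto simp: disjnt_def a b)
  qed
 qed auto
 also have "\<dots> = (\<Sum>X\<in>?E. 2)"
 proof (rule sum.cong)
  fix X assume "X : ?E"
  then obtain a where "a : A" "X = {a, glue D a}" by blast
  thus "card X = 2" using g(1)[of a] by (simp add: card_insert_if)
 qed simp
 finally have "card (\<Union>?E) = 2 * card ?E" by simp
 moreover have "\<Union>?E = A" using assms(2) by auto
 ultimately show ?thesis by simp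
qed

lemma Rdeg_rotate:
 assumes "Rdeg r (sum_list (map e (V @ U))) n"
 shows "Rdeg r (sum_list (map e (U @ V)) :: 'g::group_add) n"
proof -
 have "sum_list (map e (U @ V)) = sum_list (map e U) + sum_list (map e (V @ U)) - sum_list (map e U)"
  by (simp add: add.assoc diff_conv_add_uminus del: add_uminus_conv_diff)
 thus ?thesis using Rdeg_conj[OF assms] by simp
qed

text \<open>A spanning tree of the dual graph is built disk by disk. After \<open>m\<close> gluings
  the disks of \<open>J\<close> form one polygon with boundary \<open>W\<close>: every gluing uses
  up two sides, keeps all vertices and multiplies conjugates of the boundary values, so degrees add.
  The base vertex \<open>p\<close> is listed separately because \<open>W\<close> may be
  empty.\<close>

lemma merge_faces:
 assumes D: "gluing D" "K : components D"
  and n: "!!i. i < length (disks D) ==> Rdeg r (ev (concat (disks D ! i))) (n i)"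
  and "m < card K"
 shows "\<exists>J W p. J <= K & card J = Suc m & distinct W & set W <= sides_of D J &
   (\<forall>a \<in> sides_of D J - set W. glue D a : sides_of D J - set W) &
   length W + 2 * card J = card (sides_of D J) + 2 &
   walk (vertex D) (glue D) p W p & vertex D ` sides_of D J <= insert p (vertex D ` set W) &
   Rdeg r (sum_list (map (%a. ev (side_label D a)) W)) (\<Sum>i\<in>J. n i)" using \<open>m < card K\<close>
proof (induction m)
 case 0
 obtain i where i: "i : K" using components_subset[OF D] by blast
 hence il: "i < length (disks D)" using components_subset[OF D] by auto
 have "card (sides_of D {i}) = length (face D i)"
  by (subst set_face[OF il, symmetric], rule distinct_card) (simp add: face_def distinct_map inj_on_def)
 thus ?case using i il walk_face[OF D(1) il] n[OF il] set_face[OF il]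
  by (intro exI[of _ "{i}"] exI[of _ "face D i"] exI[of _ "vertex D (i, 0)"])
   (auto simp: ev_face, auto simp: face_def distinct_map inj_on_def)
next
 case (Suc m)
 then obtain J W p where J: "J <= K" "card J = Suc m" and dist: "distinct W" and WJ: "set W <= sides_of D J"
  and rem: "\<forall>a \<in> sides_of D J - set W. glue D a : sides_of D J - set W"
  and len: "length W + 2 * card J = card (sides_of D J) + 2"
  and wk: "walk (vertex D) (glue D) p W p" and vW: "vertex D ` sides_of D J <= insert p (vertex D ` set W)"
  and deg: "Rdeg r (sum_list (map (%a. ev (side_label D a)) W)) (\<Sum>i\<in>J. n i)" by auto
 have "J ~= {}" "J ~= K" using J Suc.prems by auto
 then obtain a where a: "a : sides_of D J" "glue D a : sides_of D (K - J)" using component_crossing[OF D J(1)] by metis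
 define b where "b = glue D a"
 define i where "i = fst b"
 have iK: "i : K - J" and il: "i < length (disks D)" and bs: "b : sides_of D {i}"
  using a(2) by (auto simp: b_def i_def sides_of_def sides_def)
 have gb: "glue D b = a" and eb: "ev (side_label D b) = - ev (side_label D a)" using a D(1) by (auto simp: b_def gluing_def sides_of_def)
 have aW: "a : set W" using rem a by (force simp: sides_of_def)
 obtain X Y where XY: "W = X @ a # Y" using aW by (meson split_list)
 obtain X' Y' where XY': "face D i = X' @ b # Y'" using bs set_face[OF il] by (metis split_list)
 define Y1 where "Y1 = Y @ X"
 define Z1 where "Z1 = Y' @ X'"
 have disj: "sides_of D J Int sides_of D {i} = {}" using iK by (auto simp: sides_of_def)
 have df: "distinct (face D i)" by (simp add: face_def distinct_map inj_on_def)
 have sY: "set Y1 = set W - {a}" using dist XY by (auto simp: Y1_def)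
 have sZ: "set Z1 = sides_of D {i} - {b}" using df XY' set_face[OF il] by (auto simp: Z1_def)
 have wY: "walk (vertex D) (glue D) (vertex D b) Y1 (vertex D a)" using walk_rotate[OF wk[unfolded XY]] by (simp add: Y1_def b_def)
 have wZ: "walk (vertex D) (glue D) (vertex D a) Z1 (vertex D b)"
  using walk_rotate[OF walk_face[OF D(1) il, unfolded XY']] by (simp add: Z1_def gb)
 let ?W = "Y1 @ Z1" and ?J = "insert i J"
 let ?e = "%a. ev (side_label D a)"
 have finJ: "finite J" using J(2) card_ge_0_finite by force
 have cl: "glue D c : sides_of D ?J - set ?W" if "c : sides_of D ?J - set ?W" for c
 proof (cases "c : sides_of D J - set W")
  case True
  hence "glue D c : sides_of D J - set W" using rem by blast
  thus ?thesis using disj WJ sY sZ by (auto simp: sides_of_insert[of D i J])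
 next
  case False
  hence "c = a \<or> c = b" using that sY sZ by (auto simp: sides_of_insert[of D i J])
  hence "glue D c = b \<or> glue D c = a" using gb b_def by auto
  thus ?thesis using bs a(1) aW disj sY sZ WJ by (auto simp: sides_of_insert[of D i J])
 qed
 \<comment> \<open>Both ends of the glued edge survive, since the remaining boundary
   \<open>Z1\<close> of the new disk leads from one to the other.\<close>
 have ca: "vertex D a : insert (vertex D b) (vertex D ` set ?W)" using wZ by (cases Z1) auto
 have p: "p : insert (vertex D a) (vertex D ` set Y1)" using wk aW sY by (cases W) auto
 have vv: "vertex D ` sides_of D ?J <= insert (vertex D b) (vertex D ` set ?W)"
 proof -
  have "vertex D ` sides_of D J <= insert (vertex D b) (vertex D ` set ?W)"
  proof -
   have "vertex D ` set W = insert (vertex D a) (vertex D ` set Y1)" using sY aW by (metis image_insert insert_Diff)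
   hence h1: "insert p (vertex D ` set W) <= insert (vertex D a) (vertex D ` set Y1)" using p by simp
   have "vertex D ` set Y1 <= vertex D ` set ?W" by (rule image_mono) simp
   hence h2: "insert (vertex D a) (vertex D ` set Y1) <= insert (vertex D b) (vertex D ` set ?W)"
    by (intro insert_subsetI[OF ca] subset_insertI2)
   from order.trans[OF vW order.trans[OF h1 h2]] show ?thesis .
  qed
  moreover have "vertex D ` sides_of D {i} <= insert (vertex D b) (vertex D ` set ?W)"
  proof -
   have "vertex D ` sides_of D {i} = insert (vertex D b) (vertex D ` set Z1)" using sZ bs by (metis image_insert insert_Diff)
   moreover have "vertex D ` set Z1 <= vertex D ` set ?W" by (rule image_mono) simp
   ultimately show ?thesis by (simp add: subset_insertI2)
  qed
  ultimately show ?thesis by (simp add: sides_of_insert[of D i J] image_Un)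
 qed
 have c1: "card (sides_of D ?J) = card (sides_of D J) + card (sides_of D {i})"
  unfolding sides_of_insert[of D i J] using disj by (intro card_Un_disjoint) auto
 have c2: "card (sides_of D {i}) = length (face D i)" using distinct_card[OF df] set_face[OF il] by simp
 have "length ?W + 2 * card ?J = card (sides_of D ?J) + 2" using len XY XY' iK finJ by (simp add: c1 c2 Y1_def Z1_def)
 moreover have "Rdeg r (sum_list (map ?e ?W)) (\<Sum>i\<in>?J. n i)"
 proof -
  have 1: "Rdeg r (sum_list (map ?e (a # Y1))) (\<Sum>i\<in>J. n i)" using deg Rdeg_rotate[of r ?e X "a # Y"] by (simp add: XY Y1_def)
  have 2: "Rdeg r (sum_list (map ?e (b # Z1))) (n i)"
   using n[OF il] Rdeg_rotate[of r ?e X' "b # Y'"] by (simp add: XY' Z1_def flip: ev_face)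
  have "sum_list (map ?e ?W) = (- ?e a + sum_list (map ?e (a # Y1)) + ?e a) + sum_list (map ?e (b # Z1))" by (simp add: eb add.assoc)
  hence "Rdeg r (sum_list (map ?e ?W)) ((\<Sum>i\<in>J. n i) + n i)" using Rdeg_add[OF Rdeg_conj'[OF 1, of "?e a"] 2] by (simp only:)
  thus ?thesis using iK finJ by (simp add: add.commute)
 qed
 moreover have "distinct ?W"
 proof -
  have "distinct Y1" "distinct Z1" using dist df by (simp_all add: XY XY' Y1_def Z1_def) blast+
  moreover have "set Y1 Int set Z1 = {}" using disj WJ unfolding sY sZ by blast
  ultimately show ?thesis by simp
 qed
 moreover have "set ?W <= sides_of D ?J" using WJ sY sZ by (simp add: sides_of_insert[of D i J]) blast
 moreover have "walk (vertex D) (glue D) (vertex D b) ?W (vertex D b)" using wY wZ walk_append by metis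
 moreover have "?J <= K" "card ?J = Suc (Suc m)" using iK J finJ by simp_all
 ultimately show ?case using cl vv by blast
qed

text \<open>The component is cut open to one polygon. Its boundary value is a relation because it is
  assembled from the disks, and a product of at most genus many commutators because its sides are
  glued in pairs.\<close>

theorem component_relation:
 assumes D: "gluing D" "K : components D"
  and n: "!!i. i < length (disks D) ==> Rdeg r (ev (concat (disks D ! i))) (n i)"
 shows "\<exists>w k. Rdeg r w (\<Sum>i\<in>K. n i) & Comm k w & 2 * int k <= 2 - euler_characteristic D K"
proof -
 have fin: "finite K" using components_subset[OF D] finite_subset by blast
 have "card K > 0" using components_subset[OF D] fin by auto
 then obtain J W p where J: "J <= K" "card J = card K" and dist: "distinct W" and WJ: "set W <= sides_of D J"
  and rem: "\<forall>a \<in> sides_of D J - set W. glue D a : sides_of D J - set W"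
  and len: "length W + 2 * card J = card (sides_of D J) + 2"
  and wk: "walk (vertex D) (glue D) p W p" and vW: "vertex D ` sides_of D J <= insert p (vertex D ` set W)"
  and deg: "Rdeg r (sum_list (map (%a. ev (side_label D a)) W)) (\<Sum>i\<in>J. n i)"
  using merge_faces[OF D n, where m = "card K - 1"] by auto
 have [simp]: "J = K" using J fin card_subset_eq by blast
 have glK: "glue D a : sides_of D K" if "a : sides_of D K" for a
 proof -
  have "fst a : K" "a : sides D" using that by (auto simp: sides_of_def)
  moreover obtain i where "K = same_component D `` {i}" using D(2) by (auto simp: components_def quotient_def)
  ultimately have "fst (glue D a) : K" by (auto simp: same_component_def intro: equivclp_trans r_into_equivclp)
  thus ?thesis using \<open>a : sides D\<close> D(1) by (auto simp: sides_of_def gluing_def)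
 qed
 have g: "glue D a : set W & glue D a ~= a & glue D (glue D a) = a &
   ev (side_label D (glue D a)) = - ev (side_label D a)" if "a : set W" for a
 proof -
  have a: "a : sides_of D K" using that WJ by auto
  have "glue D a : set W"
  proof (rule ccontr)
   assume "glue D a ~: set W"
   hence "glue D (glue D a) ~: set W" using rem glK[OF a] by auto
   thus False using that a D(1) by (auto simp: gluing_def sides_of_def)
  qed
  thus ?thesis using a D(1) by (auto simp: gluing_def sides_of_def)
 qed
 obtain k where k: "Comm k (sum_list (map (%a. ev (side_label D a)) W))"
  "4 * k + 2 * card (insert p (vertex D ` set W)) <= length W + 2" using Comm_closed_walk[OF dist g wk] by blast
 have "card (vertex D ` sides_of D K) <= card (insert p (vertex D ` set W))" using vW by (intro card_mono) auto
 moreover have "sides_of D K // same_vertex D = vertex D ` sides_of D K" by (auto simp: quotient_def vertex_def)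
 moreover have "2 * card ((%a. {a, glue D a}) ` sides_of D K) = card (sides_of D K)"
  using glK by (intro card_edges[OF D(1)]) (auto simp: sides_of_def)
 ultimately have "2 * int k <= 2 - euler_characteristic D K" using k(2) len unfolding euler_characteristic_def by simp
 thus ?thesis using k(1) deg by auto
qed

section \<open>Diagrams from relations\<close>

text \<open>A closed surface is kept as a list of polygons \<open>Ps\<close> together with one further polygon \<open>Q\<close> whose
  sides are to be folded away. The sides are numbers, \<open>gl\<close> pairs them, \<open>l\<close> gives their letters and \<open>v\<close>
 assigns labels to initial vertices. The set \<open>T\<close> meets every component that does not contain \<open>Q\<close>.
 The last condition says that the sum over all components of \<open>2\<close> minus the Euler
 characteristic is at most \<open>2 * k\<close>; it is stated without subtraction, and both the number of
 components and the number of vertices enter through estimates only.\<close>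

definition closed_under :: "nat list list => (nat => nat) => nat set => bool" where
 "closed_under Fs gl Z \<longleftrightarrow> (\<forall>a\<in>Z. gl a : Z) & (\<forall>F\<in>set Fs. set F Int Z ~= {} --> set F <= Z)"

definition folding_surface ::
 "nat list list => nat list => (nat => nat) => (nat => 'a letter) => (nat => nat) => nat set => nat => bool" where
 "folding_surface Ps Q gl l v T k \<longleftrightarrow>
   distinct (Q @ concat Ps) & [] ~: set Ps &
   (\<forall>a\<in>set (Q @ concat Ps). gl a : set (Q @ concat Ps) & gl a ~= a & gl (gl a) = a &
    l (gl a) = inverse_letter (l a)) &
   (\<forall>F\<in>set (Q # Ps). \<exists>p. walk v gl p F p) & finite T &
   (\<forall>Z. Z <= set (Q @ concat Ps) --> closed_under (Q # Ps) gl Z --> Z ~= {} --> Z Int (set Q Un T) ~= {}) &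
   4 * card T + 4 + card (set (Q @ concat Ps))
    <= 4 * k + 2 * card (v ` set (Q @ concat Ps)) + 2 * (length Ps + 1)"

lemma walk_cong:
 assumes "walk v g p W q" "!!a. a : set W ==> v' a = f (v a) & v' (g' a) = f (v (g a))"
 shows "walk v' g' (f p) W (f q)" using assms
proof (induction W arbitrary: p)
 case (Cons a W)
 have "walk v' g' (f (v (g a))) W (f q)" using Cons.prems by (intro Cons.IH) auto
 thus ?case using Cons.prems by auto
qed simp

text \<open>Along a walk every vertex is entered as often as it is left, except for the two
  ends.\<close>

lemma walk_mset: "walk v g p W q ==> add_mset p (mset (map (v o g) W)) = add_mset q (mset (map v W))"
proof (induction W arbitrary: p)
 case (Cons a W)
 hence "add_mset (v (g a)) (mset (map (v o g) W)) = add_mset q (mset (map v W))" by (auto simp: comp_def)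
 thus ?case using Cons.prems by (simp add: add_mset_commute comp_def)
qed simp

lemma mset_concat_closed_walks:
 assumes "!!F. F : set Fs ==> \<exists>p. walk v g p F p"
 shows "mset (map (v o g) (concat Fs)) = mset (map v (concat Fs))" using assms
proof (induction Fs)
 case (Cons F Fs)
 obtain p where "walk v g p F p" using Cons.prems by auto
 hence "mset (map (v o g) F) = mset (map v F)" using walk_mset by fastforce
 moreover have "mset (map (v o g) (concat Fs)) = mset (map v (concat Fs))" using Cons.prems by (intro Cons.IH) auto
 ultimately show ?case by (simp only: concat.simps map_append mset_append)
qed simp

lemma card_image_fold:
 assumes "finite B" "X <= insert x (f ` B)"
 shows "card X <= Suc (card (f ` B))"
proof -
 have "card X <= card (insert x (f ` B))" using assms by (intro card_mono) auto
 also have "\<dots> <= Suc (card (f ` B))" using assms by (intro card_insert_le_m1) auto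
 finally show ?thesis .
qed

lemma folding_surfaceI:
 assumes "A = set (Q @ concat Ps)" "distinct (Q @ concat Ps)" "[] ~: set Ps"
  and "!!a. a : A ==> gl a : A & gl a ~= a & gl (gl a) = a & l (gl a) = inverse_letter (l a)"
  and "\<forall>F\<in>set (Q # Ps). \<exists>p. walk v gl p F p" "finite T"
  and "!!Z. Z <= A ==> closed_under (Q # Ps) gl Z ==> Z ~= {} ==> Z Int (set Q Un T) ~= {}"
  and "4 * card T + 4 + card A <= 4 * k + 2 * card (v ` A) + 2 * (length Ps + 1)"
 shows "folding_surface Ps Q gl l v T k" unfolding folding_surface_def assms(1)[symmetric] using assms(2-) by blast

text \<open>If \<open>s\<close> and \<open>t\<close> are glued to each other, folding removes one
  edge and at most one vertex. Otherwise their partners are glued to each other, and the start of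
  \<open>s\<close> must be identified with the end of \<open>t\<close>. When these are different
  vertices, one edge and one vertex disappear; when they agree, folding may pinch off a component,
  which then gets a vertex of its own and a representative in \<open>T\<close>.\<close>

lemma fold_step:
 assumes surf: "folding_surface Ps (U @ s # t # W) gl l v T k"
  and ne: "U @ W ~= []" and lt: "l t = inverse_letter (l s)"
 shows "\<exists>gl' v' T'. folding_surface Ps (U @ W) gl' l v' T' k &
  (\<forall>a\<in>set (U @ W). gl a : set (U @ W) --> gl' a = gl a)"
proof -
 let ?Q = "U @ s # t # W" and ?Q' = "U @ W"
 define A where "A = set (?Q @ concat Ps)"
 define A' where "A' = set (?Q' @ concat Ps)"
 have dist: "distinct (?Q @ concat Ps)" and nonnil: "[] ~: set Ps"
  and gl: "!!a. a : A ==> gl a : A" "!!a. a : A ==> gl a ~= a" "!!a. a : A ==> gl (gl a) = a"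
   "!!a. a : A ==> l (gl a) = inverse_letter (l a)"
  and walks: "!!F. F : set Ps ==> \<exists>p. walk v gl p F p" and wQ: "\<exists>p. walk v gl p ?Q p" and finT: "finite T"
  and conn: "!!Z. Z <= A ==> closed_under (?Q # Ps) gl Z ==> Z ~= {} ==> Z Int (set ?Q Un T) ~= {}"
  and count: "4 * card T + 4 + card A <= 4 * k + 2 * card (v ` A) + 2 * (length Ps + 1)"
  using surf unfolding folding_surface_def A_def by (blast, blast, blast, blast, blast, blast, fastforce, fastforce, blast, blast, blast)
 have A'A: "A' = A - {s, t}" and st: "s : A" "t : A" "s ~= t" using dist by (auto simp: A_def A'_def)
 have finA: "finite A" "finite A'" by (simp_all add: A_def A'_def)
 have cA: "card A = card A' + 2"
 proof -
  have "A = insert s (insert t A')" using st A'A by auto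
  moreover have "s ~: insert t A'" "t ~: A'" using st A'A by auto
  ultimately show ?thesis using finA(2) by simp
 qed
 have dist': "distinct (?Q' @ concat Ps)" using dist by auto
 obtain p where wU: "walk v gl p U (v s)" and vt: "v t = v (gl s)" and wW: "walk v gl (v (gl t)) W p" using wQ by (auto simp: walk_append)
 have old: "Z Int (set ?Q' Un T) ~= {}"
  if Z: "Z <= A'" "closed_under (?Q' # Ps) gl' Z" "Z ~= {}" and agree: "!!a. a : Z ==> gl' a = gl a" for Z gl'
 proof
  assume disj: "Z Int (set ?Q' Un T) = {}"
  have "closed_under (?Q # Ps) gl Z" using Z disj agree unfolding closed_under_def A'A by auto
  hence "Z Int (set ?Q Un T) ~= {}" using conn Z A'A by blast
  thus False using disj Z(1) unfolding A'A by auto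
 qed
 show ?thesis
 proof (cases "gl s = t")
  case True
  hence ts: "gl t = s" using gl(3)[OF st(1)] by simp
  have glA': "gl a : A'" if "a : A'" for a
  proof -
   have "a : A" "a ~= s" "a ~= t" using that A'A by auto
   hence "gl a ~= s" "gl a ~= t" using gl(3)[of a] True ts by metis+
   thus ?thesis using gl(1) \<open>a : A\<close> A'A by auto
  qed
  have wQ': "walk v gl p ?Q' p" using wU wW ts walk_append by metis
  have "v ` A <= insert (v t) (v ` A')"
  proof -
   have "v s : v ` A'"
   proof (cases W)
    case Nil
    hence "U ~= []" "p = v s" using ne wW ts by auto
    hence "v (hd U) = v s" "hd U : A'" using wU by (cases U; auto simp: A'_def)+
    thus ?thesis by (metis imageI)
   next
    case (Cons y W')
    hence "v y = v s" "y : A'" using wW ts by (auto simp: A'_def)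
    thus ?thesis by (metis imageI)
   qed
   thus ?thesis unfolding A'A by auto
  qed
  hence cv: "card (v ` A) <= Suc (card (v ` A'))" by (rule card_image_fold[OF finA(2)])
  have "folding_surface Ps ?Q' gl l v T k"
  proof (rule folding_surfaceI[OF A'_def dist' nonnil _ _ finT])
   show "gl a : A' & gl a ~= a & gl (gl a) = a & l (gl a) = inverse_letter (l a)" if "a : A'" for a using glA'[OF that] gl that A'A by simp
   show "\<forall>F\<in>set (?Q' # Ps). \<exists>p. walk v gl p F p" using wQ' walks by (metis set_ConsD)
   show "4 * card T + 4 + card A' <= 4 * k + 2 * card (v ` A') + 2 * (length Ps + 1)" using count cA cv by linarith
  qed (rule old, simp_all)
  thus ?thesis by blast
 next
  case False
  define s' where "s' = gl s"
  define t' where "t' = gl t"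
  have is': "gl s' = s" and it': "gl t' = t" using gl(3) st by (auto simp: s'_def t'_def)
  have s't': "s' : A'" "t' : A'" "s' ~= t'" "s' ~= s" "t' ~= t" using gl(1,2) st False is' it' unfolding A'A s'_def t'_def by (auto; metis)+
  define j where "j = gl(s' := t', t' := s')"
  have j: "j s' = t'" "j t' = s'" "!!a. a ~= s' ==> a ~= t' ==> j a = gl a" using s't' by (auto simp: j_def)
  have jA: "j a : A' & j a ~= a & j (j a) = a & l (j a) = inverse_letter (l a)" if a: "a : A'" for a
  proof (cases "a = s' \<or> a = t'")
   case True
   have "l s' = inverse_letter (l s)" "l t' = inverse_letter (l t)" using gl(4) st by (auto simp: s'_def t'_def)
   thus ?thesis using True s't' j lt by auto
  next
   case False
   have aA: "a : A" "a ~= s" "a ~= t" using a A'A by auto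
   have "gl a ~= s" "gl a ~= t" "gl a ~= s'" "gl a ~= t'" using gl(3)[OF aA(1)] False aA is' it' s'_def t'_def by metis+
   thus ?thesis using gl[OF aA(1)] aA False A'A j by auto
  qed
  have vj: "v (j t') = v (gl t')" using vt it' j by (simp add: s'_def)
  have agreeQ: "\<forall>a\<in>set (U @ W). gl a : set (U @ W) --> j a = gl a"
  proof (intro ballI impI)
   fix a assume "a : set (U @ W)" "gl a : set (U @ W)"
   hence "gl a ~= s" "gl a ~= t" using dist by auto
   thus "j a = gl a" using j(3) is' it' by metis
  qed
  have walk_j: "walk (f o v) j (f q) F (f q')"
   if "walk v gl q F q'" "f (v s) = f (v t')" for f :: "nat => nat" and F q q'
  proof (rule walk_cong[OF that(1)])
   fix a
   show "(f o v) a = f (v a) & (f o v) (j a) = f (v (gl a))" using j vj is' that(2) by (cases "a = s'"; cases "a = t'") auto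
  qed
  have walks_f: "\<forall>F\<in>set (?Q' # Ps). \<exists>q. walk (f o v) j q F q"
   if f: "f (v s) = f (v t')" for f :: "nat => nat"
  proof
   fix F assume "F : set (?Q' # Ps)"
   then consider "F = ?Q'" | "F : set Ps" by auto
   thus "\<exists>q. walk (f o v) j q F q"
   proof cases
    case 1
    have "walk (f o v) j (f p) U (f (v s))" "walk (f o v) j (f (v t')) W (f p)"
     using walk_j[OF wU f] walk_j[OF wW f] by (simp_all add: t'_def)
    thus ?thesis using 1 f walk_append by metis
   next
    case 2
    thus ?thesis using walks walk_j[OF _ f] by metis
   qed
  qed
  \<comment> \<open>The common vertex is still visited by the remaining boundary \<open>?Q'\<close>,
    so it survives outside a component that splits off.\<close>
  have y: "\<exists>y\<in>set ?Q'. v y = v t'" if "v s = v t'"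
  proof (cases W)
   case Nil
   hence "U ~= []" "p = v t'" using ne wW by (auto simp: t'_def)
   thus ?thesis using wU by (cases U) auto
  next
   case (Cons y W')
   thus ?thesis using wW by (auto simp: t'_def)
  qed
  \<comment> \<open>Over the polygons in \<open>Z\<close>, terminal vertices match initial ones with
    multiplicity: with respect to \<open>gl\<close> because boundaries are closed walks, with
    respect to \<open>j\<close> because \<open>j\<close> permutes \<open>Z\<close>. On
    \<open>Z\<close> the two differ only in the end of \<open>s'\<close>.\<close>
  have sep: "v s = v t'"
   if Z: "Z <= A'" "closed_under (?Q' # Ps) j Z" "s' : Z" "Z Int set ?Q' = {}" for Z
  proof -
   define Fs where "Fs = filter (%F. set F Int Z ~= {}) Ps"
   have setFs: "set (concat Fs) = Z"
   proof (intro equalityI subsetI)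
    fix z assume "z : set (concat Fs)"
    then obtain F where "F : set Ps" "set F Int Z ~= {}" "z : set F" by (auto simp: Fs_def)
    moreover from this have "set F <= Z" using Z(2) unfolding closed_under_def by simp
    ultimately show "z : Z" by blast
   next
    fix z assume z: "z : Z"
    hence "z : set (concat Ps)" using Z(1,4) unfolding A'_def by auto
    then obtain F where "F : set Ps" "z : set F" by auto
    thus "z : set (concat Fs)" using z by (auto simp: Fs_def)
   qed
   have "distinct (concat Ps)" using dist by auto
   hence dFs: "distinct (concat Fs)" unfolding Fs_def by (induction Ps) auto
   have ms: "mset (concat Fs) = mset_set Z" using mset_set_set[OF dFs] setFs by simp
   have t'Z: "t' : Z" using Z(2,3) j(1) by (auto simp: closed_under_def)
   have jZ: "j a : Z" if "a : Z" for a using Z(2) that by (auto simp: closed_under_def)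
   have finZ: "finite Z" using Z(1) finA(2) finite_subset by blast
   have injj: "inj_on j Z" using jA Z(1) by (intro inj_on_inverseI[of _ j]) auto
   have "j ` Z = Z" using jZ injj finZ by (intro endo_inj_surj) auto
   hence "image_mset j (mset_set Z) = mset_set Z" using injj by (simp add: image_mset_mset_set)
   hence "image_mset (v o j) (mset_set Z) = image_mset v (mset_set Z)" by (metis multiset.map_comp)
   also have "\<dots> = image_mset (v o gl) (mset_set Z)" using mset_concat_closed_walks[of Fs v gl] walks ms by (simp add: Fs_def)
   finally have eq: "image_mset (v o j) (mset_set Z) = image_mset (v o gl) (mset_set Z)" .
   have Zs: "mset_set Z = add_mset s' (mset_set (Z - {s'}))" using finZ Z(3) by (metis mset_set.remove)
   have "image_mset (v o j) (mset_set (Z - {s'})) = image_mset (v o gl) (mset_set (Z - {s'}))"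
   proof (rule image_mset_cong)
    fix a assume "a \<in># mset_set (Z - {s'})"
    hence "a ~= s'" using finZ by auto
    thus "(v o j) a = (v o gl) a" using vj j(3) by (cases "a = t'") auto
   qed
   thus ?thesis using eq j(1) is' unfolding Zs by simp
  qed
  have key: "v s = v t' & s' : Z & t' : Z"
   if Z: "Z <= A'" "closed_under (?Q' # Ps) j Z" "Z ~= {}" "Z Int (set ?Q' Un T) = {}" for Z
  proof -
   have st: "s' : Z \<longleftrightarrow> t' : Z" using Z(2) j by (auto simp: closed_under_def)
   have "s' : Z"
   proof (rule ccontr)
    assume "s' ~: Z"
    hence "!!a. a : Z ==> j a = gl a" using st j(3) by metis
    thus False using old[OF Z(1-3)] Z(4) by blast
   qed
   thus ?thesis using st sep[OF Z(1,2)] Z(4) by blast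
  qed
  show ?thesis
  proof (cases "\<exists>Z. Z <= A' & closed_under (?Q' # Ps) j Z & Z ~= {} & Z Int (set ?Q' Un T) = {}")
   case False
   \<comment> \<open>No component splits off, so the two ends are identified, at the cost of one
     vertex.\<close>
   define f where "f = (%x. if x = v s then v t' else x)"
   have f: "f (v s) = f (v t')" by (auto simp: f_def)
   have "v ` A <= insert (v s) ((f o v) ` A')"
   proof
    fix x assume "x : v ` A"
    then obtain a where a: "a : A" "x = v a" by blast
    show "x : insert (v s) ((f o v) ` A')"
    proof (cases "v a = v s")
     case False
     hence "\<exists>b\<in>A'. v b = v a" using a vt s't'(1) unfolding A'A by (cases "a = t") (auto simp: s'_def)
     then obtain b where b: "b : A'" "v b = v a" by blast
     hence "(f o v) b = x" using False a by (simp add: f_def)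
     thus ?thesis using b(1) by blast
    qed (use a in auto)
   qed
   hence cv: "card (v ` A) <= Suc (card ((f o v) ` A'))" by (rule card_image_fold[OF finA(2)])
   have "folding_surface Ps ?Q' j l (f o v) T k"
   proof (rule folding_surfaceI[OF A'_def dist' nonnil jA walks_f[OF f] finT])
    show "4 * card T + 4 + card A' <= 4 * k + 2 * card ((f o v) ` A') + 2 * (length Ps + 1)" using count cA cv by linarith
   qed (use False in blast)+
   thus ?thesis using agreeQ by blast
  next
   case True
   then obtain Z where Z: "Z <= A'" "closed_under (?Q' # Ps) j Z" "Z ~= {}" "Z Int (set ?Q' Un T) = {}" by blast
   have vs: "v s = v t'" and sZ: "s' : Z" "t' : Z" using key[OF Z] by auto
   obtain y where y: "y : set ?Q'" "v y = v t'" using y[OF vs] by blast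
   \<comment> \<open>Doubled labels leave the odd numbers for the vertices of the new
     component.\<close>
   define v' where "v' = (%a. 2 * v a + (if a : Z then 1 else 0))"
   have jZ: "j a : Z \<longleftrightarrow> a : Z" if "a : A'" for a using Z(2) jA[OF that] unfolding closed_under_def by metis
   have wv: "\<forall>F\<in>set (?Q' # Ps). \<exists>q. walk v' j q F q"
   proof
    fix F assume F: "F : set (?Q' # Ps)"
    then obtain q where q: "walk v j q F q" using walks_f[of id] vs by auto
    define h where "h = (if set F Int Z = {} then 0 else 1 :: nat)"
    have FA: "set F <= A'" using F by (auto simp: A'_def)
    have "walk v' j ((%x. 2 * x + h) q) F ((%x. 2 * x + h) q)"
    proof (rule walk_cong[OF q])
     fix a assume a: "a : set F"
     hence iff: "a : Z \<longleftrightarrow> set F Int Z ~= {}" using Z(2) F unfolding closed_under_def by auto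
     have "j a : Z \<longleftrightarrow> a : Z" using jZ a FA by blast
     thus "v' a = 2 * v a + h & v' (j a) = 2 * v (j a) + h" by (simp add: v'_def h_def iff)
    qed
    thus "\<exists>q. walk v' j q F q" by blast
   qed
   \<comment> \<open>An old label x becomes 2 x if this label occurs outside \<open>Z\<close>, and 2
     x + 1 otherwise. The vertex of \<open>y\<close> occurs on both sides, so \<open>v' t'\<close>
     is an additional label; this vertex and the two removed sides pay for the new element of
     \<open>T\<close>.\<close>
   have "insert (v' t') ((%x. 2 * x + (if x = v y then 0 else if 2 * x : v' ` A' then 0 else 1)) ` (v ` A')) <= v' ` A'"
   proof -
    have "2 * v y : v' ` A'" using y Z(4) by (force simp: v'_def A'_def image_iff)
    hence "2 * v a + (if v a = v y then 0 else if 2 * v a : v' ` A' then 0 else 1) : v' ` A'"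
     if "a : A'" for a using imageI[OF that, of v'] by (cases "a : Z") (auto simp: v'_def)
    thus ?thesis using s't'(2) by (intro insert_subsetI) blast+
   qed
   hence "card (insert (v' t') ((%x. 2 * x + (if x = v y then 0 else if 2 * x : v' ` A' then 0 else 1)) ` (v ` A')))
     <= card (v' ` A')" using finA by (intro card_mono) auto
   moreover have "v' t' ~: (%x. 2 * x + (if x = v y then 0 else if 2 * x : v' ` A' then 0 else 1)) ` (v ` A')"
   proof
    assume "v' t' : (%x. 2 * x + (if x = v y then 0 else if 2 * x : v' ` A' then 0 else 1)) ` (v ` A')"
    then obtain x where "2 * v t' + 1 = 2 * x + (if x = v y then 0 else if 2 * x : v' ` A' then 0 else 1)" using sZ by (auto simp: v'_def)
    thus False using y by (auto split: if_splits) presburger+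
   qed
   moreover have "inj_on (%x. 2 * x + (if x = v y then 0 else if 2 * x : v' ` A' then 0 else 1)) (v ` A')"
    by (rule inj_onI, drule arg_cong[where f = "%n. n div 2"]) (simp split: if_splits)
   moreover have "v ` A = v ` A'"
   proof -
    have "v s : v ` A'" "v t : v ` A'" using s't' vs vt by (auto simp: s'_def)
    thus ?thesis using A'A by auto
   qed
   ultimately have cv: "Suc (card (v ` A)) <= card (v' ` A')" using finA by (simp add: card_image)
   have conn': "Z2 Int (set ?Q' Un insert t' T) ~= {}"
    if Z2: "Z2 <= A'" "closed_under (?Q' # Ps) j Z2" "Z2 ~= {}" for Z2 using key[OF Z2] by blast
   have cT: "card (insert t' T) = Suc (card T)" using Z(4) sZ finT by (subst card_insert_disjoint) auto
   have "folding_surface Ps ?Q' j l v' (insert t' T) k"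
   proof (rule folding_surfaceI[OF A'_def dist' nonnil jA wv _ conn'])
    show "4 * card (insert t' T) + 4 + card A' <= 4 * k + 2 * card (v' ` A') + 2 * (length Ps + 1)" using count cA cv cT by linarith
   qed (use finT in simp_all)
   thus ?thesis using agreeQ by blast
  qed
 qed
qed

lemma not_reduced_split:
 assumes "~ reduced w"
 obtains u x w' where "w = u @ x # inverse_letter x # w'" using assms
proof (induction w arbitrary: thesis)
 case (Cons a w)
 show ?case
 proof (cases "reduced w")
  case True
  hence "w ~= []" "hd w = inverse_letter a" using Cons.prems by (auto simp: reduced_Cons)
  thus ?thesis using Cons.prems(1)[of "[]" a "tl w"] by (cases w) auto
 next
  case False
  then obtain u x w' where "w = u @ x # inverse_letter x # w'" using Cons.IH by blast
  thus ?thesis using Cons.prems(1)[of "a # u"] by auto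
 qed
qed simp

text \<open>A nonempty word of trivial value has adjacent inverse letters to fold. The markers stay
  glued to each other because folding keeps all pairs whose two sides both remain in the folded
  polygon.\<close>

lemma fold_all:
 assumes "folding_surface Ps (Q @ [m, m']) gl l v T k" "gl m = m'" "ev (map l Q) = 0"
 shows "\<exists>gl v T. folding_surface Ps [m, m'] gl l v T k & gl m = m'" using assms
proof (induction "length Q" arbitrary: Q gl v T rule: less_induct)
 case less
 show ?case
 proof (cases "Q = []")
  case True
  thus ?thesis using less.prems by auto
 next
  case False
  have "~ reduced (map l Q)"
  proof
   assume "reduced (map l Q)"
   hence "map l Q = Rep_fg (ev (map l Q))" by simp
   thus False using less.prems(3) False by simp
  qed
  then obtain u x w where "map l Q = u @ x # inverse_letter x # w" by (rule not_reduced_split)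
  then obtain U s t W where Q: "Q = U @ s # t # W" "map l U = u" "map l W = w" "l s = x" "l t = inverse_letter x"
   by (auto simp: map_eq_append_conv map_eq_Cons_conv)
  have "folding_surface Ps (U @ s # t # (W @ [m, m'])) gl l v T k" using less.prems(1) Q by simp
  from fold_step[OF this] Q obtain j v' T' where
   j: "folding_surface Ps (U @ W @ [m, m']) j l v' T' k" "\<forall>a\<in>set (U @ W @ [m, m']). gl a : set (U @ W @ [m, m']) --> j a = gl a"
   by auto
  have "ev (map l Q) = ev (map l (U @ W))"
   using ev_append[of "[x]" "[inverse_letter x]"] by (simp add: Q ev_inverse_letter ev_Cons[of "_ # _"] flip: Q(2,3))
    (metis (no_types, lifting) add.assoc add_0_left append_Cons append_Nil ev_append ev_inverse_letter right_minus)
  thus ?thesis using j less.prems(2,3) Q by (intro less.hyps[of "U @ W" j v' T']) auto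
 qed
qed

section \<open>Enlarging a surface by disks and handles\<close>

definition paired :: "nat set => (nat => nat) => (nat => 'a letter) => bool" where
 "paired A gl l \<longleftrightarrow> (\<forall>a\<in>A. gl a : A & gl a ~= a & gl (gl a) = a & l (gl a) = inverse_letter (l a))"

definition agree_on where
 "agree_on A v gl l v' gl' l' \<longleftrightarrow> (\<forall>a\<in>A. v' a = v a & gl' a = gl a & l' a = l a)"

lemma walk_agree:
 assumes "walk v gl p F q" "agree_on A v gl l v' gl' l'" "paired A gl l" "set F <= A"
 shows "walk v' gl' p F q"
proof -
 have "walk v' gl' (id p) F (id q)" using assms(2-4) by (intro walk_cong[OF assms(1)]) (auto simp: agree_on_def paired_def subset_iff)
 thus ?thesis by simp
qed

text \<open>Adding two chains of new sides that are glued to each other in opposite directions, the first one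
  leading from the vertex \<open>q\<close> to \<open>e\<close> through new vertices.\<close>

lemma extend_pairing:
 fixes A :: "nat set" and w :: "'a word" and v :: "nat => nat"
 assumes fin: "finite A" and pr: "paired A gl l" and q: "q : v ` A"
 obtains xs xs' gl' l' and v' :: "nat => nat" and e where
  "distinct (xs @ xs')" "set (xs @ xs') Int A = {}" "length xs = length w" "length xs' = length w"
  "agree_on A v gl l v' gl' l'" "paired (A Un set (xs @ xs')) gl' l'"
  "!!a. a : set xs ==> gl' a : set xs'" "!!a. a : set xs' ==> gl' a : set xs"
  "map l' xs = w" "map l' xs' = inverse_word w" "walk v' gl' q xs e" "walk v' gl' e xs' q"
  "e : v' ` (A Un set (xs @ xs'))" "closed_loop ==> e = q"
  "card (v ` A) + length w <= card (v' ` (A Un set (xs @ xs'))) + (if closed_loop then 1 else 0)"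
proof -
 obtain N where N: "!!a. a : A ==> a < N" using fin by (auto simp: finite_nat_set_iff_bounded)
 have "finite (v ` A)" using fin by simp
 then obtain M where M: "!!x. x : v ` A ==> x < M" unfolding finite_nat_set_iff_bounded by blast
 define n where "n = length w"
 define xs where "xs = [N..<N + n]"
 define xs' where "xs' = [N + n..<N + 2 * n]"
 \<comment> \<open>The new sides are N, ..., N + 2 n - 1, and reversing this interval glues the
   first chain to the second with opposite direction.\<close>
 define gl' where "gl' = (%a. if a < N then gl a else 2 * N + 2 * n - 1 - a)"
 define l' where "l' = (%a. if a < N then l a else if a < N + n then w ! (a - N)
  else inverse_letter (w ! (N + 2 * n - 1 - a)))"
 \<comment> \<open>The vertices along the first chain: \<open>q\<close>, then fresh labels above
   those of \<open>A\<close>. A closed loop returns to \<open>q\<close> and so has one new vertex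
   less.\<close>
 define \<sigma> where "\<sigma> = (%i. if i = 0 then q else if i = n & closed_loop then q else M + i)"
 define v' where "v' = (%a. if a < N then v a else if a < N + n then \<sigma> (a - N) else \<sigma> (N + 2 * n - a))"
 have new: "set (xs @ xs') = {N..<N + 2 * n}" by (auto simp: xs_def xs'_def)
 have ag: "agree_on A v gl l v' gl' l'" using N by (auto simp: agree_on_def v'_def gl'_def l'_def)
 have prn: "gl' a : set (xs @ xs') & gl' a ~= a & gl' (gl' a) = a & l' (gl' a) = inverse_letter (l' a)"
  if a: "a : set (xs @ xs')" for a
 proof -
  have aN: "N <= a" "a < N + 2 * n" using a new by auto
  have "l' (gl' a) = inverse_letter (l' a)"
  proof (cases "a < N + n")
   case True
   hence "gl' a = 2 * N + 2 * n - 1 - a" "~ gl' a < N + n" "~ gl' a < N" using aN by (auto simp: gl'_def)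
   moreover have "N + 2 * n - 1 - (2 * N + 2 * n - 1 - a) = a - N" using aN True by simp
   ultimately show ?thesis using aN True by (simp add: l'_def)
  next
   case False
   hence "gl' a = 2 * N + 2 * n - 1 - a" "gl' a < N + n" "~ gl' a < N" using aN by (auto simp: gl'_def)
   moreover have "2 * N + 2 * n - 1 - a - N = N + 2 * n - 1 - a" using aN False by simp
   ultimately show ?thesis using aN False by (simp add: l'_def)
  qed
  moreover have "gl' a ~= a" using aN by (simp add: gl'_def) presburger
  ultimately show ?thesis using aN unfolding new by (auto simp: gl'_def)
 qed
 have pr': "paired (A Un set (xs @ xs')) gl' l'" unfolding paired_def
 proof
  fix a assume "a : A Un set (xs @ xs')"
  thus "gl' a : A Un set (xs @ xs') & gl' a ~= a & gl' (gl' a) = a & l' (gl' a) = inverse_letter (l' a)"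
   using prn[of a] ag pr unfolding agree_on_def paired_def by (metis Un_iff)
 qed
 have cross: "a : set xs ==> gl' a : set xs'" "a : set xs' ==> gl' a : set xs" for a by (auto simp: xs_def xs'_def gl'_def)
 have l1: "map l' xs = w" by (rule nth_equalityI) (auto simp: xs_def n_def l'_def)
 have l2: "map l' xs' = inverse_word w" by (rule nth_equalityI) (auto simp: xs'_def n_def l'_def inverse_word_def rev_nth)
 have w1: "walk v' gl' q xs (\<sigma> n)"
 proof (rule walk_nth)
  show "v' (gl' (xs ! i)) = (if Suc i < length xs then v' (xs ! Suc i) else \<sigma> n)" if "i < length xs" for i
  proof -
   have i: "i < n" using that by (simp add: xs_def)
   have "gl' (xs ! i) = N + 2 * n - 1 - i" using i by (simp add: xs_def gl'_def)
   moreover have "v' (N + 2 * n - 1 - i) = \<sigma> (Suc i)"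
   proof -
    have "~ N + 2 * n - 1 - i < N + n" "N + 2 * n - (N + 2 * n - 1 - i) = Suc i" using i by auto
    thus ?thesis by (simp add: v'_def)
   qed
   moreover have "Suc i < n ==> v' (xs ! Suc i) = \<sigma> (Suc i)" by (simp add: xs_def v'_def)
   moreover have "~ Suc i < n ==> n = Suc i" using i by simp
   ultimately show ?thesis by (auto simp: xs_def)
  qed
  show "q = (if xs = [] then \<sigma> n else v' (xs ! 0))" by (auto simp: xs_def v'_def \<sigma>_def)
 qed
 have w2: "walk v' gl' (\<sigma> n) xs' q"
 proof (rule walk_nth)
  show "v' (gl' (xs' ! i)) = (if Suc i < length xs' then v' (xs' ! Suc i) else q)" if "i < length xs'" for i
  proof -
   have i: "i < n" using that by (simp add: xs'_def)
   have "gl' (xs' ! i) = N + n - 1 - i" using i by (simp add: xs'_def gl'_def)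
   moreover have "v' (N + n - 1 - i) = \<sigma> (n - Suc i)"
   proof -
    have "N + n - 1 - i < N + n" "~ N + n - 1 - i < N" "N + n - 1 - i - N = n - Suc i" using i by auto
    thus ?thesis by (simp add: v'_def)
   qed
   moreover have "Suc i < n ==> v' (xs' ! Suc i) = \<sigma> (n - Suc i)"
   proof -
    assume "Suc i < n"
    hence "xs' ! Suc i = N + n + Suc i" "N + 2 * n - (N + n + Suc i) = n - Suc i" by (auto simp: xs'_def)
    thus ?thesis by (simp add: v'_def)
   qed
   moreover have "~ Suc i < n ==> n - Suc i = 0" using i by simp
   ultimately show ?thesis by (auto simp: xs'_def \<sigma>_def)
  qed
  show "\<sigma> n = (if xs' = [] then q else v' (xs' ! 0))" by (auto simp: xs'_def v'_def \<sigma>_def)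
 qed
 have vA: "v' ` A = v ` A" using ag by (auto simp: agree_on_def image_iff)
 have e: "\<sigma> n : v' ` (A Un set (xs @ xs'))"
 proof (cases "n = 0")
  case True
  thus ?thesis using q vA by (auto simp: \<sigma>_def)
 next
  case False
  hence "v' (N + n) = \<sigma> n" "N + n : set (xs @ xs')" unfolding new by (auto simp: v'_def)
  thus ?thesis by (metis UnI2 imageI)
 qed
 have cl: "closed_loop ==> \<sigma> n = q" by (simp add: \<sigma>_def)
 have cnt: "card (v ` A) + length w <= card (v' ` (A Un set (xs @ xs'))) + (if closed_loop then 1 else 0)"
 proof -
  define B where "B = (%i. M + i) ` (if closed_loop then {1..<n} else {1..<Suc n})"
  have "B <= v' ` (A Un set (xs @ xs'))"
  proof
   fix x assume "x : B"
   then obtain i where i: "x = M + i" "1 <= i" "i < n \<or> (i = n & ~ closed_loop)"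
   proof -
    obtain i where "i : (if closed_loop then {1..<n} else {1..<Suc n})" "x = M + i" using \<open>x : B\<close> unfolding B_def by blast
    thus thesis by (intro that[of i]) (auto split: if_splits)
   qed
   show "x : v' ` (A Un set (xs @ xs'))"
   proof (cases "i < n")
    case True
    hence "v' (N + i) = x" "N + i : set (xs @ xs')" using i unfolding new by (auto simp: v'_def \<sigma>_def)
    thus ?thesis by (metis UnI2 imageI)
   next
    case False
    thus ?thesis using e i by (simp add: \<sigma>_def)
   qed
  qed
  hence "v ` A Un B <= v' ` (A Un set (xs @ xs'))" using vA by auto
  hence "card (v ` A Un B) <= card (v' ` (A Un set (xs @ xs')))" using fin by (intro card_mono) auto
  moreover have "card (v ` A Un B) = card (v ` A) + card B"
  proof (rule card_Un_disjoint)
   have "M <= x" if "x : B" for x using that unfolding B_def by auto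
   thus "v ` A Int B = {}" using M by force
  qed (use fin in \<open>auto simp: B_def\<close>)
  moreover have "card B = (if closed_loop then n - 1 else n)" by (simp add: B_def card_image)
  ultimately show ?thesis by (auto simp: n_def)
 qed
 have dA: "set (xs @ xs') Int A = {}" using N unfolding new by force
 show thesis by (rule that[of xs xs', OF _ dA _ _ ag pr' cross l1 l2 w1 w2 e cl cnt])
   (auto simp: xs_def xs'_def n_def)
qed

lemma folding_surfaceD:
 assumes "folding_surface Ps Q gl l v T k"
 shows "distinct (Q @ concat Ps)" "[] ~: set Ps" "paired (set (Q @ concat Ps)) gl l"
  "!!F. F : set (Q # Ps) ==> \<exists>p. walk v gl p F p" "finite T"
  "!!Z. Z <= set (Q @ concat Ps) ==> closed_under (Q # Ps) gl Z ==> Z ~= {} ==> Z Int (set Q Un T) ~= {}"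
  "4 * card T + 4 + card (set (Q @ concat Ps))
    <= 4 * k + 2 * card (v ` set (Q @ concat Ps)) + 2 * (length Ps + 1)" using assms unfolding folding_surface_def paired_def by blast+

text \<open>\<open>B\<close> runs along a tail labelled \<open>f\<close>, around the new disk and
  back. This adds |f| + |w| edges, at least |f| + |w| - 1 vertices and one disk, so the bound
  \<open>k\<close> is kept. The disk lies on the other side of its edges and therefore reads the
  inverse of \<open>w\<close>.\<close>

lemma add_polygon:
 assumes surf: "folding_surface Ps Q gl l v {} k" and "Q ~= []" "w ~= []"
 shows "\<exists>P B gl' l' v'. folding_surface (P # Ps) (B @ Q) gl' l' v' {} k & map l' P = inverse_word w &
  ev (map l' B) = ev f + ev w - ev f & agree_on (set (Q @ concat Ps)) v gl l v' gl' l'"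
proof -
 note surfD = folding_surfaceD[OF surf]
 define A where "A = set (Q @ concat Ps)"
 obtain q where wQ: "walk v gl q Q q" using surfD(4)[of Q] by auto
 hence "q = v (hd Q)" "hd Q : A" using \<open>Q ~= []\<close> by (cases Q; auto simp: A_def)+
 hence q: "q : v ` A" by blast
 have fin: "finite A" by (simp add: A_def)
 have pr: "paired A gl l" using surfD(3) by (simp add: A_def)
 obtain xs xs' gl1 l1 v1 e where x: "distinct (xs @ xs')" "set (xs @ xs') Int A = {}"
  "length xs = length f" "length xs' = length f"
  "agree_on A v gl l v1 gl1 l1" "paired (A Un set (xs @ xs')) gl1 l1"
  "map l1 xs = f" "map l1 xs' = inverse_word f" "walk v1 gl1 q xs e" "walk v1 gl1 e xs' q"
  "e : v1 ` (A Un set (xs @ xs'))"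
  "card (v ` A) + length f <= card (v1 ` (A Un set (xs @ xs')))" by (rule extend_pairing[OF fin pr q, of f False]) auto
 define A1 where "A1 = A Un set (xs @ xs')"
 have fin1: "finite A1" using fin by (simp add: A1_def)
 obtain qs P gl2 l2 v2 e' where y: "distinct (qs @ P)" "set (qs @ P) Int A1 = {}"
  "length qs = length w" "length P = length w"
  "agree_on A1 v1 gl1 l1 v2 gl2 l2" "paired (A1 Un set (qs @ P)) gl2 l2"
  "!!a. a : set P ==> gl2 a : set qs"
  "map l2 qs = w" "map l2 P = inverse_word w" "walk v2 gl2 e qs e'" "walk v2 gl2 e' P e" "e' = e"
  "card (v1 ` A1) + length w <= card (v2 ` (A1 Un set (qs @ P))) + 1"
  by (rule extend_pairing[OF fin1 x(6)[folded A1_def] x(11)[folded A1_def], of w True]) auto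
 have ag: "agree_on A v gl l v2 gl2 l2" using x(5) y(5) by (auto simp: agree_on_def A1_def)
 let ?B = "xs @ qs @ xs'"
 define A2 where "A2 = set ((?B @ Q) @ concat (P # Ps))"
 have A2: "A2 = A1 Un set (qs @ P)" by (auto simp: A2_def A1_def A_def)
 have "distinct ((qs @ P) @ (xs @ xs') @ Q @ concat Ps)" using surfD(1) x(1,2) y(1,2) unfolding A1_def A_def
  by (simp only: distinct_append[of "qs @ P"] distinct_append[of "xs @ xs'"] set_append[of "xs @ xs'"] Int_commute Un_commute)
 moreover have "mset ((qs @ P) @ (xs @ xs') @ Q @ concat Ps) = mset ((?B @ Q) @ concat (P # Ps))" by (simp add: ac_simps)
 ultimately have dist: "distinct ((?B @ Q) @ concat (P # Ps))" using mset_eq_imp_distinct_iff by blast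
 have walks: "\<exists>p. walk v2 gl2 p F p" if "F : set ((?B @ Q) # P # Ps)" for F
 proof -
  consider "F = ?B @ Q" | "F = P" | "F : set Ps" using \<open>F : _\<close> by auto
  thus ?thesis
  proof cases
   case 1
   have "walk v2 gl2 q xs e" "walk v2 gl2 e xs' q"
    using walk_agree[OF x(9) y(5) x(6)[folded A1_def]] walk_agree[OF x(10) y(5) x(6)[folded A1_def]] by (auto simp: A1_def)
   moreover have "walk v2 gl2 q Q q" using walk_agree[OF wQ ag pr] by (auto simp: A_def)
   ultimately have "walk v2 gl2 q (?B @ Q) q" using y(10,12) by (auto simp: walk_append)
   thus ?thesis using 1 by blast
  next
   case 2
   thus ?thesis using y(11,12) by blast
  next
   case 3
   then obtain p where "walk v gl p F p" using surfD(4)[of F] by auto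
   moreover have "set F <= A" using 3 by (auto simp: A_def)
   ultimately show ?thesis using walk_agree[OF _ ag pr] by blast
  qed
 qed
 have "folding_surface (P # Ps) (?B @ Q) gl2 l2 v2 {} k"
 proof (rule folding_surfaceI[OF A2_def dist])
  show "[] ~: set (P # Ps)" using surfD(2) y(4) \<open>w ~= []\<close> by auto
  show "gl2 a : A2 & gl2 a ~= a & gl2 (gl2 a) = a & l2 (gl2 a) = inverse_letter (l2 a)" if "a : A2" for a
   using y(6) that unfolding A2 paired_def by blast
  show "\<forall>F\<in>set ((?B @ Q) # P # Ps). \<exists>p. walk v2 gl2 p F p" using walks by blast
  show "Z Int (set (?B @ Q) Un {}) ~= {}"
   if Z: "Z <= A2" "closed_under ((?B @ Q) # P # Ps) gl2 Z" "Z ~= {}" for Z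
  proof
   assume disj: "Z Int (set (?B @ Q) Un {}) = {}"
   have Zgl: "gl2 a : Z" if "a : Z" for a using Z(2) that unfolding closed_under_def by blast
   have "Z Int set P = {}" using y(7) Zgl disj by auto
   hence ZA: "Z <= A" using Z(1) disj by (auto simp: A2_def A_def)
   hence "!!a. a : Z ==> gl a : Z" using Z(2) ag unfolding closed_under_def agree_on_def by (metis subsetD)
   hence "closed_under (Q # Ps) gl Z" using Z(2) disj unfolding closed_under_def by auto
   thus False using surfD(6)[of Z] ZA Z(3) disj by (auto simp: A_def)
  qed
  have "card A2 = card A + 2 * length f + 2 * length w"
  proof -
   have "card A2 = length ((?B @ Q) @ concat (P # Ps))" unfolding A2_def using dist by (rule distinct_card)
   moreover have "card A = length (Q @ concat Ps)" unfolding A_def using surfD(1) by (rule distinct_card)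
   ultimately show ?thesis using x(3,4) y(3,4) by simp
  qed
  thus "4 * card {} + 4 + card A2 <= 4 * k + 2 * card (v2 ` A2) + 2 * (length (P # Ps) + 1)"
   using surfD(7) x(12) y(13) unfolding A2 A1_def[symmetric] A_def[symmetric] by simp
 qed simp
 moreover have "ev (map l2 ?B) = ev f + ev w - ev f"
 proof -
  have "map l2 xs = map l1 xs" "map l2 xs' = map l1 xs'" using y(5) by (auto simp: agree_on_def A1_def)
  thus ?thesis using x(7,8) y(8) by (simp add: add.assoc diff_conv_add_uminus del: add_uminus_conv_diff)
 qed
 ultimately show ?thesis using y(9) ag unfolding A_def by blast
qed

text \<open>The commutator is a handle: two loops at the base vertex add |f| + |w| edges but in
  general only |f| + |w| - 2 vertices, which raises \<open>k\<close> by one.\<close>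

lemma add_commutator:
 assumes surf: "folding_surface Ps Q gl l v {} k" and "Q ~= []"
 shows "\<exists>B gl' l' v'. folding_surface Ps (B @ Q) gl' l' v' {} (Suc k) &
  ev (map l' B) = ev f + ev w - ev f - ev w & agree_on (set (Q @ concat Ps)) v gl l v' gl' l'"
proof -
 note surfD = folding_surfaceD[OF surf]
 define A where "A = set (Q @ concat Ps)"
 obtain q where wQ: "walk v gl q Q q" using surfD(4)[of Q] by auto
 hence "q = v (hd Q)" "hd Q : A" using \<open>Q ~= []\<close> by (cases Q; auto simp: A_def)+
 hence q: "q : v ` A" by blast
 have fin: "finite A" by (simp add: A_def)
 have pr: "paired A gl l" using surfD(3) by (simp add: A_def)
 obtain xs xs' gl1 l1 v1 e where x: "distinct (xs @ xs')" "set (xs @ xs') Int A = {}"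
  "length xs = length f" "length xs' = length f"
  "agree_on A v gl l v1 gl1 l1" "paired (A Un set (xs @ xs')) gl1 l1"
  "map l1 xs = f" "map l1 xs' = inverse_word f" "walk v1 gl1 q xs e" "walk v1 gl1 e xs' q"
  "e = q" "e : v1 ` (A Un set (xs @ xs'))"
  "card (v ` A) + length f <= card (v1 ` (A Un set (xs @ xs'))) + 1" by (rule extend_pairing[OF fin pr q, of f True]) auto
 define A1 where "A1 = A Un set (xs @ xs')"
 have fin1: "finite A1" using fin by (simp add: A1_def)
 obtain ys ys' gl2 l2 v2 e' where y: "distinct (ys @ ys')" "set (ys @ ys') Int A1 = {}"
  "length ys = length w" "length ys' = length w"
  "agree_on A1 v1 gl1 l1 v2 gl2 l2" "paired (A1 Un set (ys @ ys')) gl2 l2"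
  "map l2 ys = w" "map l2 ys' = inverse_word w" "walk v2 gl2 e ys e'" "walk v2 gl2 e' ys' e" "e' = e"
  "card (v1 ` A1) + length w <= card (v2 ` (A1 Un set (ys @ ys'))) + 1"
  by (rule extend_pairing[OF fin1 x(6)[folded A1_def] x(12)[folded A1_def], of w True]) auto
 have ag: "agree_on A v gl l v2 gl2 l2" using x(5) y(5) by (auto simp: agree_on_def A1_def)
 let ?B = "xs @ ys @ xs' @ ys'"
 define A2 where "A2 = set ((?B @ Q) @ concat Ps)"
 have A2: "A2 = A1 Un set (ys @ ys')" by (auto simp: A2_def A1_def A_def)
 have "distinct ((ys @ ys') @ (xs @ xs') @ Q @ concat Ps)" using surfD(1) x(1,2) y(1,2) unfolding A1_def A_def
  by (simp only: distinct_append[of "ys @ ys'"] distinct_append[of "xs @ xs'"] set_append[of "xs @ xs'"] Int_commute Un_commute)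
 moreover have "mset ((ys @ ys') @ (xs @ xs') @ Q @ concat Ps) = mset ((?B @ Q) @ concat Ps)" by (simp add: ac_simps)
 ultimately have dist: "distinct ((?B @ Q) @ concat Ps)" using mset_eq_imp_distinct_iff by blast
 have walks: "\<exists>p. walk v2 gl2 p F p" if "F : set ((?B @ Q) # Ps)" for F
 proof -
  consider "F = ?B @ Q" | "F : set Ps" using \<open>F : _\<close> by auto
  thus ?thesis
  proof cases
   case 1
   have "walk v2 gl2 q xs e" "walk v2 gl2 e xs' q"
    using walk_agree[OF x(9) y(5) x(6)[folded A1_def]] walk_agree[OF x(10) y(5) x(6)[folded A1_def]] by (auto simp: A1_def)
   moreover have "walk v2 gl2 q Q q" using walk_agree[OF wQ ag pr] by (auto simp: A_def)
   ultimately have "walk v2 gl2 q (?B @ Q) q" using y(9,10,11) x(11) by (auto simp: walk_append)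
   thus ?thesis using 1 by blast
  next
   case 2
   then obtain p where "walk v gl p F p" using surfD(4)[of F] by auto
   moreover have "set F <= A" using 2 by (auto simp: A_def)
   ultimately show ?thesis using walk_agree[OF _ ag pr] by blast
  qed
 qed
 have "folding_surface Ps (?B @ Q) gl2 l2 v2 {} (Suc k)"
 proof (rule folding_surfaceI[OF A2_def dist surfD(2)])
  show "gl2 a : A2 & gl2 a ~= a & gl2 (gl2 a) = a & l2 (gl2 a) = inverse_letter (l2 a)" if "a : A2" for a
   using y(6) that unfolding A2 paired_def by blast
  show "\<forall>F\<in>set ((?B @ Q) # Ps). \<exists>p. walk v2 gl2 p F p" using walks by blast
  show "Z Int (set (?B @ Q) Un {}) ~= {}"
   if Z: "Z <= A2" "closed_under ((?B @ Q) # Ps) gl2 Z" "Z ~= {}" for Z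
  proof
   assume disj: "Z Int (set (?B @ Q) Un {}) = {}"
   hence ZA: "Z <= A" using Z(1) by (auto simp: A2_def A_def)
   hence "!!a. a : Z ==> gl a : Z" using Z(2) ag unfolding closed_under_def agree_on_def by (metis subsetD)
   hence "closed_under (Q # Ps) gl Z" using Z(2) disj unfolding closed_under_def by auto
   thus False using surfD(6)[of Z] ZA Z(3) disj by (auto simp: A_def)
  qed
  have "card A2 = card A + 2 * length f + 2 * length w"
  proof -
   have "card A2 = length ((?B @ Q) @ concat Ps)" unfolding A2_def using dist by (rule distinct_card)
   moreover have "card A = length (Q @ concat Ps)" unfolding A_def using surfD(1) by (rule distinct_card)
   ultimately show ?thesis using x(3,4) y(3,4) by simp
  qed
  thus "4 * card {} + 4 + card A2 <= 4 * Suc k + 2 * card (v2 ` A2) + 2 * (length Ps + 1)"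
   using surfD(7) x(13) y(12) unfolding A2 A1_def[symmetric] A_def[symmetric] by simp
 qed simp
 moreover have "ev (map l2 ?B) = ev f + ev w - ev f - ev w"
 proof -
  have "map l2 xs = map l1 xs" "map l2 xs' = map l1 xs'" using y(5) by (auto simp: agree_on_def A1_def)
  thus ?thesis using x(7,8) y(7,8) by (simp add: add.assoc diff_conv_add_uminus del: add_uminus_conv_diff)
 qed
 ultimately show ?thesis using ag unfolding A_def by blast
qed

text \<open>The sides \<open>m\<close> and \<open>m'\<close> are markers that keep \<open>Q\<close> from becoming empty.\<close>

definition relation_surface :: "'a word => nat => int => 'a fg => bool" where
 "relation_surface r k n x \<longleftrightarrow>
   (\<exists>Ps Q m m' gl l v. folding_surface Ps (Q @ [m, m']) gl l v {} k & gl m = m' & ev (map l Q) = x &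
    (\<forall>P\<in>set Ps. map l P = r \<or> map l P = inverse_word r) &
    (\<Sum>P\<leftarrow>Ps. if map l P = r then 1 else - 1) = n)"

text \<open>The starting point is a sphere: a digon whose two sides are the markers, glued to each
  other.\<close>

lemma relation_surface_zero: "relation_surface r 0 0 0"
proof -
 define gl where "gl = (%a :: nat. 1 - a)"
 define l where "l = (%a :: nat. (undefined :: 'a, a = 0))"
 have "folding_surface [] [0, 1] gl l id {} 0"
 proof (rule folding_surfaceI[where A = "{0, 1}"])
  show "\<forall>F\<in>set ([0, 1] # []). \<exists>p. walk id gl p F p" by (auto simp: gl_def)
 qed (auto simp: gl_def l_def inverse_letter_def)
 thus ?thesis unfolding relation_surface_def
  by (intro exI[of _ "[]"] exI[of _ 0] exI[of _ 1] exI[of _ gl] exI[of _ l] exI[of _ id]) (auto simp: gl_def)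
qed

lemma map_agree_on: "agree_on A v gl l v' gl' l' ==> set P <= A ==> map l' P = map l P" by (auto simp: agree_on_def)

text \<open>Prefixing a conjugate of \<open>w\<close> to \<open>Q\<close> attaches a disk that reads
  the inverse of \<open>w\<close>; hence the sign of the change in degree.\<close>

lemma relation_surface_polygon:
 assumes "relation_surface r k n x" "r ~= []" "r ~= inverse_word r" "w = r \<or> w = inverse_word r"
 shows "relation_surface r k (n + (if w = r then - 1 else 1)) (u + ev w - u + x)"
proof -
 obtain Ps Q m m' gl l v where s: "folding_surface Ps (Q @ [m, m']) gl l v {} k" "gl m = m'" "ev (map l Q) = x"
  "\<forall>P\<in>set Ps. map l P = r \<or> map l P = inverse_word r" "(\<Sum>P\<leftarrow>Ps. if map l P = r then 1 else - 1) = n"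
  using assms(1) unfolding relation_surface_def by blast
 have "w ~= []" using assms(2,4) by (auto simp: inverse_word_def)
 from add_polygon[OF s(1) _ this, of "Rep_fg u"] obtain P B gl' l' v' where
  t: "folding_surface (P # Ps) (B @ Q @ [m, m']) gl' l' v' {} k" "map l' P = inverse_word w"
  "ev (map l' B) = u + ev w - u" "agree_on (set ((Q @ [m, m']) @ concat Ps)) v gl l v' gl' l'" by auto
 have Ps: "map l' P' = map l P'" if "P' : set Ps" for P' using that by (intro map_agree_on[OF t(4)]) auto
 have Q: "map l' Q = map l Q" by (intro map_agree_on[OF t(4)]) auto
 have f1: "gl' m = m'" using t(4) s(2) by (simp add: agree_on_def)
 have f2: "ev (map l' (B @ Q)) = u + ev w - u + x" by (simp only: map_append ev_append t(3) Q s(3))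
 have f3: "\<forall>P\<in>set (P # Ps). map l' P = r \<or> map l' P = inverse_word r"
  using s(4) Ps t(2) assms(4) by (metis inverse_word_simps(4) set_ConsD)
 have sm: "map (%P. if map l' P = r then 1 else - 1 :: int) Ps = map (%P. if map l P = r then 1 else - 1) Ps"
  by (intro map_cong refl) (simp only: Ps)
 have "(\<Sum>P\<leftarrow>Ps. if map l' P = r then 1 else - 1) = n" using s(5) unfolding sm .
 hence f4: "(\<Sum>P\<leftarrow>P # Ps. if map l' P = r then 1 else - 1) = n + (if w = r then - 1 else 1)" using t(2) assms(3,4) by auto
 show ?thesis unfolding relation_surface_def
  by (rule exI[of _ "P # Ps"], rule exI[of _ "B @ Q"], rule exI[of _ m], rule exI[of _ m'], rule exI[of _ gl'],
    rule exI[of _ l'], rule exI[of _ v'])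
   (intro conjI f1 f2 f3 f4, use t(1) in simp)
qed

lemma relation_surface_commutator:
 assumes "relation_surface r k n x"
 shows "relation_surface r (Suc k) n (a + b - a - b + x)"
proof -
 obtain Ps Q m m' gl l v where s: "folding_surface Ps (Q @ [m, m']) gl l v {} k" "gl m = m'" "ev (map l Q) = x"
  "\<forall>P\<in>set Ps. map l P = r \<or> map l P = inverse_word r" "(\<Sum>P\<leftarrow>Ps. if map l P = r then 1 else - 1) = n"
  using assms(1) unfolding relation_surface_def by blast
 from add_commutator[OF s(1), of "Rep_fg a" "Rep_fg b"] obtain B gl' l' v' where
  t: "folding_surface Ps (B @ Q @ [m, m']) gl' l' v' {} (Suc k)"
  "ev (map l' B) = a + b - a - b" "agree_on (set ((Q @ [m, m']) @ concat Ps)) v gl l v' gl' l'" by auto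
 have Ps: "map l' P' = map l P'" if "P' : set Ps" for P' using that by (intro map_agree_on[OF t(3)]) auto
 have Q: "map l' Q = map l Q" by (intro map_agree_on[OF t(3)]) auto
 have f1: "gl' m = m'" using t(3) s(2) by (simp add: agree_on_def)
 have f2: "ev (map l' (B @ Q)) = a + b - a - b + x" by (simp only: map_append ev_append t(2) Q s(3))
 have f3: "\<forall>P\<in>set Ps. map l' P = r \<or> map l' P = inverse_word r" using s(4) Ps by metis
 have sm: "map (%P. if map l' P = r then 1 else - 1 :: int) Ps = map (%P. if map l P = r then 1 else - 1) Ps"
  by (intro map_cong refl) (simp only: Ps)
 have f4: "(\<Sum>P\<leftarrow>Ps. if map l' P = r then 1 else - 1) = n" using s(5) unfolding sm .
 show ?thesis unfolding relation_surface_def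
  by (rule exI[of _ "Ps"], rule exI[of _ "B @ Q"], rule exI[of _ m], rule exI[of _ m'], rule exI[of _ gl'],
    rule exI[of _ l'], rule exI[of _ v'])
   (intro conjI f1 f2 f3 f4, use t(1) in simp)
qed

text \<open>The trivial element is spelled as - x + x, the first summand by commutators and the
  second by conjugates of the relator and its inverse. Each conjugate attaches a disk of the
  opposite sign, hence the degree - n.\<close>

lemma relation_surface_closed:
 assumes "Rdeg (ev r) x n" "Comm k x" "r ~= []" "r ~= inverse_word r"
 shows "relation_surface r k (- n) 0"
proof -
 have "relation_surface r 0 (- n) x" using assms(1)
 proof (induction rule: Rdeg.induct)
  case zero
  thus ?case using relation_surface_zero by simp
 next
  case (pos w n u)
  thus ?case using relation_surface_polygon[OF pos.IH assms(3,4), of r u] by simp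
 next
  case (neg w n u)
  thus ?case using relation_surface_polygon[OF neg.IH assms(3,4), of "inverse_word r" u] assms(4) by auto
 qed
 moreover have "relation_surface r (k' + k) n' (y + x')"
  if "Comm k y" "relation_surface r k' n' x'" for k k' n' y x' using that
 proof (induction rule: Comm.induct)
  case (Suc k w a b)
  thus ?case using relation_surface_commutator[of r "k' + k" n' "w + x'" a b] by (simp add: add.assoc)
 qed simp
 ultimately have "relation_surface r (0 + k) (- n) (- x + x)" using Comm_uminus[OF assms(2)] by blast
 thus ?thesis by simp
qed

section \<open>From folded surfaces to van Kampen diagrams\<close>

lemma equivclp_invariant:
 assumes "equivclp R a b" "!!x y. R x y ==> f x = f y"
 shows "f a = f b" using assms(1) by (induction rule: equivclp_induct) (use assms(2) in \<open>metis+\<close>)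

lemma sides_of_glue:
 assumes "gluing D" "K : components D" "a : sides_of D K"
 shows "glue D a : sides_of D K"
proof -
 have "fst a : K" "a : sides D" using assms(3) by (auto simp: sides_of_def)
 moreover obtain i where "K = same_component D `` {i}" using assms(2) by (auto simp: components_def quotient_def)
 ultimately have "fst (glue D a) : K" by (auto simp: same_component_def intro: equivclp_trans r_into_equivclp)
 thus ?thesis using \<open>a : sides D\<close> assms(1) by (auto simp: sides_of_def gluing_def)
qed

lemma components_disjoint:
 assumes "K : components D" "L : components D" "K Int L ~= {}"
 shows "K = L"
proof -
 obtain i j where "K = same_component D `` {i}" "L = same_component D `` {j}" using assms(1,2) by (auto simp: components_def quotient_def)
 moreover define R where "R = (%i j. \<exists>a\<in>sides D. i = fst a & j = fst (glue D a))"
 ultimately have KL: "K = {y. equivclp R i y}" "L = {y. equivclp R j y}" by (auto simp: same_component_def)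
 then obtain x where "equivclp R i x" "equivclp R j x" using assms(3) by blast
 hence "equivclp R i y \<longleftrightarrow> equivclp R j y" for y by (meson equivclp_trans equivclp_sym)
 thus ?thesis by (simp add: KL)
qed

lemma Union_components:
 assumes "gluing D"
 shows "\<Union>(components D) = {..<length (disks D)}"
proof
 show "{..<length (disks D)} <= \<Union>(components D)"
 proof
  fix i assume "i : {..<length (disks D)}"
  hence "same_component D `` {i} : components D" unfolding components_def by (rule quotientI)
  moreover have "i : same_component D `` {i}" by (simp add: same_component_def)
  ultimately show "i : \<Union>(components D)" by blast
 qed
qed (use components_subset[OF assms] in blast)

lemma finite_components: "finite (components D)" by (simp add: components_def quotient_def)

lemma card_edges_component:
 assumes "gluing D" "K : components D"
 shows "2 * card ((%a. {a, glue D a}) ` sides_of D K) = card (sides_of D K)"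
 using sides_of_glue[OF assms] by (intro card_edges[OF assms(1)]) (auto simp: sides_of_def)

lemma sum_components_card_sides:
 assumes "gluing D"
 shows "(\<Sum>K\<in>components D. card (sides_of D K)) = card (sides D)"
proof -
 have "sides D = (\<Union>K\<in>components D. sides_of D K)"
 proof
  show "sides D <= (\<Union>K\<in>components D. sides_of D K)"
  proof
   fix a assume a: "a : sides D"
   hence "fst a : \<Union>(components D)" unfolding Union_components[OF assms] by (auto simp: sides_def)
   thus "a : (\<Union>K\<in>components D. sides_of D K)" using a by (auto simp: sides_of_def)
  qed
 qed (auto simp: sides_of_def)
 moreover have "card (\<Union>K\<in>components D. sides_of D K) = (\<Sum>K\<in>components D. card (sides_of D K))"
 proof (rule card_UN_disjoint)
  show "\<forall>K\<in>components D. \<forall>L\<in>components D. K ~= L --> sides_of D K Int sides_of D L = {}"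
   using components_disjoint by (fastforce simp: sides_of_def)
 qed (simp_all add: finite_components)
 ultimately show ?thesis by simp
qed

text \<open>One negative Euler characteristic uses the summand 2 once; for all others - min 0 x <= 2
  - x. So a bound on the total of 2 - chi becomes a bound on the negative parts.\<close>

lemma sum_min_zero:
 fixes x :: "'i => int"
 assumes "finite I" "!!i. i : I ==> x i <= 2" "(\<Sum>i\<in>I. 2 - x i) <= 2 * k"
 shows "min 0 (2 - 2 * k) <= (\<Sum>i\<in>I. min 0 (x i))"
proof (cases "\<forall>i\<in>I. x i >= 0")
 case True
 hence "(\<Sum>i\<in>I. min 0 (x i)) = 0" by (intro sum.neutral) auto
 thus ?thesis by simp
next
 case False
 then obtain i where i: "i : I" "x i < 0" by auto
 have "(\<Sum>j\<in>I - {i}. - min 0 (x j)) <= (\<Sum>j\<in>I - {i}. 2 - x j)" using assms(2) by (intro sum_mono) (auto simp: min_def)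
 moreover have "(\<Sum>j\<in>I. - min 0 (x j)) = - x i + (\<Sum>j\<in>I - {i}. - min 0 (x j))"
  using i assms(1) by (subst sum.remove[of _ i]) auto
 moreover have "(\<Sum>j\<in>I. 2 - x j) = 2 - x i + (\<Sum>j\<in>I - {i}. 2 - x j)" using i assms(1) by (subst sum.remove[of _ i]) auto
 ultimately show ?thesis using assms(3) by (simp add: sum_negf)
qed

lemma walk_nthD:
 assumes "walk v g p W q" "j < length W"
 shows "v (g (W ! j)) = (if Suc j < length W then v (W ! Suc j) else q)" using assms
proof (induction W arbitrary: p j)
 case (Cons a W)
 thus ?case by (cases j; cases W) auto
qed simp

lemma walk_closed_nth:
 assumes "walk v g p W p" "j < length W"
 shows "v (W ! (Suc j mod length W)) = v (g (W ! j))"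
proof (cases "Suc j < length W")
 case True
 thus ?thesis using walk_nthD[OF assms] by simp
next
 case False
 hence "Suc j mod length W = 0" using assms(2) by (metis Suc_lessI mod_self)
 moreover have "v (W ! 0) = p" using assms by (cases W) auto
 ultimately show ?thesis using walk_nthD[OF assms] False by simp
qed

lemma van_kampen_gluing: "D : van_kampen_diagrams r ==> gluing D" unfolding van_kampen_diagrams_def gluing_def by auto

lemma Rdeg_reads:
 "reads_cyclic_word d r ==> Rdeg (ev r) (ev (concat d)) 1"
 "reads_cyclic_word d (inverse_word r) ==> Rdeg (ev r) (ev (concat d)) (- 1)"
proof -
 show "Rdeg (ev r) (ev (concat d)) 1" if "reads_cyclic_word d r"
  using that Rdeg_conj'[OF Rdeg_rel(1)] ev_rotate by (metis reads_cyclic_word_def)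
 show "Rdeg (ev r) (ev (concat d)) (- 1)" if "reads_cyclic_word d (inverse_word r)"
  using that Rdeg_conj'[OF Rdeg_rel(2)] ev_rotate by (metis reads_cyclic_word_def ev_inverse_word)
qed

lemma van_kampen_Rdeg:
 assumes "D : van_kampen_diagrams r" "i < length (disks D)"
 shows "Rdeg (ev r) (ev (concat (disks D ! i))) (disk_sign r (disks D ! i))"
proof -
 have "disks D ! i : set (disks D)" using assms(2) by simp
 hence "reads_cyclic_word (disks D ! i) r \<or> reads_cyclic_word (disks D ! i) (inverse_word r)"
  using assms(1) unfolding van_kampen_diagrams_def by blast
 thus ?thesis using Rdeg_reads by (auto simp: disk_sign_def)
qed

text \<open>A cyclic word that spells both the relator and its inverse would have degree 1 and -
  1.\<close>

lemma disk_sign_letters: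
 assumes "ev r ~= 0" "concat d = r \<or> concat d = inverse_word r"
 shows "disk_sign r d = (if concat d = r then 1 else - 1)"
proof -
 have rd: "reads_cyclic_word d w" if "concat d = w" for w :: "'a word"
  using that unfolding reads_cyclic_word_def by (intro exI[of _ 0]) simp
 show ?thesis
 proof (cases "concat d = r")
  case True
  thus ?thesis using rd by (simp add: disk_sign_def)
 next
  case False
  hence "~ reads_cyclic_word d r" using Rdeg_unique[OF assms(1) Rdeg_reads(1) Rdeg_reads(2)] rd assms(2) by fastforce
  thus ?thesis using False by (simp add: disk_sign_def)
 qed
qed

text \<open>After folding, the polygon of the two markers is a sphere of its own. Discarding it
  leaves a surface made of disks that read the relator or its inverse, every edge being a single
  letter.\<close>

theorem relation_diagram:
 assumes "Rdeg (ev r) x n" "Comm k x" and r: "ev r ~= 0"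
 shows "\<exists>D\<in>van_kampen_diagrams r. diagram_degree r D = - n & chi_minus D >= min 0 (2 - 2 * int k)"
proof -
 have "r ~= []" using r by auto
 moreover have "r ~= inverse_word r"
 proof
  assume "r = inverse_word r"
  hence "ev r = - ev r" using ev_inverse_word by metis
  thus False using Rdeg_unique[OF r, of "ev r" 1 "- 1"] Rdeg_rel[of "ev r"] by simp
 qed
 ultimately have "relation_surface r k (- n) 0" using relation_surface_closed assms(1,2) by blast
 then obtain Ps Q m m' gl0 l v0 where s0: "folding_surface Ps (Q @ [m, m']) gl0 l v0 {} k" "gl0 m = m'" "ev (map l Q) = 0"
  and lab: "\<forall>P\<in>set Ps. map l P = r \<or> map l P = inverse_word r" and deg: "(\<Sum>P\<leftarrow>Ps. if map l P = r then 1 else - 1) = - n"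
  unfolding relation_surface_def by blast
 obtain gl v T where s: "folding_surface Ps [m, m'] gl l v T k" and mm: "gl m = m'" using fold_all[OF s0] by blast
 note sD = folding_surfaceD[OF s]
 define A where "A = set (concat Ps)"
 have mA: "m ~: A" "m' ~: A" "m ~= m'" using sD(1) by (auto simp: A_def)
 have prm: "gl m' = m" using sD(3) mm by (auto simp: paired_def)
 have pr: "paired A gl l" unfolding paired_def
 proof
  fix a assume a: "a : A"
  hence p: "gl a : insert m (insert m' A) & gl a ~= a & gl (gl a) = a & l (gl a) = inverse_letter (l a)"
   using sD(3) by (auto simp: paired_def A_def)
  moreover have "gl a ~= m" "gl a ~= m'" using p a mA mm prm by metis+
  ultimately show "gl a : A & gl a ~= a & gl (gl a) = a & l (gl a) = inverse_letter (l a)" by auto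
 qed
 define dart where "dart = (%(i, j). Ps ! i ! j)"
 define SD where "SD = {(i, j). i < length Ps & j < length (Ps ! i)}"
 define pos where "pos = inv_into SD dart"
 define D where "D = \<lparr>disks = map (map (%d. [l d])) Ps, glue = (%p. pos (gl (dart p)))\<rparr>"
 have disksD: "disks D = map (map (%d. [l d])) Ps" by (simp add: D_def)
 have sidesD: "sides D = SD" by (auto simp: sides_def disksD SD_def)
 have dc: "distinct (concat Ps)" using sD(1) by simp
 have dPs: "distinct Ps" using dc sD(2) by (simp add: distinct_concat_iff removeAll_id)
 have inj: "inj_on dart SD"
 proof (rule inj_onI)
  fix a b assume a: "a : SD" and b: "b : SD" and eq: "dart a = dart b"
  obtain i j i' j' where ab: "a = (i, j)" "b = (i', j')" by (cases a, cases b) auto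
  have "Ps ! i ! j : set (Ps ! i)" "Ps ! i ! j : set (Ps ! i')"
   using a b eq nth_mem[of j "Ps ! i"] nth_mem[of j' "Ps ! i'"] by (auto simp: SD_def dart_def ab)
  moreover have "Ps ! i : set Ps" "Ps ! i' : set Ps" using a b by (auto simp: SD_def ab)
  moreover have "\<forall>ys zs. ys : set Ps & zs : set Ps & ys ~= zs --> set ys Int set zs = {}"
   using dc by (simp add: distinct_concat_iff)
  ultimately have "Ps ! i = Ps ! i'" by blast
  hence "i = i'" using dPs a b by (auto simp: SD_def ab nth_eq_iff_index_eq)
  moreover have "distinct (Ps ! i)" using dc a unfolding distinct_concat_iff by (simp add: SD_def ab)
  ultimately show "a = b" using a b eq by (auto simp: SD_def ab dart_def nth_eq_iff_index_eq)
 qed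
 have im: "dart ` SD = A"
 proof
  show "dart ` SD <= A" by (auto simp: dart_def SD_def A_def) (meson nth_mem)
  show "A <= dart ` SD"
  proof
   fix d assume "d : A"
   then obtain i j where "i < length Ps" "j < length (Ps ! i)" "Ps ! i ! j = d" by (auto simp: A_def in_set_conv_nth)
   hence "(i, j) : SD" "dart (i, j) = d" by (auto simp: SD_def dart_def)
   thus "d : dart ` SD" by blast
  qed
 qed
 have dp: "dart (pos d) = d" "pos d : SD" if "d : A" for d using that im unfolding pos_def by (auto intro: f_inv_into_f inv_into_into)
 have pd: "pos (dart a) = a" if "a : SD" for a using that inj by (simp add: pos_def)
 have dA: "dart a : A" if "a : SD" for a using that im by blast
 have dg: "dart (glue D a) = gl (dart a)" "glue D a : SD" if "a : SD" for a
  using dp[of "gl (dart a)"] pr dA[OF that] by (auto simp: D_def paired_def)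
 have sl: "side_label D a = [l (dart a)]" if "a : SD" for a using that by (auto simp: side_label_def disksD SD_def dart_def)
 have vk: "D : van_kampen_diagrams r" unfolding van_kampen_diagrams_def
 proof (intro CollectI conjI ballI)
  fix d assume "d : set (disks D)"
  then obtain P where P: "P : set Ps" "d = map (%d. [l d]) P" by (auto simp: disksD)
  show "d ~= []" using P sD(2) by auto
  show "[] ~: set d" using P by auto
  have "concat d = map l P" by (simp add: P(2))
  hence "concat d = rotate 0 r \<or> concat d = rotate 0 (inverse_word r)" using lab P(1) by auto
  thus "reads_cyclic_word d r \<or> reads_cyclic_word d (inverse_word r)" unfolding reads_cyclic_word_def by blast
 next
  fix a assume "a : sides D"
  hence a: "a : SD" by (simp add: sidesD)
  have p: "gl (dart a) ~= dart a" "gl (gl (dart a)) = dart a" "l (gl (dart a)) = inverse_letter (l (dart a))"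
   using pr dA[OF a] by (auto simp: paired_def)
  show "glue D a : sides D" using dg[OF a] by (simp add: sidesD)
  show "glue D a ~= a" using dg[OF a] p by metis
  show "glue D (glue D a) = a" using dg[OF a] dg[OF dg(2)[OF a]] p pd a by metis
  show "side_label D (glue D a) = inverse_word (side_label D a)" using sl a dg[OF a] p by simp
 qed
 note gl = van_kampen_gluing[OF vk]
 have "diagram_degree r D = - n"
 proof -
  have "map (disk_sign r) (disks D) = map (%P. if map l P = r then 1 else - 1) Ps"
  proof -
   have "concat (map (%d. [l d]) P) = map l P" for P by simp
   hence "disk_sign r (map (%d. [l d]) P) = (if map l P = r then 1 else - 1)" if "P : set Ps" for P
    using disk_sign_letters[OF r, of "map (%d. [l d]) P"] lab that by metis
   thus ?thesis by (simp add: disksD)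
  qed
  thus ?thesis unfolding diagram_degree_def using deg by simp
 qed
 moreover have "chi_minus D >= min 0 (2 - 2 * int k)" unfolding chi_minus_def
 proof (rule sum_min_zero[OF finite_components])
  fix K assume K: "K : components D"
  from component_relation[OF gl K van_kampen_Rdeg[OF vk]]
  show "euler_characteristic D K <= 2" by force
 next
  define V where "V = (%K. card (sides_of D K // same_vertex D))"
  define E where "E = (%K. card ((%a. {a, glue D a}) ` sides_of D K))"
  have Vv: "V K = card (vertex D ` sides_of D K)" for K
  proof -
   have "sides_of D K // same_vertex D = vertex D ` sides_of D K" by (auto simp: quotient_def vertex_def)
   thus ?thesis by (simp add: V_def)
  qed
  \<comment> \<open>A component of the diagram is a closed set disjoint from the markers, so it
    contains an element of \<open>T\<close>.\<close>
  have cT: "card (components D) <= card T"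
  proof -
   have "\<exists>t. t : T Int dart ` sides_of D K" if K: "K : components D" for K
   proof -
    let ?Z = "dart ` sides_of D K"
    have sub: "sides_of D K <= SD" by (auto simp: sides_of_def sidesD)
    have ZA: "?Z <= A" using sub dA by blast
    have "closed_under ([m, m'] # Ps) gl ?Z" unfolding closed_under_def
    proof (intro conjI ballI impI)
     fix d assume "d : ?Z"
     then obtain a where "a : sides_of D K" "d = dart a" by blast
     thus "gl d : ?Z" using dg(1)[of a] sides_of_glue[OF gl K] sub by (metis imageI subsetD)
    next
     fix F assume F: "F : set ([m, m'] # Ps)" "set F Int ?Z ~= {}"
     hence "F : set Ps" using ZA mA by auto
     then obtain i where i: "i < length Ps" "F = Ps ! i" by (metis in_set_conv_nth)
     obtain a where a: "a : sides_of D K" "dart a : set F" using F(2) by blast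
     then obtain j where j: "j < length F" "dart a = F ! j" by (metis in_set_conv_nth)
     hence "(i, j) : SD" "dart (i, j) = dart a" using i by (auto simp: SD_def dart_def)
     hence "a = (i, j)" using inj a(1) sub by (metis inj_onD subsetD)
     hence "i : K" using a(1) by (auto simp: sides_of_def)
     show "set F <= ?Z"
     proof
      fix d assume "d : set F"
      then obtain j' where "j' < length F" "d = F ! j'" by (metis in_set_conv_nth)
      hence "d = dart (i, j')" "(i, j') : sides_of D K" using i \<open>i : K\<close> by (auto simp: dart_def sides_of_def sidesD SD_def)
      thus "d : ?Z" by blast
     qed
    qed
    moreover have "?Z ~= {}"
    proof -
     obtain i where "i : K" using components_subset[OF gl K] by blast
     moreover from this have "i < length Ps" using components_subset[OF gl K] by (auto simp: disksD)
     moreover from this have "Ps ! i ~= []" using sD(2) by (metis nth_mem)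
     ultimately have "(i, 0) : sides_of D K" by (auto simp: sides_of_def sidesD SD_def)
     thus ?thesis by blast
    qed
    moreover have "?Z <= set ([m, m'] @ concat Ps)" using ZA by (auto simp: A_def)
    ultimately have "?Z Int (set [m, m'] Un T) ~= {}" using sD(6) by blast
    thus ?thesis using ZA mA by auto
   qed
   then obtain \<tau> where \<tau>: "!!K. K : components D ==> \<tau> K : T Int dart ` sides_of D K" by metis
   have "inj_on \<tau> (components D)"
   proof (rule inj_onI)
    fix K L assume KL: "K : components D" "L : components D" and eq: "\<tau> K = \<tau> L"
    obtain a b where ab: "a : sides_of D K" "\<tau> K = dart a" "b : sides_of D L" "\<tau> L = dart b" using \<tau> KL by blast
    hence "a = b" using inj eq by (auto simp: sides_of_def sidesD inj_on_def)
    thus "K = L" using ab components_disjoint[OF KL] by (auto simp: sides_of_def)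
   qed
   thus ?thesis using \<tau> sD(5) by (intro card_inj_on_le[of \<tau>]) auto
  qed
  \<comment> \<open>The labels \<open>v\<close> are constant on the vertices of the diagram, so
    there are at least as many vertices as labels.\<close>
  have cV: "card (v ` A) <= (\<Sum>K\<in>components D. V K)"
  proof -
   have inv: "v (dart a) = v (dart b)" if "vertex D a = vertex D b" for a b
   proof -
    have "equivclp (%a b. a : sides D & b = next_side D (glue D a)) a b" using that unfolding vertex_def same_vertex_def
     by (metis (no_types, lifting) Image_singleton_iff case_prodD case_prodI equivclp_refl mem_Collect_eq)
    thus ?thesis
    proof (rule equivclp_invariant)
     fix x y assume xy: "x : sides D & y = next_side D (glue D x)"
     hence x: "x : SD" by (simp add: sidesD)
     obtain i j where ij: "glue D x = (i, j)" by (cases "glue D x")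
     hence ij2: "i < length Ps" "j < length (Ps ! i)" using dg(2)[OF x] by (auto simp: SD_def)
     obtain p where p: "walk v gl p (Ps ! i) p" using sD(4)[of "Ps ! i"] ij2 by auto
     have "v (dart y) = v (Ps ! i ! (Suc j mod length (Ps ! i)))" using xy ij ij2 by (simp add: next_side_def dart_def disksD)
     also have "\<dots> = v (gl (Ps ! i ! j))" by (rule walk_closed_nth[OF p ij2(2)])
     also have "Ps ! i ! j = gl (dart x)" using dg(1)[OF x] ij by (simp add: dart_def)
     also have "gl (gl (dart x)) = dart x" using pr dA[OF x] by (simp add: paired_def)
     finally show "v (dart x) = v (dart y)" by simp
    qed
   qed
   define h where "h = (%C. v (dart (SOME a. vertex D a = C)))"
   have "h (vertex D a) = v (dart a)" for a unfolding h_def by (rule inv) (rule someI[of _ a], simp)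
   hence "v ` A = h ` vertex D ` SD" unfolding im[symmetric] by (auto simp: image_image)
   hence "card (v ` A) <= card (vertex D ` SD)" using finite_sides[of D] by (simp add: sidesD card_image_le)
   also have "SD = (\<Union>K\<in>components D. sides_of D K)"
   proof
    show "SD <= (\<Union>K\<in>components D. sides_of D K)"
    proof
     fix a assume a: "a : SD"
     hence "fst a : \<Union>(components D)" unfolding Union_components[OF gl] by (auto simp: SD_def disksD)
     thus "a : (\<Union>K\<in>components D. sides_of D K)" using a by (auto simp: sides_of_def sidesD)
    qed
   qed (auto simp: sides_of_def sidesD)
   hence "card (vertex D ` SD) = card (\<Union>K\<in>components D. vertex D ` sides_of D K)" by (simp add: image_UN)
   also have "\<dots> <= (\<Sum>K\<in>components D. V K)" unfolding Vv by (intro card_UN_le finite_components)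
   finally show ?thesis .
  qed
  have cE: "2 * (\<Sum>K\<in>components D. E K) = card A"
   using sum_components_card_sides[OF gl] card_edges_component[OF gl] card_image[OF inj] im by (simp add: sum_distrib_left E_def sidesD)
  have cF: "length Ps <= (\<Sum>K\<in>components D. card K)"
  proof -
   have "card (\<Union>K\<in>components D. K) <= (\<Sum>K\<in>components D. card K)" by (intro card_UN_le finite_components)
   thus ?thesis using Union_components[OF gl] by (simp add: disksD)
  qed
  \<comment> \<open>Discarding the sphere of the markers takes away two sides, one polygon and at
    most two vertices. This uses up the summand 4 and leaves the bound for the total of 2 -
    chi.\<close>
  have cA: "4 * card T + card A <= 4 * k + 2 * card (v ` A) + 2 * length Ps"
  proof -
   have "set ([m, m'] @ concat Ps) = insert m (insert m' A)" by (auto simp: A_def)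
   moreover have "card (insert m (insert m' A)) = card A + 2" using mA by (simp add: A_def)
   moreover have "card (v ` insert m (insert m' A)) <= card (v ` A) + 2" by (simp add: A_def card_insert_if)
   ultimately show ?thesis using sD(7) by simp
  qed
  have "(\<Sum>K\<in>components D. 2 - euler_characteristic D K)
    = 2 * int (card (components D)) - int (\<Sum>K\<in>components D. V K)
     + int (\<Sum>K\<in>components D. E K) - int (\<Sum>K\<in>components D. card K)" unfolding euler_characteristic_def V_def E_def
   by (simp add: sum_subtractf sum.distrib)
  thus "(\<Sum>K\<in>components D. 2 - euler_characteristic D K) <= 2 * int k" using cT cV cE cF cA by linarith
 qed
 ultimately show ?thesis using vk by blast
qed

lemma diagram_degree_components:
 assumes "D : van_kampen_diagrams r"
 shows "diagram_degree r D = (\<Sum>K\<in>components D. \<Sum>i\<in>K. disk_sign r (disks D ! i))"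
proof -
 note gl = van_kampen_gluing[OF assms]
 have "diagram_degree r D = (\<Sum>i<length (disks D). disk_sign r (disks D ! i))"
  unfolding diagram_degree_def by (simp add: sum_list_sum_nth atLeast0LessThan)
 also have "\<dots> = (\<Sum>i\<in>\<Union>(components D). disk_sign r (disks D ! i))" by (simp add: Union_components[OF gl])
 also have "\<dots> = (\<Sum>K\<in>components D. \<Sum>i\<in>K. disk_sign r (disks D ! i))"
 proof -
  have "\<forall>K\<in>components D. finite K" using components_subset(1)[OF gl] finite_subset by blast
  moreover have "\<forall>K\<in>components D. \<forall>L\<in>components D. K ~= L --> K Int L = {}" using components_disjoint by blast
  ultimately show ?thesis by (simp add: sum.Union_disjoint)
 qed
 finally show ?thesis .
qed

section \<open>From real two-cycles to relations\<close>

lemma Dirichlet_approx_finite: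
 fixes c :: "'s => real"
 assumes "finite I" "\<delta> > 0"
 obtains q n where "(q :: int) > 0" "!!i. i : I ==> \<bar>of_int q * c i - of_int (n i)\<bar> < \<delta>"
proof -
 obtain f where f: "bij_betw f {..<card I} I" using ex_bij_betw_nat_finite[OF assms(1)] by (auto simp: atLeast0LessThan)
 obtain N :: nat where N: "N > 0" "1 / real N < \<delta>" using assms(2) nat_approx_posE[of \<delta>] by (metis zero_less_Suc)
 obtain q p where qp: "0 < q" "!!i. i < card I ==> \<bar>of_int q * (c o f) i - of_int (p i)\<bar> < 1 / real N"
  by (rule Dirichlet_approx_simult[OF N(1), where n = "card I" and \<theta> = "c o f"]) blast
 show thesis
 proof (rule that[of q "p o inv_into {..<card I} f"])
  fix i assume "i : I"
  hence "inv_into {..<card I} f i < card I" "f (inv_into {..<card I} f i) = i"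
   using f inv_into_into[of i f "{..<card I}"] by (auto simp: bij_betw_def f_inv_into_f)
  thus "\<bar>of_int q * c i - of_int ((p o inv_into {..<card I} f) i)\<bar> < \<delta>"
   using qp(2)[of "inv_into {..<card I} f i"] N(2) by simp
 qed (use qp in simp)
qed

text \<open>With a common denominator and small errors, every relation holds for the integral
  coefficients up to an error below 1, hence exactly. The uniform bound on \<open>a j i\<close>
  allows infinitely many relations at once.\<close>

lemma integral_approximation:
 fixes c :: "'s => real" and a :: "'j => 's => int" and d :: "'s => int"
 assumes fin: "finite I" and bd: "!!j i. i : I ==> \<bar>a j i\<bar> <= B" and rel: "!!j. (\<Sum>i\<in>I. c i * of_int (a j i)) = 0"
  and deg: "(\<Sum>i\<in>I. c i * of_int (d i)) = 1" and "\<epsilon> > 0"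
 obtains q n where "(q :: int) > 0" "!!j. (\<Sum>i\<in>I. n i * a j i) = 0" "(\<Sum>i\<in>I. n i * d i) = q"
  "of_int (\<Sum>i\<in>I. \<bar>n i\<bar>) <= (1 + \<epsilon>) * of_int q * (\<Sum>i\<in>I. \<bar>c i\<bar>)"
proof -
 define C where "C = Max (insert B ((%i. \<bar>d i\<bar>) ` I))"
 have C: "\<bar>a j i\<bar> <= C" "\<bar>d i\<bar> <= C" if "i : I" for i j
 proof -
  have "B <= C" "\<bar>d i\<bar> <= C" using that fin by (auto simp: C_def)
  thus "\<bar>a j i\<bar> <= C" "\<bar>d i\<bar> <= C" using bd[OF that, of j] by auto
 qed
 define \<Sigma> where "\<Sigma> = (\<Sum>i\<in>I. \<bar>c i\<bar>)"
 have "I ~= {}" using deg by auto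
 have "\<Sigma> > 0"
 proof -
  have "\<exists>i\<in>I. c i ~= 0"
  proof (rule ccontr)
   assume "~ ?thesis"
   hence "(\<Sum>i\<in>I. c i * of_int (d i)) = 0" by simp
   thus False using deg by simp
  qed
  then obtain i where "i : I" "0 < \<bar>c i\<bar>" by auto
  thus ?thesis unfolding \<Sigma>_def using fin by (intro sum_pos2[of I i]) auto
 qed
 \<comment> \<open>The first bound keeps the error of each relation and of the degree below 1; the
   second keeps the total error of the norm below \<epsilon> times the norm.\<close>
 define \<delta> where "\<delta> = min (1 / (of_nat (card I) * (of_int \<bar>C\<bar> + 1))) (\<epsilon> * \<Sigma> / of_nat (card I))"
 have cI: "real (card I) > 0" using fin \<open>I ~= {}\<close> by (simp add: card_gt_0_iff)
 have "\<delta> > 0" unfolding \<delta>_def using cI \<open>\<Sigma> > 0\<close> \<open>\<epsilon> > 0\<close> by (auto intro!: divide_pos_pos mult_pos_pos)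
 then obtain q n where q: "(q :: int) > 0" and n: "!!i. i : I ==> \<bar>of_int q * c i - of_int (n i)\<bar> < \<delta>"
  using Dirichlet_approx_finite[OF fin, of \<delta> c] by blast
 have small: "\<bar>of_int (\<Sum>i\<in>I. n i * b i) - of_int q * (\<Sum>i\<in>I. c i * of_int (b i))\<bar> < 1"
  if b: "!!i. i : I ==> \<bar>b i\<bar> <= C" for b
 proof -
  have "\<bar>of_int (\<Sum>i\<in>I. n i * b i) - of_int q * (\<Sum>i\<in>I. c i * of_int (b i))\<bar>
    = \<bar>\<Sum>i\<in>I. (of_int (n i) - of_int q * c i) * of_int (b i)\<bar>"
   by (simp add: sum_distrib_left algebra_simps flip: sum_subtractf)
  also have "\<dots> <= (\<Sum>i\<in>I. \<bar>of_int (n i) - of_int q * c i\<bar> * of_int \<bar>b i\<bar>)"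
   using sum_abs[of "%i. (of_int (n i) - of_int q * c i) * of_int (b i)" I] by (simp add: abs_mult)
  also have "\<dots> <= (\<Sum>i\<in>I. \<delta> * of_int \<bar>C\<bar>)"
  proof (rule sum_mono)
   fix i assume i: "i : I"
   have "\<bar>of_int (n i) - of_int q * c i\<bar> <= \<delta>" using n[OF i] by (simp add: abs_minus_commute)
   moreover have "\<bar>b i\<bar> <= \<bar>C\<bar>" using b[OF i] by simp
   ultimately show "\<bar>of_int (n i) - of_int q * c i\<bar> * of_int \<bar>b i\<bar> <= \<delta> * of_int \<bar>C\<bar>"
    by (intro mult_mono) auto
  qed
  also have "\<dots> = \<delta> * (of_nat (card I) * of_int \<bar>C\<bar>)" by simp
  also have "\<dots> < \<delta> * (of_nat (card I) * (of_int \<bar>C\<bar> + 1))"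
   using \<open>\<delta> > 0\<close> cI by (intro mult_strict_left_mono) (auto simp: algebra_simps)
  also have "\<dots> <= 1"
  proof -
   have "\<delta> <= 1 / (of_nat (card I) * (of_int \<bar>C\<bar> + 1))" by (simp add: \<delta>_def)
   moreover have "real (card I) * (of_int \<bar>C\<bar> + 1) > 0" using cI by (intro mult_pos_pos) auto
   ultimately show ?thesis by (simp only: pos_le_divide_eq)
  qed
  finally show ?thesis .
 qed
 have 1: "(\<Sum>i\<in>I. n i * a j i) = 0" for j
 proof -
  have "\<bar>of_int (\<Sum>i\<in>I. n i * a j i)\<bar> < (1 :: real)"
   using small[of "a j", OF C(1)] by (simp only: rel mult_zero_right diff_0_right)
  hence "\<bar>\<Sum>i\<in>I. n i * a j i\<bar> < 1" by (simp only: flip: of_int_abs)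
  thus ?thesis by simp
 qed
 have 2: "(\<Sum>i\<in>I. n i * d i) = q"
 proof -
  have "\<bar>of_int ((\<Sum>i\<in>I. n i * d i) - q)\<bar> < (1 :: real)" using small[of d] C deg by simp
  hence "\<bar>(\<Sum>i\<in>I. n i * d i) - q\<bar> < 1" by (simp only: flip: of_int_abs)
  thus ?thesis by simp
 qed
 have "of_int (\<Sum>i\<in>I. \<bar>n i\<bar>) = (\<Sum>i\<in>I. \<bar>of_int (n i)\<bar> :: real)" by simp
 also have "\<dots> <= (\<Sum>i\<in>I. of_int q * \<bar>c i\<bar> + \<epsilon> * \<Sigma> / of_nat (card I))"
 proof (rule sum_mono)
  fix i assume i: "i : I"
  have "\<delta> <= \<epsilon> * \<Sigma> / of_nat (card I)" by (simp add: \<delta>_def)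
  moreover have "\<bar>of_int q * c i\<bar> = of_int q * \<bar>c i\<bar>" using q by (simp add: abs_mult)
  ultimately show "\<bar>of_int (n i)\<bar> <= of_int q * \<bar>c i\<bar> + \<epsilon> * \<Sigma> / of_nat (card I)"
   using n[OF i] by linarith
 qed
 also have "\<dots> = of_int q * \<Sigma> + \<epsilon> * \<Sigma>"
 proof -
  have "(\<Sum>i\<in>I. of_int q * \<bar>c i\<bar>) = of_int q * \<Sigma>" by (simp add: \<Sigma>_def sum_distrib_left)
  thus ?thesis using cI by (simp only: sum.distrib sum_constant) simp
 qed
 also have "\<dots> <= of_int q * \<Sigma> + of_int q * (\<epsilon> * \<Sigma>)"
  using q \<open>\<epsilon> > 0\<close> \<open>\<Sigma> > 0\<close> by simp
 finally have 3: "of_int (\<Sum>i\<in>I. \<bar>n i\<bar>) <= (1 + \<epsilon>) * of_int q * (\<Sum>i\<in>I. \<bar>c i\<bar>)"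
  by (simp add: algebra_simps \<Sigma>_def)
 show thesis using that q 1 2 3 by blast
qed

section \<open>Surfaces glued from triangles\<close>

lemma pairing_exists:
 fixes lab :: "'p => 'q \<times> bool"
 assumes "finite P" "!!q. card {p\<in>P. lab p = (q, True)} = card {p\<in>P. lab p = (q, False)}"
 obtains g where "!!p. p : P ==> g p : P & g p ~= p & g (g p) = p & lab (g p) = (fst (lab p), ~ snd (lab p))"
proof -
 let ?T = "%q. {p\<in>P. lab p = (q, True)}" and ?F = "%q. {p\<in>P. lab p = (q, False)}"
 have "\<exists>f. bij_betw f (?T q) (?F q)" for q using assms by (intro finite_same_card_bij) auto
 then obtain f where f: "!!q. bij_betw (f q) (?T q) (?F q)" by metis
 define g where "g p = (if snd (lab p) then f (fst (lab p)) p else inv_into (?T (fst (lab p))) (f (fst (lab p))) p)" for p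
 show thesis
 proof (rule that)
  fix p assume p: "p : P"
  obtain q b where l: "lab p = (q, b)" by (cases "lab p")
  show "g p : P & g p ~= p & g (g p) = p & lab (g p) = (fst (lab p), ~ snd (lab p))"
  proof (cases b)
   case True
   hence "p : ?T q" using p l by simp
   hence "f q p : ?F q" "inv_into (?T q) (f q) (f q p) = p" using f[of q] by (auto simp: bij_betw_def)
   thus ?thesis using l True by (auto simp: g_def)
  next
   case False
   hence "p : ?F q" using p l by simp
   hence "p : f q ` ?T q" using f[of q] by (simp add: bij_betw_def)
   from inv_into_into[OF this] f_inv_into_f[OF this] show ?thesis using l False by (auto simp: g_def)
  qed
 qed
qed

lemma card_positions:
 "card {(i, j). i < length L & j < length (L ! i) & L ! i ! j = x} = count_list (concat L) x"
proof -
 have "{(i, j). i < length L & j < length (L ! i) & L ! i ! j = x}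
   = Sigma {..<length L} (%i. {j. j < length (L ! i) & L ! i ! j = x})" by auto
 hence "card {(i, j). i < length L & j < length (L ! i) & L ! i ! j = x}
   = (\<Sum>i<length L. card {j. j < length (L ! i) & L ! i ! j = x})" by (simp add: card_SigmaI)
 also have "\<dots> = (\<Sum>i<length L. count_list (L ! i) x)"
  by (intro sum.cong refl) (simp add: count_list_eq_length_filter length_filter_conv_card eq_commute)
 also have "\<dots> = sum_list (map (%l. count_list l x) L)" by (simp add: sum_list_sum_nth atLeast0LessThan)
 also have "\<dots> = count_list (concat L) x" by (induction L) auto
 finally show ?thesis .
qed

text \<open>An integral two-cycle of the bar complex gives a closed surface made of triangles.\<close>

lemma integral_cycle_relation:
 fixes w :: "'q => 'a fg" and gs hs ks :: "'s => 'q" and n d :: "'s => int"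
 assumes fin: "finite I" and cyc: "!!q. (\<Sum>i\<in>I. n i * (of_bool (gs i = q) + of_bool (hs i = q) - of_bool (ks i = q))) = 0"
  and d: "!!i. i : I ==> Rdeg r (w (gs i) + w (hs i) - w (ks i)) (d i)"
  and pos: "(\<Sum>i\<in>I. n i * d i) > 0"
 shows "\<exists>x k N. N ~= 0 & Rdeg r x N & Comm k x &
  max 0 (4 * int k - 4) * (\<Sum>i\<in>I. n i * d i) <= (\<Sum>i\<in>I. \<bar>n i\<bar>) * \<bar>N\<bar>"
proof -
 obtain ils where ils: "set ils = I" "distinct ils" using finite_distinct_list[OF fin] by blast
 \<comment> \<open>A simplex with coefficient n gives |n| triangles; a negative coefficient inverts
   the boundary word and thereby changes the sign of the degree.\<close>
 define tri where "tri i = (if n i > 0 then [(gs i, True), (hs i, True), (ks i, False)]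
  else [(ks i, True), (hs i, False), (gs i, False)])" for i
 define Is where "Is = concat (map (%i. replicate (nat \<bar>n i\<bar>) i) ils)"
 define TL where "TL = map tri Is"
 have sumIs: "sum_list (map f Is) = (\<Sum>i\<in>I. int (nat \<bar>n i\<bar>) * f i)" for f :: "'s => int"
 proof -
  have "sum_list (map f (concat (map (%i. replicate (nat \<bar>n i\<bar>) i) js))) = (\<Sum>i\<leftarrow>js. int (nat \<bar>n i\<bar>) * f i)" for js
   by (induction js) (auto simp: map_replicate sum_list_replicate)
  thus ?thesis using ils by (simp add: Is_def sum_list_distinct_conv_sum_set)
 qed
 define ev1 where "ev1 = (%(q, b). if b then Rep_fg (w q) else inverse_word (Rep_fg (w q)))"
 have ev1: "ev (ev1 (q, b)) = (if b then w q else - w q)" for q b by (simp add: ev1_def)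
 define P where "P = {(i, j). i < length TL & j < length (TL ! i)}"
 define lab where "lab = (%(i, j). TL ! i ! j)"
 have finP: "finite P"
 proof -
  have "P = Sigma {..<length TL} (%i. {..<length (TL ! i)})" by (auto simp: P_def)
  thus ?thesis by simp
 qed
 have cl: "card {p\<in>P. lab p = x} = count_list (concat TL) x" for x
 proof -
  have "{p\<in>P. lab p = x} = {(i, j). i < length TL & j < length (TL ! i) & TL ! i ! j = x}" by (auto simp: P_def lab_def)
  thus ?thesis by (simp only: card_positions)
 qed
 \<comment> \<open>The cycle condition says that every edge label occurs equally often in the two
   directions.\<close>
 have bal: "card {p\<in>P. lab p = (q, True)} = card {p\<in>P. lab p = (q, False)}" for q
 proof -
  have c: "int (count_list (concat TL) x) = (\<Sum>i\<in>I. int (nat \<bar>n i\<bar>) * int (count_list (tri i) x))" for x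
  proof -
   have "int (count_list (concat (map tri js)) x) = (\<Sum>i\<leftarrow>js. int (count_list (tri i) x))" for js by (induction js) auto
   thus ?thesis unfolding TL_def sumIs[symmetric] by simp
  qed
  have "int (count_list (concat TL) (q, True)) - int (count_list (concat TL) (q, False))
    = (\<Sum>i\<in>I. n i * (of_bool (gs i = q) + of_bool (hs i = q) - of_bool (ks i = q)))" unfolding c sum_subtractf[symmetric]
   by (intro sum.cong refl) (auto simp: tri_def)
  thus ?thesis using cyc[of q] cl by simp
 qed
 obtain g where g: "!!p. p : P ==> g p : P & g p ~= p & g (g p) = p & lab (g p) = (fst (lab p), ~ snd (lab p))"
  using pairing_exists[of P lab, OF finP bal] by blast
 define D where "D = \<lparr>disks = map (map ev1) TL, glue = g\<rparr>"
 have sidesD: "sides D = P" by (auto simp: D_def sides_def P_def)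
 have slD: "side_label D p = ev1 (lab p)" if "p : P" for p using that by (auto simp: D_def side_label_def P_def lab_def)
 have gl: "gluing D" unfolding gluing_def sidesD
 proof
  fix p assume p: "p : P"
  obtain q b where "lab p = (q, b)" by (cases "lab p")
  thus "glue D p : P & glue D p ~= p & glue D (glue D p) = p &
    ev (side_label D (glue D p)) = - ev (side_label D p)" using g[OF p] slD[OF p] slD[of "g p"] by (simp add: D_def ev1)
 qed
 define e where "e i = sgn (n (Is ! i)) * d (Is ! i)" for i
 have lenD: "length (disks D) = length Is" by (simp add: D_def TL_def)
 have IsI: "Is ! i : I & n (Is ! i) ~= 0" if "i < length Is" for i
 proof -
  have "Is ! i : set Is" using that by simp
  thus ?thesis using ils unfolding Is_def by (auto split: if_splits)
 qed
 have Rd: "Rdeg r (ev (concat (disks D ! i))) (e i)" if "i < length (disks D)" for i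
 proof -
  have i: "i < length Is" using that lenD by simp
  let ?s = "Is ! i"
  have c: "concat (disks D ! i) = concat (map ev1 (tri ?s))" using i by (simp add: D_def TL_def)
  show ?thesis
  proof (cases "n ?s > 0")
   case True
   thus ?thesis unfolding c using d[of ?s] IsI[OF i] by (simp add: tri_def ev1 e_def add.assoc add_diff_eq)
  next
   case False
   hence "n ?s < 0" using IsI[OF i] by simp
   moreover have "- (w (gs ?s) + w (hs ?s) - w (ks ?s)) = w (ks ?s) + (- w (hs ?s) + - w (gs ?s))"
    by (simp only: minus_add diff_conv_add_uminus minus_minus add.assoc)
   ultimately show ?thesis unfolding c using Rdeg_uminus[OF d[of ?s]] IsI[OF i] by (simp add: tri_def ev1 e_def)
  qed
 qed
 have len3: "length (disks D ! i) = 3" if "i < length Is" for i using that by (simp add: D_def TL_def tri_def)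
 have lt: "i < length Is" if "K : components D" "i : K" for i K using components_subset[OF gl that(1)] that(2) lenD by auto
 \<comment> \<open>A component of T triangles has 3 T / 2 edges and at least one vertex, so chi >= 1
   - T / 2.\<close>
 have euler: "2 * euler_characteristic D K >= 2 - int (card K)" if K: "K : components D" for K
 proof -
  have "sides_of D K = K \<times> {..<3}" using lt[OF K] len3 lenD by (auto simp: sides_of_def sides_def)
  hence "card (sides_of D K) = 3 * card K" and ne: "sides_of D K ~= {}"
   using components_subset(2)[OF gl K] by (auto simp: card_cartesian_product lessThan_empty_iff)
  hence "2 * card ((%a. {a, glue D a}) ` sides_of D K) = 3 * card K" using card_edges_component[OF gl K] by simp
  hence e: "2 * int (card ((%a. {a, glue D a}) ` sides_of D K)) = 3 * int (card K)" by linarith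
  have "sides_of D K // same_vertex D = vertex D ` sides_of D K" by (auto simp: quotient_def vertex_def)
  hence "card (sides_of D K // same_vertex D) >= 1" using ne by (simp add: Suc_le_eq card_gt_0_iff)
  hence "int (card (sides_of D K // same_vertex D)) >= 1" by linarith
  thus ?thesis unfolding euler_characteristic_def using e by (simp add: algebra_simps)
 qed
 define q where "q = (\<Sum>i\<in>I. n i * d i)"
 define M where "M = (\<Sum>i\<in>I. \<bar>n i\<bar>)"
 define N where "N K = (\<Sum>i\<in>K. e i)" for K
 have finK: "finite K" if "K : components D" for K using components_subset(1)[OF gl that] finite_subset by blast
 have part: "(\<Sum>K\<in>components D. \<Sum>i\<in>K. f i) = (\<Sum>i<length Is. f i)" for f :: "nat => int"
 proof -
  have "(\<Sum>i\<in>\<Union>(components D). f i) = (\<Sum>K\<in>components D. \<Sum>i\<in>K. f i)"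
   using finK components_disjoint by (subst sum.Union_disjoint) (simp_all, blast)
  thus ?thesis by (simp add: Union_components[OF gl] lenD)
 qed
 have sumN: "(\<Sum>K\<in>components D. N K) = q"
 proof -
  have "(\<Sum>i<length Is. e i) = sum_list (map (%s. sgn (n s) * d s) Is)" by (simp add: sum_list_sum_nth atLeast0LessThan e_def)
  also have "\<dots> = q" unfolding sumIs q_def by (intro sum.cong refl) (simp add: sgn_if)
  finally show ?thesis by (simp add: N_def part)
 qed
 have sumF: "(\<Sum>K\<in>components D. int (card K)) = M"
 proof -
  have "(\<Sum>i<length Is. 1) = sum_list (map (%s. 1 :: int) Is)" by (simp add: sum_list_sum_nth atLeast0LessThan)
  also have "\<dots> = M" unfolding sumIs M_def by simp
  finally show ?thesis using part[of "%_. 1"] by simp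
 qed
 \<comment> \<open>If every component of nonzero degree had a larger ratio of triangles to degree
   than the whole surface, summing over the components would contradict the totals \<open>M\<close>
   and \<open>q\<close>.\<close>
 have "\<exists>K\<in>components D. N K ~= 0 & int (card K) * q <= M * \<bar>N K\<bar>"
 proof (rule ccontr)
  assume contr: "~ ?thesis"
  have le: "M * \<bar>N K\<bar> <= int (card K) * q" if "K : components D" for K
   using contr that pos by (cases "N K = 0") (auto simp: q_def)
  have "\<exists>K\<in>components D. N K ~= 0" using sumN pos by (metis q_def less_irrefl sum.neutral)
  hence "\<exists>K\<in>components D. M * \<bar>N K\<bar> < int (card K) * q" using contr by force
  hence "(\<Sum>K\<in>components D. M * \<bar>N K\<bar>) < (\<Sum>K\<in>components D. int (card K) * q)"
   using le by (intro sum_strict_mono_ex1 finite_components) auto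
  also have "\<dots> = M * q" by (simp add: sumF flip: sum_distrib_right)
  also have "M * q <= M * (\<Sum>K\<in>components D. \<bar>N K\<bar>)"
   using sumN sum_abs[of N "components D"] by (intro mult_left_mono) (auto simp: M_def sum_nonneg)
  finally show False by (simp add: sum_distrib_left)
 qed
 then obtain K where K: "K : components D" "N K ~= 0" "int (card K) * q <= M * \<bar>N K\<bar>" by blast
 obtain x k where xk: "Rdeg r x (N K)" "Comm k x" "2 * int k <= 2 - euler_characteristic D K"
  using component_relation[OF gl K(1) Rd] unfolding N_def by blast
 have "max 0 (4 * int k - 4) <= int (card K)" using xk(3) euler[OF K(1)] by simp
 hence "max 0 (4 * int k - 4) * q <= int (card K) * q" using pos by (intro mult_right_mono) (auto simp: q_def)
 hence "max 0 (4 * int k - 4) * q <= M * \<bar>N K\<bar>" using K(3) by linarith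
 thus ?thesis using xk(1,2) K(2) unfolding q_def M_def by blast
qed

text \<open>The edges of the cycle carry labels, and \<open>w\<close> chooses words for them. The
  triangle \<open>i\<close> then spells a relation of degree \<open>d i\<close>, and these degrees
  have total 1 over the cycle. An integral approximation with denominator q has total degree q, and
  q cancels.\<close>

theorem real_cycle_relation:
 fixes w :: "'q => 'a fg" and gs hs ks :: "'s => 'q" and c :: "'s => real" and d :: "'s => int"
 assumes fin: "finite I"
  and cyc: "!!q. (\<Sum>i\<in>I. c i * (of_bool (gs i = q) + of_bool (hs i = q) - of_bool (ks i = q))) = 0"
  and d: "!!i. i : I ==> Rdeg r (w (gs i) + w (hs i) - w (ks i)) (d i)"
  and deg: "(\<Sum>i\<in>I. c i * of_int (d i)) = 1" and "\<epsilon> > 0"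
 shows "\<exists>x k N. N ~= 0 & Rdeg r x N & Comm k x &
  max 0 (4 * real k - 4) <= (1 + \<epsilon>) * (\<Sum>i\<in>I. \<bar>c i\<bar>) * \<bar>of_int N\<bar>"
proof -
 define a where "a q i = (of_bool (gs i = q) + of_bool (hs i = q) - of_bool (ks i = q) :: int)" for q i
 have "\<bar>a q i\<bar> <= 2" for q i by (auto simp: a_def)
 moreover have "(\<Sum>i\<in>I. c i * of_int (a q i)) = 0" for q using cyc[of q] by (simp add: a_def)
 ultimately obtain q n where qn: "(q :: int) > 0" "!!j. (\<Sum>i\<in>I. n i * a j i) = 0" "(\<Sum>i\<in>I. n i * d i) = q"
  "of_int (\<Sum>i\<in>I. \<bar>n i\<bar>) <= (1 + \<epsilon>) * of_int q * (\<Sum>i\<in>I. \<bar>c i\<bar>)"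
  using integral_approximation[OF fin _ _ deg \<open>\<epsilon> > 0\<close>, of a 2] by blast
 have "\<exists>x k N. N ~= 0 & Rdeg r x N & Comm k x &
  max 0 (4 * int k - 4) * (\<Sum>i\<in>I. n i * d i) <= (\<Sum>i\<in>I. \<bar>n i\<bar>) * \<bar>N\<bar>"
 proof (rule integral_cycle_relation[where w = w and gs = gs and hs = hs and ks = ks, OF fin])
  show "(\<Sum>i\<in>I. n i * (of_bool (gs i = j) + of_bool (hs i = j) - of_bool (ks i = j))) = 0" for j
   using qn(2)[of j] by (simp add: a_def)
 qed (use qn(1,3) d in auto)
 then obtain x k N where x: "N ~= 0" "Rdeg r x N" "Comm k x"
  "max 0 (4 * int k - 4) * q <= (\<Sum>i\<in>I. \<bar>n i\<bar>) * \<bar>N\<bar>" using qn(3) by metis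
 have "max 0 (4 * real k - 4) * of_int q = of_int (max 0 (4 * int k - 4) * q)" by (simp add: of_int_max)
 also have "\<dots> <= of_int ((\<Sum>i\<in>I. \<bar>n i\<bar>) * \<bar>N\<bar>)" using x(4) by (simp only: of_int_le_iff)
 also have "\<dots> = of_int (\<Sum>i\<in>I. \<bar>n i\<bar>) * \<bar>of_int N\<bar>" by (simp only: of_int_mult of_int_abs)
 also have "\<dots> <= ((1 + \<epsilon>) * of_int q * (\<Sum>i\<in>I. \<bar>c i\<bar>)) * \<bar>of_int N\<bar>"
  using qn(4) by (intro mult_right_mono) auto
 finally have "max 0 (4 * real k - 4) * of_int q <= ((1 + \<epsilon>) * (\<Sum>i\<in>I. \<bar>c i\<bar>) * \<bar>of_int N\<bar>) * of_int q"
  by (simp add: ac_simps)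
 hence "max 0 (4 * real k - 4) <= (1 + \<epsilon>) * (\<Sum>i\<in>I. \<bar>c i\<bar>) * \<bar>of_int N\<bar>"
  using qn(1) by (simp only: mult_le_cancel_right)
 thus ?thesis using x by blast
qed

section \<open>Singular simplices in low dimensions\<close>

lemma singular_simplex_iff:
 "singular_simplex p X f \<longleftrightarrow>
   continuous_map (top_of_set (standard_simplex p)) X f & f : extensional (standard_simplex p)"
 by (simp add: singular_simplex_def euclidean_product_topology)

lemma continuous_on_coord [continuous_intros]: "continuous_on A (%x :: nat => real. x i)"
 by (rule continuous_on_subset[OF continuous_on_product_coordinates]) simp

lemma standard_simplexI:
 assumes "!!i. i <= p ==> 0 <= x i" "!!i. i > p ==> x i = 0" "(\<Sum>i\<le>p. x i) = 1"
 shows "x : standard_simplex p"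
proof -
 have "x i <= 1" if "i <= p" for i using member_le_sum[of i "{..p}" x] assms that by simp
 thus ?thesis using assms by (auto simp: standard_simplex_def) (metis leI order.refl zero_le_one)+
qed

section \<open>Filling horns of singular simplices\<close>

definition del_coord :: "nat => (nat => real) => nat => real" where
 "del_coord i y = (%j. if j < i then y j else y (Suc j))"

lemma del_coord_face [simp]: "del_coord i (simplical_face i z) = z" by (auto simp: del_coord_def simplical_face_def)

lemma face_del_coord: "y i = 0 ==> simplical_face i (del_coord i y) = y" by (auto simp: del_coord_def simplical_face_def fun_eq_iff)

lemma del_coord_in_simplex:
 assumes "y : standard_simplex (Suc n)" "i <= Suc n" "y i = 0"
 shows "del_coord i y : standard_simplex n"
proof (rule standard_simplexI)
 have y: "!!j. 0 <= y j" "!!j. j > Suc n ==> y j = 0" "(\<Sum>j\<le>Suc n. y j) = 1" using assms(1) by (auto simp: standard_simplex_def)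
 show "0 <= del_coord i y j" for j using y by (simp add: del_coord_def)
 show "del_coord i y j = 0" if "j > n" for j using y that assms(2) by (simp add: del_coord_def)
 have "(\<Sum>j\<le>n. del_coord i y j) = (\<Sum>j\<in>{..Suc n} - {i}. y j)"
  by (rule sum.reindex_bij_witness[of _ "%j. if j < i then j else j - 1" "%j. if j < i then j else Suc j"])
   (use assms(2) in \<open>auto simp: del_coord_def split: if_splits\<close>)
 also have "\<dots> = 1" using y(3) assms(2,3) by (subst sum_diff1) auto
 finally show "(\<Sum>j\<le>n. del_coord i y j) = 1" .
qed

lemma continuous_on_del_coord: "continuous_on A (del_coord i)"
proof (rule continuous_on_coordinatewise_then_product)
 show "continuous_on A (%x. del_coord i x j)" for j by (cases "j < i") (simp_all add: del_coord_def continuous_on_coord)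
qed

lemma simplical_face_swap:
 "i < j ==> simplical_face j (simplical_face i z) = simplical_face i (simplical_face (j - 1) (z :: nat => real))"
 by (auto simp: simplical_face_def fun_eq_iff)

lemma singular_face_swap:
 assumes "i < j" "j <= Suc (Suc n)"
 shows "singular_face (Suc n) i (singular_face (Suc (Suc n)) j f) =
  singular_face (Suc n) (j - 1) (singular_face (Suc (Suc n)) i f)"
proof
 fix z
 show "singular_face (Suc n) i (singular_face (Suc (Suc n)) j f) z =
  singular_face (Suc n) (j - 1) (singular_face (Suc (Suc n)) i f) z"
 proof (cases "z : standard_simplex n")
  case True
  hence "simplical_face i z : standard_simplex (Suc n)" "simplical_face (j - 1) z : standard_simplex (Suc n)"
   using simplical_face_in_standard_simplex[of "Suc n"] assms by auto
  thus ?thesis using True simplical_face_swap[OF assms(1), of z] by (simp add: singular_face_def)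
 qed (simp add: singular_face_def)
qed

text \<open>The boundary of a simplex without its \<open>k\<close>-th face is a retract of the simplex: move every
  point away from the \<open>k\<close>-th face, towards the opposite vertex.\<close>

lemma horn_filler:
 assumes k: "k <= Suc (Suc n)"
  and \<sigma>: "!!i. i <= Suc (Suc n) ==> i ~= k ==> singular_simplex (Suc n) X (\<sigma> i)"
  and compat: "!!i j. i < j ==> j <= Suc (Suc n) ==> i ~= k ==> j ~= k ==>
   singular_face (Suc n) i (\<sigma> j) = singular_face (Suc n) (j - 1) (\<sigma> i)"
 obtains \<Sigma> where "singular_simplex (Suc (Suc n)) X \<Sigma>"
  "!!i. i <= Suc (Suc n) ==> i ~= k ==> singular_face (Suc (Suc n)) i \<Sigma> = \<sigma> i"
proof -
 let ?n = "Suc (Suc n)"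
 let ?\<Delta> = "standard_simplex ?n"
 define I where "I = {..?n} - {k}"
 define C where "C i = {x : ?\<Delta>. \<forall>j\<in>I. x i <= x j}" for i
 \<comment> \<open>On \<open>C i\<close> the coordinate \<open>i\<close> is the smallest one besides
   \<open>k\<close>. Subtracting it from all coordinates in \<open>I\<close> and adding it to
   coordinate \<open>k\<close>, once for each of the \<open>?n\<close> elements of \<open>I\<close>,
   leads to the face opposite to vertex \<open>i\<close>.\<close>
 define ret where "ret i x = (%j. if j > ?n then 0 else if j = k then x k + real ?n * x i else x j - x i)"
  for i and x :: "nat => real"
 define f where "f i x = \<sigma> i (del_coord i (ret i x))" for i x
 have split: "(\<Sum>j\<le>?n. h j) = h k + (\<Sum>j\<in>I. h j)" for h :: "nat => real" unfolding I_def using k by (intro sum.remove) auto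
 have ret_in: "ret i x : ?\<Delta>" if "x : C i" "i : I" for i x
 proof (rule standard_simplexI)
  have x: "!!j. 0 <= x j" "(\<Sum>j\<le>?n. x j) = 1" "!!j. j : I ==> x i <= x j" using that by (auto simp: C_def standard_simplex_def)
  show "0 <= ret i x j" if "j <= ?n" for j using x that by (auto simp: ret_def I_def)
  show "ret i x j = 0" if "j > ?n" for j using that by (simp add: ret_def)
  have "(\<Sum>j\<le>?n. ret i x j) = ret i x k + (\<Sum>j\<in>I. ret i x j)" by (rule split)
  also have "(\<Sum>j\<in>I. ret i x j) = (\<Sum>j\<in>I. x j - x i)" by (rule sum.cong) (auto simp: ret_def I_def)
  also have "\<dots> = (\<Sum>j\<in>I. x j) - real ?n * x i" using k by (simp add: sum_subtractf I_def)
  also have "ret i x k + \<dots> = x k + (\<Sum>j\<in>I. x j)" using k by (simp add: ret_def)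
  also have "\<dots> = 1" using x(2) by (simp only: split)
  finally show "(\<Sum>j\<le>?n. ret i x j) = 1" .
 qed
 have ret_i: "ret i x i = 0" if "i : I" for i x using that by (auto simp: ret_def I_def)
 have fin: "finite I" "I ~= {}"
 proof -
  have "(if k = 0 then 1 else 0) : I" by (simp add: I_def)
  thus "I ~= {}" by blast
 qed (simp add: I_def)
 have cover: "\<exists>i\<in>I. x : C i" if "x : ?\<Delta>" for x
 proof -
  have "Min (x ` I) : x ` I" using fin by (intro Min_in) auto
  then obtain i where "i : I" "Min (x ` I) = x i" by blast
  hence "x : C i" using that fin Min_le[of "x ` I"] by (auto simp: C_def)
  thus ?thesis using \<open>i : I\<close> by blast
 qed
 define g where "g x = f (SOME i. i : I & x : C i) x" for x
 \<comment> \<open>Where two coordinates are both minimal, the retracted point lies on both faces,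
   and there the given simplices agree by \<open>compat\<close>.\<close>
 have overlap: "f i x = f j x" if "i : I" "j : I" "x : C i Int C j" for i j x
 proof -
  have main: "f i x = f j x" if ij: "i : I" "j : I" "x : C i Int C j" "i < j" for i j
  proof -
   have "x i = x j" using ij by (auto simp: C_def intro: order.antisym)
   hence req: "ret j x = ret i x" by (auto simp: ret_def)
   define y where "y = ret i x"
   have y: "y : ?\<Delta>" "y i = 0" "y j = 0"
    using ret_in[of x i] ij ret_i[OF ij(1), of x] ret_i[OF ij(2), of x] req unfolding y_def by auto
   define z where "z = del_coord i (del_coord j y)"
   have jn: "j <= ?n" "i <= Suc n" "i ~= k" "j ~= k" using ij by (auto simp: I_def)
   have dj: "del_coord j y : standard_simplex (Suc n)" by (rule del_coord_in_simplex[OF y(1) jn(1) y(3)])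
   have "del_coord j y i = 0" using y ij(4) by (simp add: del_coord_def)
   hence z: "z : standard_simplex n" "simplical_face i z = del_coord j y"
    unfolding z_def using del_coord_in_simplex[OF dj jn(2)] face_del_coord by auto
   have "simplical_face (j - 1) z = del_coord i y"
   proof -
    have "y = simplical_face j (simplical_face i z)" using z(2) y(3) face_del_coord by simp
    also have "\<dots> = simplical_face i (simplical_face (j - 1) z)" by (rule simplical_face_swap[OF ij(4)])
    finally show ?thesis by simp
   qed
   hence "\<sigma> i (del_coord i y) = singular_face (Suc n) (j - 1) (\<sigma> i) z" using z(1) by (simp add: singular_face_def)
   also have "\<dots> = singular_face (Suc n) i (\<sigma> j) z" using compat[OF ij(4) jn(1,3,4)] by simp
   also have "\<dots> = \<sigma> j (del_coord j y)" using z by (simp add: singular_face_def)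
   finally show ?thesis by (simp add: f_def req y_def)
  qed
  show ?thesis
  proof (cases i j rule: linorder_cases)
   case greater
   have "x : C j Int C i" using that(3) by blast
   from main[OF that(2,1) this greater] show ?thesis by simp
  qed (use main[OF that] in simp_all)
 qed
 have gf: "g x = f i x" if "i : I" "x : C i" for i x
 proof -
  have "(SOME i. i : I & x : C i) : I & x : C (SOME i. i : I & x : C i)" using that by (intro someI[of "%i. i : I & x : C i" i]) auto
  thus ?thesis unfolding g_def using that by (intro overlap) auto
 qed
 have cont: "continuous_map (top_of_set ?\<Delta>) X g"
 proof (rule pasting_lemma_closed[where I = I and T = C and f = f])
  show "finite I" by (rule fin)
  show "closedin (top_of_set ?\<Delta>) (C i)" for i
  proof -
   have "closed {x :: nat => real. \<forall>j\<in>I. x i <= x j}"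
   proof -
    have "closed (\<Inter>j\<in>I. {x :: nat => real. x i <= x j})" by (intro closed_INT ballI closed_Collect_le continuous_on_coord)
    moreover have "(\<Inter>j\<in>I. {x :: nat => real. x i <= x j}) = {x. \<forall>j\<in>I. x i <= x j}" by auto
    ultimately show ?thesis by simp
   qed
   moreover have "C i = ?\<Delta> Int {x. \<forall>j\<in>I. x i <= x j}" by (auto simp: C_def)
   ultimately show ?thesis by (auto simp: closedin_closed)
  qed
  show "continuous_map (subtopology (top_of_set ?\<Delta>) (C i)) X (f i)" if i: "i : I" for i
  proof -
   have "continuous_map (top_of_set (C i)) (top_of_set (standard_simplex (Suc n))) (%x. del_coord i (ret i x))"
   proof -
    have "continuous_on (C i) (ret i)"
    proof (rule continuous_on_coordinatewise_then_product)
     show "continuous_on (C i) (%x. ret i x j)" for j by (cases "j > ?n"; cases "j = k")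
       (simp_all add: ret_def continuous_on_coord continuous_on_add continuous_on_diff continuous_on_mult_left)
    qed
    hence "continuous_on (C i) (%x. del_coord i (ret i x))" by (rule continuous_on_compose2[OF continuous_on_del_coord[of UNIV]]) simp
    moreover have "del_coord i (ret i x) : standard_simplex (Suc n)" if "x : C i" for x
     using i del_coord_in_simplex[OF ret_in[OF that i] _ ret_i[OF i]] by (simp add: I_def)
    ultimately show ?thesis by auto
   qed
   moreover have "continuous_map (top_of_set (standard_simplex (Suc n))) X (\<sigma> i)"
    using \<sigma>[of i] i by (auto simp: singular_simplex_iff I_def)
   ultimately have "continuous_map (top_of_set (C i)) X (\<sigma> i o (%x. del_coord i (ret i x)))" by (rule continuous_map_compose)
   moreover have "subtopology (top_of_set ?\<Delta>) (C i) = top_of_set (C i)"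
   proof -
    have "?\<Delta> Int C i = C i" by (auto simp: C_def)
    thus ?thesis by (simp add: subtopology_subtopology)
   qed
   ultimately show ?thesis by (simp add: f_def[abs_def] comp_def)
  qed
  show "f i x = f j x" if "i : I" "j : I" "x : topspace (top_of_set ?\<Delta>) Int C i Int C j" for i j x using that by (intro overlap) auto
  show "\<exists>j. j : I & x : C j & g x = f j x" if "x : topspace (top_of_set ?\<Delta>)" for x using cover[of x] gf that by auto
 qed
 define \<Sigma> where "\<Sigma> = restrict g ?\<Delta>"
 have "continuous_map (top_of_set ?\<Delta>) X \<Sigma>" by (rule continuous_map_eq[OF cont]) (simp add: \<Sigma>_def)
 hence "singular_simplex ?n X \<Sigma>" by (simp add: singular_simplex_iff \<Sigma>_def)
 moreover have "singular_face ?n i \<Sigma> = \<sigma> i" if i: "i <= ?n" "i ~= k" for i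
 proof
  fix z
  have iI: "i : I" using i by (simp add: I_def)
  show "singular_face ?n i \<Sigma> z = \<sigma> i z"
  proof (cases "z : standard_simplex (Suc n)")
   case True
   let ?x = "simplical_face i z"
   have x: "?x : ?\<Delta>" using simplical_face_in_standard_simplex[of ?n i z] True i by simp
   have x0: "?x i = 0" by (simp add: simplical_face_def)
   hence "?x : C i" using x by (auto simp: C_def standard_simplex_def)
   moreover have "ret i ?x = ?x" using x x0 by (auto simp: ret_def standard_simplex_def fun_eq_iff)
   ultimately show ?thesis using True x gf[OF iI] by (simp add: singular_face_def \<Sigma>_def f_def)
  next
   case False
   thus ?thesis using \<sigma>[OF i] by (auto simp: singular_face_def singular_simplex_iff extensional_def)
  qed
 qed
 ultimately show thesis using that by blast
qed

text \<open>\<open>triangle X \<sigma> p q s\<close>: the singular 2-simplex \<open>\<sigma>\<close> has the edges \<open>p\<close> from vertex 0 to 1, \<open>q\<close> from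
  1 to 2, and \<open>s\<close> from 0 to 2.\<close>

definition triangle :: "'x topology => ((nat => real) => 'x) => ((nat => real) => 'x) =>
  ((nat => real) => 'x) => ((nat => real) => 'x) => bool" where
 "triangle X \<sigma> p q s \<longleftrightarrow> singular_simplex 2 X \<sigma> & singular_face 2 2 \<sigma> = p &
   singular_face 2 0 \<sigma> = q & singular_face 2 1 \<sigma> = s"

definition tetrahedron where
 "tetrahedron X \<Sigma> a b c d \<longleftrightarrow> singular_simplex 3 X \<Sigma> & singular_face 3 0 \<Sigma> = a &
   singular_face 3 1 \<Sigma> = b & singular_face 3 2 \<Sigma> = c & singular_face 3 3 \<Sigma> = d"

lemma triangle_edges:
 assumes "triangle X \<sigma> p q s"
 shows "singular_simplex 1 X p" "singular_simplex 1 X q" "singular_simplex 1 X s"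
  "singular_face 1 0 p = singular_face 1 1 q" "singular_face 1 0 q = singular_face 1 0 s"
  "singular_face 1 1 p = singular_face 1 1 s"
 using assms singular_simplex_singular_face[of 2 X \<sigma>] singular_face_swap[of 0 2 0 \<sigma>]
  singular_face_swap[of 0 1 0 \<sigma>] singular_face_swap[of 1 2 0 \<sigma>] unfolding triangle_def by (auto simp: numeral_2_eq_2)

lemma le3: "i <= 3 \<longleftrightarrow> i = 0 \<or> i = 1 \<or> i = 2 \<or> i = (3 :: nat)" by auto

lemma tetrahedron_faces:
 assumes "singular_simplex 3 X \<Sigma>"
 shows "singular_face 2 0 (singular_face 3 1 \<Sigma>) = singular_face 2 0 (singular_face 3 0 \<Sigma>)"
  "singular_face 2 0 (singular_face 3 2 \<Sigma>) = singular_face 2 1 (singular_face 3 0 \<Sigma>)"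
  "singular_face 2 0 (singular_face 3 3 \<Sigma>) = singular_face 2 2 (singular_face 3 0 \<Sigma>)"
  "singular_face 2 1 (singular_face 3 2 \<Sigma>) = singular_face 2 1 (singular_face 3 1 \<Sigma>)"
  "singular_face 2 1 (singular_face 3 3 \<Sigma>) = singular_face 2 2 (singular_face 3 1 \<Sigma>)"
  "singular_face 2 2 (singular_face 3 3 \<Sigma>) = singular_face 2 2 (singular_face 3 2 \<Sigma>)"
  "i <= 3 ==> singular_simplex 2 X (singular_face 3 i \<Sigma>)"
 using singular_face_swap[of 0 1 1 \<Sigma>] singular_face_swap[of 0 2 1 \<Sigma>] singular_face_swap[of 0 3 1 \<Sigma>]
  singular_face_swap[of 1 2 1 \<Sigma>] singular_face_swap[of 1 3 1 \<Sigma>] singular_face_swap[of 2 3 1 \<Sigma>]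
  singular_simplex_singular_face[OF assms, of i] by (simp_all add: numeral_2_eq_2 numeral_3_eq_3)

lemma tetrahedron_fill:
 assumes k: "k <= 3"
  and 0: "k ~= 0 ==> triangle X (\<sigma> 0) e12 e23 e13" and 1: "k ~= 1 ==> triangle X (\<sigma> 1) e02 e23 e03"
  and 2: "k ~= 2 ==> triangle X (\<sigma> 2) e01 e13 e03" and 3: "k ~= 3 ==> triangle X (\<sigma> 3) e01 e12 e02"
 obtains \<Sigma> where "singular_simplex 3 X \<Sigma>" "!!i. i <= 3 ==> i ~= k ==> singular_face 3 i \<Sigma> = \<sigma> i"
proof (rule horn_filler[of k 1 X \<sigma>])
 show "k <= Suc (Suc 1)" using k by simp
 show "singular_simplex (Suc 1) X (\<sigma> i)" if "i <= Suc (Suc 1)" "i ~= k" for i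
  using that assms le3[of i] by (auto simp: triangle_def numeral_2_eq_2 numeral_3_eq_3)
 show "singular_face (Suc 1) i (\<sigma> j) = singular_face (Suc 1) (j - 1) (\<sigma> i)"
  if "i < j" "j <= Suc (Suc 1)" "i ~= k" "j ~= k" for i j
 proof -
  have "(i = 0 & j = 1) \<or> (i = 0 & j = 2) \<or> (i = 0 & j = 3) \<or> (i = 1 & j = 2) \<or> (i = 1 & j = 3) \<or> (i = 2 & j = 3)"
   using that by auto
  thus ?thesis using that(3,4) 0 1 2 3 by (elim disjE conjE) (auto simp: triangle_def numeral_2_eq_2 numeral_3_eq_3)
 qed
qed (use that in \<open>auto simp: numeral_3_eq_3\<close>)

text \<open>The edge \<open>eij\<close> joins the vertices i and j, and the face opposite to vertex
  1 is found. Up to filling, this is associativity of the composition of paths.\<close>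

lemma tetrahedron_fill_1:
 assumes "triangle X a e12 e23 e13" "triangle X c e01 e13 e03" "triangle X d e01 e12 e02"
 obtains b \<Sigma> where "triangle X b e02 e23 e03" "tetrahedron X \<Sigma> a b c d"
proof -
 obtain \<Sigma> where \<Sigma>: "singular_simplex 3 X \<Sigma>" "!!i. i <= 3 ==> i ~= 1 ==> singular_face 3 i \<Sigma> = ((%_. d)(0 := a, 2 := c)) i"
  by (rule tetrahedron_fill[of 1 X "(%_. d)(0 := a, 2 := c)"]) (use assms in auto)
 show thesis by (rule that[of "singular_face 3 1 \<Sigma>" \<Sigma>])
   (use \<Sigma>(2)[of 0] \<Sigma>(2)[of 2] \<Sigma>(2)[of 3] \<Sigma>(1) tetrahedron_faces[OF \<Sigma>(1)] assms in
    \<open>auto simp: tetrahedron_def triangle_def\<close>)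
qed

lemma tetrahedron_fill_2:
 assumes "triangle X a e12 e23 e13" "triangle X b e02 e23 e03" "triangle X d e01 e12 e02"
 obtains c \<Sigma> where "triangle X c e01 e13 e03" "tetrahedron X \<Sigma> a b c d"
proof -
 obtain \<Sigma> where \<Sigma>: "singular_simplex 3 X \<Sigma>" "!!i. i <= 3 ==> i ~= 2 ==> singular_face 3 i \<Sigma> = ((%_. d)(0 := a, 1 := b)) i"
  by (rule tetrahedron_fill[of 2 X "(%_. d)(0 := a, 1 := b)"]) (use assms in auto)
 show thesis by (rule that[of "singular_face 3 2 \<Sigma>" \<Sigma>])
   (use \<Sigma>(2)[of 0] \<Sigma>(2)[of 1] \<Sigma>(2)[of 3] \<Sigma>(1) tetrahedron_faces[OF \<Sigma>(1)] assms in
    \<open>auto simp: tetrahedron_def triangle_def\<close>)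
qed

lemma chain_boundary_triangle:
 "triangle X \<sigma> p q s ==> chain_boundary 2 (frag_of \<sigma>) = frag_of q - frag_of s + frag_of p"
 by (simp add: chain_boundary_of triangle_def numeral_2_eq_2 atMost_Suc algebra_simps)

lemma chain_boundary_tetrahedron:
 "tetrahedron X \<Sigma> a b c d ==> chain_boundary 3 (frag_of \<Sigma>) = frag_of a - frag_of b + frag_of c - frag_of d"
 by (simp add: chain_boundary_of tetrahedron_def numeral_3_eq_3 numeral_2_eq_2 atMost_Suc algebra_simps)

section \<open>Constant and affine simplices\<close>

definition const_simplex :: "nat => 'x => (nat => real) => 'x" where
 "const_simplex n a = restrict (%_. a) (standard_simplex n)"

lemma standard_simplex_1:
 "x : standard_simplex 1 \<longleftrightarrow> 0 <= x 0 & 0 <= x 1 & x 0 + x 1 = 1 & (\<forall>i>1. x i = 0)"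
proof
 assume "x : standard_simplex 1"
 thus "0 <= x 0 & 0 <= x 1 & x 0 + x 1 = 1 & (\<forall>i>1. x i = 0)" by (auto simp: standard_simplex_def)
qed (auto intro!: standard_simplexI simp: le_Suc_eq)

lemma standard_simplex_2:
 "x : standard_simplex 2 \<longleftrightarrow> 0 <= x 0 & 0 <= x 1 & 0 <= x 2 & x 0 + x 1 + x 2 = 1 & (\<forall>i>2. x i = 0)"
proof
 assume "x : standard_simplex 2"
 thus "0 <= x 0 & 0 <= x 1 & 0 <= x 2 & x 0 + x 1 + x 2 = 1 & (\<forall>i>2. x i = 0)" by (auto simp: standard_simplex_def numeral_2_eq_2)
qed (auto intro!: standard_simplexI simp: le_Suc_eq numeral_2_eq_2)

lemma face_2_simps:
 fixes x :: "nat => real"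
 shows "simplical_face 0 x 0 = 0" "simplical_face 0 x 1 = x 0" "simplical_face 0 x 2 = x 1"
  "simplical_face 1 x 0 = x 0" "simplical_face 1 x 1 = 0" "simplical_face 1 x 2 = x 1"
  "simplical_face 2 x 0 = x 0" "simplical_face 2 x 1 = x 1" "simplical_face 2 x 2 = 0" by (simp_all add: simplical_face_def)

lemmas face_2_simps' [simp] = face_2_simps[unfolded One_nat_def]
lemmas standard_simplex_1' = standard_simplex_1[unfolded One_nat_def]

lemma face_in_simplex_2: "x : standard_simplex 1 ==> k <= 2 ==> simplical_face k x : standard_simplex 2"
 using simplical_face_in_standard_simplex[of 2 k x] by simp

lemma triangleI:
 assumes "continuous_map (top_of_set (standard_simplex 2)) X f"
  and "!!x. x : standard_simplex 1 ==> f (simplical_face 2 x) = p x" "p : extensional (standard_simplex 1)"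
  and "!!x. x : standard_simplex 1 ==> f (simplical_face 0 x) = q x" "q : extensional (standard_simplex 1)"
  and "!!x. x : standard_simplex 1 ==> f (simplical_face 1 x) = s x" "s : extensional (standard_simplex 1)"
 shows "triangle X (restrict f (standard_simplex 2)) p q s"
proof -
 have "continuous_map (top_of_set (standard_simplex 2)) X (restrict f (standard_simplex 2))" by (rule continuous_map_eq[OF assms(1)]) simp
 moreover have "singular_face 2 k (restrict f (standard_simplex 2)) = g"
  if "k <= 2" "!!x. x : standard_simplex 1 ==> f (simplical_face k x) = g x" "g : extensional (standard_simplex 1)" for k g
 proof
  fix x show "singular_face 2 k (restrict f (standard_simplex 2)) x = g x"
   using that face_in_simplex_2[of x k] by (cases "x : standard_simplex 1") (auto simp: singular_face_def extensional_def)
 qed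
 ultimately show ?thesis using assms(2-) by (simp add: triangle_def singular_simplex_iff)
qed

definition seg :: "('v::real_normed_vector => 'x) => 'v => 'v => (nat => real) => 'x" where
 "seg f a b = restrict (%x. f (x 0 *\<^sub>R a + x 1 *\<^sub>R b)) (standard_simplex 1)"

definition triangle_simplex :: "('v::real_normed_vector => 'x) => 'v => 'v => 'v => (nat => real) => 'x" where
 "triangle_simplex f a b c = restrict (%x. f (x 0 *\<^sub>R a + x 1 *\<^sub>R b + x 2 *\<^sub>R c)) (standard_simplex 2)"

lemma singular_simplex_segment:
 assumes "continuous_map (top_of_set K) X f" "convex K" "a : K" "b : K"
 shows "singular_simplex 1 X (seg f a b)"
proof -
 have "continuous_map (top_of_set (standard_simplex 1)) (top_of_set K) (%x. x 0 *\<^sub>R a + x 1 *\<^sub>R b)"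
  using assms(2-) by (auto simp: standard_simplex_1' convex_def intro!: continuous_intros)
 from continuous_map_compose[OF this assms(1)]
 have "continuous_map (top_of_set (standard_simplex 1)) X (seg f a b)" by (rule continuous_map_eq) (simp add: seg_def)
 thus ?thesis by (simp add: singular_simplex_iff seg_def)
qed

lemma convex_triple:
 assumes "convex K" "a : K" "b : K" "c : K" "0 <= u" "0 <= v" "0 <= w" "u + v + w = (1 :: real)"
 shows "u *\<^sub>R a + v *\<^sub>R b + w *\<^sub>R c : K"
proof -
 have "convex hull {a, b, c} <= K" using assms(1-4) by (intro hull_minimal) auto
 thus ?thesis using assms(5-) unfolding convex_hull_3 by blast
qed

lemma triangle_triangle_simplex:
 assumes "continuous_map (top_of_set K) X f" "convex K" "a : K" "b : K" "c : K"
 shows "triangle X (triangle_simplex f a b c) (seg f a b) (seg f b c) (seg f a c)" unfolding triangle_simplex_def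
proof (rule triangleI)
 have "continuous_map (top_of_set (standard_simplex 2)) (top_of_set K) (%x. x 0 *\<^sub>R a + x 1 *\<^sub>R b + x 2 *\<^sub>R c)"
  using convex_triple[OF assms(2-5)] by (auto simp: standard_simplex_2 intro!: continuous_intros)
 from continuous_map_compose[OF this assms(1)]
 show "continuous_map (top_of_set (standard_simplex 2)) X (%x. f (x 0 *\<^sub>R a + x 1 *\<^sub>R b + x 2 *\<^sub>R c))"
  by (simp add: comp_def)
qed (simp_all add: seg_def)

lemma singular_face_1:
 "singular_face 1 k g = const_simplex 0 (g (simplical_face k (%j. if j = 0 then 1 else 0)))"
proof
 fix x
 show "singular_face 1 k g x = const_simplex 0 (g (simplical_face k (%j. if j = 0 then 1 else 0))) x"
 proof (cases "x : standard_simplex 0")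
  case True
  hence "x = (%j. if j = 0 then 1 else 0)" using standard_simplex_0 by blast
  with True show ?thesis by (simp add: singular_face_def const_simplex_def)
 qed (simp add: singular_face_def const_simplex_def)
qed

lemma singular_face_segment:
 "singular_face 1 0 (seg f a b) = const_simplex 0 (f b)"
 "singular_face 1 1 (seg f a b) = const_simplex 0 (f a)"
proof -
 let ?e = "%j :: nat. if j = 0 then 1 else 0 :: real"
 have *: "simplical_face k ?e : standard_simplex 1" if "k <= 1" for k
  using simplical_face_in_standard_simplex[of 1 k ?e] that by (simp add: standard_simplex_0)
 show "singular_face 1 0 (seg f a b) = const_simplex 0 (f b)" unfolding singular_face_1 seg_def restrict_apply'[OF *[of 0, OF zero_le]]
  by (simp add: simplical_face_def)
 show "singular_face 1 1 (seg f a b) = const_simplex 0 (f a)" unfolding singular_face_1 seg_def restrict_apply'[OF *[of 1, OF order_refl]]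
  by (simp add: simplical_face_def)
qed

lemma concatenation:
 assumes "singular_simplex 1 X p" "singular_simplex 1 X q" "singular_face 1 0 p = singular_face 1 1 q"
 shows "\<exists>s \<sigma>. triangle X \<sigma> p q s"
proof -
 obtain \<Sigma> where \<Sigma>: "singular_simplex (Suc (Suc 0)) X \<Sigma>"
  "!!i. i <= Suc (Suc 0) ==> i ~= 1 ==> singular_face (Suc (Suc 0)) i \<Sigma> = ((%_. p)(0 := q)) i"
 proof (rule horn_filler[of 1 0 X "(%_. p)(0 := q)"])
  show "singular_face (Suc 0) i (((%_. p)(0 := q)) j) = singular_face (Suc 0) (j - 1) (((%_. p)(0 := q)) i)"
   if "i < j" "j <= Suc (Suc 0)" "i ~= 1" "j ~= 1" for i j
  proof -
   have "i = 0" "j = 2" using that by auto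
   thus ?thesis using assms(3) by simp
  qed
 qed (use assms in auto)
 thus ?thesis using \<Sigma>(2)[of 0] \<Sigma>(2)[of 2] by (auto simp: triangle_def numeral_2_eq_2)
qed

text \<open>A nonabelian 1-cocycle: for a subgroup \<open>H\<close>, a homomorphism from the
  fundamental groupoid to \<open>H\<close>, written on singular simplices so that no base points
  occur.\<close>

definition cocycle :: "'x topology => 'g::group_add set => (((nat => real) => 'x) => 'g) => bool" where
 "cocycle X H \<phi> \<longleftrightarrow> (\<forall>\<tau>. singular_simplex 1 X \<tau> --> \<phi> \<tau> : H) &
   (\<forall>\<sigma> p q s. triangle X \<sigma> p q s --> \<phi> s = \<phi> p + \<phi> q)"

lemma singular_simplex_continuous_map:
 "singular_simplex p X \<sigma> ==> continuous_map X Y f ==> singular_simplex p Y (simplex_map p f \<sigma>)"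
 by (rule singular_simplex_simplex_map)

lemma triangle_simplex_map:
 assumes "triangle X \<sigma> p q s" "continuous_map X Y f"
 shows "triangle Y (simplex_map 2 f \<sigma>) (simplex_map 1 f p) (simplex_map 1 f q) (simplex_map 1 f s)"
proof -
 have "singular_face 2 k (simplex_map 2 f \<sigma>) = simplex_map 1 f (singular_face 2 k \<sigma>)" if "k <= 2" for k
  using that face_in_simplex_2[unfolded One_nat_def] by (auto simp: singular_face_simplex_map simplex_map_def singular_face_def fun_eq_iff)
 thus ?thesis using assms singular_simplex_simplex_map[of 2 X \<sigma> Y f] by (simp add: triangle_def)
qed

lemma cocycle_pullback:
 assumes "cocycle Y H \<phi>" "continuous_map X Y f"
 shows "cocycle X H (%\<tau>. \<phi> (simplex_map 1 f \<tau>))"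
 using assms triangle_simplex_map[OF _ assms(2)] singular_simplex_simplex_map[OF _ assms(2), of 1] unfolding cocycle_def by blast

lemma cocycle_const:
 assumes "cocycle X H \<phi>" "a : topspace X"
 shows "\<phi> (const_simplex 1 a) = 0"
proof -
 have "triangle X (restrict (%_. a) (standard_simplex 2)) (const_simplex 1 a) (const_simplex 1 a) (const_simplex 1 a)"
  using assms(2) by (intro triangleI) (auto simp: const_simplex_def)
 hence "\<phi> (const_simplex 1 a) = \<phi> (const_simplex 1 a) + \<phi> (const_simplex 1 a)" using assms(1) unfolding cocycle_def by blast
 hence "- \<phi> (const_simplex 1 a) + \<phi> (const_simplex 1 a)
   = - \<phi> (const_simplex 1 a) + (\<phi> (const_simplex 1 a) + \<phi> (const_simplex 1 a))" by (rule arg_cong)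
 thus ?thesis unfolding left_minus minus_add_cancel by (rule sym)
qed

section \<open>Gluing cocycles\<close>

definition subgroup_set :: "'g::group_add set => bool" where
 "subgroup_set H \<longleftrightarrow> 0 : H & (\<forall>x\<in>H. \<forall>y\<in>H. x + y : H) & (\<forall>x\<in>H. - x : H)"

lemma cocycle_segment:
 assumes "cocycle X H \<phi>" "continuous_map (top_of_set K) X f" "convex K" "a : K" "b : K" "c : K"
 shows "\<phi> (seg f a c) = \<phi> (seg f a b) + \<phi> (seg f b c)"
 using triangle_triangle_simplex[OF assms(2-6)] assms(1) unfolding cocycle_def by blast

lemma seg_refl: "seg f a a = const_simplex 1 (f a)"
 by (auto simp: seg_def const_simplex_def standard_simplex_1' fun_eq_iff simp flip: scaleR_add_left)

lemma cocycle_segment_refl: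
 assumes "cocycle X H \<phi>" "f a : topspace X"
 shows "\<phi> (seg f a a) = 0" unfolding seg_refl by (rule cocycle_const[OF assms])

definition edge_pt :: "real => nat => real" where
 "edge_pt t = (%i. if i = 0 then 1 - t else if i = 1 then t else 0)"

lemma edge_pt_in: "t : {0..1} ==> edge_pt t : standard_simplex 1" by (auto simp: edge_pt_def standard_simplex_1')

lemma edge_pt_coord: "x : standard_simplex 1 ==> edge_pt (x 1) = x"
 by (auto simp: edge_pt_def standard_simplex_1' fun_eq_iff not_less le_Suc_eq)

lemma continuous_on_edge_pt: "continuous_on A edge_pt"
proof (rule continuous_on_coordinatewise_then_product)
 show "continuous_on A (%t. edge_pt t i)" for i by (cases "i = 0"; cases "i = 1") (auto simp: edge_pt_def intro!: continuous_intros)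
qed

lemma continuous_map_edge_pt:
 "continuous_map (top_of_set {0..1}) (top_of_set (standard_simplex 1)) edge_pt" using edge_pt_in continuous_on_edge_pt by auto

lemma seg_edge_pt:
 assumes "singular_simplex 1 X \<tau>"
 shows "seg (\<tau> o edge_pt) 0 1 = \<tau>"
proof
 fix x
 show "seg (\<tau> o edge_pt) 0 1 x = \<tau> x" using assms edge_pt_coord[of x]
  by (cases "x : standard_simplex 1") (auto simp: seg_def singular_simplex_iff extensional_def)
qed

text \<open>In the square that sends (t, u) to h (t, \<tau> u) the side t = 1 is constant, so the
  value on the side t = 0 is the difference of the values on the two remaining sides. The primitive
  \<open>b\<close> is the value along the track of a point under the homotopy.\<close>

lemma cocycle_coboundary:
 assumes \<phi>: "cocycle X H \<phi>" and h: "continuous_map (prod_topology (top_of_set {0..1}) Y) X h"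
  and a: "!!y. y : topspace Y ==> h (1 :: real, y) = a"
 shows "\<exists>b. (\<forall>y\<in>topspace Y. b y : H) &
  (\<forall>\<tau>. singular_simplex 1 Y \<tau> -->
   \<phi> (simplex_map 1 (%y. h (0, y)) \<tau>) = b (\<tau> (edge_pt 0)) - b (\<tau> (edge_pt 1)))"
proof (intro exI conjI ballI allI impI)
 define b where "b y = \<phi> (seg (%t. h (t, y)) 0 1)" for y
 have path: "continuous_map (top_of_set {0..1}) X (%t. h (t, y))" if "y : topspace Y" for y
  using continuous_map_compose[OF _ h, of "top_of_set {0..1}" "%t. (t, y)"] that by (auto simp: comp_def continuous_map_pairwise)
 show "b y : H" if "y : topspace Y" for y using singular_simplex_segment[OF path[OF that], of 0 1] \<phi> by (auto simp: b_def cocycle_def)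
 fix \<tau> assume \<tau>: "singular_simplex 1 Y \<tau>"
 let ?K = "{0..1} \<times> {0..1} :: (real \<times> real) set"
 define F where "F = (%p. h (fst p, \<tau> (edge_pt (snd p))))"
 have K: "convex ?K" by (intro convex_Times) auto
 have ts: "continuous_map (top_of_set {0..1}) Y (\<tau> o edge_pt)"
  using \<tau> by (intro continuous_map_compose[OF continuous_map_edge_pt]) (auto simp: singular_simplex_iff)
 have fs: "continuous_map (top_of_set ?K) (top_of_set {0..1}) fst" "continuous_map (top_of_set ?K) (top_of_set {0..1}) snd"
  by (auto intro!: continuous_intros)
 from continuous_map_compose[OF fs(2) ts]
 have "continuous_map (top_of_set ?K) Y ((\<tau> o edge_pt) o snd)" .
 with fs(1) have "continuous_map (top_of_set ?K) (prod_topology (top_of_set {0..1}) Y) (%p. (fst p, \<tau> (edge_pt (snd p))))"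
  unfolding continuous_map_pairwise by (simp only: comp_def fst_conv snd_conv)
 from continuous_map_compose[OF this h] have F: "continuous_map (top_of_set ?K) X F" unfolding F_def comp_def .
 have Y: "\<tau> (edge_pt t) : topspace Y" if "t : {0..1}" for t
  using \<tau> edge_pt_in[OF that] by (auto simp: singular_simplex_iff continuous_map_def)
 have seg: "seg F (0, 0) (1, 0) = seg (%t. h (t, \<tau> (edge_pt 0))) 0 1"
  "seg F (0, 1) (1, 1) = seg (%t. h (t, \<tau> (edge_pt 1))) 0 1" by (auto simp: seg_def F_def standard_simplex_1' fun_eq_iff)
 have top: "seg F (1, 0) (1, 1) = const_simplex 1 a"
  using a Y by (auto simp: seg_def F_def standard_simplex_1' fun_eq_iff const_simplex_def)
 have bot: "seg F (0, 0) (0, 1) = simplex_map 1 (%y. h (0, y)) \<tau>"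
 proof
  fix x show "seg F (0, 0) (0, 1) x = simplex_map 1 (%y. h (0, y)) \<tau> x" using edge_pt_coord[of x]
   by (cases "x : standard_simplex 1") (auto simp: seg_def F_def simplex_map_def)
 qed
 have "a : topspace X"
 proof -
  have "h (1, \<tau> (edge_pt 0)) : topspace X" using path[OF Y[of 0]] by (auto simp: continuous_map_def)
  thus ?thesis using a Y[of 0] by simp
 qed
 hence "\<phi> (seg F (1, 0) (1, 1)) = 0" using cocycle_const[OF \<phi>] top by simp
 moreover have "\<phi> (seg F (0, 0) (1, 1)) = \<phi> (seg F (0, 0) (1, 0)) + \<phi> (seg F (1, 0) (1, 1))"
  "\<phi> (seg F (0, 0) (1, 1)) = \<phi> (seg F (0, 0) (0, 1)) + \<phi> (seg F (0, 1) (1, 1))"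
  by (rule cocycle_segment[OF \<phi> F K]; simp)+
 ultimately have "b (\<tau> (edge_pt 0)) = \<phi> (simplex_map 1 (%y. h (0, y)) \<tau>) + b (\<tau> (edge_pt 1))"
  by (simp add: seg bot b_def)
 thus "\<phi> (simplex_map 1 (%y. h (0, y)) \<tau>) = b (\<tau> (edge_pt 0)) - b (\<tau> (edge_pt 1))" by simp
qed

text \<open>Lifts of a map \<open>f\<close> along local cocycles, in the manner of a covering space: \<open>g\<close> is determined
  near every point up to translation by one of the local cocycles.\<close>

definition local_lift ::
 "('i => 'x set) => ('i => ((nat => real) => 'x) => 'g::group_add) => 'v::real_normed_vector set =>
  ('v => 'x) => ('v => 'g) => bool" where
 "local_lift N \<phi> D f g \<longleftrightarrow> (\<forall>x\<in>D. \<exists>e>0. \<exists>i. f ` (D Int ball x e) <= N i &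
   (\<forall>y\<in>D \<inter> ball x e. \<forall>z\<in>D \<inter> ball x e. g z = g y + \<phi> i (seg f y z)))"

lemma local_liftE:
 assumes "local_lift N \<phi> D f g" "x : D"
 obtains e i where "e > 0" "f ` (D Int ball x e) <= N i"
  "!!y z. y : D Int ball x e ==> z : D Int ball x e ==> g z = g y + \<phi> i (seg f y z)"
proof -
 from assms obtain e i where "e > 0 & f ` (D Int ball x e) <= N i &
   (\<forall>y\<in>D \<inter> ball x e. \<forall>z\<in>D \<inter> ball x e. g z = g y + \<phi> i (seg f y z))"
  unfolding local_lift_def by meson
 thus thesis by (elim conjE) (rule that[of e i], assumption, assumption, blast)
qed

lemma local_liftI:
 assumes "!!x. x : D ==> \<exists>e i. e > 0 & f ` (D Int ball x e) <= N i &
   (\<forall>y z. y : D Int ball x e --> z : D Int ball x e --> g z = g y + \<phi> i (seg f y z))"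
 shows "local_lift N \<phi> D f g" unfolding local_lift_def
proof
 fix x assume "x : D"
 from assms[OF this] obtain e i where "e > 0" "f ` (D Int ball x e) <= N i"
   "\<forall>y z. y : D Int ball x e --> z : D Int ball x e --> g z = g y + \<phi> i (seg f y z)" by (elim exE conjE)
 thus "\<exists>e>0. \<exists>i. f ` (D Int ball x e) <= N i &
   (\<forall>y\<in>D \<inter> ball x e. \<forall>z\<in>D \<inter> ball x e. g z = g y + \<phi> i (seg f y z))"
  by (intro exI[of _ e] exI[of _ i] conjI ballI) blast+
qed

lemma local_lift_subset:
 assumes "local_lift N \<phi> D f g" "D' <= D"
 shows "local_lift N \<phi> D' f g"
proof (rule local_liftI)
 fix x assume "x : D'"
 hence "x : D" using assms(2) by blast
 from local_liftE[OF assms(1) this] obtain e i where e: "e > 0" "f ` (D Int ball x e) <= N i"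
  "!!y z. y : D Int ball x e ==> z : D Int ball x e ==> g z = g y + \<phi> i (seg f y z)" by blast
 have "D' Int ball x e <= D Int ball x e" using assms(2) by blast
 thus "\<exists>e i. e > 0 & f ` (D' Int ball x e) <= N i &
   (\<forall>y z. y : D' Int ball x e --> z : D' Int ball x e --> g z = g y + \<phi> i (seg f y z))"
  using e by (intro exI[of _ e] exI[of _ i] conjI allI impI) blast+
qed

lemma local_lift_translate:
 assumes "local_lift N \<phi> D f g"
 shows "local_lift N \<phi> D f (%x. c + g x)"
proof (rule local_liftI)
 fix x assume "x : D"
 from local_liftE[OF assms this] obtain e i where e: "e > 0" "f ` (D Int ball x e) <= N i"
  "!!y z. y : D Int ball x e ==> z : D Int ball x e ==> g z = g y + \<phi> i (seg f y z)" by blast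
 have "c + g z = c + g y + \<phi> i (seg f y z)" if "y : D Int ball x e" "z : D Int ball x e" for y z
  using e(3)[OF that] by (simp only: add.assoc)
 thus "\<exists>e i. e > 0 & f ` (D Int ball x e) <= N i &
   (\<forall>y z. y : D Int ball x e --> z : D Int ball x e --> c + g z = c + g y + \<phi> i (seg f y z))"
  using e by (intro exI[of _ e] exI[of _ i] conjI allI impI) blast+
qed

text \<open>Cocycles on the members of an open cover that agree on overlaps are glued to one on the
  whole space. This is the theorem of van Kampen for groupoids, so disconnected overlaps are
  included.\<close>

locale cocycle_cover =
 fixes Y :: "'x topology" and H :: "'g::group_add set" and N :: "'i => 'x set"
  and \<phi> :: "'i => ((nat => real) => 'x) => 'g"
 assumes H: "subgroup_set H"
  and opn: "openin Y (N i)" and cover: "topspace Y <= (\<Union>i. N i)"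
  and coc: "cocycle (subtopology Y (N i)) H (\<phi> i)"
  and agree: "singular_simplex 1 (subtopology Y (N i Int N j)) \<tau> ==> \<phi> i \<tau> = \<phi> j \<tau>"
begin

lemma continuous_map_restrict:
 assumes "continuous_map (top_of_set K) Y f" "D <= K" "f ` D <= N'"
 shows "continuous_map (top_of_set D) (subtopology Y N') f" using continuous_map_from_subtopology_mono[OF assms(1,2)] assms(3)
 by (auto simp: continuous_map_in_subtopology)

lemma local_nbhd:
 assumes "continuous_map (top_of_set K) Y f" "x : K" "f x : N i"
 obtains e where "e > 0" "f ` (K Int ball x e) <= N i"
proof -
 have "openin (top_of_set K) {y : K. f y : N i}" using openin_continuous_map_preimage[OF assms(1) opn] by simp
 then obtain e where "e > 0" "ball x e Int K <= {y : K. f y : N i}" using assms(2,3) unfolding openin_contains_ball by blast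
 thus thesis using that[of e] by blast
qed

lemma segment_add:
 assumes "continuous_map (top_of_set K) Y f" "D <= K" "convex D" "f ` D <= N i" "x : D" "y : D" "z : D"
 shows "\<phi> i (seg f x z) = \<phi> i (seg f x y) + \<phi> i (seg f y z)"
 by (rule cocycle_segment[OF coc continuous_map_restrict[OF assms(1,2,4)] assms(3,5-7)])

lemma segment_agree:
 assumes "continuous_map (top_of_set K) Y f" "D <= K" "convex D" "f ` D <= N i" "f ` D <= N j" "x : D" "y : D"
 shows "\<phi> i (seg f x y) = \<phi> j (seg f x y)"
proof -
 have "f ` D <= N i Int N j" using assms by blast
 thus ?thesis using singular_simplex_segment[OF continuous_map_restrict[OF assms(1,2)] assms(3,6,7)] agree by blast
qed

lemma local_lift_small:
 assumes f: "continuous_map (top_of_set K) Y f" and D: "D <= K" "convex D" "f ` D <= N i" and x: "x : D"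
 shows "local_lift N \<phi> D f (%y. \<phi> i (seg f x y))"
proof (rule local_liftI)
 fix y assume "y : D"
 show "\<exists>e j. e > 0 & f ` (D Int ball y e) <= N j & (\<forall>u z. u : D Int ball y e --> z : D Int ball y e -->
   \<phi> i (seg f x z) = \<phi> i (seg f x u) + \<phi> j (seg f u z))"
  using D(3) segment_add[OF f D x] by (intro exI[of _ 1] exI[of _ i] conjI allI impI) auto
qed

text \<open>The difference of two lifts is locally constant, since the increments of both are values
  of local cocycles that agree on overlaps.\<close>

lemma local_lift_unique:
 assumes f: "continuous_map (top_of_set K) Y f" and D: "D <= K" "convex D"
  and g: "local_lift N \<phi> D f g" and g': "local_lift N \<phi> D f g'" and x: "x : D" "y : D"
 shows "g' x - g x = g' y - g y"
proof (rule connected_local_const[OF convex_connected[OF D(2)] x], intro ballI)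
 fix u assume u: "u : D"
 obtain e i where e: "e > 0" "f ` (D Int ball u e) <= N i"
  "!!y z. y : D Int ball u e ==> z : D Int ball u e ==> g z = g y + \<phi> i (seg f y z)" by (rule local_liftE[OF g u]) (rule that)
 obtain e' j where e': "e' > 0" "f ` (D Int ball u e') <= N j"
  "!!y z. y : D Int ball u e' ==> z : D Int ball u e' ==> g' z = g' y + \<phi> j (seg f y z)" by (rule local_liftE[OF g' u]) (rule that)
 let ?B = "D Int ball u (min e e')"
 have B: "?B <= K" "convex ?B" "f ` ?B <= N i" "f ` ?B <= N j" "u : ?B" using D u e(1,2) e'(1,2) by (auto intro: convex_Int)
 have "g' u - g u = g' z - g z" if "z : ?B" for z
 proof -
  have "g z = g u + \<phi> i (seg f u z)" "g' z = g' u + \<phi> j (seg f u z)" using that u e(1) e'(1) e(3)[of u z] e'(3)[of u z] by auto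
  moreover have "\<phi> i (seg f u z) = \<phi> j (seg f u z)" by (rule segment_agree[OF f B that])
  ultimately show ?thesis by (simp add: diff_conv_add_uminus minus_add add.assoc del: add_uminus_conv_diff)
 qed
 thus "\<forall>\<^sub>F z in at u within D. g' u - g u = g' z - g z"
  unfolding eventually_at using e(1) e'(1) by (intro exI[of _ "min e e'"]) (auto simp: dist_commute)
qed

text \<open>The two lifts differ by a constant on the intersection, which is convex, and translating
  one of them makes them agree there.\<close>

lemma local_lift_glue:
 assumes f: "continuous_map (top_of_set K) Y f" and K: "D1 Un D2 <= K" and D: "convex D1" "convex D2" "convex (D1 Un D2)"
  "closed D1" "closed D2"
  and g1: "local_lift N \<phi> D1 f g1" and g2: "local_lift N \<phi> D2 f g2"
 shows "\<exists>g. local_lift N \<phi> (D1 Un D2) f g"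
proof -
 \<comment> \<open>Two nonempty closed pieces of a connected union meet.\<close>
 consider "D1 = {}" | "D2 = {}" | "D1 Int D2 ~= {}" using convex_connected[OF D(3)] D(4,5) unfolding connected_closed by blast
 thus ?thesis
 proof cases
  case 3
  then obtain p where p: "p : D1" "p : D2" by blast
  define c where "c = g1 p - g2 p"
  define h2 where "h2 = (%x. c + g2 x)"
  have h2: "local_lift N \<phi> D2 f h2" unfolding h2_def by (rule local_lift_translate[OF g2])
  have eq: "g1 x = h2 x" if "x : D1 Int D2" for x
  proof -
   have "g1 x - h2 x = g1 p - h2 p" using that p K D
    by (intro local_lift_unique[OF f, of "D1 Int D2"] local_lift_subset[OF g1] local_lift_subset[OF h2]) (auto intro: convex_Int)
   thus ?thesis by (simp add: h2_def c_def)
  qed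
  define g where "g = (%x. if x : D1 then g1 x else h2 x)"
  have gD: "!!x. x : D1 ==> g x = g1 x" "!!x. x : D2 ==> g x = h2 x" using eq by (auto simp: g_def)
  let ?near = "%x. \<exists>e i. e > 0 & f ` ((D1 Un D2) Int ball x e) <= N i &
   (\<forall>y z. y : (D1 Un D2) Int ball x e --> z : (D1 Un D2) Int ball x e --> g z = g y + \<phi> i (seg f y z))"
  have one: "?near x"
   if A: "A Un B = D1 Un D2" "x : A" "x ~: B" "closed B" and l: "local_lift N \<phi> A f k" and gk: "!!x. x : A ==> g x = k x" for A B k x
  proof -
   obtain e i where e: "e > 0" "f ` (A Int ball x e) <= N i"
    "!!y z. y : A Int ball x e ==> z : A Int ball x e ==> k z = k y + \<phi> i (seg f y z)" by (rule local_liftE[OF l A(2)]) (rule that)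
   obtain d where d: "d > 0" "ball x d <= - B" using A(3,4) by (metis ComplI open_Compl open_contains_ball)
   have sub: "(D1 Un D2) Int ball x (min e d) <= A Int ball x e" using d A(1) by auto
   have "g z = g y + \<phi> i (seg f y z)"
    if "y : (D1 Un D2) Int ball x (min e d)" "z : (D1 Un D2) Int ball x (min e d)" for y z
   proof -
    have "y : A Int ball x e" "z : A Int ball x e" using that sub by blast+
    thus ?thesis using e(3)[of y z] gk by simp
   qed
   thus ?thesis using e(1,2) d(1) sub by (intro exI[of _ "min e d"] exI[of _ i] conjI) (simp, blast+)
  qed
  have "local_lift N \<phi> (D1 Un D2) f g"
  proof (rule local_liftI)
   fix x assume x: "x : D1 Un D2"
   consider "x : D1" "x ~: D2" | "x : D2" "x ~: D1" | "x : D1" "x : D2" using x by blast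
   thus "?near x"
   proof cases
    case 1
    thus ?thesis by (intro one[OF _ 1 D(5) g1 gD(1)]) auto
   next
    case 2
    thus ?thesis by (intro one[OF _ 2 D(4) h2 gD(2)]) auto
   next
    case 3
    obtain e1 i where e1: "e1 > 0" "f ` (D1 Int ball x e1) <= N i"
     "!!y z. y : D1 Int ball x e1 ==> z : D1 Int ball x e1 ==> g1 z = g1 y + \<phi> i (seg f y z)"
     by (rule local_liftE[OF g1 3(1)]) (rule that)
    obtain e2 j where e2: "e2 > 0" "f ` (D2 Int ball x e2) <= N j"
     "!!y z. y : D2 Int ball x e2 ==> z : D2 Int ball x e2 ==> h2 z = h2 y + \<phi> j (seg f y z)"
     by (rule local_liftE[OF h2 3(2)]) (rule that)
    have fx: "f x : N i" using e1(1,2) 3(1) by auto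
    have xK: "x : K" using x K by blast
    obtain d where d: "d > 0" "f ` (K Int ball x d) <= N i" using local_nbhd[OF f xK fx] by blast
    define e where "e = Min {d, e1, e2}"
    have e: "e > 0" "e <= d" "e <= e1" "e <= e2" using d(1) e1(1) e2(1) by (auto simp: e_def)
    let ?B = "(D1 Un D2) Int ball x e"
    have B: "?B <= K" "convex ?B" "f ` ?B <= N i" "x : ?B"
    proof -
     have sub: "?B <= K Int ball x d" using K e(2) by auto
     thus "?B <= K" by blast
     show "convex ?B" using D(3) by (intro convex_Int) auto
     show "f ` ?B <= N i" using image_mono[OF sub] d(2) by (rule order.trans)
     show "x : ?B" using x e(1) by auto
    qed
    \<comment> \<open>The chart \<open>i\<close> serves for both pieces: the segment from
      \<open>x\<close> to a point of \<open>D2\<close> stays in \<open>D2\<close>, where the charts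
      \<open>i\<close> and \<open>j\<close> agree on it.\<close>
    have gx: "g z = g x + \<phi> i (seg f x z)" if z: "z : ?B" for z
    proof (cases "z : D1")
     case True
     thus ?thesis using z e 3(1) e1(1) e1(3)[of x z] gD(1) by auto
    next
     case False
     hence z2: "z : D2 Int ball x e" using z by blast
     have B2: "D2 Int ball x e <= K" "convex (D2 Int ball x e)" "f ` (D2 Int ball x e) <= N j"
      "f ` (D2 Int ball x e) <= N i" "x : D2 Int ball x e"
     proof -
      show "D2 Int ball x e <= K" using K by blast
      show "convex (D2 Int ball x e)" using D(2) by (intro convex_Int) auto
      have "D2 Int ball x e <= D2 Int ball x e2" using e(4) by auto
      thus "f ` (D2 Int ball x e) <= N j" using e2(2) by (meson image_mono order.trans)
      show "f ` (D2 Int ball x e) <= N i" using B(3) by blast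
      show "x : D2 Int ball x e" using 3(2) e(1) by auto
     qed
     have "g z = g x + \<phi> j (seg f x z)" using z2 e 3(2) e2(1) e2(3)[of x z] gD(2) by auto
     also have "\<phi> j (seg f x z) = \<phi> i (seg f x z)" by (rule segment_agree[OF f B2 z2])
     finally show ?thesis .
    qed
    have gyz: "g z = g y + \<phi> i (seg f y z)" if "y : ?B" "z : ?B" for y z
     using segment_add[OF f B(1-4) that] gx[OF that(1)] gx[OF that(2)] by (simp add: add.assoc)
    show ?thesis by (rule exI[of _ e], rule exI[of _ i], intro conjI allI impI, rule e(1), rule B(3), rule gyz)
   qed
  qed
  thus ?thesis by blast
 qed (use g1 g2 in auto)
qed

text \<open>Small rectangles lift by a single local cocycle, and rectangles with a common side are
  glued. Bisection in the second coordinate, near a fixed first one, yields a strip; bisection in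
  the first coordinate then yields the square.\<close>

lemma local_lift_exists_square:
 fixes f :: "real \<times> real => 'x"
 assumes f: "continuous_map (top_of_set ({0..1} \<times> {0..1})) Y f"
 shows "\<exists>g. local_lift N \<phi> ({0..1} \<times> {0..1}) f g"
proof -
 let ?K = "{0..1} \<times> {0..1} :: (real \<times> real) set"
 define R where "R a b c d = ?K Int ({a..b} \<times> {c..d})" for a b c d :: real
 define P where "P a b c d \<longleftrightarrow> (\<exists>g. local_lift N \<phi> (R a b c d) f g)" for a b c d
 have R: "convex (R a b c d)" "closed (R a b c d)" "R a b c d <= ?K" for a b c d
  by (auto simp: R_def intro!: convex_Int convex_Times closed_Int closed_Times)
 have Rv: "R a b c d Un R a b d e = R a b c e" if "c <= d" "d <= e" for a b c d e using that by (auto simp: R_def)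
 have Rh: "R a b c d Un R b b' c d = R a b' c d" if "a <= b" "b <= b'" for a b b' c d using that by (auto simp: R_def)
 have mono: "P a b c d" if "P a' b' c d" "a' <= a" "b <= b'" for a b a' b' c d
  using that local_lift_subset unfolding P_def R_def by (metis (no_types, lifting) Int_mono Sigma_mono atLeastatMost_subset_iff order_refl)
 have vert: "P a b c e" if "P a b c d" "P a b d e" "c <= d" "d <= e" for a b c d e
  using that local_lift_glue[OF f, of "R a b c d" "R a b d e"] R Rv[OF that(3,4)] unfolding P_def by force
 have horiz: "P a b' c d" if "P a b c d" "P b b' c d" "a <= b" "b <= b'" for a b b' c d
  using that local_lift_glue[OF f, of "R a b c d" "R b b' c d"] R Rh[OF that(3,4)] unfolding P_def by force
 have near: "\<exists>e>0. \<forall>a b c d. a <= s & s <= b & b - a < e & c <= t & t <= d & d - c < e --> P a b c d"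
  if st: "s : {0..1}" "t : {0..1}" for s t
 proof -
  have fst: "f (s, t) : topspace Y" using f st by (auto simp: continuous_map_def)
  then obtain i where i: "f (s, t) : N i" using cover by blast
  obtain e where e: "e > 0" "f ` (?K Int ball (s, t) e) <= N i" using local_nbhd[OF f _ i] st by auto
  have "P a b c d" if abcd: "a <= s" "s <= b" "b - a < e / 2" "c <= t" "t <= d" "d - c < e / 2" for a b c d
  proof -
   have "R a b c d <= ?K Int ball (s, t) e"
   proof
    fix q assume q: "q : R a b c d"
    hence "a <= fst q" "fst q <= b" "c <= snd q" "snd q <= d" by (auto simp: R_def)
    hence "\<bar>s - fst q\<bar> < e / 2" "\<bar>t - snd q\<bar> < e / 2" using abcd by linarith+
    hence "dist (s, t) q < e" using norm_Pair_le[of "s - fst q" "t - snd q"] by (cases q) (simp add: dist_norm)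
    thus "q : ?K Int ball (s, t) e" using q by (auto simp: R_def)
   qed
   moreover have "(s, t) : R a b c d" using st abcd by (auto simp: R_def)
   ultimately have "local_lift N \<phi> (R a b c d) f (%y. \<phi> i (seg f (s, t) y))" using R e(2) by (intro local_lift_small[OF f]) blast+
   thus ?thesis unfolding P_def by blast
  qed
  thus ?thesis using e(1) by (intro exI[of _ "e / 2"]) auto
 qed
 have "P 0 1 0 1"
 proof (rule Bolzano[of 0 1 "%a b. P a b 0 1"])
  fix s :: real assume s: "0 <= s" "s <= 1"
  have "\<exists>e>0. \<forall>a b. a <= s & s <= b & b - a < e --> P a b 0 1"
  proof (rule Bolzano[of 0 1 "%c d. \<exists>e>0. \<forall>a b. a <= s & s <= b & b - a < e --> P a b c d"])
   fix c d e' :: real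
   assume "\<exists>e>0. \<forall>a b. a <= s & s <= b & b - a < e --> P a b c d"
    "\<exists>e>0. \<forall>a b. a <= s & s <= b & b - a < e --> P a b d e'" and cd: "c <= d" "d <= e'"
   then obtain e1 e2 where "e1 > 0" "e2 > 0" "\<forall>a b. a <= s & s <= b & b - a < e1 --> P a b c d"
    "\<forall>a b. a <= s & s <= b & b - a < e2 --> P a b d e'" by blast
   thus "\<exists>e>0. \<forall>a b. a <= s & s <= b & b - a < e --> P a b c e'"
    using vert[of _ _ c d e'] cd by (intro exI[of _ "min e1 e2"]) auto
  next
   fix t :: real assume t: "0 <= t" "t <= 1"
   then obtain e where "e > 0" "\<forall>a b c d. a <= s & s <= b & b - a < e & c <= t & t <= d & d - c < e --> P a b c d"
    using near[of s t] s by auto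
   thus "\<exists>\<delta>>0. \<forall>c d. c <= t & t <= d & d - c < \<delta> -->
     (\<exists>e>0. \<forall>a b. a <= s & s <= b & b - a < e --> P a b c d)" by blast
  qed simp
  thus "\<exists>\<delta>>0. \<forall>a b. a <= s & s <= b & b - a < \<delta> --> P a b 0 1" by blast
 qed (use horiz in auto)
 moreover have "R 0 1 0 1 = ?K" by (auto simp: R_def)
 ultimately show ?thesis by (simp add: P_def)
qed

lemma local_lift_line:
 fixes f :: "'v::real_normed_vector => 'x"
 assumes g: "local_lift N \<phi> D f g" and ab: "!!t. t : {0..1} ==> a + t *\<^sub>R b : D"
 shows "local_lift N \<phi> {0..1} (%t. f (a + t *\<^sub>R b)) (%t. g (a + t *\<^sub>R b))"
proof (rule local_liftI)
 fix t :: real assume t: "t : {0..1}"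
 obtain e i where e: "e > 0" "f ` (D Int ball (a + t *\<^sub>R b) e) <= N i"
  "!!y z. y : D Int ball (a + t *\<^sub>R b) e ==> z : D Int ball (a + t *\<^sub>R b) e ==> g z = g y + \<phi> i (seg f y z)"
  by (rule local_liftE[OF g ab[OF t]]) (rule that)
 \<comment> \<open>The added 1 covers the case of a constant line, \<open>b = 0\<close>.\<close>
 define d where "d = e / (norm b + 1)"
 have d: "d > 0" using e(1) by (simp add: d_def add_nonneg_pos)
 have sub: "a + u *\<^sub>R b : D Int ball (a + t *\<^sub>R b) e" if u: "u : {0..1} Int ball t d" for u
 proof -
  have "dist (a + t *\<^sub>R b) (a + u *\<^sub>R b) = \<bar>t - u\<bar> * norm b" by (simp add: dist_norm flip: scaleR_diff_left)
  also have "\<dots> <= \<bar>t - u\<bar> * (norm b + 1)" by (intro mult_left_mono) auto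
  also have "\<dots> < e" using u by (simp add: dist_real_def d_def pos_less_divide_eq add_nonneg_pos)
  finally show ?thesis using ab u by simp
 qed
 have seg: "seg (%t. f (a + t *\<^sub>R b)) u w = seg f (a + u *\<^sub>R b) (a + w *\<^sub>R b)" for u w unfolding seg_def
 proof (rule restrict_ext)
  fix x assume "x : standard_simplex 1"
  hence "x 0 *\<^sub>R a + x 1 *\<^sub>R a = a" by (simp add: standard_simplex_1' flip: scaleR_add_left)
  hence "x 0 *\<^sub>R (a + u *\<^sub>R b) + x 1 *\<^sub>R (a + w *\<^sub>R b) = a + (x 0 *\<^sub>R u + x 1 *\<^sub>R w) *\<^sub>R b"
   by (simp add: algebra_simps)
  thus "f (a + (x 0 *\<^sub>R u + x 1 *\<^sub>R w) *\<^sub>R b) = f (x 0 *\<^sub>R (a + u *\<^sub>R b) + x 1 *\<^sub>R (a + w *\<^sub>R b))" by simp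
 qed
 show "\<exists>d i. d > 0 & (%t. f (a + t *\<^sub>R b)) ` ({0..1} Int ball t d) <= N i &
   (\<forall>u w. u : {0..1} Int ball t d --> w : {0..1} Int ball t d --> g (a + w *\<^sub>R b) =
    g (a + u *\<^sub>R b) + \<phi> i (seg (%t. f (a + t *\<^sub>R b)) u w))"
  unfolding seg using d sub e(2,3) by (intro exI[of _ d] exI[of _ i] conjI allI impI) blast+
qed

lemma local_lift_cong:
 assumes "local_lift N \<phi> D f g" "convex D" "!!x. x : D ==> f x = f' x"
 shows "local_lift N \<phi> D f' g"
proof -
 have seg: "seg f' y z = seg f y z" if "y : D" "z : D" for y z unfolding seg_def
 proof (rule restrict_ext)
  fix x assume "x : standard_simplex 1"
  hence "x 0 *\<^sub>R y + x 1 *\<^sub>R z : D" using that assms(2) by (simp add: convex_def standard_simplex_1')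
  thus "f' (x 0 *\<^sub>R y + x 1 *\<^sub>R z) = f (x 0 *\<^sub>R y + x 1 *\<^sub>R z)" using assms(3) by simp
 qed
 show ?thesis
 proof (rule local_liftI)
  fix x assume "x : D"
  from local_liftE[OF assms(1) this] obtain e i where e: "e > 0" "f ` (D Int ball x e) <= N i"
   "!!y z. y : D Int ball x e ==> z : D Int ball x e ==> g z = g y + \<phi> i (seg f y z)" by blast
  have "f' ` (D Int ball x e) = f ` (D Int ball x e)" using assms(3) by (intro image_cong) auto
  hence im: "f' ` (D Int ball x e) <= N i" using e(2) by simp
  have gz: "g z = g y + \<phi> i (seg f' y z)" if "y : D Int ball x e" "z : D Int ball x e" for y z
   using e(3)[OF that] seg[of y z] that by simp
  show "\<exists>e i. e > 0 & f' ` (D Int ball x e) <= N i &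
    (\<forall>y z. y : D Int ball x e --> z : D Int ball x e --> g z = g y + \<phi> i (seg f' y z))"
   by (intro exI[of _ e] exI[of _ i] conjI allI impI, rule e(1), rule im, rule gz; assumption)
 qed
qed

lemma local_lift_exists_path:
 fixes f :: "real => 'x"
 assumes f: "continuous_map (top_of_set {0..1}) Y f"
 shows "\<exists>g. local_lift N \<phi> {0..1} f g"
proof -
 have "continuous_map (top_of_set ({0..1} \<times> {0..1})) (top_of_set {0..1}) (fst :: real \<times> real => real)"
  by (auto intro!: continuous_intros)
 hence "continuous_map (top_of_set ({0..1} \<times> {0..1})) Y (f o (fst :: real \<times> real => real))"
  by (rule continuous_map_compose[OF _ f])
 then obtain g where "local_lift N \<phi> ({0..1} \<times> {0..1}) (f o (fst :: real \<times> real => real)) g"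
  using local_lift_exists_square by blast
 from local_lift_line[OF this, of "(0, 0)" "(1, 0)"]
 have "local_lift N \<phi> {0..1} (%t. (f o fst) ((0, 0) + t *\<^sub>R (1, 0))) (%t. g ((0, 0) + t *\<^sub>R (1, 0)))" by auto
 thus ?thesis by (auto simp: comp_def)
qed

text \<open>Lifts are unique up to translation from the left, and this leaves - g 0 + g 1 unchanged;
  so any lift may be chosen.\<close>

definition holonomy :: "((nat => real) => 'x) => 'g" where
 "holonomy \<tau> = (let g = SOME g. local_lift N \<phi> {0..1} (\<tau> o edge_pt) g in - g 0 + g 1)"

lemma continuous_map_simplex_path:
 "singular_simplex 1 X \<tau> ==> continuous_map (top_of_set {0..1}) X (\<tau> o edge_pt)"
 by (rule continuous_map_compose[OF continuous_map_edge_pt]) (simp add: singular_simplex_iff)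

lemma holonomy_eq:
 assumes \<tau>: "singular_simplex 1 Y \<tau>" and g: "local_lift N \<phi> {0..1} (\<tau> o edge_pt) g"
 shows "holonomy \<tau> = - g 0 + g 1"
proof -
 define g' where "g' = (SOME g. local_lift N \<phi> {0..1} (\<tau> o edge_pt) g)"
 have "local_lift N \<phi> {0..1} (\<tau> o edge_pt) g'"
  unfolding g'_def using someI[of "%g. local_lift N \<phi> {0..1} (\<tau> o edge_pt) g" g] g by blast
 hence "g' 0 - g 0 = g' 1 - g 1" by (intro local_lift_unique[OF continuous_map_simplex_path[OF \<tau>] _ _ g]) auto
 hence eq: "g' 1 = (g' 0 - g 0) + g 1" by (simp add: diff_eq_eq)
 have "- g' 0 + g' 1 = - g 0 + g 1" unfolding eq by (simp add: diff_conv_add_uminus add.assoc del: add_uminus_conv_diff)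
 thus ?thesis by (simp add: holonomy_def g'_def)
qed

lemma holonomy_agree:
 assumes "singular_simplex 1 (subtopology Y (N i)) \<tau>"
 shows "holonomy \<tau> = \<phi> i \<tau>"
proof -
 have \<tau>: "singular_simplex 1 Y \<tau>" "\<tau> ` standard_simplex 1 <= N i" using assms by (auto simp: singular_simplex_subtopology)
 have "local_lift N \<phi> {0..1} (\<tau> o edge_pt) (%y. \<phi> i (seg (\<tau> o edge_pt) 0 y))"
  using \<tau>(2) edge_pt_in by (intro local_lift_small[OF continuous_map_simplex_path[OF \<tau>(1)]]) auto
 from holonomy_eq[OF \<tau>(1) this]
 have "holonomy \<tau> = - \<phi> i (seg (\<tau> o edge_pt) 0 0) + \<phi> i \<tau>" by (simp only: seg_edge_pt[OF \<tau>(1)])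
 moreover have "(\<tau> o edge_pt) 0 : topspace (subtopology Y (N i))"
  using assms edge_pt_in[of 0] by (auto simp: singular_simplex_iff continuous_map_def)
 ultimately show ?thesis using cocycle_segment_refl[OF coc] by fastforce
qed

text \<open>Membership of - g 0 + g u in \<open>H\<close> is a locally constant property of u, since
  nearby values differ by an element of \<open>H\<close>.\<close>

lemma holonomy_in:
 assumes \<tau>: "singular_simplex 1 Y \<tau>"
 shows "holonomy \<tau> : H"
proof -
 let ?f = "\<tau> o edge_pt"
 obtain g where g: "local_lift N \<phi> {0..1} ?f g" using local_lift_exists_path[OF continuous_map_simplex_path[OF \<tau>]] by blast
 have "(- g 0 + g 0 : H) = (- g 0 + g 1 : H)"
 proof (rule connected_local_const[of "{0..1}" 0 1], intro connected_Icc, simp, simp, intro ballI)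
  fix u :: real assume u: "u : {0..1}"
  obtain e i where e: "e > 0" "?f ` ({0..1} Int ball u e) <= N i"
   "!!y z. y : {0..1} Int ball u e ==> z : {0..1} Int ball u e ==> g z = g y + \<phi> i (seg ?f y z)"
   by (rule local_liftE[OF g u]) (rule that)
  have "(- g 0 + g u : H) = (- g 0 + g z : H)" if z: "z : {0..1} Int ball u e" for z
  proof -
   let ?B = "{0..1} Int ball u e"
   have "continuous_map (top_of_set ?B) (subtopology Y (N i)) ?f"
    using continuous_map_restrict[OF continuous_map_simplex_path[OF \<tau>] _ e(2)] by simp
   hence "singular_simplex 1 (subtopology Y (N i)) (seg ?f u z)"
    using z u e(1) by (intro singular_simplex_segment[of ?B]) (auto intro: convex_Int)
   hence h: "\<phi> i (seg ?f u z) : H" using coc[of i] by (auto simp: cocycle_def)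
   have gz: "- g 0 + g z = (- g 0 + g u) + \<phi> i (seg ?f u z)" using e(1) e(3)[of u z] u z by (simp add: add.assoc)
   have "- g 0 + g u = (- g 0 + g z) + - \<phi> i (seg ?f u z)" unfolding gz by (simp only: add.assoc right_minus add_0_right)
   thus ?thesis using gz h H unfolding subgroup_set_def by metis
  qed
  thus "\<forall>\<^sub>F z in at u within {0..1}. (- g 0 + g u : H) = (- g 0 + g z : H)"
   unfolding eventually_at using e(1) by (intro exI[of _ e]) (auto simp: dist_commute)
 qed
 thus ?thesis using holonomy_eq[OF \<tau> g] H by (simp add: subgroup_set_def)
qed

lemma holonomy_const:
 assumes "a : topspace Y"
 shows "holonomy (const_simplex 1 a) = 0"
proof -
 obtain i where i: "a : N i" using assms cover by blast
 have "singular_simplex 1 (subtopology Y (N i)) (const_simplex 1 a)" using assms i by (auto simp: singular_simplex_iff const_simplex_def)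
 thus ?thesis using holonomy_agree cocycle_const[OF coc, of a i] assms i by simp
qed

text \<open>The map \<open>c\<close> collapses the side u = 0 of the square to the vertex 0 of the
  simplex. A lift over the square restricts to lifts along all three edges, and it takes the same
  value at both ends of the collapsed side.\<close>

lemma cocycle_holonomy: "cocycle Y H holonomy" unfolding cocycle_def
proof (intro conjI allI impI)
 fix \<sigma> p q s assume t: "triangle Y \<sigma> p q s"
 note edges = triangle_edges[OF t]
 define c :: "real \<times> real => nat => real" where
  "c = (%(u, t) i. if i = 0 then 1 - u else if i = 1 then u * (1 - t) else if i = 2 then u * t else 0)"
 let ?K = "{0..1} \<times> {0..1} :: (real \<times> real) set"
 have "continuous_on ?K c"
 proof (rule continuous_on_coordinatewise_then_product)
  fix i
  have c: "(%x. c x i) = (%x. if i = 0 then 1 - fst x else if i = 1 then fst x * (1 - snd x)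
    else if i = 2 then fst x * snd x else 0)" by (auto simp: c_def)
  show "continuous_on ?K (%x. c x i)" unfolding c by (cases "i = 0"; cases "i = 1"; cases "i = 2") (auto intro!: continuous_intros)
 qed
 moreover have "c x : standard_simplex 2" if "x : ?K" for x using that by (auto simp: c_def standard_simplex_2 algebra_simps mult_left_le)
 ultimately have "continuous_map (top_of_set ?K) (top_of_set (standard_simplex 2)) c" by auto
 moreover have \<sigma>: "continuous_map (top_of_set (standard_simplex 2)) Y \<sigma>"
  using t by (simp add: triangle_def singular_simplex_iff)
 ultimately have f: "continuous_map (top_of_set ?K) Y (\<sigma> o c)" by (rule continuous_map_compose)
 obtain g where g: "local_lift N \<phi> ?K (\<sigma> o c) g" using local_lift_exists_square[OF f] by blast
 have edge: "holonomy \<tau> = - g a + g (a + b)"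
  if "singular_simplex 1 Y \<tau>" "!!t. t : {0..1} ==> a + t *\<^sub>R b : ?K"
   "!!t. t : {0..1} ==> \<sigma> (c (a + t *\<^sub>R b)) = \<tau> (edge_pt t)" for \<tau> a b
 proof -
  have "local_lift N \<phi> {0..1} (%t. (\<sigma> o c) (a + t *\<^sub>R b)) (%t. g (a + t *\<^sub>R b))"
   by (rule local_lift_line[OF g that(2)])
  hence "local_lift N \<phi> {0..1} (\<tau> o edge_pt) (%t. g (a + t *\<^sub>R b))" by (rule local_lift_cong) (use that(3) in auto)
  from holonomy_eq[OF that(1) this] show ?thesis by simp
 qed
 have face: "\<sigma> (simplical_face k (edge_pt t)) = singular_face 2 k \<sigma> (edge_pt t)"
  if "t : {0..1}" for k t using edge_pt_in[OF that] by (simp add: singular_face_def)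
 have c: "c (t, 0) = simplical_face 2 (edge_pt t)" "c (1, t) = simplical_face 0 (edge_pt t)"
  "c (t, 1) = simplical_face 1 (edge_pt t)" "c (0, t) = (%i. if i = 0 then 1 else 0)" for t
  by (auto simp: c_def simplical_face_def edge_pt_def fun_eq_iff)
 have "holonomy p = - g (0, 0) + g ((0, 0) + (1, 0))" using t c(1) face[of _ 2] by (intro edge edges(1)) (auto simp: triangle_def)
 moreover have "holonomy q = - g (1, 0) + g ((1, 0) + (0, 1))" using t c(2) face[of _ 0] by (intro edge edges(2)) (auto simp: triangle_def)
 moreover have "holonomy s = - g (0, 1) + g ((0, 1) + (1, 0))" using t c(3) face[of _ 1] by (intro edge edges(3)) (auto simp: triangle_def)
 moreover have "- g (0, 0) + g ((0, 0) + (0, 1)) = 0"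
 proof -
  let ?v = "\<sigma> (%i. if i = 0 then 1 else 0)"
  have v: "?v : topspace Y" using \<sigma> by (auto simp: continuous_map_def)
  have "holonomy (const_simplex 1 ?v) = - g (0, 0) + g ((0, 0) + (0, 1))"
  proof (rule edge)
   show "singular_simplex 1 Y (const_simplex 1 ?v)" using v by (auto simp: singular_simplex_iff const_simplex_def)
  qed (use c(4) edge_pt_in in \<open>auto simp: const_simplex_def\<close>)
  thus ?thesis using holonomy_const[OF v] by simp
 qed
 hence "g (0, 1) = g (0, 0)" by (simp add: add_eq_0_iff)
 ultimately show "holonomy s = holonomy p + holonomy q" by (simp add: add.assoc)
qed (rule holonomy_in)

end

text \<open>Integrating \<psi> along the path from its start is itself a local lift.\<close>

lemma (in cocycle_cover) holonomy_unique:
 assumes \<psi>: "cocycle Y H' \<psi>"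
  and eq: "!!i \<tau>. singular_simplex 1 (subtopology Y (N i)) \<tau> ==> \<psi> \<tau> = \<phi> i \<tau>"
  and \<tau>: "singular_simplex 1 Y \<tau>"
 shows "\<psi> \<tau> = holonomy \<tau>"
proof -
 let ?f = "\<tau> o edge_pt"
 have f: "continuous_map (top_of_set {0..1}) Y ?f" by (rule continuous_map_simplex_path[OF \<tau>])
 have "local_lift N \<phi> {0..1} ?f (%y. \<psi> (seg ?f 0 y))"
 proof (rule local_liftI)
  fix x :: real assume x: "x : {0..1}"
  hence "?f x : topspace Y" using f by (auto simp: continuous_map_def)
  then obtain i where "?f x : N i" using cover by blast
  then obtain e where e: "e > 0" "?f ` ({0..1} Int ball x e) <= N i" using local_nbhd[OF f x] by blast
  let ?B = "{0..1} Int ball x e"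
  have gz: "\<psi> (seg ?f 0 z) = \<psi> (seg ?f 0 y) + \<phi> i (seg ?f y z)"
   if "y : ?B" "z : ?B" for y z
  proof -
   have "continuous_map (top_of_set ?B) (subtopology Y (N i)) ?f" using continuous_map_restrict[OF f _ e(2)] by simp
   hence "singular_simplex 1 (subtopology Y (N i)) (seg ?f y z)"
    using that by (intro singular_simplex_segment[of ?B]) (auto intro: convex_Int)
   thus ?thesis using cocycle_segment[OF \<psi> f, of 0 y z] that eq by auto
  qed
  show "\<exists>e i. e > 0 & ?f ` ({0..1} Int ball x e) <= N i &
    (\<forall>y z. y : {0..1} Int ball x e --> z : {0..1} Int ball x e -->
     \<psi> (seg ?f 0 z) = \<psi> (seg ?f 0 y) + \<phi> i (seg ?f y z))"
   by (intro exI[of _ e] exI[of _ i] conjI allI impI, rule e(1), rule e(2), rule gz; assumption)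
 qed
 from holonomy_eq[OF \<tau> this]
 have "holonomy \<tau> = - \<psi> (seg ?f 0 0) + \<psi> \<tau>" by (simp only: seg_edge_pt[OF \<tau>])
 moreover have "?f 0 : topspace Y" using f by (auto simp: continuous_map_def)
 ultimately show ?thesis using cocycle_segment_refl[OF \<psi>] by fastforce
qed

text \<open>Both cocycles coincide with the holonomy of the cover on which \<phi> serves as every
  local cocycle. In this way equality on small simplices extends to all simplices.\<close>

lemma cocycle_eqI:
 assumes H: "subgroup_set H" and \<phi>: "cocycle Y H \<phi>" and \<psi>: "cocycle Y H \<psi>"
  and N: "!!i. openin Y (N i)" "topspace Y <= (\<Union>i. N i)"
  and eq: "!!i \<tau>. singular_simplex 1 (subtopology Y (N i)) \<tau> ==> \<phi> \<tau> = \<psi> \<tau>"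
  and \<tau>: "singular_simplex 1 Y \<tau>"
 shows "\<phi> \<tau> = \<psi> \<tau>"
proof -
 interpret cocycle_cover Y H N "%_. \<phi>"
 proof
  show "cocycle (subtopology Y (N i)) H \<phi>" for i using \<phi> by (auto simp: cocycle_def triangle_def singular_simplex_subtopology)
 qed (use H N in auto)
 show ?thesis using holonomy_unique[OF \<phi> _ \<tau>] holonomy_unique[OF \<psi> _ \<tau>] eq by simp
qed

lemma face_edge_pt:
 "simplical_face 2 (edge_pt 0) = simplical_face 1 (edge_pt 0)"
 "simplical_face 2 (edge_pt 1) = simplical_face 0 (edge_pt 0)"
 "simplical_face 0 (edge_pt 1) = simplical_face 1 (edge_pt 1)" by (auto simp: simplical_face_def edge_pt_def fun_eq_iff)

lemma triangle_endpoints: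
 assumes "triangle X \<sigma> p q s"
 shows "p (edge_pt 0) = s (edge_pt 0)" "p (edge_pt 1) = q (edge_pt 0)"
  "q (edge_pt 1) = s (edge_pt 1)"
proof -
 have "singular_face 2 k \<sigma> (edge_pt t) = \<sigma> (simplical_face k (edge_pt t))" if "t : {0..1}" for k t
  using edge_pt_in[OF that] by (simp add: singular_face_def)
 hence p: "p (edge_pt t) = \<sigma> (simplical_face 2 (edge_pt t))"
  "q (edge_pt t) = \<sigma> (simplical_face 0 (edge_pt t))"
  "s (edge_pt t) = \<sigma> (simplical_face 1 (edge_pt t))" if "t : {0..1}" for t using assms that by (auto simp: triangle_def)
 show "p (edge_pt 0) = s (edge_pt 0)" "p (edge_pt 1) = q (edge_pt 0)"
  "q (edge_pt 1) = s (edge_pt 1)" by (simp_all only: p face_edge_pt atLeastAtMost_iff order_refl zero_le_one simp_thms)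
qed

lemma simplex_point_in: "singular_simplex 1 X \<tau> ==> t : {0..1} ==> \<tau> (edge_pt t) : topspace X"
 using edge_pt_in[of t] by (auto simp: singular_simplex_iff continuous_map_def)

lemma simplex_map_point: "t : {0..1} ==> simplex_map 1 f \<tau> (edge_pt t) = f (\<tau> (edge_pt t))"
 using edge_pt_in[of t] by (simp add: simplex_map_def)

definition coboundary :: "('x => 'g::group_add) => ((nat => real) => 'x) => 'g" where
 "coboundary b \<tau> = b (\<tau> (edge_pt 0)) - b (\<tau> (edge_pt 1))"

lemma subgroup_set_diff: "subgroup_set H ==> x : H ==> y : H ==> x - y : H" unfolding subgroup_set_def by (metis diff_conv_add_uminus)

lemma cocycle_coboundary_fun:
 assumes "subgroup_set H" "!!y. y : topspace Y ==> b y : H"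
 shows "cocycle Y H (coboundary b)" unfolding cocycle_def coboundary_def
proof (intro conjI allI impI)
 fix \<tau> assume "singular_simplex 1 Y \<tau>"
 thus "b (\<tau> (edge_pt 0)) - b (\<tau> (edge_pt 1)) : H" by (intro subgroup_set_diff assms simplex_point_in) auto
next
 fix \<sigma> p q s assume "triangle Y \<sigma> p q s"
 note e = triangle_endpoints[OF this]
 show "b (s (edge_pt 0)) - b (s (edge_pt 1)) = b (p (edge_pt 0)) - b (p (edge_pt 1)) +
   (b (q (edge_pt 0)) - b (q (edge_pt 1)))" unfolding e by (simp add: diff_conv_add_uminus add.assoc del: add_uminus_conv_diff)
qed

subsection \<open>Extending cocycles over cells\<close>

lemma connected_standard_simplex: "connected (standard_simplex 1)"
proof -
 have "standard_simplex 1 = edge_pt ` {0..1}"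
 proof (intro equalityI subsetI)
  fix x assume x: "x : standard_simplex 1"
  hence "x 1 : {0..1}" by (auto simp: standard_simplex_1')
  with edge_pt_coord[OF x] show "x : edge_pt ` {0..1}" by (metis imageI)
 qed (use edge_pt_in in blast)
 thus ?thesis using connected_continuous_image[OF continuous_on_edge_pt] connected_Icc by metis
qed

lemma topspace_attach_cells:
 "topspace (attach_cells A D I \<Phi>) = topspace A Un (\<Union>i\<in>I. \<Phi> i ` topspace D)" (is "_ = ?T")
proof
 show "topspace (attach_cells A D I \<Phi>) <= ?T"
  using openin_topspace[of "attach_cells A D I \<Phi>"] unfolding openin_attach_cells by blast
 have "{z : topspace D. \<Phi> i z : ?T} = topspace D" if "i : I" for i using that by auto
 moreover have "?T Int topspace A = topspace A" by auto
 ultimately have "openin (attach_cells A D I \<Phi>) ?T" unfolding openin_attach_cells by auto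
 thus "?T <= topspace (attach_cells A D I \<Phi>)" by (rule openin_subset)
qed

lemma continuous_map_characteristic: "i : I ==> continuous_map D (attach_cells A D I \<Phi>) (\<Phi> i)"
 unfolding continuous_map_def topspace_attach_cells openin_attach_cells by auto

locale cell_attachment =
 fixes A :: "'x topology" and D :: "'d topology" and B :: "'d set" and I :: "'i set" and \<Phi> :: "'i => 'd => 'x"
 assumes char: "characteristic_maps A D B I \<Phi>" and closed_boundary: "closedin D B"
begin

abbreviation "Y \<equiv> attach_cells A D I \<Phi>"

lemma boundary_subset: "B <= topspace D" using closedin_subset[OF closed_boundary] .

lemma in_A_iff: "i : I ==> z : topspace D ==> \<Phi> i z : topspace A \<longleftrightarrow> z : B"
 using char unfolding characteristic_maps_def by (auto simp: continuous_map_def Pi_iff)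

lemma cell_inj:
 "i : I ==> j : I ==> z : topspace D - B ==> w : topspace D - B ==> \<Phi> i z = \<Phi> j w ==> i = j & z = w"
 using char inj_onD[of "%(i, z). \<Phi> i z" "I \<times> (topspace D - B)" "(i, z)" "(j, w)"] unfolding characteristic_maps_def by simp

lemma preimage_closed:
 assumes "closedin A C" "i : I"
 shows "closedin D {z : topspace D. \<Phi> i z : C}"
proof -
 have "continuous_map (subtopology D B) A (\<Phi> i)" using char assms(2) by (simp add: characteristic_maps_def)
 from closedin_continuous_map_preimage[OF this assms(1)]
 have "closedin D {z : topspace (subtopology D B). \<Phi> i z : C}" using closed_boundary closedin_trans_full by blast
 moreover have "{z : topspace (subtopology D B). \<Phi> i z : C} = {z : topspace D. \<Phi> i z : C}"
  using in_A_iff[OF assms(2)] closedin_subset[OF assms(1)] by auto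
 ultimately show ?thesis by simp
qed

lemma closedin_attach:
 assumes "closedin A C"
 shows "closedin Y C"
proof -
 have "{z : topspace D. \<Phi> i z : topspace Y - C} = topspace D - {z : topspace D. \<Phi> i z : C}" if "i : I" for i
  using that by (auto simp: topspace_attach_cells)
 hence "openin D {z : topspace D. \<Phi> i z : topspace Y - C}" if "i : I" for i
  using preimage_closed[OF assms that] that by (simp add: openin_diff)
 moreover have "(topspace Y - C) Int topspace A = topspace A - C" by (auto simp: topspace_attach_cells)
 hence "openin A ((topspace Y - C) Int topspace A)" using assms by (simp add: closedin_def)
 ultimately have "openin Y (topspace Y - C)" unfolding openin_attach_cells by (auto simp: topspace_attach_cells)
 thus ?thesis using closedin_subset[OF assms] by (auto simp: closedin_def topspace_attach_cells)
qed

lemma subtopology_attach: "subtopology Y (topspace A) = A"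
proof (rule topology_eq[THEN iffD2], intro allI iffI)
 fix U assume "openin (subtopology Y (topspace A)) U"
 thus "openin A U" unfolding openin_subtopology openin_attach_cells by auto
next
 fix U assume U: "openin A U"
 hence c: "closedin Y (topspace A - U)" by (intro closedin_attach closedin_diff) auto
 have "openin Y (topspace Y - (topspace A - U))" using c by blast
 moreover have "U = (topspace Y - (topspace A - U)) Int topspace A" using openin_subset[OF U] by (auto simp: topspace_attach_cells)
 ultimately show "openin (subtopology Y (topspace A)) U" unfolding openin_subtopology by blast
qed

lemma t1_attach:
 assumes "t1_space A" "t1_space D"
 shows "t1_space Y" unfolding t1_space_closedin_singleton
proof
 fix y assume y: "y : topspace Y"
 show "closedin Y {y}"
 proof (cases "y : topspace A")
  case True
  thus ?thesis using assms(1) closedin_attach unfolding t1_space_closedin_singleton by blast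
 next
  case False
  then obtain i z where i: "i : I" "z : topspace D" "y = \<Phi> i z" using y by (auto simp: topspace_attach_cells)
  hence z: "z : topspace D - B" using False in_A_iff by blast
  have "openin D {w : topspace D. \<Phi> j w : topspace Y - {y}}" if j: "j : I" for j
  proof -
   have "j = i & w = z" if w: "w : topspace D" "\<Phi> j w = y" for w
   proof -
    have "w : topspace D - B" using in_A_iff[OF j w(1)] False w by simp
    thus ?thesis using cell_inj[OF j i(1) _ z, of w] w(2) i(3) by simp
   qed
   hence "{w : topspace D. \<Phi> j w : topspace Y - {y}} = topspace D - (if j = i then {z} else {})"
    using j i by (auto simp: topspace_attach_cells)
   moreover have "closedin D {z}" using assms(2) i(2) unfolding t1_space_closedin_singleton by blast
   ultimately show ?thesis by (auto intro: openin_diff)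
  qed
  moreover have "(topspace Y - {y}) Int topspace A = topspace A" using False by (auto simp: topspace_attach_cells)
  ultimately have "openin Y (topspace Y - {y})" unfolding openin_attach_cells by (auto simp: topspace_attach_cells)
  thus ?thesis using y by (simp add: closedin_def)
 qed
qed

lemma openin_cells:
 assumes W: "openin D W" "W Int B = {}" and J: "J <= I"
 shows "openin Y (\<Union>i\<in>J. \<Phi> i ` W)"
proof -
 have sub: "W <= topspace D - B" using openin_subset[OF W(1)] W(2) by blast
 have "(\<Union>i\<in>J. \<Phi> i ` W) Int topspace A = {}" using in_A_iff J sub by blast
 moreover have "openin D {z : topspace D. \<Phi> j z : (\<Union>i\<in>J. \<Phi> i ` W)}" if j: "j : I" for j
 proof -
  have "j : J & z : W" if z: "z : topspace D" "i : J" "w : W" "\<Phi> j z = \<Phi> i w" for z i w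
  proof -
   have "\<Phi> i w ~: topspace A" using in_A_iff[of i w] z J sub by auto
   hence "z : topspace D - B" using in_A_iff[OF j z(1)] z by auto
   thus ?thesis using cell_inj[of j i z w] z J sub j by auto
  qed
  hence "{z : topspace D. \<Phi> j z : (\<Union>i\<in>J. \<Phi> i ` W)} = (if j : J then W else {})" using sub by auto
  thus ?thesis using W(1) by auto
 qed
 moreover have "(\<Union>i\<in>J. \<Phi> i ` W) <= topspace A Un (\<Union>i\<in>I. \<Phi> i ` topspace D)" using J sub by blast
 ultimately show ?thesis unfolding openin_attach_cells by simp
qed

definition cell :: "'x => 'i \<times> 'd" where
 "cell = the_inv_into (I \<times> (topspace D - B)) (%(i, z). \<Phi> i z)"

lemma cell_eq: "i : I ==> z : topspace D - B ==> cell (\<Phi> i z) = (i, z)"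
 using the_inv_into_f_f[of "%(i, z). \<Phi> i z" "I \<times> (topspace D - B)" "(i, z)"] char
 unfolding cell_def characteristic_maps_def by simp

lemma in_cell:
 assumes "y : topspace Y - topspace A"
 obtains i z where "i : I" "z : topspace D - B" "y = \<Phi> i z" using assms in_A_iff unfolding topspace_attach_cells by blast

lemma openin_open_cells: "openin Y (topspace Y - topspace A)" using closedin_attach[of "topspace A"] by blast

lemma continuous_map_cell:
 "continuous_map (subtopology Y (topspace Y - topspace A)) (discrete_topology I) (%y. fst (cell y))" (is ?f)
 "continuous_map (subtopology Y (topspace Y - topspace A)) (subtopology D (topspace D - B)) (%y. snd (cell y))" (is ?s)
proof -
 let ?V = "subtopology Y (topspace Y - topspace A)"
 have ts: "topspace ?V = topspace Y - topspace A" by auto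
 have V: "cell y : I \<times> (topspace D - B)" if "y : topspace ?V" for y using that unfolding ts by (elim in_cell) (simp add: cell_eq)
 have ci: "y : topspace ?V ==> y = \<Phi> (fst (cell y)) (snd (cell y))" for y unfolding ts by (elim in_cell) (simp add: cell_eq)
 have sub: "i : I ==> z : topspace D - B ==> \<Phi> i z : topspace ?V" for i z using in_A_iff by (auto simp: topspace_attach_cells)
 have DB: "openin D (topspace D - B)" using closed_boundary by (simp add: openin_diff)
 have opn: "openin ?V U" if "openin Y U" "U <= topspace ?V" for U using that openin_open_cells by (simp add: openin_open_subtopology ts)
 show ?f unfolding continuous_map_def
 proof (intro conjI allI impI)
  fix J assume J: "openin (discrete_topology I) J"
  have "{y : topspace ?V. fst (cell y) : J} = (\<Union>i\<in>J. \<Phi> i ` (topspace D - B))"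
  proof (rule Set.set_eqI, rule iffI)
   fix y assume "y : {y : topspace ?V. fst (cell y) : J}"
   hence y: "y : topspace ?V" "fst (cell y) : J" by simp_all
   hence "snd (cell y) : topspace D - B" using V[OF y(1)] by (simp only: mem_Times_iff)
   with ci[OF y(1)] have "y : \<Phi> (fst (cell y)) ` (topspace D - B)" by (rule image_eqI)
   with y(2) show "y : (\<Union>i\<in>J. \<Phi> i ` (topspace D - B))" by (rule UN_I)
  next
   fix y assume "y : (\<Union>i\<in>J. \<Phi> i ` (topspace D - B))"
   then obtain i z where iz: "i : J" "z : topspace D - B" "y = \<Phi> i z" by blast
   hence "i : I" using J by auto
   thus "y : {y : topspace ?V. fst (cell y) : J}" using iz cell_eq[of i z] sub[of i z] by simp
  qed
  moreover have "openin ?V (\<Union>i\<in>J. \<Phi> i ` (topspace D - B))" using openin_cells[OF DB] J sub by (intro opn) auto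
  ultimately show "openin ?V {y : topspace ?V. fst (cell y) : J}" by simp
 qed (use V in fastforce)
 show ?s unfolding continuous_map_def
 proof (intro conjI allI impI)
  fix W assume "openin (subtopology D (topspace D - B)) W"
  hence W: "openin D W" "W <= topspace D - B" using DB by (auto simp: openin_open_subtopology)
  have "{y : topspace ?V. snd (cell y) : W} = (\<Union>i\<in>I. \<Phi> i ` W)"
  proof (rule Set.set_eqI, rule iffI)
   fix y assume "y : {y : topspace ?V. snd (cell y) : W}"
   hence y: "y : topspace ?V" "snd (cell y) : W" by simp_all
   hence "fst (cell y) : I" using V[OF y(1)] by (simp only: mem_Times_iff)
   moreover from ci[OF y(1)] y(2) have "y : \<Phi> (fst (cell y)) ` W" by (rule image_eqI)
   ultimately show "y : (\<Union>i\<in>I. \<Phi> i ` W)" by (rule UN_I)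
  next
   fix y assume "y : (\<Union>i\<in>I. \<Phi> i ` W)"
   then obtain i z where iz: "i : I" "z : W" "y = \<Phi> i z" by blast
   hence "z : topspace D - B" using W by blast
   thus "y : {y : topspace ?V. snd (cell y) : W}" using iz cell_eq[of i z] sub[of i z] by simp
  qed
  moreover have "openin ?V (\<Union>i\<in>I. \<Phi> i ` W)" using openin_cells[OF W(1)] W(2) sub by (intro opn) blast+
  ultimately show "openin ?V {y : topspace ?V. snd (cell y) : W}" by simp
 qed (use V in fastforce)
qed

end

text \<open>The complement of the centres retracts to \<open>A\<close>, and together with the open
  cells it covers the new space. Edges without midpoints, the punctured disk and punctured cells of
  higher dimension are all instances.\<close>

locale punctured_cell_attachment = cell_attachment A D B I \<Phi>
 for A :: "'x topology" and D :: "'d topology" and B :: "'d set" and I :: "'i set" and \<Phi> :: "'i => 'd => 'x" +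
 fixes z0 :: 'd and \<rho> :: "'d => 'd"
 assumes centre: "z0 : topspace D - B" "closedin D {z0}"
  and retract: "continuous_map (subtopology D (topspace D - {z0})) (subtopology D B) \<rho>" "!!z. z : B ==> \<rho> z = z"
begin

definition punctured :: "'x set" where
 "punctured = topspace Y - (%i. \<Phi> i z0) ` I"

definition retraction :: "'x => 'x" where
 "retraction y = (if y : topspace A then y else (case cell y of (i, z) => \<Phi> i (\<rho> z)))"

lemma centre_eq: "i : I ==> j : I ==> z : topspace D ==> \<Phi> i z = \<Phi> j z0 ==> i = j & z = z0"
 using cell_inj[of i j z z0] centre in_A_iff[of i z] in_A_iff[of j z0] by auto

lemma preimage_punctured: "i : I ==> {z : topspace D. \<Phi> i z : punctured} = topspace D - {z0}"
 using centre_eq by (auto simp: punctured_def topspace_attach_cells)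

lemma A_punctured: "topspace A <= punctured" using centre in_A_iff by (auto simp: punctured_def topspace_attach_cells)

lemma openin_punctured: "openin Y punctured"
proof -
 have "punctured Int topspace A = topspace A" using A_punctured by blast
 thus ?thesis unfolding openin_attach_cells using preimage_punctured centre by (auto simp: punctured_def topspace_attach_cells openin_diff)
qed

lemma retraction_characteristic: "i : I ==> z : topspace D - {z0} ==> retraction (\<Phi> i z) = \<Phi> i (\<rho> z)"
 using cell_eq[of i z] in_A_iff[of i z] retract(2)[of z] by (auto simp: retraction_def)

lemma retract_in: "z : topspace D - {z0} ==> \<rho> z : B" using retract(1) by (auto simp: continuous_map_def Pi_iff)

lemma continuous_map_retraction: "continuous_map (subtopology Y punctured) A retraction" unfolding continuous_map_def
proof (intro conjI allI impI)
 show "retraction : topspace (subtopology Y punctured) \<rightarrow> topspace A"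
 proof
  fix y assume "y : topspace (subtopology Y punctured)"
  hence y: "y : topspace Y" "y : punctured" by auto
  show "retraction y : topspace A"
  proof (cases "y : topspace A")
   case False
   then obtain i z where iz: "i : I" "z : topspace D - B" "y = \<Phi> i z" using y in_cell by blast
   hence "z : topspace D - {z0}" using y(2) by (auto simp: punctured_def)
   thus ?thesis using iz retraction_characteristic retract_in in_A_iff[of i "\<rho> z"] boundary_subset by auto
  qed (simp add: retraction_def)
 qed
next
 fix W assume W: "openin A W"
 let ?U = "{y : topspace (subtopology Y punctured). retraction y : W}"
 have pt: "topspace (subtopology Y punctured) = punctured" by (auto simp: punctured_def)
 have "?U Int topspace A = W" using openin_subset[OF W] A_punctured unfolding pt by (auto simp: retraction_def)
 moreover have "openin D {z : topspace D. \<Phi> i z : ?U}" if i: "i : I" for i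
 proof -
  have "continuous_map (subtopology D (topspace D - {z0})) A (\<Phi> i o \<rho>)"
   by (rule continuous_map_compose[OF retract(1)]) (use char i in \<open>simp add: characteristic_maps_def\<close>)
  from openin_continuous_map_preimage[OF this W]
  have "openin D {z : topspace (subtopology D (topspace D - {z0})). (\<Phi> i o \<rho>) z : W}"
   using centre(2) by (auto simp: openin_open_subtopology openin_diff)
  moreover have "{z : topspace (subtopology D (topspace D - {z0})). (\<Phi> i o \<rho>) z : W} = {z : topspace D. \<Phi> i z : ?U}"
  proof (rule Set.set_eqI)
   fix z
   have "z : topspace D ==> \<Phi> i z : punctured \<longleftrightarrow> z ~= z0" using preimage_punctured[OF i] by blast
   thus "z : {z : topspace (subtopology D (topspace D - {z0})). (\<Phi> i o \<rho>) z : W} \<longleftrightarrow>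
     z : {z : topspace D. \<Phi> i z : ?U}" using retraction_characteristic[OF i, of z] unfolding pt by auto
  qed
  ultimately show ?thesis by simp
 qed
 ultimately have "openin Y ?U" unfolding openin_attach_cells using W by (auto simp: topspace_attach_cells)
 thus "openin (subtopology Y punctured) ?U" using openin_punctured by (auto simp: openin_open_subtopology)
qed

text \<open>A cocycle extends over a cell once its pullback to the boundary is a coboundary. On the
  punctured space it is pulled back by the retraction, on the open cells it is the coboundary of
  \<open>b i\<close> composed with \<rho>, and the two are glued. The last clause records the value
  across a cell, which for an edge of the rose is the prescribed value of a generator.\<close>

lemma extend_cocycle:
 assumes H: "subgroup_set H" and \<phi>: "cocycle A H \<phi>" and bH: "!!i z. i : I ==> z : B ==> b i z : H"
  and b: "!!i \<tau>. i : I ==> singular_simplex 1 (subtopology D B) \<tau> ==> \<phi> (simplex_map 1 (\<Phi> i) \<tau>) = coboundary (b i) \<tau>"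
 shows "\<exists>\<phi>'. cocycle Y H \<phi>' & (\<forall>\<tau>. singular_simplex 1 A \<tau> --> \<phi>' \<tau> = \<phi> \<tau>) &
  (\<forall>i\<in>I. \<forall>\<tau>. singular_simplex 1 D \<tau> --> \<tau> (edge_pt 0) : B --> \<tau> (edge_pt 1) : B -->
   \<phi>' (simplex_map 1 (\<Phi> i) \<tau>) = coboundary (b i) \<tau>)"
proof -
 \<comment> \<open>Any element of \<open>H\<close> would do at the centre, because the centre lies
   outside the overlap of the two open sets.\<close>
 define \<beta> where "\<beta> i z = (if z = z0 then 0 else b i (\<rho> z))" for i z
 define \<gamma> where "\<gamma> y = (case cell y of (i, z) => \<beta> i z)" for y
 let ?V = "topspace Y - topspace A"
 define N where "N u = (if u then punctured else ?V)" for u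
 define \<psi> where "\<psi> u = (if u then %\<tau>. \<phi> (simplex_map 1 retraction \<tau>) else coboundary \<gamma>)" for u
 have \<beta>H: "\<beta> i z : H" if "i : I" "z : topspace D" for i z
  using that bH[OF that(1) retract_in[of z]] H by (auto simp: \<beta>_def subgroup_set_def)
 have \<gamma>: "\<gamma> (\<Phi> i z) = \<beta> i z" if "i : I" "z : topspace D - B" for i z
  using cell_eq[OF that] by (simp add: \<gamma>_def)
 have retr: "\<phi> (simplex_map 1 retraction (simplex_map 1 (\<Phi> i) \<tau>)) = coboundary (\<beta> i) \<tau>"
  if i: "i : I" and \<tau>: "singular_simplex 1 (subtopology D (topspace D - {z0})) \<tau>" for i \<tau>
 proof -
  have im: "\<tau> x : topspace D - {z0}" if "x : standard_simplex 1" for x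
   using \<tau> that by (auto simp: singular_simplex_iff continuous_map_def)
  hence "simplex_map 1 retraction (simplex_map 1 (\<Phi> i) \<tau>) = simplex_map 1 (\<Phi> i) (simplex_map 1 \<rho> \<tau>)"
   using retraction_characteristic[OF i] by (auto simp: simplex_map_def fun_eq_iff)
  hence "\<phi> (simplex_map 1 retraction (simplex_map 1 (\<Phi> i) \<tau>)) = coboundary (b i) (simplex_map 1 \<rho> \<tau>)"
   using b[OF i singular_simplex_continuous_map[OF \<tau> retract(1)]] by simp
  moreover have "\<tau> (edge_pt 0) ~= z0" "\<tau> (edge_pt 1) ~= z0" using im edge_pt_in[of 0] edge_pt_in[of 1] by auto
  ultimately show ?thesis by (simp add: coboundary_def simplex_map_point \<beta>_def del: One_nat_def)
 qed
 interpret cocycle_cover Y H N \<psi>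
 proof
  show "openin Y (N i)" for i using openin_punctured openin_open_cells by (simp add: N_def)
  have "topspace Y <= N True Un N False" using A_punctured by (auto simp: N_def)
  thus "topspace Y <= (\<Union>i. N i)" by blast
  have "cocycle (subtopology Y punctured) H (%\<tau>. \<phi> (simplex_map 1 retraction \<tau>))"
   by (rule cocycle_pullback[OF \<phi> continuous_map_retraction])
  moreover have "cocycle (subtopology Y ?V) H (coboundary \<gamma>)"
  proof (rule cocycle_coboundary_fun[OF H])
   fix y assume "y : topspace (subtopology Y ?V)"
   hence "y : ?V" by auto
   thus "\<gamma> y : H" by (elim in_cell) (simp add: \<gamma> \<beta>H)
  qed
  ultimately show "cocycle (subtopology Y (N i)) H (\<psi> i)" for i by (simp add: N_def \<psi>_def)
  have ag: "\<phi> (simplex_map 1 retraction \<tau>) = coboundary \<gamma> \<tau>"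
   if "singular_simplex 1 (subtopology Y (punctured Int ?V)) \<tau>" for \<tau>
  proof -
   have \<tau>: "singular_simplex 1 (subtopology Y ?V) \<tau>" "\<tau> ` standard_simplex 1 <= punctured"
    using that by (auto simp: singular_simplex_subtopology)
   have c: "continuous_map (top_of_set (standard_simplex 1)) (subtopology Y ?V) \<tau>" using \<tau>(1) by (simp add: singular_simplex_iff)
   \<comment> \<open>A simplex in the union of the open cells lies in one of them, because the index
     of the cell is a continuous map to a discrete space.\<close>
   have "connectedin (top_of_set (standard_simplex 1)) (standard_simplex 1)"
    using connected_standard_simplex by (simp add: connectedin_subtopology)
   from connectedin_continuous_map_image[OF continuous_map_compose[OF c continuous_map_cell(1)] this]
   have "\<exists>i. ((%y. fst (cell y)) o \<tau>) ` standard_simplex 1 <= {i}" unfolding connectedin_discrete_topology by (rule conjunct2)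
   then obtain i where "((%y. fst (cell y)) o \<tau>) ` standard_simplex 1 <= {i}" ..
   hence i: "fst (cell (\<tau> x)) = i" if "x : standard_simplex 1" for x using that by (simp add: image_subset_iff)
   let ?\<tau>' = "simplex_map 1 (%y. snd (cell y)) \<tau>"
   have \<tau>': "singular_simplex 1 (subtopology D (topspace D - B)) ?\<tau>'"
    by (rule singular_simplex_continuous_map[OF \<tau>(1) continuous_map_cell(2)])
   have x: "i : I" "snd (cell (\<tau> x)) : topspace D - B - {z0}" "\<tau> x = \<Phi> i (snd (cell (\<tau> x)))"
    if "x : standard_simplex 1" for x
   proof -
    have "\<tau> x : ?V" using c that by (auto simp: continuous_map_def)
    then obtain j z where j: "j : I" "z : topspace D - B" "\<tau> x = \<Phi> j z" using in_cell by blast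
    moreover have "j = i" using i[OF that] j cell_eq[of j z] by simp
    moreover have "z ~= z0" using \<tau>(2) that j by (auto simp: punctured_def)
    ultimately show "i : I" "snd (cell (\<tau> x)) : topspace D - B - {z0}" "\<tau> x = \<Phi> i (snd (cell (\<tau> x)))"
     using cell_eq[of j z] by auto
   qed
   have iI: "i : I" using x(1)[OF edge_pt_in[of 0]] by simp
   have \<tau>2: "singular_simplex 1 (subtopology D (topspace D - {z0})) ?\<tau>'"
    using \<tau>' x(2) by (auto simp: singular_simplex_subtopology simplex_map_def)
   have "simplex_map 1 (\<Phi> i) ?\<tau>' = \<tau>"
   proof
    fix u show "simplex_map 1 (\<Phi> i) ?\<tau>' u = \<tau> u"
     using x(3)[of u] \<tau>(1) by (cases "u : standard_simplex 1") (auto simp: simplex_map_def singular_simplex_iff extensional_def)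
   qed
   hence "\<phi> (simplex_map 1 retraction \<tau>) = coboundary (\<beta> i) ?\<tau>'" using retr[OF iI \<tau>2] by simp
   also have "\<dots> = coboundary \<gamma> \<tau>" using x(2,3)[OF edge_pt_in[of 0]] x(2,3)[OF edge_pt_in[of 1]] \<gamma>[OF iI]
    by (simp add: coboundary_def simplex_map_point del: One_nat_def) metis
   finally show ?thesis .
  qed
  show "\<psi> i \<tau> = \<psi> j \<tau>" if "singular_simplex 1 (subtopology Y (N i Int N j)) \<tau>" for i j \<tau>
   using that ag[of \<tau>] by (cases i; cases j) (simp_all add: N_def \<psi>_def Int_commute)
 qed (rule H)
 show ?thesis
 proof (intro exI[of _ holonomy] conjI allI impI ballI)
  show "cocycle Y H holonomy" by (rule cocycle_holonomy)
 next
  fix \<tau> assume \<tau>: "singular_simplex 1 A \<tau>"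
  hence im: "\<tau> ` standard_simplex 1 <= topspace A" by (auto simp: singular_simplex_iff continuous_map_def)
  have "singular_simplex 1 (subtopology Y (topspace A)) \<tau>" using \<tau> by (simp add: subtopology_attach)
  hence "singular_simplex 1 (subtopology Y (N True)) \<tau>" using A_punctured by (auto simp: singular_simplex_subtopology N_def)
  hence "holonomy \<tau> = \<phi> (simplex_map 1 retraction \<tau>)" using holonomy_agree by (auto simp: \<psi>_def)
  also have "simplex_map 1 retraction \<tau> = \<tau>"
  proof
   fix u show "simplex_map 1 retraction \<tau> u = \<tau> u"
    using im \<tau> by (cases "u : standard_simplex 1") (auto simp: simplex_map_def singular_simplex_iff extensional_def retraction_def)
  qed
  finally show "holonomy \<tau> = \<phi> \<tau>" .
 next
  fix i \<tau> assume i: "i : I" and \<tau>: "singular_simplex 1 D \<tau>" and e: "\<tau> (edge_pt 0) : B" "\<tau> (edge_pt 1) : B"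
  define M where "M u = (if u then topspace D - {z0} else topspace D - B)" for u
  \<comment> \<open>A path in the cell may meet both the centre and the boundary. So the formula is
    checked on paths that avoid one of the two and then extended by
    \<open>cocycle_eqI\<close>.\<close>
  have "holonomy (simplex_map 1 (\<Phi> i) \<tau>) = coboundary (\<beta> i) \<tau>"
  proof (rule cocycle_eqI[OF H, where N = M])
   show "cocycle D H (%\<tau>. holonomy (simplex_map 1 (\<Phi> i) \<tau>))"
    by (rule cocycle_pullback[OF cocycle_holonomy continuous_map_characteristic[OF i]])
   show "cocycle D H (coboundary (\<beta> i))" by (rule cocycle_coboundary_fun[OF H \<beta>H[OF i]])
   show "openin D (M u)" for u using centre closed_boundary by (auto simp: M_def intro!: openin_diff)
   have "topspace D <= M True Un M False" using centre by (auto simp: M_def)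
   thus "topspace D <= (\<Union>u. M u)" by blast
   fix u \<sigma> assume \<sigma>: "singular_simplex 1 (subtopology D (M u)) \<sigma>"
   let ?\<sigma> = "simplex_map 1 (\<Phi> i) \<sigma>"
   have \<sigma>D: "singular_simplex 1 D \<sigma>" "\<sigma> ` standard_simplex 1 <= M u"
    using \<sigma> by (auto simp: singular_simplex_subtopology)
   have s: "singular_simplex 1 Y ?\<sigma>" by (rule singular_simplex_continuous_map[OF \<sigma>D(1) continuous_map_characteristic[OF i]])
   have "\<Phi> i z : N u" if "z : M u" for z
    using that preimage_punctured[OF i] in_A_iff[OF i] i by (auto simp: M_def N_def topspace_attach_cells split: if_splits)
   hence "singular_simplex 1 (subtopology Y (N u)) ?\<sigma>"
    using s \<sigma>D(2) by (auto simp: singular_simplex_subtopology simplex_map_def)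
   hence h: "holonomy ?\<sigma> = \<psi> u ?\<sigma>" by (rule holonomy_agree)
   show "holonomy ?\<sigma> = coboundary (\<beta> i) \<sigma>"
   proof (cases u)
    case True
    thus ?thesis using h retr[OF i] \<sigma> by (simp add: \<psi>_def M_def)
   next
    case False
    thus ?thesis using h \<gamma>[OF i] \<sigma>D(2) edge_pt_in[of 0] edge_pt_in[of 1]
     by (simp add: \<psi>_def M_def coboundary_def simplex_map_point image_subset_iff del: One_nat_def)
   qed
  qed (rule \<tau>)
  thus "holonomy (simplex_map 1 (\<Phi> i) \<tau>) = coboundary (b i) \<tau>"
   using e retract(2) centre(1) by (auto simp: coboundary_def \<beta>_def)
 qed
qed

end

subsection \<open>Cocycles on spheres\<close>

lemma nsphere_top_of_set: "nsphere k = top_of_set {x. (\<forall>i>k. x i = 0) & (\<Sum>i\<le>k. (x i)\<^sup>2) = 1}"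
 unfolding nsphere_def Euclidean_space_def subtopology_subtopology euclidean_product_topology
 by (rule arg_cong[where f = top_of_set]) (auto simp: Suc_le_eq)

lemma topspace_nsphere_iff: "x : topspace (nsphere k) \<longleftrightarrow> (\<forall>i>k. x i = 0) & (\<Sum>i\<le>k. (x i)\<^sup>2) = 1"
 by (simp add: nsphere_top_of_set)

lemma ndisk_top_of_set: "ndisk (Suc k) = top_of_set {x. (\<forall>i>k. x i = 0) & (\<Sum>i\<le>k. (x i)\<^sup>2) <= 1}"
 unfolding ndisk_def Euclidean_space_def subtopology_subtopology euclidean_product_topology lessThan_Suc_atMost
 by (rule arg_cong[where f = top_of_set]) (auto simp: Suc_le_eq)

definition normalize_upto :: "nat => (nat => real) => nat => real" where
 "normalize_upto k x = (%i. x i / sqrt (\<Sum>j\<le>k. (x j)\<^sup>2))"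

lemma normalize_upto_in:
 assumes "\<forall>i>k. x i = 0" "(\<Sum>j\<le>k. (x j)\<^sup>2) ~= 0"
 shows "normalize_upto k x : topspace (nsphere k)" using assms sum_nonneg[of "{..k}" "%j. (x j)\<^sup>2"]
 by (auto simp: normalize_upto_def topspace_nsphere_iff power_divide real_sqrt_pow2 simp flip: sum_divide_distrib)

lemma continuous_on_normalize_upto:
 assumes "continuous_on A f" "!!x. x : A ==> (\<Sum>j\<le>k. (f x j)\<^sup>2) ~= 0"
 shows "continuous_on A (%x. normalize_upto k (f x))" unfolding normalize_upto_def
proof (rule continuous_on_coordinatewise_then_product)
 fix i
 have c: "continuous_on A (%x. f x j)" for j using continuous_on_product_then_coordinatewise[OF assms(1)] .
 show "continuous_on A (%x. f x i / sqrt (\<Sum>j\<le>k. (f x j)\<^sup>2))" using assms(2) by (intro continuous_intros c) auto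
qed

lemma normalize_upto_id: "x : topspace (nsphere k) ==> normalize_upto k x = x" by (simp add: normalize_upto_def topspace_nsphere_iff)

definition interpolate :: "real => (nat => real) => (nat => real) => nat => real" where
 "interpolate t y v = (%i. (1 - t) * y i + t * v i)"

text \<open>If the segment passes through 0, comparing norms gives t = 1/2 and hence y = - v,
  contrary to the coordinate \<open>i\<close>.\<close>

lemma interpolate_nonzero:
 assumes y: "y : topspace (nsphere k)" and v: "v : topspace (nsphere k)" and ne: "i <= k" "y i ~= - v i" and t: "0 <= t"
 shows "(\<Sum>j\<le>k. (interpolate t y v j)\<^sup>2) ~= 0"
proof
 assume "(\<Sum>j\<le>k. (interpolate t y v j)\<^sup>2) = 0"
 hence z: "(1 - t) * y j = - (t * v j)" if "j <= k" for j using that by (simp add: sum_nonneg_eq_0_iff interpolate_def add_eq_0_iff2)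
 have "(1 - t)\<^sup>2 * (\<Sum>j\<le>k. (y j)\<^sup>2) = t\<^sup>2 * (\<Sum>j\<le>k. (v j)\<^sup>2)"
  unfolding sum_distrib_left power_mult_distrib[symmetric] using z by (intro sum.cong) (auto simp: power2_eq_square)
 hence "(1 - t)\<^sup>2 = t\<^sup>2" using y v by (simp add: topspace_nsphere_iff)
 hence "t = 1/2" by (simp add: power2_eq_square algebra_simps)
 with z[OF ne(1)] have "(1 - 1/2) * y i = - (1/2 * v i)" by (simp only:)
 thus False using ne(2) by simp
qed

lemma continuous_map_arc:
 assumes v: "v : topspace (nsphere k)" and U: "!!y. y : topspace (nsphere k) Int U ==> \<exists>i\<le>k. y i ~= - v i"
 shows "continuous_map (prod_topology (top_of_set {0..1}) (subtopology (nsphere k) U)) (nsphere k)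
  (%(t, y). normalize_upto k (interpolate t y v))"
proof -
 let ?S = "topspace (nsphere k) Int U"
 have S: "subtopology (nsphere k) U = top_of_set ?S" unfolding nsphere_top_of_set by (simp add: subtopology_subtopology)
 have nz: "(\<Sum>j\<le>k. (interpolate t y v j)\<^sup>2) ~= 0" if "y : ?S" "t : {0..1}" for t y
  using U[OF that(1)] interpolate_nonzero[OF _ v] that by auto
 have "continuous_on ({0..1} \<times> ?S) (%p. interpolate (fst p) (snd p) v)" unfolding interpolate_def
  by (intro continuous_on_coordinatewise_then_product continuous_intros
    continuous_on_product_then_coordinatewise[OF continuous_on_snd[OF continuous_on_id]])
 hence "continuous_on ({0..1} \<times> ?S) (%p. normalize_upto k (interpolate (fst p) (snd p) v))"
  using nz by (intro continuous_on_normalize_upto) auto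
 moreover have "normalize_upto k (interpolate t y v) : topspace (nsphere k)" if "y : ?S" "t : {0..1}" for t y
  using nz[OF that] that(1) v by (intro normalize_upto_in) (auto simp: interpolate_def topspace_nsphere_iff)
 ultimately show ?thesis unfolding S prod_topology_subtopology_eu case_prod_beta'
  by (subst (2) nsphere_top_of_set) (auto simp: topspace_nsphere_iff)
qed

text \<open>The complement of a pole contracts along arcs to the opposite pole, which gives a
  primitive there. On the overlap the two primitives differ by a constant, because for k >= 2 its
  points are joined by arcs that avoid both poles.\<close>

lemma cocycle_nsphere:
 assumes k: "k >= 2" and H: "subgroup_set H" and \<phi>: "cocycle (nsphere k) H \<phi>"
 shows "\<exists>b. (\<forall>z\<in>topspace (nsphere k). b z : H) &
  (\<forall>\<tau>. singular_simplex 1 (nsphere k) \<tau> --> \<phi> \<tau> = coboundary b \<tau>)"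
proof -
 let ?S = "topspace (nsphere k)"
 define e :: "nat => nat => real" where "e j = (%i. if i = j then 1 else 0)" for j
 define pole where "pole u = (%i. (if u then -1 else 1) * e 0 i)" for u
 define N where "N u = {y : ?S. if u then y 0 < 1 else y 0 > -1}" for u
 have e: "e j : ?S" if "j <= k" for j
  using that by (auto simp: topspace_nsphere_iff e_def if_distrib[where f = "%x. x\<^sup>2"] cong: if_cong)
 have pole: "pole u : ?S" for u using e[of 0] by (simp add: topspace_nsphere_iff pole_def power_mult_distrib)
 have "\<exists>b. (\<forall>y\<in>N u. b y : H) & (\<forall>\<tau>. singular_simplex 1 (subtopology (nsphere k) (N u)) \<tau> --> \<phi> \<tau> = coboundary b \<tau>)" for u
 proof -
  let ?h = "%(t, y). normalize_upto k (interpolate t y (pole u))"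
  have "\<exists>i\<le>k. y i ~= - pole u i" if "y : ?S Int N u" for y using that by (intro exI[of _ 0]) (auto simp: N_def pole_def e_def)
  from continuous_map_arc[OF pole this]
  have c: "continuous_map (prod_topology (top_of_set {0..1}) (subtopology (nsphere k) (N u))) (nsphere k) ?h" .
  have "?h (1, y) = pole u" for y using normalize_upto_id[OF pole] by (simp add: interpolate_def)
  from cocycle_coboundary[OF \<phi> c this]
  obtain b where b: "\<forall>y\<in>topspace (subtopology (nsphere k) (N u)). b y : H"
   "\<forall>\<tau>. singular_simplex 1 (subtopology (nsphere k) (N u)) \<tau> -->
    \<phi> (simplex_map 1 (%y. ?h (0, y)) \<tau>) = b (\<tau> (edge_pt 0)) - b (\<tau> (edge_pt 1))" by blast
  have "simplex_map 1 (%y. ?h (0, y)) \<tau> = \<tau>" if "singular_simplex 1 (subtopology (nsphere k) (N u)) \<tau>" for \<tau>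
  proof
   fix x show "simplex_map 1 (%y. ?h (0, y)) \<tau> x = \<tau> x" using that normalize_upto_id[of "\<tau> x" k]
    by (cases "x : standard_simplex 1")
     (auto simp: simplex_map_def singular_simplex_iff extensional_def interpolate_def continuous_map_def Pi_iff)
  qed
  with b show ?thesis by (intro exI[of _ b]) (auto simp: coboundary_def N_def)
 qed
 then obtain b where bH: "!!u y. y : N u ==> b u y : H"
  and b: "!!u \<tau>. singular_simplex 1 (subtopology (nsphere k) (N u)) \<tau> ==> \<phi> \<tau> = coboundary (b u) \<tau>" by metis
 define c where "c y = - b False y + b True y" for y
 have tail: "\<bar>y 0\<bar> < 1" if y: "y : ?S" "i : {1..k}" "y i ~= 0" for y i
 proof -
  have "(y 0)\<^sup>2 + (y i)\<^sup>2 = (\<Sum>j\<in>{0, i}. (y j)\<^sup>2)" using y(2) by simp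
  also have "\<dots> <= (\<Sum>j\<le>k. (y j)\<^sup>2)" using y(2) by (intro sum_mono2) auto
  also have "\<dots> = 1" using y(1) by (simp add: topspace_nsphere_iff)
  finally have "(y 0)\<^sup>2 < 1" using y(3) zero_less_power2[of "y i"] by linarith
  thus ?thesis using abs_square_less_1 by blast
 qed
 \<comment> \<open>The arc from \<open>y\<close> to \<open>v\<close> stays in the overlap as long as
   some coordinate of positive index remains nonzero, so both primitives have the same increment
   along it.\<close>
 have const: "c y = c v" if y: "y : N True Int N False" and v: "v : ?S"
  and nz: "!!t. t : {0..1} ==> \<exists>i\<in>{1..k}. interpolate t y v i ~= 0" for y v
 proof -
  let ?g = "%t. normalize_upto k (interpolate t y v)"
  have yS: "y : ?S" using y by (simp add: N_def)
  obtain i where i: "i : {1..k}" "interpolate (1/2) y v i ~= 0" using nz[of "1/2"] by auto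
  hence ne: "\<exists>i\<le>k. x i ~= - v i" if "x : ?S Int {y}" for x using that by (auto simp: interpolate_def intro!: exI[of _ i])
  have "continuous_map (top_of_set {0..1}) (prod_topology (top_of_set {0..1}) (subtopology (nsphere k) {y})) (%t. (t, y))"
   using yS by (auto simp: continuous_map_pairwise comp_def)
  from continuous_map_compose[OF this continuous_map_arc[OF v ne]]
  have g: "continuous_map (top_of_set {0..1}) (nsphere k) ?g" by (simp add: comp_def)
  have "?g t : N u" if t: "t : {0..1}" for t u
  proof -
   have gS: "?g t : ?S" using g t by (auto simp: continuous_map_def)
   obtain i where i: "i : {1..k}" "interpolate t y v i ~= 0" using nz[OF t] by blast
   moreover have "(\<Sum>j\<le>k. (interpolate t y v j)\<^sup>2) ~= 0" using i by (subst sum_nonneg_eq_0_iff) (auto intro!: bexI[of _ i])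
   ultimately have "?g t i ~= 0" by (simp add: normalize_upto_def)
   from tail[OF gS i(1) this] show ?thesis using gS by (auto simp: N_def)
  qed
  hence "continuous_map (top_of_set {0..1}) (subtopology (nsphere k) (N u)) ?g" for u using g by (auto simp: continuous_map_in_subtopology)
  hence "singular_simplex 1 (subtopology (nsphere k) (N u)) (seg ?g 0 1)" for u by (intro singular_simplex_segment) auto
  from b[OF this] have "b u (?g 0) - b u (?g 1) = \<phi> (seg ?g 0 1)" for u using edge_pt_in[of 0] edge_pt_in[of 1]
   by (simp add: coboundary_def seg_def edge_pt_def)
  moreover have "?g 0 = y" "?g 1 = v" using normalize_upto_id[OF yS] normalize_upto_id[OF v] by (simp_all add: interpolate_def)
  ultimately have *: "b True y - b True v = b False y - b False v" by metis
  have "b True y = (b True y - b True v) + b True v" by simp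
  also have "\<dots> = b False y + (- b False v + b True v)"
   unfolding * by (simp add: diff_conv_add_uminus add.assoc del: add_uminus_conv_diff)
  finally show ?thesis unfolding c_def by (metis add.assoc add_0_left left_minus)
 qed
 have eN: "e j : N True Int N False" if "j : {1..k}" for j using that e[of j] by (auto simp: N_def e_def)
 \<comment> \<open>A point with a nonzero coordinate of index at least 2 is joined to
   \<open>e 1\<close> directly. Otherwise its coordinate 1 is nonzero, and the way leads through
   \<open>e 2\<close>, since the point may be opposite to \<open>e 1\<close>.\<close>
 have c1: "c y = c (e 1)" if y: "y : N True Int N False" for y
 proof (cases "\<exists>i\<in>{2..k}. y i ~= 0")
  case True
  then obtain i where i: "i : {2..k}" "y i ~= 0" by blast
  show ?thesis
  proof (rule const[OF y])
   show "e 1 : ?S" using e k by simp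
   fix t :: real assume "t : {0..1}"
   thus "\<exists>i\<in>{1..k}. interpolate t y (e 1) i ~= 0"
    using i k by (cases "t = 1"; intro bexI[of _ "if t = 1 then 1 else i"]) (auto simp: interpolate_def e_def)
  qed
 next
  case False
  have "y 1 ~= 0"
  proof
   assume y1: "y 1 = 0"
   have "y j = 0" if "j : {..k} - {0}" for j using False y1 that by (cases "j = 1") auto
   hence "(\<Sum>j\<in>{0}. (y j)\<^sup>2) = (\<Sum>j\<le>k. (y j)\<^sup>2)" by (intro sum.mono_neutral_left) auto
   hence "(y 0)\<^sup>2 = 1" using y by (simp add: N_def topspace_nsphere_iff)
   thus False using y by (auto simp: N_def power2_eq_1_iff)
  qed
  have "c y = c (e 2)"
  proof (rule const[OF y])
   show "e 2 : ?S" using e k by simp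
   fix t :: real assume "t : {0..1}"
   thus "\<exists>i\<in>{1..k}. interpolate t y (e 2) i ~= 0" using \<open>y 1 ~= 0\<close> k
    by (cases "t = 1"; intro bexI[of _ "if t = 1 then 2 else 1"]) (auto simp: interpolate_def e_def simp del: One_nat_def)
  qed
  also have "\<dots> = c (e 1)"
  proof (rule const[OF eN])
   show "e 1 : ?S" "2 : {1..k}" using e k by simp_all
   fix t :: real assume "t : {0..1}"
   thus "\<exists>i\<in>{1..k}. interpolate t (e 2) (e 1) i ~= 0"
    using k by (cases "t = 1"; intro bexI[of _ "if t = 1 then 1 else 2"]) (auto simp: interpolate_def e_def)
  qed
  finally show ?thesis .
 qed
 have cH: "c (e 1) : H" using bH[of "e 1" True] bH[of "e 1" False] eN[of 1] k H by (auto simp: c_def subgroup_set_def)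
 define b' where "b' y = (if y : N True then b True y else b False y + c (e 1))" for y
 have b'F: "b' y = b False y + c (e 1)" if "y : N False" for y
 proof (cases "y : N True")
  case True
  have "b False y + c y = b True y" unfolding c_def by (simp flip: add.assoc)
  thus ?thesis using c1[of y] that True by (simp add: b'_def)
 qed (simp add: b'_def)
 have b'H: "b' y : H" if "y : ?S" for y using that bH[of y True] bH[of y False] cH H by (auto simp: b'_def subgroup_set_def N_def)
 have "\<phi> \<tau> = coboundary b' \<tau>" if "singular_simplex 1 (nsphere k) \<tau>" for \<tau>
 proof (rule cocycle_eqI[OF H \<phi> _ _ _ _ that, where N = N])
  show "cocycle (nsphere k) H (coboundary b')" by (rule cocycle_coboundary_fun[OF H b'H])
  have "openin (nsphere k) {y : ?S. y 0 : {..<1}}" "openin (nsphere k) {y : ?S. y 0 : {-1<..}}"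
   by (rule openin_continuous_map_preimage[OF continuous_map_nsphere_projection]; simp)+
  thus "openin (nsphere k) (N u)" for u by (cases u) (simp_all add: N_def)
  have "?S <= N True Un N False" by (auto simp: N_def)
  thus "?S <= (\<Union>u. N u)" by blast
  fix u \<sigma> assume \<sigma>: "singular_simplex 1 (subtopology (nsphere k) (N u)) \<sigma>"
  have "\<sigma> (edge_pt 0) : N u" "\<sigma> (edge_pt 1) : N u"
   using simplex_point_in[OF \<sigma>, of 0] simplex_point_in[OF \<sigma>, of 1] by auto
  hence "coboundary b' \<sigma> = coboundary (b u) \<sigma>"
   using b'F by (cases u) (simp_all add: coboundary_def b'_def diff_conv_add_uminus minus_add add.assoc del: add_uminus_conv_diff)
  thus "\<phi> \<sigma> = coboundary b' \<sigma>" using b[OF \<sigma>] by simp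
 qed
 with b'H show ?thesis by blast
qed

text \<open>On the line, which covers the circle by \<open>cis\<close>, the cocycle is a coboundary.
  The vanishing value on the full turn makes its primitive periodic, so it descends to the circle;
  paths in the circle are lifted by a continuous logarithm.\<close>

lemma cocycle_circle:
 assumes H: "subgroup_set H" and \<phi>: "cocycle (top_of_set (sphere 0 1 :: complex set)) H \<phi>"
  and loop: "\<phi> (seg cis 0 (2 * pi)) = 0"
 shows "\<exists>b. (\<forall>z\<in>sphere 0 1. b z : H) &
  (\<forall>\<tau>. singular_simplex 1 (top_of_set (sphere 0 1)) \<tau> --> \<phi> \<tau> = coboundary b \<tau>)"
proof -
 let ?C = "top_of_set (sphere 0 1 :: complex set)"
 have cis: "continuous_map (top_of_set UNIV) ?C cis" by (auto simp: continuous_map_in_subtopology intro!: continuous_intros)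
 have "continuous_map (prod_topology (top_of_set {0..1}) (top_of_set UNIV)) ?C (%(t, x). cis ((1 - t) * x))"
  unfolding prod_topology_subtopology_eu case_prod_beta' by (auto intro!: continuous_intros)
 from cocycle_coboundary[OF \<phi> this, of 1]
 obtain b where bH: "!!x. b x : H" and b: "!!\<tau>. singular_simplex 1 (top_of_set UNIV) \<tau> ==>
   \<phi> (simplex_map 1 cis \<tau>) = b (\<tau> (edge_pt 0)) - b (\<tau> (edge_pt 1))" by (auto simp: eta_contract_eq)
 note seg = cocycle_segment[OF \<phi> cis, of x for x]
 have per: "b (x + 2 * pi) = b x" for x
 proof -
  have "simplex_map 1 cis (seg (%u. u) x y) = seg cis x y" for x y :: real by (auto simp: simplex_map_def seg_def fun_eq_iff)
  hence bs: "\<phi> (seg cis x y) = b x - b y" for x y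
   using b[of "seg (%u. u) x y"] singular_simplex_segment[of UNIV "top_of_set UNIV" "%u. u" x y]
    edge_pt_in[of 0] edge_pt_in[of 1] by (simp add: seg_def edge_pt_def)
  have "seg cis (2 * pi) (x + 2 * pi) = seg cis 0 x" unfolding seg_def
  proof (rule restrict_ext)
   fix u :: "nat => real" assume "u : standard_simplex 1"
   hence "u 0 + u 1 = 1" by (simp add: standard_simplex_1')
   moreover have "u 0 *\<^sub>R (2 * pi) + u 1 *\<^sub>R (x + 2 * pi) = u 1 * x + (u 0 + u 1) * (2 * pi)" by (simp add: algebra_simps)
   ultimately have "u 0 *\<^sub>R (2 * pi) + u 1 *\<^sub>R (x + 2 * pi) = u 1 * x + 2 * pi" by simp
   thus "cis (u 0 *\<^sub>R (2 * pi) + u 1 *\<^sub>R (x + 2 * pi)) = cis (u 0 *\<^sub>R 0 + u 1 *\<^sub>R x)" by (simp flip: cis_mult)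
  qed
  hence "b (2 * pi) - b (x + 2 * pi) = b 0 - b x" using bs by metis
  moreover have "b 0 - b (2 * pi) = 0" using loop bs by simp
  hence "b (2 * pi) = b 0" by simp
  ultimately show ?thesis by (simp add: diff_conv_add_uminus del: add_uminus_conv_diff)
 qed
 have pern: "b (x + 2 * pi * real n) = b x" for x n
 proof (induction n)
  case (Suc n)
  have "x + 2 * pi * real (Suc n) = (x + 2 * pi * real n) + 2 * pi" by (simp add: algebra_simps)
  with Suc per show ?case by metis
 qed simp
 have peri: "b (x + 2 * pi * of_int n) = b x" for x n
 proof (cases "n >= 0")
  case True
  thus ?thesis using pern[of x "nat n"] by simp
 next
  case False
  thus ?thesis using pern[of "x + 2 * pi * of_int n" "nat (- n)"] by (simp add: algebra_simps)
 qed
 define b' where "b' z = b (Arg2pi z)" for z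
 have b'cis: "b' (cis x) = b x" for x
 proof -
  have "cis (Arg2pi (cis x)) = cis x" using Arg2pi_eq[of "cis x"] by (simp flip: cis_conv_exp)
  hence "sin (Arg2pi (cis x)) = sin x & cos (Arg2pi (cis x)) = cos x" by (simp add: complex_eq_iff)
  then obtain n where "Arg2pi (cis x) = x + 2 * pi * of_int n" unfolding sin_cos_eq_iff by blast
  thus ?thesis using peri by (simp add: b'_def)
 qed
 have "\<phi> \<tau> = coboundary b' \<tau>" if \<tau>: "singular_simplex 1 ?C \<tau>" for \<tau>
 proof -
  have "continuous_map (top_of_set {0..1}) ?C (\<tau> o edge_pt)"
   using \<tau> by (intro continuous_map_compose[OF continuous_map_edge_pt]) (auto simp: singular_simplex_iff)
  hence c: "continuous_on {0..1} (\<tau> o edge_pt)" and n: "t : {0..1} ==> norm (\<tau> (edge_pt t)) = 1" for t by (auto simp: Pi_iff)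
  have ct: "contractible {0..1 :: real}" by (rule convex_imp_contractible) simp
  have nz: "(\<tau> o edge_pt) t ~= 0" if "t : {0..1}" for t using n[OF that] by auto
  obtain g where g: "continuous_on {0..1} g" "!!t. t : {0..1} ==> (\<tau> o edge_pt) t = exp (g t)"
   using continuous_logarithm_on_contractible[OF c ct nz] by blast
  have ex: "\<tau> (edge_pt t) = cis (Im (g t))" if "t : {0..1}" for t
  proof -
   have eq: "\<tau> (edge_pt t) = of_real (exp (Re (g t))) * cis (Im (g t))" using g(2)[OF that] by (simp add: exp_eq_polar)
   hence "exp (Re (g t)) = 1" using n[OF that] by (simp add: norm_mult)
   thus ?thesis using eq by simp
  qed
  let ?\<sigma> = "seg (%t. Im (g t)) 0 1"
  have "continuous_map (top_of_set {0..1}) (top_of_set UNIV) (%t. Im (g t))" using g(1) by (auto intro!: continuous_intros)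
  hence "singular_simplex 1 (top_of_set UNIV) ?\<sigma>" by (rule singular_simplex_segment) auto
  from b[OF this] have "\<phi> (simplex_map 1 cis ?\<sigma>) = b (Im (g 0)) - b (Im (g 1))"
   using edge_pt_in[of 0] edge_pt_in[of 1] by (simp add: seg_def edge_pt_def)
  moreover have "simplex_map 1 cis ?\<sigma> = seg (\<tau> o edge_pt) 0 1"
   using ex by (auto simp: simplex_map_def seg_def fun_eq_iff standard_simplex_1')
  ultimately show ?thesis using b'cis by (simp add: seg_edge_pt[OF \<tau>] coboundary_def ex)
 qed
 with bH show ?thesis by (intro exI[of _ b']) (auto simp: b'_def)
qed

subsection \<open>Extending cocycles over cells of dimension at least three\<close>

lemma subtopology_ndisk_sphere: "subtopology (ndisk (Suc k)) (topspace (nsphere k)) = nsphere k"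
 unfolding ndisk_top_of_set subtopology_subtopology
 by (subst nsphere_top_of_set) (rule arg_cong[where f = top_of_set], auto simp: topspace_nsphere_iff)

lemma continuous_on_square_sum: "continuous_on A (%x :: nat => real. \<Sum>i\<le>k. (x i)\<^sup>2)" by (intro continuous_intros)

lemma ndisk_attachment:
 assumes "characteristic_maps A (ndisk (Suc k)) (topspace (nsphere k)) I \<Phi>"
 shows "punctured_cell_attachment A (ndisk (Suc k)) (topspace (nsphere k)) I \<Phi> (%_. 0) (normalize_upto k)"
proof
 show "characteristic_maps A (ndisk (Suc k)) (topspace (nsphere k)) I \<Phi>" by fact
 let ?D = "{x. (\<forall>i>k. x i = 0) & (\<Sum>i\<le>k. (x i)\<^sup>2) <= 1} :: (nat => real) set"
 have S: "topspace (nsphere k) = ?D Int (%x. \<Sum>i\<le>k. (x i)\<^sup>2) -` {1}" by (auto simp: topspace_nsphere_iff)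
 show "closedin (ndisk (Suc k)) (topspace (nsphere k))"
  unfolding S ndisk_top_of_set by (rule continuous_closedin_preimage[OF continuous_on_square_sum]) simp
 have D0: "x : ?D - {%_. 0} ==> (\<Sum>i\<le>k. (x i)\<^sup>2) ~= 0" for x
  by (auto simp: sum_nonneg_eq_0_iff fun_eq_iff) (metis atMost_iff not_le)
 show "(%_. 0) : topspace (ndisk (Suc k)) - topspace (nsphere k)" by (auto simp: topspace_nsphere_iff ndisk_top_of_set)
 thus "closedin (ndisk (Suc k)) {%_. 0}" unfolding ndisk_top_of_set by (auto simp: closedin_closed intro!: exI[of _ "{%_. 0}"])
 have "continuous_on (?D - {%_. 0}) (%x. normalize_upto k x)" using D0 by (intro continuous_on_normalize_upto continuous_on_id) auto
 moreover have "normalize_upto k x : topspace (nsphere k)" if "x : ?D - {%_. 0}" for x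
  using normalize_upto_in[of k x] D0[OF that] that by blast
 ultimately show "continuous_map (subtopology (ndisk (Suc k)) (topspace (ndisk (Suc k)) - {%_. 0}))
   (subtopology (ndisk (Suc k)) (topspace (nsphere k))) (normalize_upto k)" unfolding subtopology_ndisk_sphere ndisk_top_of_set
  by (subst nsphere_top_of_set) (auto simp: subtopology_subtopology topspace_nsphere_iff Int_absorb1)
qed (rule normalize_upto_id)

lemma t1_space_ndisk: "t1_space (ndisk (Suc k))"
 unfolding ndisk_top_of_set by (intro Hausdorff_imp_t1_space Hausdorff_space_subtopology) simp

text \<open>The index is shifted: stage \<open>j\<close> contains the cells attached up to dimension
  \<open>m + j\<close>, so stage 0 is the initial space.\<close>

locale cell_filtration =
 fixes m :: nat and Xs :: "nat => 'x topology" and X :: "'x topology"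
 assumes step: "!!j. \<exists>(I :: 'x set) \<Phi>.
   characteristic_maps (Xs j) (ndisk (Suc (m + j))) (topspace (nsphere (m + j))) I \<Phi> &
   Xs (Suc j) = attach_cells (Xs j) (ndisk (Suc (m + j))) I \<Phi>"
  and colimit: "!!U. openin X U \<longleftrightarrow>
   U <= (\<Union>j. topspace (Xs j)) & (\<forall>j. openin (Xs j) (U Int topspace (Xs j)))"
begin

lemma attachment:
 obtains I :: "'x set" and \<Phi> where
  "punctured_cell_attachment (Xs j) (ndisk (Suc (m + j))) (topspace (nsphere (m + j))) I \<Phi> (%_. 0) (normalize_upto (m + j))"
  "Xs (Suc j) = attach_cells (Xs j) (ndisk (Suc (m + j))) I \<Phi>" using step[of j] ndisk_attachment by blast

lemma Suc_facts:
 "topspace (Xs j) <= topspace (Xs (Suc j))" "closedin (Xs j) C ==> closedin (Xs (Suc j)) C"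
 "subtopology (Xs (Suc j)) (topspace (Xs j)) = Xs j" "t1_space (Xs j) ==> t1_space (Xs (Suc j))"
proof -
 obtain I :: "'x set" and \<Phi> where a: "punctured_cell_attachment (Xs j) (ndisk (Suc (m + j))) (topspace (nsphere (m + j))) I \<Phi> (%_. 0) (normalize_upto (m + j))"
  and eq: "Xs (Suc j) = attach_cells (Xs j) (ndisk (Suc (m + j))) I \<Phi>" by (rule attachment)
 interpret punctured_cell_attachment "Xs j" "ndisk (Suc (m + j))" "topspace (nsphere (m + j))" I \<Phi> "%_. 0" "normalize_upto (m + j)"
  by (rule a)
 show "topspace (Xs j) <= topspace (Xs (Suc j))" unfolding eq topspace_attach_cells by blast
 show "closedin (Xs (Suc j)) C" if "closedin (Xs j) C" unfolding eq using closedin_attach[OF that] .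
 show "subtopology (Xs (Suc j)) (topspace (Xs j)) = Xs j" unfolding eq by (rule subtopology_attach)
 show "t1_space (Xs (Suc j))" if "t1_space (Xs j)" unfolding eq using t1_attach[OF that t1_space_ndisk] .
qed

lemma topspace_mono: "i <= j ==> topspace (Xs i) <= topspace (Xs j)" by (induction rule: dec_induct) (use Suc_facts(1) in auto)

lemma closedin_mono: "i <= j ==> closedin (Xs i) C ==> closedin (Xs j) C" by (induction rule: dec_induct) (use Suc_facts(2) in auto)

lemma subtopology_mono: "i <= j ==> subtopology (Xs j) (topspace (Xs i)) = Xs i"
proof (induction rule: dec_induct)
 case (step j)
 have "subtopology (Xs (Suc j)) (topspace (Xs i)) = subtopology (subtopology (Xs (Suc j)) (topspace (Xs j))) (topspace (Xs i))"
  using topspace_mono[OF step.hyps(1)] by (simp add: subtopology_subtopology Int_absorb1)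
 thus ?case using step.IH by (simp add: Suc_facts(3))
qed simp

lemma topspace_colimit: "topspace X = (\<Union>j. topspace (Xs j))"
proof
 show "topspace X <= (\<Union>j. topspace (Xs j))" using openin_topspace[of X] unfolding colimit by blast
 have "(\<Union>j. topspace (Xs j)) Int topspace (Xs i) = topspace (Xs i)" for i by blast
 hence "openin X (\<Union>j. topspace (Xs j))" unfolding colimit by simp
 thus "(\<Union>j. topspace (Xs j)) <= topspace X" by (rule openin_subset)
qed

lemma closedin_colimit:
 assumes "C <= topspace X" "!!j. closedin (Xs j) (C Int topspace (Xs j))"
 shows "closedin X C"
proof -
 have "(topspace X - C) Int topspace (Xs j) = topspace (Xs j) - C Int topspace (Xs j)" for j by (auto simp: topspace_colimit)
 hence "openin X (topspace X - C)" unfolding colimit using assms(2) by (auto simp: topspace_colimit closedin_def)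
 with assms(1) show ?thesis by (simp add: closedin_def)
qed

lemma subtopology_colimit: "subtopology X (topspace (Xs i)) = Xs i"
proof (rule topology_eq[THEN iffD2], intro allI iffI)
 fix U assume "openin (subtopology X (topspace (Xs i))) U"
 thus "openin (Xs i) U" unfolding openin_subtopology colimit by auto
next
 fix U assume U: "openin (Xs i) U"
 let ?C = "topspace (Xs i) - U"
 have C: "closedin (Xs i) ?C" using U by (simp add: closedin_diff)
 have "closedin X ?C"
 proof (rule closedin_colimit)
  fix j
  show "closedin (Xs j) (?C Int topspace (Xs j))"
  proof (cases "i <= j")
   case True
   thus ?thesis using closedin_mono[OF True C] topspace_mono[OF True] by (simp add: Int_absorb2 subset_iff)
  next
   case False
   hence "subtopology (Xs i) (topspace (Xs j)) = Xs j" by (simp add: subtopology_mono)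
   with C show ?thesis by (metis closedin_subtopology)
  qed
 qed (auto simp: topspace_colimit)
 hence "openin X (topspace X - ?C)" by blast
 moreover have "U = (topspace X - ?C) Int topspace (Xs i)" using openin_subset[OF U] by (auto simp: topspace_colimit)
 ultimately show "openin (subtopology X (topspace (Xs i))) U" unfolding openin_subtopology by blast
qed

text \<open>A point outside each stage yields an infinite closed discrete set in the compact image.\<close>

lemma compact_image_in_stage:
 assumes t1: "t1_space (Xs 0)" and K: "compact_space K" and f: "continuous_map K X f"
 shows "\<exists>j. f ` topspace K <= topspace (Xs j)"
proof (rule ccontr)
 assume "~ ?thesis"
 hence "\<forall>j. \<exists>x. x : topspace K & f x ~: topspace (Xs j)" by blast
 then obtain x where x: "!!j. x j : topspace K" "!!j. f (x j) ~: topspace (Xs j)" by metis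
 have t1j: "t1_space (Xs j)" for j by (induction j) (use t1 Suc_facts(4) in auto)
 define C where "C j = (%i. f (x i)) ` {j..}" for j
 have fX: "f (x i) : topspace X" for i using f x(1) by (auto simp: continuous_map_def)
 have Cm: "C j Int topspace (Xs n) <= (%i. f (x i)) ` {..<n}" for j n
  using x(2) topspace_mono by (auto simp: C_def) (meson imageI lessThan_iff not_le subsetD)
 have closed: "closedin X (C j)" for j
 proof (rule closedin_colimit)
  show "closedin (Xs n) (C j Int topspace (Xs n))" for n using t1j[of n] finite_subset[OF Cm] by (auto simp: t1_space_closedin_finite)
 qed (use fX in \<open>auto simp: C_def\<close>)
 have "compactin X (f ` topspace K)" using K f image_compactin unfolding compact_space_def by blast
 moreover have "openin X U" if "U : range (%j. topspace X - C j)" for U using closed that by blast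
 moreover have "f ` topspace K <= \<Union> (range (%j. topspace X - C j))"
 proof
  fix y assume "y : f ` topspace K"
  hence "y : topspace X" using f by (auto simp: continuous_map_def)
  then obtain n where n: "y : topspace (Xs n)" by (auto simp: topspace_colimit)
  have "y ~: C n" using n x(2) topspace_mono by (fastforce simp: C_def)
  thus "y : \<Union> (range (%j. topspace X - C j))" using \<open>y : topspace X\<close> by blast
 qed
 ultimately obtain F where F: "finite F" "F <= range (%j. topspace X - C j)" "f ` topspace K <= \<Union>F" unfolding compactin_def by meson
 obtain J where J: "finite J" "F = (%j. topspace X - C j) ` J" using finite_subset_image[OF F(1,2)] by blast
 obtain n where n: "!!j. j : J ==> j <= n" using J(1) by (meson finite_nat_set_iff_bounded_le)
 have "f (x n) : \<Union>F" using F(3) x(1) by blast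
 then obtain j where "j : J" "f (x n) ~: C j" unfolding J(2) by blast
 thus False using n by (auto simp: C_def)
qed

lemma simplex_in_stage:
 assumes "t1_space (Xs 0)" "singular_simplex p X \<sigma>"
 obtains j where "singular_simplex p (Xs j) \<sigma>"
proof -
 have "compact_space (top_of_set (standard_simplex p))"
  using compactin_standard_simplex[of p] by (intro compact_space_subtopology) (simp add: euclidean_product_topology)
 with compact_image_in_stage[OF assms(1)] assms(2)
 obtain j where "\<sigma> ` standard_simplex p <= topspace (Xs j)" unfolding singular_simplex_iff by fastforce
 hence "singular_simplex p (subtopology X (topspace (Xs j))) \<sigma>" using assms(2) by (simp add: singular_simplex_subtopology)
 thus thesis using that[of j] by (simp add: subtopology_colimit)
qed

lemma simplex_mono: "i <= j ==> singular_simplex p (Xs i) \<sigma> ==> singular_simplex p (Xs j) \<sigma>"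
 by (metis subtopology_mono singular_simplex_subtopology)

text \<open>The boundary spheres have dimension at least 2 and carry only coboundaries, so no stage
  offers an obstruction. Every simplex of \<open>X\<close> lies in a stage by compactness, so the
  stagewise extensions define a cocycle on \<open>X\<close>.\<close>

lemma extend_cocycle_colimit:
 assumes m: "m >= 2" and t1: "t1_space (Xs 0)" and H: "subgroup_set H" and \<phi>: "cocycle (Xs 0) H \<phi>"
 shows "\<exists>\<phi>'. cocycle X H \<phi>' & (\<forall>\<tau>. singular_simplex 1 (Xs 0) \<tau> --> \<phi>' \<tau> = \<phi> \<tau>)"
proof -
 let ?ext = "%j \<psi> \<psi>'. \<forall>\<tau>. singular_simplex 1 (Xs j) \<tau> --> \<psi>' \<tau> = \<psi> \<tau>"
 have one: "\<exists>\<psi>'. cocycle (Xs (Suc j)) H \<psi>' & ?ext j \<psi> \<psi>'" if \<psi>: "cocycle (Xs j) H \<psi>" for j \<psi>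
 proof -
  obtain I :: "'x set" and \<Phi> where a: "punctured_cell_attachment (Xs j) (ndisk (Suc (m + j))) (topspace (nsphere (m + j))) I \<Phi> (%_. 0) (normalize_upto (m + j))"
   and eq: "Xs (Suc j) = attach_cells (Xs j) (ndisk (Suc (m + j))) I \<Phi>" by (rule attachment)
  interpret punctured_cell_attachment "Xs j" "ndisk (Suc (m + j))" "topspace (nsphere (m + j))" I \<Phi> "%_. 0" "normalize_upto (m + j)"
   by (rule a)
  have "\<exists>b. (\<forall>z\<in>topspace (nsphere (m + j)). b z : H) & (\<forall>\<tau>. singular_simplex 1 (nsphere (m + j)) \<tau> -->
    \<psi> (simplex_map 1 (\<Phi> i) \<tau>) = coboundary b \<tau>)" if i: "i : I" for i
  proof (rule cocycle_nsphere[OF _ H])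
   show "cocycle (nsphere (m + j)) H (%\<tau>. \<psi> (simplex_map 1 (\<Phi> i) \<tau>))"
    using char i by (intro cocycle_pullback[OF \<psi>]) (simp add: characteristic_maps_def subtopology_ndisk_sphere)
  qed (use m in simp)
  then obtain b where "!!i z. i : I ==> z : topspace (nsphere (m + j)) ==> b i z : H"
   "!!i \<tau>. i : I ==> singular_simplex 1 (nsphere (m + j)) \<tau> ==> \<psi> (simplex_map 1 (\<Phi> i) \<tau>) = coboundary (b i) \<tau>"
   by metis
  with extend_cocycle[OF H \<psi>, of b] show ?thesis unfolding eq subtopology_ndisk_sphere by blast
 qed
 have "\<exists>\<psi>. \<forall>j. (cocycle (Xs j) H (\<psi> j) & (j = 0 --> \<psi> j = \<phi>)) & ?ext j (\<psi> j) (\<psi> (Suc j))"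
  using \<phi> one by (intro dependent_nat_choice) auto
 then obtain \<psi> where \<psi>: "!!j. cocycle (Xs j) H (\<psi> j)" "\<psi> 0 = \<phi>" "!!j. ?ext j (\<psi> j) (\<psi> (Suc j))" by metis
 have mono: "\<psi> j \<tau> = \<psi> i \<tau>" if "i <= j" "singular_simplex 1 (Xs i) \<tau>" for i j \<tau>
  using that by (induction rule: dec_induct) (use \<psi>(3) simplex_mono in auto)
 define \<phi>' where "\<phi>' \<tau> = \<psi> (LEAST j. singular_simplex 1 (Xs j) \<tau>) \<tau>" for \<tau>
 have \<phi>': "\<phi>' \<tau> = \<psi> j \<tau>" if "singular_simplex 1 (Xs j) \<tau>" for \<tau> j
 proof -
  let ?P = "%j. singular_simplex 1 (Xs j) \<tau>"
  have "(LEAST j. ?P j) <= j" "?P (LEAST j. ?P j)" using Least_le[of ?P j] LeastI[of ?P j] that by blast+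
  thus ?thesis unfolding \<phi>'_def by (rule mono[symmetric])
 qed
 have "cocycle X H \<phi>'" unfolding cocycle_def
 proof (intro conjI allI impI)
  fix \<tau> assume "singular_simplex 1 X \<tau>"
  with t1 obtain j where "singular_simplex 1 (Xs j) \<tau>" by (rule simplex_in_stage)
  thus "\<phi>' \<tau> : H" using \<phi>' \<psi>(1)[of j] by (simp add: cocycle_def)
 next
  fix \<sigma> p q s assume t: "triangle X \<sigma> p q s"
  hence "singular_simplex 2 X \<sigma>" by (simp add: triangle_def)
  with t1 obtain j where "singular_simplex 2 (Xs j) \<sigma>" by (rule simplex_in_stage)
  hence tj: "triangle (Xs j) \<sigma> p q s" using t by (simp add: triangle_def)
  hence "\<psi> j s = \<psi> j p + \<psi> j q" using \<psi>(1)[of j] unfolding cocycle_def by blast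
  thus "\<phi>' s = \<phi>' p + \<phi>' q" using triangle_edges[OF tj] \<phi>' by simp
 qed
 thus ?thesis using \<phi>' \<psi>(2) by (intro exI[of _ \<phi>']) simp
qed

end

lemma cells_attached_above_filtration:
 assumes "cells_attached_above n A X"
 obtains Xs where "cell_filtration n Xs X" "Xs 0 = A"
proof -
 from assms obtain Ys where Ys: "Ys n = A" "!!k. k >= n ==> \<exists>(I :: 'a set) \<Phi>.
   characteristic_maps (Ys k) (ndisk (Suc k)) (topspace (nsphere k)) I \<Phi> &
   Ys (Suc k) = attach_cells (Ys k) (ndisk (Suc k)) I \<Phi>"
  "!!U. openin X U \<longleftrightarrow> U <= (\<Union>k\<in>{n..}. topspace (Ys k)) & (\<forall>k\<ge>n. openin (Ys k) (U Int topspace (Ys k)))"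
  unfolding cells_attached_above_def by metis
 have "cell_filtration n (%j. Ys (n + j)) X"
 proof
  show "\<exists>(I :: 'a set) \<Phi>. characteristic_maps (Ys (n + j)) (ndisk (Suc (n + j))) (topspace (nsphere (n + j))) I \<Phi> &
   Ys (n + Suc j) = attach_cells (Ys (n + j)) (ndisk (Suc (n + j))) I \<Phi>" for j using Ys(2)[of "n + j"] by simp
  have "(\<Union>k\<in>{n..}. topspace (Ys k)) = (\<Union>j. topspace (Ys (n + j)))" by (auto simp: le_iff_add) (metis atLeast_iff le_add1)
  moreover have "(\<forall>k\<ge>n. openin (Ys k) (U Int topspace (Ys k))) = (\<forall>j. openin (Ys (n + j)) (U Int topspace (Ys (n + j))))" for U
   by (auto simp: le_iff_add)
  ultimately show "openin X U = (U <= (\<Union>j. topspace (Ys (n + j))) & (\<forall>j. openin (Ys (n + j)) (U Int topspace (Ys (n + j)))))" for U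
   unfolding Ys(3) by simp
 qed
 thus thesis using that[of "%j. Ys (n + j)"] Ys(1) by simp
qed

section \<open>The presentation complex\<close>

lemma t1_space_top_of_set: "t1_space (top_of_set (A :: 'b::metric_space set))"
 by (intro Hausdorff_imp_t1_space Hausdorff_space_subtopology) simp

lemma edge_map_end [simp]: "edge_map s 0 = Vertex" "edge_map s 1 = Vertex" by (simp_all add: edge_map_def)

lemma rose_attachment:
 "punctured_cell_attachment (discrete_topology {Vertex}) (top_of_set {0..1}) {0, 1} S edge_map (1/2)
  (%t. if t < 1/2 then 0 else 1)"
proof
 let ?I = "top_of_set {0..1 :: real}"
 show "characteristic_maps (discrete_topology {Vertex}) ?I {0, 1} S edge_map" unfolding characteristic_maps_def
 proof (intro conjI ballI)
  show "continuous_map (subtopology ?I {0, 1}) (discrete_topology {Vertex}) (edge_map s)" for s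
   by (rule continuous_map_eq[of _ _ "%_. Vertex"]) auto
  show "inj_on (%(s, t). edge_map s t) (S \<times> (topspace ?I - {0, 1}))" by (auto simp: inj_on_def edge_map_def split: if_splits)
  show "edge_map s t ~: topspace (discrete_topology {Vertex})" if "t : topspace ?I - {0, 1}" for s t using that by (auto simp: edge_map_def)
 qed
 show "closedin ?I {0, 1}" "closedin ?I {1/2}" by (rule closed_subset; simp)+
 have "continuous_on ({0..1} - {1/2}) (%t :: real. if t < 1/2 then 0 else 1 :: real)"
 proof -
  have "continuous_on ({0..1} - {1/2}) (%t :: real. (sgn (t - 1/2) + 1) / 2)" by (intro continuous_intros) auto
  thus ?thesis by (rule continuous_on_eq) (auto simp: sgn_if)
 qed
 moreover have "{0..1} Int ({0..1} - {1/2}) = {0..1} - {1/2 :: real}" by auto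
 ultimately show "continuous_map (subtopology ?I (topspace ?I - {1/2})) (subtopology ?I {0, 1}) (%t. if t < 1/2 then 0 else 1)"
  by (auto simp: subtopology_subtopology continuous_map_in_subtopology)
qed auto

lemma t1_space_rose: "t1_space (rose S)"
proof -
 interpret punctured_cell_attachment "discrete_topology {Vertex}" "top_of_set {0..1}" "{0, 1}" S edge_map "1/2"
   "%t. if t < 1/2 then 0 else 1" by (rule rose_attachment)
 show ?thesis unfolding rose_def by (rule t1_attach) (simp_all add: t1_space_top_of_set t1_space_closedin_singleton)
qed

lemma continuous_map_edge: "s : S ==> continuous_map (top_of_set {0..1}) (rose S) (edge_map s)"
 unfolding rose_def by (rule continuous_map_characteristic)

lemma Vertex_in_rose: "Vertex : topspace (rose S)" by (simp add: rose_def topspace_attach_cells)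

section \<open>Paths that spell words\<close>

definition letter_value :: "('a => 'g::group_add) => 'a letter => 'g" where
 "letter_value h x = (if snd x then h (fst x) else - h (fst x))"

text \<open>\<open>word_loop\<close> with one unit of time per letter.\<close>

definition word_path :: "'a word => real => 'a cell_point" where
 "word_path r x = edge_map (fst (r ! nat \<lfloor>x\<rfloor>)) (if snd (r ! nat \<lfloor>x\<rfloor>) then frac x else 1 - frac x)"

lemma word_loop_path: "word_loop r t = word_path r (t * real (length r))" by (simp add: word_loop_def word_path_def Let_def case_prod_beta')

lemma word_path_nat [simp]: "word_path r (real k) = Vertex" "word_path r 0 = Vertex" by (simp_all add: word_path_def frac_def)

text \<open>At the right end point the definition already looks beyond the letter \<open>k\<close>,
  but \<open>frac\<close> is 0 there and both formulas give \<open>Vertex\<close>.\<close>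

lemma word_path_segment:
 assumes "real k <= x" "x <= real k + 1"
 shows "word_path r x = edge_map (fst (r ! k)) (if snd (r ! k) then x - real k else 1 - (x - real k))"
proof (cases "x = real k + 1")
 case True
 hence "x = real (Suc k)" by simp
 thus ?thesis using word_path_nat(1)[of r "Suc k"] by (simp add: algebra_simps)
next
 case False
 hence "\<lfloor>x\<rfloor> = int k" using assms by (intro floor_unique) auto
 thus ?thesis by (simp add: word_path_def frac_def)
qed

lemma continuous_map_word_path:
 assumes "fst ` set r <= S"
 shows "continuous_map (top_of_set {0..real (length r)}) (rose S) (word_path r)"
proof (cases "r = []")
 case True
 hence "continuous_map (top_of_set {0..real (length r)}) (rose S) (%_. Vertex)" using Vertex_in_rose[of S] by simp
 thus ?thesis by (rule continuous_map_eq) (use True in auto)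
next
 case False
 let ?X = "top_of_set {0..real (length r)}"
 show ?thesis
 proof (rule pasting_lemma_closed[of "{..<length r}" ?X "%k. {real k..real k + 1}" _ "%_. word_path r"])
  show "closedin ?X {real k..real k + 1}" if "k : {..<length r}" for k
   using that by (auto simp: closedin_closed intro!: exI[of _ "{real k..real k + 1}"])
  fix k assume k: "k : {..<length r}"
  let ?g = "%x. if snd (r ! k) then x - real k else 1 - (x - real k)"
  have "fst (r ! k) : S" using assms k by (auto simp: image_subset_iff)
  moreover have "continuous_map (subtopology ?X {real k..real k + 1}) (top_of_set {0..1}) ?g"
   by (auto simp: subtopology_subtopology continuous_map_in_subtopology intro!: continuous_intros)
  ultimately have "continuous_map (subtopology ?X {real k..real k + 1}) (rose S) (edge_map (fst (r ! k)) o ?g)"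
   by (intro continuous_map_compose[OF _ continuous_map_edge])
  thus "continuous_map (subtopology ?X {real k..real k + 1}) (rose S) (word_path r)"
   by (rule continuous_map_eq) (use word_path_segment[of k _ r] in auto)
 next
  fix x assume x: "x : topspace ?X"
  show "\<exists>k. k : {..<length r} & x : {real k..real k + 1} & word_path r x = word_path r x"
  proof (cases "x = real (length r)")
   case True
   thus ?thesis using False by (intro exI[of _ "length r - 1"]) (auto simp: of_nat_diff Suc_leI)
  next
   case False
   hence "nat \<lfloor>x\<rfloor> < length r" using x by (auto simp: floor_less_iff nat_less_iff)
   thus ?thesis using x by (intro exI[of _ "nat \<lfloor>x\<rfloor>"]) (auto simp: of_nat_nat)
  qed
 qed auto
qed

lemma face_map_cis:
 assumes "0 <= x" "x <= 2 * pi"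
 shows "face_map r (cis x) = word_path r (x / (2 * pi) * real (length r))"
\<comment> \<open>At the end of the full turn \<open>Arg2pi\<close> jumps back to 0, where the path
  has the same value.\<close>
proof (cases "x = 2 * pi")
 case True
 hence "Arg2pi (cis x) = 0" by (simp add: Arg2pi_eq_0)
 thus ?thesis using True by (simp add: face_map_def word_loop_path)
next
 case False
 hence "Arg2pi (cis x) = x" using assms by (intro Arg2pi_unique[of 1]) (auto simp: cis_conv_exp)
 thus ?thesis by (simp add: face_map_def word_loop_path)
qed

lemma cis_surj: "z : sphere 0 1 ==> \<exists>x. 0 <= x & x < 2 * pi & z = cis x"
 using Arg2pi[of z] by (intro exI[of _ "Arg2pi z"]) (simp add: is_Arg_def cis_conv_exp)

text \<open>The jump of \<open>Arg2pi\<close> is avoided: \<open>cis\<close> makes the circle a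
  quotient of [0, 2 pi], and on this interval the map is a reparametrised
  \<open>word_path\<close>.\<close>

lemma continuous_map_face_boundary:
 assumes "fst ` set r <= S"
 shows "continuous_map (top_of_set (sphere 0 1)) (rose S) (face_map r)"
proof (rule continuous_compose_quotient_map)
 show "quotient_map (top_of_set {0..2 * pi}) (top_of_set (sphere 0 1)) cis"
 proof (rule continuous_closed_imp_quotient_map)
  have im: "cis ` {0..2 * pi} = sphere 0 1" using cis_surj by (auto simp: image_iff) (metis atLeastAtMost_iff less_imp_le mem_sphere_0)
  thus "cis ` topspace (top_of_set {0..2 * pi}) = topspace (top_of_set (sphere 0 1))" by simp
  show "closed_map (top_of_set {0..2 * pi}) (top_of_set (sphere 0 1)) cis" by (rule continuous_imp_closed_map)
    (auto simp: continuous_map_in_subtopology intro!: continuous_intros compact_space_subtopology Hausdorff_space_subtopology)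
 qed (auto simp: continuous_map_in_subtopology intro!: continuous_intros)
 have "continuous_map (top_of_set {0..2 * pi}) (top_of_set {0..real (length r)}) (%x. x / (2 * pi) * real (length r))"
 proof -
  have "x / (2 * pi) * real (length r) <= real (length r)" if "0 <= x" "x <= 2 * pi" for x
   using that mult_right_mono[of "x / (2 * pi)" 1 "real (length r)"] by simp
  thus ?thesis by (auto simp: continuous_map_in_subtopology intro!: continuous_intros)
 qed
 from continuous_map_compose[OF this continuous_map_word_path[OF assms]]
 show "continuous_map (top_of_set {0..2 * pi}) (rose S) (face_map r o cis)" by (rule continuous_map_eq) (simp add: face_map_cis)
qed

lemma presentation_attachment:
 assumes "fst ` set r <= S"
 shows "punctured_cell_attachment (rose S) (top_of_set (cball 0 1)) (sphere 0 1) {()} (%_. face_map r) 0 sgn"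
proof
 let ?D = "top_of_set (cball 0 1 :: complex set)"
 have S: "subtopology ?D (sphere 0 1) = top_of_set (sphere 0 1)" by (simp add: subtopology_subtopology Int_absorb1 sphere_cball)
 show "characteristic_maps (rose S) ?D (sphere 0 1) {()} (%_. face_map r)" unfolding characteristic_maps_def S
  using continuous_map_face_boundary[OF assms]
  by (auto simp: inj_on_def face_map_def rose_def topspace_attach_cells edge_map_def dist_norm split: if_splits)
 show "closedin ?D (sphere 0 1)" "closedin ?D {0}" by (rule closed_subset; simp add: sphere_cball)+
 show "continuous_map (subtopology ?D (topspace ?D - {0})) (subtopology ?D (sphere 0 1)) sgn" unfolding S
  by (auto simp: subtopology_subtopology continuous_map_in_subtopology norm_sgn sgn_div_norm[abs_def] intro!: continuous_intros)
qed (auto simp: sgn_div_norm)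

lemma continuous_map_face: "continuous_map (top_of_set (cball 0 1)) (presentation_complex S r) (face_map r)"
 using continuous_map_characteristic[of "()" "{()}" _ "rose S" "%_. face_map r"] by (simp add: presentation_complex_def)

lemma presentation_rose:
 assumes "fst ` set r <= S"
 shows "subtopology (presentation_complex S r) (topspace (rose S)) = rose S" "t1_space (presentation_complex S r)"
proof -
 interpret punctured_cell_attachment "rose S" "top_of_set (cball 0 1)" "sphere 0 1" "{()}" "%_. face_map r" 0 sgn
  by (rule presentation_attachment[OF assms])
 show "subtopology (presentation_complex S r) (topspace (rose S)) = rose S" unfolding presentation_complex_def by (rule subtopology_attach)
 show "t1_space (presentation_complex S r)" unfolding presentation_complex_def by (rule t1_attach[OF t1_space_rose t1_space_top_of_set])
qed

section \<open>Cocycles with prescribed values on the generators\<close>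

lemma rose_cocycle:
 assumes H: "subgroup_set H" and h: "!!s. s : S ==> h s : H"
 shows "\<exists>\<phi>. cocycle (rose S) H \<phi> & (\<forall>s\<in>S. \<phi> (seg (edge_map s) 0 1) = h s)"
proof -
 interpret punctured_cell_attachment "discrete_topology {Vertex}" "top_of_set {0..1}" "{0, 1}" S edge_map "1/2"
   "%t. if t < 1/2 then 0 else 1" by (rule rose_attachment)
 \<comment> \<open>The coboundary of this function across the edge \<open>s\<close>, from parameter
   0 to 1, is \<open>h s\<close>.\<close>
 define b where "b s t = (if t = 0 then h s else 0)" for s and t :: real
 have "\<exists>\<phi>. cocycle (rose S) H \<phi> & (\<forall>\<tau>. singular_simplex 1 (discrete_topology {Vertex}) \<tau> --> \<phi> \<tau> = 0) &
  (\<forall>i\<in>S. \<forall>\<tau>. singular_simplex 1 (top_of_set {0..1}) \<tau> --> \<tau> (edge_pt 0) : {0, 1} --> \<tau> (edge_pt 1) : {0, 1} -->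
   \<phi> (simplex_map 1 (edge_map i) \<tau>) = coboundary (b i) \<tau>)" unfolding rose_def
 proof (rule extend_cocycle[OF H])
  show "cocycle (discrete_topology {Vertex}) H (%_. 0)" using H by (simp add: cocycle_def subgroup_set_def)
  show "b s z : H" if "s : S" "z : {0, 1}" for s z using h that H by (auto simp: b_def subgroup_set_def)
  fix s and \<tau> :: "(nat => real) => real"
  assume \<tau>: "singular_simplex 1 (subtopology (top_of_set {0..1}) {0, 1}) \<tau>"
  have deq: "subtopology (top_of_set {0..1}) {0, 1 :: real} = discrete_topology {0, 1}"
   by (rule finite_t1_space_imp_discrete_topology) (auto simp: subtopology_subtopology intro: t1_space_top_of_set)
  have "continuous_map (top_of_set (standard_simplex 1)) (discrete_topology {0, 1}) \<tau>"
   unfolding deq[symmetric] using \<tau> unfolding singular_simplex_iff by (rule conjunct1)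
  from connectedin_continuous_map_image[OF this, of "standard_simplex 1"]
  have "\<exists>a. \<tau> ` standard_simplex 1 <= {a}"
   using connected_standard_simplex by (simp add: connectedin_subtopology connectedin_discrete_topology)
  hence "\<tau> (edge_pt 0) = \<tau> (edge_pt 1)" using edge_pt_in[of 0] edge_pt_in[of 1] by auto
  thus "0 = coboundary (b s) \<tau>" by (simp add: coboundary_def)
 qed
 then obtain \<phi> where \<phi>: "cocycle (rose S) H \<phi>" and *: "\<forall>i\<in>S. \<forall>\<tau>. singular_simplex 1 (top_of_set {0..1}) \<tau> -->
   \<tau> (edge_pt 0) : {0, 1} --> \<tau> (edge_pt 1) : {0, 1} --> \<phi> (simplex_map 1 (edge_map i) \<tau>) = coboundary (b i) \<tau>"
  by (elim exE conjE) (rule that)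
 have "\<phi> (seg (edge_map s) 0 1) = h s" if s: "s : S" for s
 proof -
  let ?\<tau> = "seg (%t. t) 0 (1 :: real)"
  have "singular_simplex 1 (top_of_set {0..1}) ?\<tau>" by (rule singular_simplex_segment[of "{0..1}"]) auto
  moreover have pt: "?\<tau> (edge_pt 0) = 0" "?\<tau> (edge_pt 1) = 1"
   using edge_pt_in[of 0] edge_pt_in[of 1] by (simp_all add: seg_def edge_pt_def)
  ultimately have "\<phi> (simplex_map 1 (edge_map s) ?\<tau>) = coboundary (b s) ?\<tau>" using *[rule_format, OF s, of ?\<tau>] by simp
  with pt have "\<phi> (simplex_map 1 (edge_map s) ?\<tau>) = h s" by (simp add: coboundary_def b_def)
  moreover have "simplex_map 1 (edge_map s) ?\<tau> = seg (edge_map s) 0 1" by (auto simp: simplex_map_def seg_def fun_eq_iff)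
  ultimately show ?thesis by simp
 qed
 with \<phi> show ?thesis by blast
qed

lemma cocycle_inverse_segment:
 assumes "cocycle X H \<phi>" "continuous_map (top_of_set K) X f" "convex K" "a : K" "b : K"
 shows "\<phi> (seg f b a) = - \<phi> (seg f a b)"
proof -
 have "f a : topspace X" using assms(2,4) by (auto simp: continuous_map_def)
 with cocycle_segment[OF assms(1-3), of a b a] assms(4,5) cocycle_segment_refl[OF assms(1), of f a]
 have "\<phi> (seg f a b) + \<phi> (seg f b a) = 0" by simp
 thus ?thesis by (simp add: add_eq_0_iff)
qed

lemma cocycle_word_path:
 assumes \<phi>: "cocycle (rose S) H \<phi>" "!!s. s : S ==> \<phi> (seg (edge_map s) 0 1) = h s"
  and r: "fst ` set r <= S" and k: "k <= length r"
 shows "\<phi> (seg (word_path r) 0 (real k)) = sum_list (map (letter_value h) (take k r))" using k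
proof (induction k)
 case 0
 thus ?case using cocycle_segment_refl[OF \<phi>(1), of "word_path r" 0] Vertex_in_rose[of S] by simp
next
 case (Suc k)
 let ?s = "fst (r ! k)"
 have s: "?s : S" using r Suc.prems by (auto simp: image_subset_iff)
 have "seg (word_path r) (real k) (real (Suc k)) =
  (if snd (r ! k) then seg (edge_map ?s) 0 1 else seg (edge_map ?s) 1 0)"
 proof
  fix u
  show "seg (word_path r) (real k) (real (Suc k)) u =
   (if snd (r ! k) then seg (edge_map ?s) 0 1 else seg (edge_map ?s) 1 0) u"
  proof (cases "u : standard_simplex 1")
   case True
   hence u: "0 <= u 0" "0 <= u 1" "u 0 + u 1 = 1" by (auto simp: standard_simplex_1')
   hence e: "u 0 * real k + u 1 * real (Suc k) = real k + u 1" by (simp add: algebra_simps flip: distrib_left)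
   have u0: "u 0 = 1 - u 1" "u 1 <= 1" using u by auto
   have "word_path r (u 0 * real k + u 1 * real (Suc k)) =
     edge_map ?s (if snd (r ! k) then u 1 else u 0)" unfolding e using word_path_segment[of k "real k + u 1" r] u u0 by simp
   thus ?thesis using True by (simp add: seg_def)
  qed (simp add: seg_def)
 qed
 hence "\<phi> (seg (word_path r) (real k) (real (Suc k))) = letter_value h (r ! k)"
  using \<phi>(2)[OF s] cocycle_inverse_segment[OF \<phi>(1) continuous_map_edge[OF s], of 0 1] by (simp add: letter_value_def)
 moreover have "\<phi> (seg (word_path r) 0 (real (Suc k))) =
   \<phi> (seg (word_path r) 0 (real k)) + \<phi> (seg (word_path r) (real k) (real (Suc k)))"
  using Suc.prems by (intro cocycle_segment[OF \<phi>(1) continuous_map_word_path[OF r]]) auto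
 ultimately show ?case using Suc by (simp add: take_Suc_conv_app_nth)
qed

text \<open>On the boundary loop of the 2-cell the cocycle takes the value of the relator under
  \<open>h\<close>. As this vanishes, the pullback to the circle is a coboundary and the cocycle
  extends over the cell.\<close>

lemma presentation_cocycle:
 assumes H: "subgroup_set H" and h: "!!s. s : S ==> h s : H" and r: "fst ` set r <= S"
  and rel: "sum_list (map (letter_value h) r) = 0"
 shows "\<exists>\<phi>. cocycle (presentation_complex S r) H \<phi> & (\<forall>s\<in>S. \<phi> (seg (edge_map s) 0 1) = h s)"
proof -
 have "\<exists>\<phi>. cocycle (rose S) H \<phi> & (\<forall>s\<in>S. \<phi> (seg (edge_map s) 0 1) = h s)" by (rule rose_cocycle[OF H h])
 then obtain \<phi> where \<phi>1: "cocycle (rose S) H \<phi>" and \<phi>s: "\<forall>s\<in>S. \<phi> (seg (edge_map s) 0 1) = h s"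
  by (elim exE conjE) (rule that)
 note \<phi> = \<phi>1 \<phi>s[rule_format]
 interpret punctured_cell_attachment "rose S" "top_of_set (cball 0 1)" "sphere 0 1" "{()}" "%_. face_map r" 0 sgn
  by (rule presentation_attachment[OF r])
 have S: "subtopology (top_of_set (cball 0 1)) (sphere 0 1) = top_of_set (sphere 0 1 :: complex set)"
  by (simp add: subtopology_subtopology Int_absorb1 sphere_cball)
 have "\<exists>b. (\<forall>z\<in>sphere 0 1. b z : H) & (\<forall>\<tau>. singular_simplex 1 (top_of_set (sphere 0 1)) \<tau> -->
   \<phi> (simplex_map 1 (face_map r) \<tau>) = coboundary b \<tau>)"
 proof (rule cocycle_circle[OF H cocycle_pullback[OF \<phi>(1) continuous_map_face_boundary[OF r]]])
  have "simplex_map 1 (face_map r) (seg cis 0 (2 * pi)) = seg (word_path r) 0 (real (length r))"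
  proof
   fix u
   show "simplex_map 1 (face_map r) (seg cis 0 (2 * pi)) u = seg (word_path r) 0 (real (length r)) u"
    using face_map_cis[of "u 1 * (2 * pi)" r] by (cases "u : standard_simplex 1") (auto simp: simplex_map_def seg_def standard_simplex_1')
  qed
  thus "\<phi> (simplex_map 1 (face_map r) (seg cis 0 (2 * pi))) = 0" using cocycle_word_path[OF \<phi> r, of "length r"] rel by simp
 qed
 then obtain b where b: "\<forall>z\<in>sphere 0 1. b z : H"
  "\<forall>\<tau>. singular_simplex 1 (top_of_set (sphere 0 1)) \<tau> --> \<phi> (simplex_map 1 (face_map r) \<tau>) = coboundary b \<tau>"
  by (elim exE conjE) (rule that)
 note ext = extend_cocycle[OF H \<phi>(1), of "%_. b", unfolded S]
 have "\<exists>\<phi>'. cocycle Y H \<phi>' & (\<forall>\<tau>. singular_simplex 1 (rose S) \<tau> --> \<phi>' \<tau> = \<phi> \<tau>)"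
 proof -
  have "\<exists>\<phi>'. cocycle Y H \<phi>' & (\<forall>\<tau>. singular_simplex 1 (rose S) \<tau> --> \<phi>' \<tau> = \<phi> \<tau>) &
    (\<forall>i\<in>{()}. \<forall>\<tau>. singular_simplex 1 (top_of_set (cball 0 1)) \<tau> --> \<tau> (edge_pt 0) : sphere 0 1 -->
     \<tau> (edge_pt 1) : sphere 0 1 --> \<phi>' (simplex_map 1 (face_map r) \<tau>) = coboundary b \<tau>)"
   by (rule ext) (use b in simp_all)
  thus ?thesis by (elim exE conjE, intro exI conjI) assumption+
 qed
 then
 obtain \<phi>' where \<phi>': "cocycle (presentation_complex S r) H \<phi>'"
  "\<forall>\<tau>. singular_simplex 1 (rose S) \<tau> --> \<phi>' \<tau> = \<phi> \<tau>"
  unfolding presentation_complex_def by (elim exE conjE)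
 have "singular_simplex 1 (rose S) (seg (edge_map s) 0 1)" if "s : S" for s
  by (rule singular_simplex_segment[OF continuous_map_edge[OF that]]) auto
 with \<phi>' \<phi>(2) show ?thesis by (intro exI[of _ \<phi>']) simp
qed

text \<open>Cells of dimension at least 3 do not obstruct the extension, so values on the generators
  that respect the relator extend to all paths of \<open>X\<close>. The cell structure is used
  rather than the isomorphism of fundamental groups because the latter does not say which loops
  represent the generators.\<close>

lemma classifying_cocycle:
 assumes X: "classifying_extension S r X c"
  and H: "subgroup_set H" and h: "!!s. s : S ==> h s : H" and r: "fst ` set r <= S"
  and rel: "sum_list (map (letter_value h) r) = 0"
 shows "continuous_map (presentation_complex S r) X c"
  "\<exists>\<phi>. cocycle X H \<phi> & (\<forall>s\<in>S. \<phi> (simplex_map 1 c (seg (edge_map s) 0 1)) = h s)"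
proof -
 obtain A where A: "homeomorphic_map (presentation_complex S r) A c" "cells_attached_above 2 A X"
  using X by (auto simp: classifying_extension_def)
 obtain Xs where "cell_filtration 2 Xs X" and A0: "Xs 0 = A" by (rule cells_attached_above_filtration[OF A(2)])
 then interpret cell_filtration 2 Xs X by simp
 obtain c' where c': "homeomorphic_maps (presentation_complex S r) A c c'" using A(1) by (auto simp: homeomorphic_map_maps)
 have t1: "t1_space (Xs 0)"
  using presentation_rose(2)[OF r] homeomorphic_t1_space[OF homeomorphic_map_imp_homeomorphic_space[OF A(1)]] A0 by simp
 have c: "continuous_map (presentation_complex S r) A c" using c' by (simp add: homeomorphic_maps_def)
 thus "continuous_map (presentation_complex S r) X c" using subtopology_colimit[of 0] A0 continuous_map_into_fulltopology by metis
 have "\<exists>\<phi>. cocycle (presentation_complex S r) H \<phi> & (\<forall>s\<in>S. \<phi> (seg (edge_map s) 0 1) = h s)"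
  by (rule presentation_cocycle[OF H h r rel])
 then obtain \<phi> where \<phi>1: "cocycle (presentation_complex S r) H \<phi>" and \<phi>s: "\<forall>s\<in>S. \<phi> (seg (edge_map s) 0 1) = h s"
  by (elim exE conjE) (rule that)
 note \<phi> = \<phi>1 \<phi>s[rule_format]
 have "continuous_map A (presentation_complex S r) c'" using c' by (simp add: homeomorphic_maps_def)
 from cocycle_pullback[OF \<phi>(1) this] have "cocycle (Xs 0) H (%\<tau>. \<phi> (simplex_map 1 c' \<tau>))" by (simp add: A0)
 from extend_cocycle_colimit[OF _ t1 H this] obtain \<phi>' where \<phi>': "cocycle X H \<phi>'"
  "!!\<tau>. singular_simplex 1 A \<tau> ==> \<phi>' \<tau> = \<phi> (simplex_map 1 c' \<tau>)" by (auto simp: A0)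
 have "\<phi>' (simplex_map 1 c (seg (edge_map s) 0 1)) = h s" if s: "s : S" for s
 proof -
  let ?e = "seg (edge_map s) 0 1"
  have "singular_simplex 1 (rose S) ?e" by (rule singular_simplex_segment[OF continuous_map_edge[OF s]]) auto
  hence e: "singular_simplex 1 (presentation_complex S r) ?e" using presentation_rose(1)[OF r] by (metis singular_simplex_subtopology)
  have "simplex_map 1 c' (simplex_map 1 c ?e) = ?e"
  proof
   fix u show "simplex_map 1 c' (simplex_map 1 c ?e) u = ?e u" using e c' by (cases "u : standard_simplex 1")
     (auto simp: simplex_map_def singular_simplex_iff continuous_map_def extensional_def homeomorphic_maps_def)
  qed
  thus ?thesis using \<phi>'(2)[OF singular_simplex_continuous_map[OF e c]] \<phi>(2)[OF s] by simp
 qed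
 with \<phi>'(1) show "\<exists>\<phi>. cocycle X H \<phi> & (\<forall>s\<in>S. \<phi> (simplex_map 1 c (seg (edge_map s) 0 1)) = h s)" by blast
qed

section \<open>The second homology of a rose\<close>

definition edges :: "'a set => real set => 'a cell_point set" where
 "edges S J = (%(s, t). edge_map s t) ` (S \<times> J)"

lemma edges_iff: "y : edges S J \<longleftrightarrow> (\<exists>s\<in>S. \<exists>t\<in>J. y = edge_map s t)" by (auto simp: edges_def)

lemma edges_UN: "edges S J = (\<Union>s\<in>S. edge_map s ` J)" unfolding edges_def by auto

lemma openin_rose:
 assumes "S ~= {}"
 shows "openin (rose S) U \<longleftrightarrow> U <= edges S {0..1} & (\<forall>s\<in>S. openin (top_of_set {0..1}) {t : {0..1}. edge_map s t : U})"
proof -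
 have "Vertex : edges S {0..1}" using assms by (auto simp: edges_iff intro!: bexI[of _ 0])
 hence "{Vertex} Un (\<Union>i\<in>S. edge_map i ` {0..1}) = edges S {0..1}" unfolding edges_UN[symmetric] by (simp add: insert_absorb)
 thus ?thesis unfolding rose_def openin_attach_cells by simp
qed

lemma topspace_rose: "S ~= {} ==> topspace (rose S) = edges S {0..1}" by (force simp: rose_def topspace_attach_cells edges_def image_iff)

lemma openin_discrete_prod:
 "openin (prod_topology (discrete_topology S) Y) W \<longleftrightarrow> W <= S \<times> topspace Y & (\<forall>s\<in>S. openin Y {t : topspace Y. (s, t) : W})"
proof (intro iffI conjI ballI)
 assume W: "openin (prod_topology (discrete_topology S) Y) W"
 thus "W <= S \<times> topspace Y" using openin_subset by fastforce
 fix s assume "s : S"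
 hence "continuous_map Y (prod_topology (discrete_topology S) Y) (%t. (s, t))" by (simp add: continuous_map_pairwise comp_def)
 from openin_continuous_map_preimage[OF this W] show "openin Y {t : topspace Y. (s, t) : W}" .
next
 assume W: "W <= S \<times> topspace Y & (\<forall>s\<in>S. openin Y {t : topspace Y. (s, t) : W})"
 hence "W = (\<Union>s\<in>S. {s} \<times> {t : topspace Y. (s, t) : W})" by auto
 moreover have "openin (prod_topology (discrete_topology S) Y) (\<Union>s\<in>S. {s} \<times> {t : topspace Y. (s, t) : W})"
  using W by (intro openin_Union) (auto simp: openin_prod_Times_iff)
 ultimately show "openin (prod_topology (discrete_topology S) Y) W" by simp
qed

lemma quotient_map_rose:
 assumes "S ~= {}"
 shows "quotient_map (prod_topology (discrete_topology S) (top_of_set {0..1})) (rose S) (%(s, t). edge_map s t)" unfolding quotient_map_def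
proof (intro conjI allI impI)
 show "(%(s, t). edge_map s t) ` topspace (prod_topology (discrete_topology S) (top_of_set {0..1})) = topspace (rose S)"
  by (simp add: topspace_rose[OF assms] edges_def)
next
 let ?P = "prod_topology (discrete_topology S) (top_of_set {0..1 :: real})" and ?q = "%(s, t). edge_map s t"
 fix U assume U: "U <= topspace (rose S)"
 have "{t : {0..1}. (s, t) : {x : topspace ?P. ?q x : U}} = {t : {0..1}. edge_map s t : U}" if "s : S" for s using that by auto
 thus "openin ?P {x : topspace ?P. ?q x : U} = openin (rose S) U"
  using U by (simp add: openin_discrete_prod openin_rose[OF assms] topspace_rose[OF assms] del: mem_Collect_eq)
qed

text \<open>The ends of all edges are one point, so a set of parameters has to contain 0 and 1
  together for its preimage to be saturated.\<close>

lemma edges_interior: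
 assumes "J <= {0..1}" "0 : J \<longleftrightarrow> 1 : J" "s : S" "t : {0..1}"
 shows "edge_map s t : edges S J \<longleftrightarrow> t : J"
proof
 assume "edge_map s t : edges S J"
 then obtain s' t' where t': "t' : J" "edge_map s t = edge_map s' t'" by (auto simp: edges_iff)
 show "t : J"
 proof (cases "0 < t & t < 1")
  case True
  thus ?thesis using t' by (auto simp: edge_map_def split: if_splits)
 next
  case False
  hence "t = 0 \<or> t = 1" "t' = 0 \<or> t' = 1" using assms(1,4) t' by (auto simp: edge_map_def split: if_splits)
  thus ?thesis using t'(1) assms(2) by auto
 qed
qed (use assms(3) in \<open>auto simp: edges_iff\<close>)

lemma openin_edges:
 assumes "S ~= {}" "J <= {0..1}" "0 : J \<longleftrightarrow> 1 : J" "openin (top_of_set {0..1}) J"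
 shows "openin (rose S) (edges S J)"
proof -
 have "{t : {0..1}. edge_map s t : edges S J} = J" if "s : S" for s using edges_interior[OF assms(2,3) that] assms(2) by blast
 thus ?thesis using assms by (auto simp: openin_rose[OF assms(1)] edges_def)
qed

text \<open>A contraction of the parameter interval, applied to all edges at once, is continuous because the product
  of the quotient map \<open>S \<times> [0, 1] \<rightarrow> rose S\<close> with \<open>[0, 1]\<close> is again a quotient map.\<close>

lemma homotopic_edges:
 fixes G :: "real => real => real"
 assumes S: "S ~= {}" and J: "J <= {0..1}" "0 : J \<longleftrightarrow> 1 : J" "openin (top_of_set {0..1}) J"
  and G: "continuous_on ({0..1} \<times> J) (%(u, t). G u t)" "!!u t. u : {0..1} ==> t : J ==> G u t : J"
  and G0: "!!t. t : J ==> G 0 t = t" and G01: "!!u t. u : {0..1} ==> t : J Int {0, 1} ==> G u t : {0, 1}"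
 obtains g where "homotopic_with (%_. True) (subtopology (rose S) (edges S J)) (subtopology (rose S) (edges S J)) id g"
  "!!s t. s : S ==> t : J ==> g (edge_map s t) = edge_map s (G 1 t)"
proof -
 let ?R = "subtopology (rose S) (edges S J)" and ?q = "%(s, t). edge_map s t :: 'a cell_point"
  and ?I = "top_of_set {0..1 :: real}"
 let ?P = "subtopology (prod_topology (discrete_topology S) ?I) (S \<times> J)"
 have P: "?P = prod_topology (discrete_topology S) (top_of_set J)"
 proof -
  have "subtopology (discrete_topology S) S = discrete_topology S" by (metis subtopology_topspace topspace_discrete_topology)
  moreover have "{0..1} Int J = J" using J(1) by blast
  ultimately show ?thesis unfolding subtopology_Times subtopology_subtopology by simp
 qed
 have "{x : topspace (prod_topology (discrete_topology S) ?I). ?q x : edges S J} = S \<times> J"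
 proof (rule Set.set_eqI)
  fix x :: "'a \<times> real"
  obtain s t where x: "x = (s, t)" by (cases x)
  show "x : {x : topspace (prod_topology (discrete_topology S) ?I). ?q x : edges S J} \<longleftrightarrow> x : S \<times> J"
   using edges_interior[OF J(1,2), of s S t] J(1) unfolding x by (simp add: subset_iff) blast
 qed
 from quotient_map_restriction[OF quotient_map_rose[OF S] this] openin_edges[OF S J]
 have q: "quotient_map ?P ?R ?q" by blast
 have q': "quotient_map (prod_topology ?I ?P) (prod_topology ?I ?R) (%(x, y). (x, ?q y))"
 proof (rule quotient_map_prod_right[OF _ _ q])
  show "locally_compact_space ?I" by (rule compact_imp_locally_compact_space) (simp add: compact_space_subtopology)
 qed (simp add: Hausdorff_space_subtopology)
 obtain s0 where s0: "s0 : S" using S by blast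
 \<comment> \<open>The vertex is decoded as the initial point of an arbitrary edge. Since
   \<open>G u\<close> maps end points to end points, the induced map is independent of this
   choice.\<close>
 define dec where "dec y = (case y of Edge_Point s t => (s, t) | _ => (s0, 0))" for y :: "'a cell_point"
 define h where "h = (%(u, y). case dec y of (s, t) => edge_map s (G u t))"
 have h: "h (u, edge_map s t) = edge_map s (G u t)" if "u : {0..1}" "s : S" "t : J" for u s t
 proof (cases "t : {0, 1}")
  case True
  hence "0 : J" using that(3) J(2) by auto
  hence "G u t : {0, 1}" "G u 0 : {0, 1}" using G01[of u] that True by auto
  thus ?thesis using True by (auto simp: h_def dec_def)
 qed (use that J(1) in \<open>auto simp: h_def dec_def edge_map_def\<close>)
 have mem: "G u t : {0..1}" if "u : {0..1}" "t : J" for u t using G(2)[OF that] J(1) by blast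
 have "continuous_map (prod_topology ?I ?P) (prod_topology (discrete_topology S) (top_of_set J)) (%(u, s, t). (s, G u t))"
 proof -
  have 1: "continuous_map (prod_topology ?I ?P) (discrete_topology S) (%(u, s, t). s)"
   unfolding P case_prod_beta' using continuous_map_compose[OF continuous_map_snd continuous_map_fst] by (simp add: comp_def)
  have "continuous_map (prod_topology ?I (top_of_set J)) (top_of_set J) (%(u, t). G u t)"
   unfolding prod_topology_subtopology_eu using G by (auto simp: continuous_map_in_subtopology)
  moreover have "continuous_map (prod_topology ?I ?P) (prod_topology ?I (top_of_set J)) (%(u, s, t). (u, t))"
   unfolding P case_prod_beta' continuous_map_pairwise
   using continuous_map_compose[OF continuous_map_snd continuous_map_snd] by (simp add: comp_def continuous_map_fst)
  ultimately have 2: "continuous_map (prod_topology ?I ?P) (top_of_set J) ((%(u, t). G u t) o (%(u, s, t). (u, t)))"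
   by (intro continuous_map_compose)
  show ?thesis using 1 2 by (simp add: continuous_map_pairwise comp_def case_prod_beta')
 qed
 from continuous_map_compose[OF this[folded P] quotient_imp_continuous_map[OF q]]
 have "continuous_map (prod_topology ?I ?P) ?R (h o (%(x, y). (x, ?q y)))"
  by (rule continuous_map_eq) (use h in \<open>auto simp: P\<close>)
 with q' have hc: "continuous_map (prod_topology ?I ?R) ?R h" by (rule continuous_compose_quotient_map)
 have "h (0, y) = id y" if "y : topspace ?R" for y using that h[of 0] G0 by (auto simp: edges_def)
 hence "homotopic_with (%_. True) ?R ?R id (%y. h (1, y))" using hc by (subst homotopic_with) auto
 thus thesis using that[of "%y. h (1, y)"] h[of 1] by simp
qed

section \<open>Acyclicity of pieces of the rose\<close>

lemma constant_chain_bounds: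
 assumes "Poly_Mapping.keys c <= const_simplex 1 ` topspace X"
 shows "\<exists>e. singular_chain 2 X e & chain_boundary 2 e = c" using assms
proof (induction c rule: frag_induction)
 case (one x)
 then obtain a where a: "x = const_simplex 1 a" "a : topspace X" by blast
 have t: "triangle X (const_simplex 2 a) x x x" unfolding a(1) const_simplex_def using a(2) by (intro triangleI) auto
 show ?case using t chain_boundary_triangle[OF t]
  by (intro exI[of _ "frag_of (const_simplex 2 a)"]) (auto simp: triangle_def singular_chain_of)
next
 case (diff a b)
 then obtain e f where "singular_chain 2 X e" "chain_boundary 2 e = a" "singular_chain 2 X f" "chain_boundary 2 f = b" by blast
 thus ?case by (intro exI[of _ "e - f"]) (simp add: chain_boundary_diff singular_chain_diff)
qed (auto intro: exI[of _ 0])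

text \<open>The boundary of a constant 2-simplex is x - x + x = x for the constant 1-simplex x, so a
  chain of constant 2-simplices can be recovered from its boundary.\<close>

lemma constant_cycle_zero:
 assumes "Poly_Mapping.keys c <= const_simplex 2 ` UNIV" "chain_boundary 2 c = 0"
 shows "c = 0"
proof -
 define F where "F = frag_extend (%\<tau> :: (nat => real) => 'a. frag_of (const_simplex 2 (\<tau> (edge_pt 0))))"
 have "F (chain_boundary 2 c) = c" using assms(1)
 proof (induction c rule: frag_induction)
  case (one x)
  then obtain a where a: "x = const_simplex 2 a" by blast
  have "triangle (discrete_topology {a}) x (const_simplex 1 a) (const_simplex 1 a) (const_simplex 1 a)"
   unfolding a const_simplex_def by (intro triangleI) auto
  from chain_boundary_triangle[OF this] show ?case using edge_pt_in[of 0] by (simp add: F_def a const_simplex_def)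
 next
  case (diff a b)
  thus ?case by (simp add: F_def chain_boundary_diff frag_extend_diff)
 qed (simp add: F_def)
 with assms(2) show ?thesis by (simp add: F_def)
qed

text \<open>The homotopy pushes all edges simultaneously to a finite set of parameters. The points
  reached form a discrete subspace, so the pushed chain consists of constant simplices, and such
  cycles bound in dimensions 1 and 2.\<close>

lemma edges_acyclic:
 fixes G :: "real => real => real"
 assumes S: "S ~= {}" and J: "J <= {0..1}" "0 : J \<longleftrightarrow> 1 : J" "openin (top_of_set {0..1}) J"
  and G: "continuous_on ({0..1} \<times> J) (%(u, t). G u t)" "!!u t. u : {0..1} ==> t : J ==> G u t : J"
  and G0: "!!t. t : J ==> G 0 t = t" and G01: "!!u t. u : {0..1} ==> t : J Int {0, 1} ==> G u t : {0, 1}"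
  and F: "finite F" "F <= {0..1}" "!!t. t : J ==> G 1 t : F"
  and c: "singular_chain p (subtopology (rose S) (edges S J)) c" "chain_boundary p c = 0" and p: "p = 1 \<or> p = 2"
 shows "\<exists>e. singular_chain (Suc p) (subtopology (rose S) (edges S J)) e & chain_boundary (Suc p) e = c"
proof -
 let ?R = "subtopology (rose S) (edges S J)"
 obtain g where hom: "homotopic_with (%_. True) ?R ?R id g"
  and g: "!!s t. s : S ==> t : J ==> g (edge_map s t) = edge_map s (G 1 t)" using homotopic_edges[OF S J G G0 G01] by blast
 have gR: "continuous_map ?R ?R g" using homotopic_with_imp_continuous_maps[OF hom] by blast
 let ?M = "edges S F"
 have disc: "subtopology (rose S) ?M = discrete_topology ?M"
 proof (rule topology_eq[THEN iffD2], intro allI iffI)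
  have MX: "?M <= topspace (rose S)" using F(2) unfolding topspace_rose[OF S] edges_def by (intro image_mono Sigma_mono) auto
  fix A assume "openin (discrete_topology ?M) A"
  hence A: "A <= ?M" by simp
  have "openin (rose S) (topspace (rose S) - (?M - A))" unfolding openin_rose[OF S]
  proof (intro conjI ballI)
   fix s assume s: "s : S"
   let ?T = "{t : {0..1}. edge_map s t : ?M - A}"
   have "?T <= F Un {0, 1}" by (auto simp: edges_iff edge_map_def split: if_splits)
   hence "finite ?T" by (rule finite_subset) (use F(1) in simp)
   hence "closedin (top_of_set {0..1}) ?T" by (intro closed_subset finite_imp_closed) auto
   moreover have "{t : {0..1}. edge_map s t : topspace (rose S) - (?M - A)} = {0..1} - ?T"
    using s by (auto simp: topspace_rose[OF S] edges_iff)
   ultimately show "openin (top_of_set {0..1}) {t : {0..1}. edge_map s t : topspace (rose S) - (?M - A)}" by (simp add: openin_diff)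
  qed (auto simp: topspace_rose[OF S])
  moreover have "A = (topspace (rose S) - (?M - A)) Int ?M" using A MX by blast
  ultimately show "openin (subtopology (rose S) ?M) A" unfolding openin_subtopology by blast
 qed (use openin_subset in fastforce)
 have const: "\<exists>a\<in>topspace ?R. simplex_map p g \<tau> = const_simplex p a" if \<tau>: "singular_simplex p ?R \<tau>" for \<tau>
 proof -
  have \<tau>c: "continuous_map (top_of_set (standard_simplex p)) ?R \<tau>" using \<tau> by (simp add: singular_simplex_iff)
  have "g y : ?M" if "y : topspace ?R" for y
  proof -
   from that obtain s t where "s : S" "t : J" "y = edge_map s t" by (auto simp: edges_iff)
   thus ?thesis using g[of s t] F(3)[of t] unfolding edges_iff by blast
  qed
  hence "g (\<tau> x) : ?M" if "x : standard_simplex p" for x using \<tau>c that by (auto simp: continuous_map_def Pi_iff)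
  moreover have "continuous_map (top_of_set (standard_simplex p)) (rose S) (g o \<tau>)"
   by (rule continuous_map_into_fulltopology[OF continuous_map_compose[OF \<tau>c gR]])
  ultimately have gc: "continuous_map (top_of_set (standard_simplex p)) (discrete_topology ?M) (g o \<tau>)"
   unfolding disc[symmetric] by (auto simp: continuous_map_in_subtopology)
  have "connectedin (top_of_set (standard_simplex p)) (standard_simplex p)"
   using path_connectedin_imp_connectedin[OF path_connectedin_standard_simplex[of p]]
   by (simp add: connectedin_subtopology euclidean_product_topology)
  from connectedin_continuous_map_image[OF gc this]
  have "\<exists>a. (g o \<tau>) ` standard_simplex p <= {a}" unfolding connectedin_discrete_topology by (rule conjunct2)
  then obtain a where "(g o \<tau>) ` standard_simplex p <= {a}" ..
  hence a: "g (\<tau> x) = a" if "x : standard_simplex p" for x using that by (simp add: image_subset_iff)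
  obtain x where x: "x : standard_simplex p" using nonempty_standard_simplex[of p] by blast
  have "a : topspace ?R" using a[OF x] continuous_map_compose[OF \<tau>c gR] x by (auto simp: continuous_map_def)
  moreover have "simplex_map p g \<tau> = const_simplex p a" using a by (auto simp: simplex_map_def const_simplex_def)
  ultimately show ?thesis by blast
 qed
 have keys: "Poly_Mapping.keys (chain_map p g c) <= const_simplex p ` topspace ?R"
 proof -
  have "Poly_Mapping.keys (chain_map p g c) <= simplex_map p g ` Poly_Mapping.keys c"
   unfolding chain_map_def using keys_frag_extend[of "frag_of o simplex_map p g" c] by (auto simp: comp_def)
  moreover have "\<tau> : Poly_Mapping.keys c ==> singular_simplex p ?R \<tau>" for \<tau> using c(1) by (auto simp: singular_chain_def)
  ultimately show ?thesis using const by (smt (verit, best) image_iff subset_iff)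
 qed
 have rel: "singular_relcycle p ?R {} c" using c by (simp add: singular_cycle)
 have "homologous_rel p ?R {} (chain_map p id c) (chain_map p g c)"
  by (rule homotopic_imp_homologous_rel_chain_maps[OF _ rel]) (use hom in simp)
 then obtain e where e: "singular_chain (Suc p) ?R e" "chain_boundary (Suc p) e = c - chain_map p g c"
  using chain_map_id_gen[OF c(1), of id] by (auto simp: homologous_rel_def singular_boundary)
 have "\<exists>f. singular_chain (Suc p) ?R f & chain_boundary (Suc p) f = chain_map p g c"
 proof (cases "p = 1")
  case True
  thus ?thesis using constant_chain_bounds[of "chain_map p g c" ?R] keys by (simp add: numeral_2_eq_2)
 next
  case False
  hence p2: "p = 2" using p by blast
  have "chain_boundary p (chain_map p g c) = 0" using chain_boundary_chain_map[OF c(1), of g] c(2) by simp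
  hence "chain_map p g c = 0" using constant_cycle_zero[of "chain_map p g c"] keys unfolding p2 by blast
  thus ?thesis by (intro exI[of _ 0]) simp
 qed
 then obtain f where "singular_chain (Suc p) ?R f" "chain_boundary (Suc p) f = chain_map p g c" by blast
 with e show ?thesis by (intro exI[of _ "e + f"]) (simp add: chain_boundary_add singular_chain_add)
qed

text \<open>The Mayer-Vietoris argument on chains, for the complement of the vertex and the
  complement of the midpoints: both have no homology in degree 2, and their intersection has none in
  degree 1. Each of these sets contracts edgewise with a formula common to all edges, so
  \<open>S\<close> may be infinite.\<close>

lemma rose_cycle_bounds:
 assumes S: "S ~= {}" and c: "singular_chain 2 (rose S) c" "chain_boundary 2 c = 0"
 shows "\<exists>e. singular_chain 3 (rose S) e & chain_boundary 3 e = c"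
proof -
 let ?X = "rose S" and ?I = "top_of_set {0..1 :: real}"
 define U where "U = {0<..<1 :: real}"
 define V where "V = {0..1} - {1/2 :: real}"
 \<comment> \<open>The step function with value \<open>a\<close> left and \<open>b\<close> right of
   1/2, written with \<open>sgn\<close> so that continuity away from 1/2 is immediate.\<close>
 define near where "near a b t = a + (b - a) * ((sgn (t - 1/2) + 1) / 2)" for a b t :: real
 have J: "U <= {0..1}" "V <= {0..1}" "U Int V <= {0..1}" "0 : U \<longleftrightarrow> 1 : U" "0 : V \<longleftrightarrow> 1 : V" "0 : U Int V \<longleftrightarrow> 1 : U Int V"
  by (auto simp: U_def V_def)
 have opn: "openin ?I U" "openin ?I V" "openin ?I (U Int V)" unfolding U_def V_def openin_open
  by (intro exI[of _ "{0<..<1}"] exI[of _ "- {1/2}"] exI[of _ "{0<..<1} - {1/2}"]; auto simp: open_delete)+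
 have near: "near a b t = (if t < 1/2 then a else b)" if "t : V" for a b t using that by (auto simp: near_def V_def sgn_if field_simps)
 have near_cont: "continuous_on ({0..1} \<times> J') (%(u, t). t + u * (near a b t - t))" if "J' <= V" for J' a b
  unfolding near_def case_prod_beta' using that by (intro continuous_intros) (auto simp: V_def)
 have between: "min t w <= t + u * (w - t) & t + u * (w - t) <= max t w" if u: "u : {0..1}" for t u w :: real
 proof (cases "t <= w")
  case True
  thus ?thesis using mult_left_le_one_le[of "w - t" u] mult_nonneg_nonneg[of u "w - t"] u by auto
 next
  case False
  hence a: "u * (t - w) <= t - w" using mult_left_le_one_le[of "t - w" u] u by simp
  have "0 <= u * (t - w)" using u False by simp
  moreover have "u * (w - t) = - (u * (t - w))" by (simp add: algebra_simps)
  ultimately show ?thesis using False a unfolding min_def max_def by (simp only: if_False) linarith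
 qed
 have acU: "\<exists>e. singular_chain 3 (subtopology ?X (edges S U)) e & chain_boundary 3 e = x"
  if "singular_chain 2 (subtopology ?X (edges S U)) x" "chain_boundary 2 x = 0" for x
 proof -
  have "\<exists>e. singular_chain (Suc 2) (subtopology ?X (edges S U)) e & chain_boundary (Suc 2) e = x"
  proof (rule edges_acyclic[OF S J(1,4) opn(1), of "%u t. t + u * (1/2 - t)" "{1/2}"])
   fix u t :: real assume ut: "u : {0..1}" "t : U"
   show "t + u * (1/2 - t) : U" using between[OF ut(1), of t "1/2"] ut(2) by (auto simp: U_def)
  qed (use that in \<open>auto simp: U_def case_prod_beta' intro!: continuous_intros\<close>)
  thus ?thesis by (simp add: numeral_3_eq_3 numeral_2_eq_2)
 qed
 have acV: "\<exists>e. singular_chain 3 (subtopology ?X (edges S V)) e & chain_boundary 3 e = x"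
  if "singular_chain 2 (subtopology ?X (edges S V)) x" "chain_boundary 2 x = 0" for x
 proof -
  have "\<exists>e. singular_chain (Suc 2) (subtopology ?X (edges S V)) e & chain_boundary (Suc 2) e = x"
  proof (rule edges_acyclic[OF S J(2,5) opn(2), of "%u t. t + u * (near 0 1 t - t)" "{0, 1}"])
   fix u t :: real assume ut: "u : {0..1}" "t : V"
   show "t + u * (near 0 1 t - t) : V"
    using between[OF ut(1), of t "near 0 1 t"] ut(2) near[OF ut(2), of 0 1] by (auto simp: V_def split: if_splits)
  next
   fix u t :: real assume "u : {0..1}" "t : V Int {0, 1}"
   thus "t + u * (near 0 1 t - t) : {0, 1}" using near[of t 0 1] by auto
  qed (use that near near_cont[of V] in auto)
  thus ?thesis by (simp add: numeral_3_eq_3 numeral_2_eq_2)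
 qed
 have acUV: "\<exists>e. singular_chain 2 (subtopology ?X (edges S (U Int V))) e & chain_boundary 2 e = x"
  if "singular_chain 1 (subtopology ?X (edges S (U Int V))) x" "chain_boundary 1 x = 0" for x
 proof -
  have "\<exists>e. singular_chain (Suc 1) (subtopology ?X (edges S (U Int V))) e & chain_boundary (Suc 1) e = x"
  proof (rule edges_acyclic[OF S J(3,6) opn(3), of "%u t. t + u * (near (1/4) (3/4) t - t)" "{1/4, 3/4}"])
   fix u t :: real assume ut: "u : {0..1}" "t : U Int V"
   show "t + u * (near (1/4) (3/4) t - t) : U Int V"
    using between[OF ut(1), of t "near (1/4) (3/4) t"] ut(2) near[of t "1/4" "3/4"] by (auto simp: U_def V_def split: if_splits)
  qed (use that near near_cont[of "U Int V"] in \<open>auto simp: U_def\<close>)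
  thus ?thesis by (simp add: numeral_2_eq_2)
 qed
 have top: "topspace ?X - {Vertex} = edges S U" unfolding topspace_rose[OF S] by (force simp: edges_def U_def edge_map_def image_iff)
 have UV: "edges S U Int edges S V = edges S (U Int V)" by (auto simp: edges_def U_def V_def edge_map_def split: if_splits)
 have "closedin ?X {Vertex}" using t1_space_rose[of S] Vertex_in_rose[of S] by (simp add: t1_space_closedin_singleton)
 hence "?X closure_of {Vertex} = {Vertex}" by (simp add: closure_of_closedin)
 moreover have "?X interior_of (edges S V) = edges S V" using openin_edges[OF S J(2,5) opn(2)] by (simp add: interior_of_openin)
 moreover have "Vertex : edges S V" using S by (auto simp: edges_def V_def image_iff intro!: bexI[of _ 0])
 ultimately have ex: "?X closure_of {Vertex} <= ?X interior_of (edges S V)" by simp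
 have "edges S V <= topspace ?X" using J(2) by (auto simp: topspace_rose[OF S] edges_def)
 moreover have "singular_chain 2 (subtopology ?X (topspace ?X)) c" using c(1) by simp
 ultimately obtain n d e where d: "singular_chain 2 (subtopology ?X (topspace ?X - {Vertex})) d"
  and e: "singular_chain 2 (subtopology ?X (edges S V)) e" and sum: "(singular_subdivision 2 ^^ n) c = d + e"
  using excised_chain_exists[OF ex] by metis
 have cyc: "singular_relcycle 2 ?X {} ((singular_subdivision 2 ^^ m) c) & homologous_rel 2 ?X {} ((singular_subdivision 2 ^^ m) c) c" for m
 proof (induction m)
  case 0
  show ?case using c by (simp add: singular_cycle)
 next
  case (Suc m)
  thus ?case using homologous_rel_singular_subdivision[of 2 ?X "{}" "(singular_subdivision 2 ^^ m) c"]
    homologous_rel_singular_relcycle[of 2 ?X "{}"] by (metis homologous_rel_trans funpow.simps(2) comp_apply)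
 qed
 \<comment> \<open>The two parts have opposite boundaries, which lie in the intersection; a chain
   \<open>f\<close> of the intersection with this boundary corrects both parts to cycles.\<close>
 have bd: "chain_boundary 2 d = - chain_boundary 2 e"
  using cyc[of n] unfolding sum singular_cycle by (simp add: chain_boundary_add add_eq_0_iff)
 have "singular_chain 1 (subtopology ?X (edges S U)) (chain_boundary 2 d)" using singular_chain_boundary[OF d] unfolding top by simp
 moreover have "singular_chain 1 (subtopology ?X (edges S V)) (chain_boundary 2 d)"
  using singular_chain_boundary[OF e] unfolding bd by (simp add: singular_chain_minus)
 ultimately have "singular_chain 1 (subtopology ?X (edges S (U Int V))) (chain_boundary 2 d)"
  unfolding UV[symmetric] singular_chain_subtopology by auto
 moreover have "chain_boundary 1 (chain_boundary 2 d) = 0" using chain_boundary_boundary[OF d] by simp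
 ultimately obtain f where f: "singular_chain 2 (subtopology ?X (edges S (U Int V))) f" "chain_boundary 2 f = chain_boundary 2 d"
  using acUV by blast
 have fU: "singular_chain 2 (subtopology ?X (edges S U)) f" and fV: "singular_chain 2 (subtopology ?X (edges S V)) f"
  using f(1) unfolding UV[symmetric] singular_chain_subtopology by auto
 obtain a where a: "singular_chain 3 (subtopology ?X (edges S U)) a" "chain_boundary 3 a = d - f"
  using acU[of "d - f"] d fU f(2) unfolding top by (auto simp: singular_chain_diff chain_boundary_diff)
 obtain b where b: "singular_chain 3 (subtopology ?X (edges S V)) b" "chain_boundary 3 b = e + f"
  using acV[of "e + f"] e fV f(2) bd by (auto simp: singular_chain_add chain_boundary_add)
 obtain w where w: "singular_chain 3 ?X w" "chain_boundary 3 w = (d + e) - c"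
  using cyc[of n] unfolding sum homologous_rel_def singular_boundary by (auto simp: numeral_3_eq_3 numeral_2_eq_2)
 have "singular_chain 3 ?X (a + b - w)"
  using a(1) b(1) w(1) by (auto intro!: singular_chain_add singular_chain_diff simp: singular_chain_subtopology)
 moreover have "chain_boundary 3 (a + b - w) = c" by (simp add: chain_boundary_add chain_boundary_diff a b w)
 ultimately show ?thesis by blast
qed

section \<open>Loops in a rose\<close>

declare One_nat_def [simp del]

text \<open>A composition law up to homotopy: \<open>s\<close> is homotopic to \<open>p\<close>
  followed by \<open>q\<close>. With a constant \<open>q\<close> this is homotopy with fixed
  ends.\<close>

definition tri where "tri X p q s \<longleftrightarrow> (\<exists>\<sigma>. triangle X \<sigma> p q s)"

lemma triI: "triangle X \<sigma> p q s ==> tri X p q s" unfolding tri_def by (intro exI)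

lemma tri_1: "tri X e12 e23 e13 ==> tri X e01 e13 e03 ==> tri X e01 e12 e02 ==> tri X e02 e23 e03"
 unfolding tri_def by (elim exE) (erule (2) tetrahedron_fill_1, rule exI)

lemma tri_2: "tri X e12 e23 e13 ==> tri X e02 e23 e03 ==> tri X e01 e12 e02 ==> tri X e01 e13 e03"
 unfolding tri_def by (elim exE) (erule (2) tetrahedron_fill_2, rule exI)

lemma tri_map: "tri X p q s ==> continuous_map X Y f ==> tri Y (simplex_map 1 f p) (simplex_map 1 f q) (simplex_map 1 f s)"
 unfolding tri_def by (elim exE, rule exI) (rule triangle_simplex_map)

lemma tri_segment:
 assumes "continuous_map (top_of_set K) X f" "convex K" "a : K" "b : K" "c : K"
 shows "tri X (seg f a b) (seg f b c) (seg f a c)" unfolding tri_def by (rule exI) (rule triangle_triangle_simplex[OF assms])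

lemma face_vertex: "singular_face 1 0 g = const_simplex 0 (g (edge_pt 1))" "singular_face 1 1 g = const_simplex 0 (g (edge_pt 0))"
proof -
 have "simplical_face 0 (%j. if j = 0 then 1 else 0) = edge_pt 1" "simplical_face 1 (%j. if j = 0 then 1 else 0) = edge_pt 0"
  by (auto simp: simplical_face_def edge_pt_def fun_eq_iff)
 thus "singular_face 1 0 g = const_simplex 0 (g (edge_pt 1))" "singular_face 1 1 g = const_simplex 0 (g (edge_pt 0))"
  using singular_face_1[of 0 g] singular_face_1[of 1 g] by simp_all
qed

lemma const_simplex_inject: "const_simplex 0 a = const_simplex 0 b ==> a = b"
 using nonempty_standard_simplex[of 0] unfolding const_simplex_def by (metis all_not_in_conv restrict_apply')

lemma tri_const:
 assumes p: "singular_simplex 1 X p"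
 shows "singular_face 1 0 p = const_simplex 0 b ==> tri X p (const_simplex 1 b) p"
  "singular_face 1 1 p = const_simplex 0 a ==> tri X (const_simplex 1 a) p p"
proof -
 have "continuous_map (top_of_set {0..1}) X (p o edge_pt)"
  using p by (intro continuous_map_compose[OF continuous_map_edge_pt]) (simp add: singular_simplex_iff)
 note t = tri_segment[OF this convex_real_interval(5)]
 note e = seg_edge_pt[OF p] seg_refl
 show "tri X p (const_simplex 1 b) p" if "singular_face 1 0 p = const_simplex 0 b"
  using t[of 0 1 1] const_simplex_inject[OF that[unfolded face_vertex]] by (simp add: e)
 show "tri X (const_simplex 1 a) p p" if "singular_face 1 1 p = const_simplex 0 a"
  using t[of 0 0 1] const_simplex_inject[OF that[unfolded face_vertex]] by (simp add: e)
qed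

lemma tri_replace:
 assumes "tri X p q s" "tri X s (const_simplex 1 c) s'" "singular_face 1 0 q = const_simplex 0 c"
 shows "tri X p q s'"
proof -
 from assms(1) have "singular_simplex 1 X q" unfolding tri_def by (elim exE) (rule triangle_edges(2))
 from tri_2[OF tri_const(1)[OF this assms(3)] assms(2,1)] show ?thesis .
qed

text \<open>In the line any two paths with the same ends are homotopic by the straight-line homotopy.\<close>

lemma tri_real:
 fixes p q s :: "(nat => real) => real"
 assumes "singular_simplex 1 (top_of_set UNIV) p" "singular_simplex 1 (top_of_set UNIV) q" "singular_simplex 1 (top_of_set UNIV) s"
  and e: "p (edge_pt 1) = q (edge_pt 0)" "p (edge_pt 0) = s (edge_pt 0)" "q (edge_pt 1) = s (edge_pt 1)"
 shows "tri (top_of_set UNIV) p q s"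
proof -
 let ?R = "top_of_set (UNIV :: real set)"
 note f = face_vertex
 have "singular_face 1 0 p = singular_face 1 1 q" by (simp only: f e(1))
 from concatenation[OF assms(1,2) this] obtain s0 \<sigma> where \<sigma>: "triangle ?R \<sigma> p q s0" by (elim exE)
 hence s0: "tri ?R p q s0" by (rule triI)
 have s0s: "singular_simplex 1 ?R s0" using triangle_edges(3)[OF \<sigma>] .
 define a where "a = s (edge_pt 0)"
 define c where "c = s (edge_pt 1)"
 have e0: "s0 (edge_pt 0) = a" "s0 (edge_pt 1) = c" using triangle_endpoints[OF \<sigma>] e by (simp_all add: a_def c_def)
 let ?K = "{0..1} \<times> {0..1} :: (real \<times> real) set"
 define H where "H = (%(v, u). (1 - v) * s0 (edge_pt u) + v * s (edge_pt u))"
 have path: "continuous_on {0..1} (%u. g (edge_pt u))" if "singular_simplex 1 ?R g" for g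
  using continuous_map_compose[OF continuous_map_edge_pt, of ?R g] that by (simp add: singular_simplex_iff comp_def)
 have "continuous_on ?K (%x. g (edge_pt (snd x)))" if "singular_simplex 1 ?R g" for g
  using continuous_on_compose2[OF path[OF that], of ?K snd] by (force intro: continuous_intros)
 hence "continuous_map (top_of_set ?K) ?R H" unfolding H_def case_prod_beta' using assms(3) s0s by (auto intro!: continuous_intros)
 note tr = tri_segment[OF this convex_Times[OF convex_real_interval(5) convex_real_interval(5)]]
 define m where "m = seg H (0, 0) (1, 1)"
 have seg: "seg H (0, 0) (0, 1) = s0" "seg H (1, 0) (1, 1) = s"
  "seg H (0, 1) (1, 1) = const_simplex 1 c" "seg H (0, 0) (1, 0) = const_simplex 1 a"
 proof -
  have eq: "seg (%u. g (edge_pt u)) 0 1 = g" if "singular_simplex 1 ?R g" for g using seg_edge_pt[OF that] by (simp add: comp_def)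
  have "seg H (0, 0) (0, 1) = seg (%u. s0 (edge_pt u)) 0 1"
   "seg H (1, 0) (1, 1) = seg (%u. s (edge_pt u)) 0 1" by (auto simp: H_def seg_def fun_eq_iff standard_simplex_1)
  thus "seg H (0, 0) (0, 1) = s0" "seg H (1, 0) (1, 1) = s" by (simp_all only: eq[OF s0s] eq[OF assms(3)])
  show "seg H (0, 1) (1, 1) = const_simplex 1 c" "seg H (0, 0) (1, 0) = const_simplex 1 a"
   using e0 by (auto simp: H_def seg_def const_simplex_def fun_eq_iff standard_simplex_1 a_def c_def algebra_simps)
 qed
 have t1: "tri ?R s0 (const_simplex 1 c) m" and t2: "tri ?R (const_simplex 1 a) s m"
  using tr[of "(0, 0)" "(0, 1)" "(1, 1)"] tr[of "(0, 0)" "(1, 0)" "(1, 1)"] by (simp_all add: seg m_def)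
 have "tri ?R m (const_simplex 1 c) s"
  by (rule tri_1[OF tri_const(1)[OF assms(3)] tri_const(2)[OF assms(3)] t2]) (simp_all only: f a_def c_def)
 with t1 have "tri ?R s0 (const_simplex 1 c) s"
  by (rule tri_replace) (simp only: f const_simplex_def restrict_apply edge_pt_in atLeastAtMost_iff order_refl zero_le_one simp_thms if_True)
 with s0 show ?thesis by (rule tri_replace) (simp only: f e(3) c_def)
qed

section \<open>Loops up to homotopy\<close>

locale loop_space =
 fixes X :: "'x topology" and v :: 'x
 assumes v: "v : topspace X"
begin

abbreviation "K \<equiv> const_simplex 1 v"

definition loop :: "((nat => real) => 'x) => bool" where
 "loop p \<longleftrightarrow> singular_simplex 1 X p & singular_face 1 0 p = const_simplex 0 v & singular_face 1 1 p = const_simplex 0 v"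

lemma loop_K: "loop K" using v unfolding loop_def singular_face_1
 by (auto simp: singular_simplex_iff const_simplex_def standard_simplex_1 simplical_face_def)

lemma tri_loops: "tri X p q s ==> loop p ==> loop q ==> loop s"
proof -
 assume "tri X p q s" "loop p" "loop q"
 then obtain \<sigma> where "triangle X \<sigma> p q s" unfolding tri_def by blast
 note e = triangle_edges[OF this]
 show "loop s" using \<open>loop p\<close> \<open>loop q\<close> e(3) unfolding loop_def e(5) e(6) by simp
qed

lemma tri_K: "loop p ==> tri X p K p" "loop p ==> tri X K p p" unfolding loop_def by (elim conjE, (rule tri_const; assumption))+

text \<open>Here \<open>tri X s K s'\<close> expresses that \<open>s\<close> and \<open>s'\<close>
  are homotopic loops: composites are unique up to homotopy, and the next rules exchange one side of
  a triangle along a homotopy.\<close>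

lemma tri_unique: "loop q ==> tri X p q s ==> tri X p q s' ==> tri X s K s'" by (rule tri_1[OF tri_K(1)])

lemma tri_end: "loop q ==> tri X p q s ==> tri X s K s' ==> tri X p q s'" by (rule tri_2[OF tri_K(1)])

lemma tri_second: "loop s ==> tri X p q s ==> tri X q K q' ==> tri X p q' s" by (rule tri_2[OF _ tri_K(1)])

lemma tri_first: "loop q ==> tri X p q s ==> tri X p K p' ==> tri X p' q s" by (rule tri_1[OF tri_K(2)])

lemma tri_exists: "loop p ==> loop q ==> \<exists>s. tri X p q s"
 unfolding tri_def loop_def by (elim conjE) (rule concatenation, assumption+, simp)

end

lemma loop_space_rose: "loop_space (rose S) Vertex" by unfold_locales (rule Vertex_in_rose)

context fixes S :: "'a set" begin

interpretation loop_space "rose S" Vertex by (rule loop_space_rose)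

text \<open>Letters outside \<open>S\<close> have no edge and become the constant loop, so loops of
  the rose see only the part of a word over \<open>S\<close>; compare
  \<open>project\<close>.\<close>

definition letter_edge :: "'a letter => (nat => real) => 'a cell_point" where
 "letter_edge x = (if fst x : S then if snd x then seg (edge_map (fst x)) 0 1 else seg (edge_map (fst x)) 1 0 else K)"

text \<open>Composites of paths are determined only up to homotopy; one is chosen at every letter,
  so that each word has a definite loop.\<close>

primrec word_simplex :: "'a word => (nat => real) => 'a cell_point" where
 "word_simplex [] = K"
| "word_simplex (x # w) = (SOME s. tri (rose S) (letter_edge x) (word_simplex w) s)"

definition loop_of :: "'a fg => (nat => real) => 'a cell_point" where
 "loop_of w = word_simplex (Rep_fg w)"

lemma loop_letter_edge: "loop (letter_edge x)"
proof (cases "fst x : S")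
 case True
 note c = continuous_map_edge[OF True]
 show ?thesis using True singular_simplex_segment[OF c, of 0 1] singular_simplex_segment[OF c, of 1 0]
  by (auto simp: letter_edge_def loop_def singular_face_segment)
qed (simp add: letter_edge_def loop_K)

lemma loop_word_simplex: "loop (word_simplex w)"
 and tri_word_simplex_Cons: "tri (rose S) (letter_edge x) (word_simplex w) (word_simplex (x # w))"
proof -
 have t: "tri (rose S) (letter_edge x) (word_simplex w) (word_simplex (x # w))" if "loop (word_simplex w)" for x w
  using someI_ex[OF tri_exists[OF loop_letter_edge that]] by simp
 show l: "loop (word_simplex w)" for w by (induction w) (use loop_K tri_loops[OF t loop_letter_edge] in auto)
 show "tri (rose S) (letter_edge x) (word_simplex w) (word_simplex (x # w))" by (rule t[OF l])
qed

lemma tri_word_simplex_append: "tri (rose S) (word_simplex u) (word_simplex w) (word_simplex (u @ w))"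
proof (induction u)
 case (Cons x u)
 have "tri (rose S) (word_simplex (x # u)) (word_simplex w) (word_simplex (x # u @ w))"
  by (rule tri_1[OF Cons.IH]) (rule tri_word_simplex_Cons)+
 thus ?case by simp
qed (simp add: tri_K loop_word_simplex)

lemma tri_inverse_letter: "tri (rose S) (letter_edge x) (letter_edge (inverse_letter x)) K"
proof (cases "fst x : S")
 case True
 have "seg (edge_map s) t t = K" if "t : {0, 1}" for s :: 'a and t :: real
  using that by (auto simp: seg_def const_simplex_def standard_simplex_1 fun_eq_iff simp flip: distrib_right)
 thus ?thesis using True tri_segment[OF continuous_map_edge[OF True], of 0 1 0] tri_segment[OF continuous_map_edge[OF True], of 1 0 1]
  by (auto simp: letter_edge_def inverse_letter_def)
qed (simp add: letter_edge_def tri_K loop_K)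

lemma word_simplex_cons_letter: "tri (rose S) (word_simplex (x # w)) K (word_simplex (cons_letter x w))"
proof (cases "w ~= [] & hd w = inverse_letter x")
 case True
 then obtain u where w: "w = inverse_letter x # u" by (cases w) auto
 have "tri (rose S) K (word_simplex u) (word_simplex (x # w))"
  unfolding w by (rule tri_1[OF tri_word_simplex_Cons tri_word_simplex_Cons tri_inverse_letter])
 from tri_unique[OF loop_word_simplex this tri_K(2)[OF loop_word_simplex]] show ?thesis by (simp add: cons_letter_def w)
next
 case False
 hence "cons_letter x w = x # w" by (auto simp: cons_letter_def)
 thus ?thesis using tri_K(1)[OF loop_word_simplex] by metis
qed

lemma word_simplex_foldr: "tri (rose S) (word_simplex (u @ w)) K (word_simplex (foldr cons_letter u w))"
proof (induction u)
 case (Cons x u)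
 have "tri (rose S) (letter_edge x) (word_simplex (foldr cons_letter u w)) (word_simplex (x # u @ w))"
  by (rule tri_second[OF loop_word_simplex tri_word_simplex_Cons Cons.IH])
 from tri_unique[OF loop_word_simplex this tri_word_simplex_Cons]
 have "tri (rose S) (word_simplex (x # u @ w)) K (word_simplex (x # foldr cons_letter u w))" .
 from tri_end[OF loop_K this word_simplex_cons_letter] show ?case by simp
qed (simp add: tri_K loop_word_simplex)

text \<open>Free reduction of the concatenated word is a homotopy. Fans are built from triangles of
  this kind.\<close>

lemma tri_loop_of: "tri (rose S) (loop_of u) (loop_of w) (loop_of (u + w))"
 unfolding loop_of_def Rep_plus_fg by (rule tri_end[OF loop_word_simplex tri_word_simplex_append word_simplex_foldr])

lemma loop_of_0: "loop_of 0 = K" by (simp add: loop_of_def)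

lemma loop_loop_of: "loop (loop_of w)" by (simp add: loop_of_def loop_word_simplex)

lemma word_path_letter:
 assumes "fst (r ! k) : S"
 shows "seg (word_path r) (real k) (real (Suc k)) = letter_edge (r ! k)" unfolding letter_edge_def seg_def using assms
proof (simp, intro conjI impI; intro restrict_ext)
 fix u :: "nat => real" assume "u : standard_simplex (1)"
 hence u: "0 <= u 0" "0 <= u (1)" "u 0 + u (1) = 1" by (auto simp: standard_simplex_1)
 have e: "u 0 * real k + u (1) * (1 + real k) = (u 0 + u (1)) * real k + u (1)" by (simp add: algebra_simps)
 have u0: "u 0 = 1 - u (1)" "u (1) <= 1" using u by auto
 show "word_path r (u 0 * real k + u (1) * (1 + real k)) = edge_map (fst (r ! k)) (u (1))" if "snd (r ! k)"
  unfolding e using word_path_segment[of k "real k + u (1)" r] u u0 that by simp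
 show "word_path r (u 0 * real k + u (1) * (1 + real k)) = edge_map (fst (r ! k)) (u 0)" if "~ snd (r ! k)"
  unfolding e using word_path_segment[of k "real k + u (1)" r] u u0 that by simp
qed

lemma word_path_loop:
 assumes r: "fst ` set r <= S" and k: "k <= length r"
 shows "tri (rose S) (seg (word_path r) 0 (real k)) K (word_simplex (take k r))" using k
proof (induction k)
 case 0
 have "seg (word_path r) 0 0 = K" by (simp add: seg_def const_simplex_def)
 thus ?case using tri_K loop_K by simp
next
 case (Suc k)
 let ?L = "%a b. seg (word_path r) (real a) (real b)"
 have s: "fst (r ! k) : S" using r Suc.prems by (auto simp: image_subset_iff)
 have L: "loop (?L 0 j)" if "j <= length r" for j using that singular_simplex_segment[OF continuous_map_word_path[OF r], of 0 "real j"]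
  by (auto simp: loop_def singular_face_segment)
 have "tri (rose S) (?L 0 k) (?L k (Suc k)) (?L 0 (Suc k))" using Suc.prems by (intro tri_segment[OF continuous_map_word_path[OF r]]) auto
 hence "tri (rose S) (?L 0 k) (letter_edge (r ! k)) (?L 0 (Suc k))" unfolding word_path_letter[OF s] .
 moreover have "tri (rose S) (letter_edge (r ! k)) K (word_simplex [r ! k])" using tri_word_simplex_Cons[of "r ! k" "[]"] by simp
 ultimately have "tri (rose S) (?L 0 k) (word_simplex [r ! k]) (?L 0 (Suc k))" by (rule tri_second[OF L[OF Suc.prems]])
 from tri_first[OF loop_word_simplex this] Suc
 have "tri (rose S) (word_simplex (take k r)) (word_simplex [r ! k]) (?L 0 (Suc k))" by simp
 from tri_unique[OF loop_word_simplex this tri_word_simplex_append]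
 show ?case using Suc.prems by (simp add: take_Suc_conv_app_nth)
qed

end

section \<open>Cycles in the presentation complex\<close>

lemma Min_triple: "Min {a, b, c :: real} = min a (min b c)" by simp

section \<open>The simplex that represents the disk\<close>

lemma disk_sum: "(\<Sum>j\<le>2. of_real (x j) * cis (2 * pi * real j / 3)) =
  Complex (x 0 - (x 1 + x 2) / 2) ((x 1 - x 2) * sqrt 3 / 2)"
proof -
 have c: "cis (2 * pi * real 1 / 3) = Complex (- 1/2) (sqrt 3 / 2)" using cos_120 sin_120 by (simp add: complex_eq_iff)
 have "cis (2 * pi * real 2 / 3) = cis (2 * pi * real 1 / 3) * cis (2 * pi * real 1 / 3)" by (simp add: cis_mult)
 also have "\<dots> = Complex (- 1/2) (- sqrt 3 / 2)" unfolding c by (simp add: complex_eq_iff)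
 finally have c2: "cis (2 * pi * real 2 / 3) = Complex (- 1/2) (- sqrt 3 / 2)" .
 have s: "(\<Sum>j\<le>2. F j) = F 0 + F 1 + F 2" for F :: "nat => complex"
 proof -
  have "{..2} = {0, 1, 2 :: nat}" by auto
  thus ?thesis by (simp add: add.assoc)
 qed
 show ?thesis unfolding s c c2 by (simp add: complex_eq_iff algebra_simps add_divide_distrib diff_divide_distrib)
qed

text \<open>\<open>sgn\<close> is discontinuous only at 0, where it stays bounded while the factor
  \<open>f\<close> tends to 0.\<close>

lemma continuous_on_times_sgn:
 fixes g :: "'b::metric_space => complex"
 assumes f: "continuous_on A f" and g: "continuous_on A g" and 0: "!!x. x : A ==> g x = 0 ==> f x = 0"
 shows "continuous_on A (%x. of_real (f x) * sgn (g x))" unfolding continuous_on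
proof
 fix x assume x: "x : A"
 have f': "(f \<longlongrightarrow> f x) (at x within A)" and g': "(g \<longlongrightarrow> g x) (at x within A)"
  using f g x by (auto simp: continuous_on)
 show "((%x. of_real (f x) * sgn (g x)) \<longlongrightarrow> of_real (f x) * sgn (g x)) (at x within A)"
 proof (cases "g x = 0")
  case True
  have "((%y. \<bar>f y\<bar>) \<longlongrightarrow> 0) (at x within A)" using tendsto_rabs[OF f'] 0[OF x True] by simp
  hence "((%x. of_real (f x) * sgn (g x)) \<longlongrightarrow> 0) (at x within A)"
   by (rule Lim_null_comparison[rotated]) (auto simp: norm_mult norm_sgn)
  thus ?thesis using True by simp
 next
  case False
  thus ?thesis by (intro tendsto_intros f' g')
 qed
qed

lemma singular_simplex_disk: "singular_simplex 2 (top_of_set (cball 0 1)) disk_simplex"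
proof -
 let ?f = "%x :: nat => real. 1 - 3 * min (x 0) (min (x 1) (x 2))"
 let ?g = "%x :: nat => real. Complex (x 0 - (x 1 + x 2) / 2) ((x 1 - x 2) * sqrt 3 / 2)"
 let ?D = "standard_simplex 2"
 have "continuous_on ?D (%x. of_real (?f x) * sgn (?g x))"
 proof (rule continuous_on_times_sgn)
  show "continuous_on ?D ?f" by (intro continuous_intros)
  have g: "?g = (%x. of_real (x 0 - (x 1 + x 2) / 2) + \<i> * of_real ((x 1 - x 2) * sqrt 3 / 2))" by (auto simp: complex_eq_iff)
  show "continuous_on ?D ?g" unfolding g by (intro continuous_intros) auto
  show "?f x = 0" if "x : ?D" "?g x = 0" for x using that by (auto simp: complex_eq_iff standard_simplex_2 min_def)
 qed
 moreover have "norm (of_real (?f x) * sgn (?g x)) <= 1" if "x : ?D" for x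
 proof -
  have "\<bar>?f x\<bar> <= 1" using that by (auto simp: standard_simplex_2 min_def abs_le_iff)
  moreover have "norm (sgn (?g x)) <= 1" by (simp add: norm_sgn)
  ultimately show ?thesis unfolding norm_mult norm_of_real using mult_mono[of "\<bar>?f x\<bar>" 1 "norm (sgn (?g x))" 1] by simp
 qed
 ultimately have "continuous_map (top_of_set ?D) (top_of_set (cball 0 1)) (%x. of_real (?f x) * sgn (?g x))"
  by (auto simp: continuous_map_in_subtopology)
 hence "continuous_map (top_of_set ?D) (top_of_set (cball 0 1)) disk_simplex"
  by (rule continuous_map_eq) (simp add: disk_simplex_def disk_sum Min_triple)
 thus ?thesis by (simp add: singular_simplex_iff disk_simplex_def)
qed

text \<open>The angle along the edge of \<open>disk_simplex\<close> from vertex 0 to vertex 1, which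
  runs from 0 to 2 pi / 3. The other two edges arise from this one by a rotation and by complex
  conjugation.\<close>

definition arc_angle :: "(nat => real) => real" where
 "arc_angle x = Arg (Complex (x 0 - x 1 / 2) (x 1 * sqrt 3 / 2))"

lemma arc_angle:
 assumes "x : standard_simplex 1"
 shows "Complex (x 0 - x 1 / 2) (x 1 * sqrt 3 / 2) ~: \<real>\<^sub>\<le>\<^sub>0"
  "cis (arc_angle x) = sgn (Complex (x 0 - x 1 / 2) (x 1 * sqrt 3 / 2))"
proof -
 show *: "Complex (x 0 - x 1 / 2) (x 1 * sqrt 3 / 2) ~: \<real>\<^sub>\<le>\<^sub>0"
  using assms by (auto simp: complex_nonpos_Reals_iff standard_simplex_1)
 thus "cis (arc_angle x) = sgn (Complex (x 0 - x 1 / 2) (x 1 * sqrt 3 / 2))"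
  unfolding arc_angle_def by (intro cis_Arg) (metis nonpos_Reals_zero_I)
qed

lemma continuous_on_arc_angle: "continuous_on (standard_simplex 1) arc_angle"
proof -
 have g: "(%x :: nat => real. Complex (x 0 - x 1 / 2) (x 1 * sqrt 3 / 2)) =
   (%x. of_real (x 0 - x 1 / 2) + \<i> * of_real (x 1 * sqrt 3 / 2))" by (auto simp: complex_eq_iff)
 show ?thesis unfolding arc_angle_def
 proof (rule continuous_on_Arg')
  show "continuous_on (standard_simplex 1) (%x :: nat => real. Complex (x 0 - x 1 / 2) (x 1 * sqrt 3 / 2))"
   unfolding g by (intro continuous_intros) auto
 qed (use arc_angle(1) in auto)
qed

lemma arc_angle_ends: "arc_angle (edge_pt 0) = 0" "arc_angle (edge_pt 1) = 2 * pi / 3"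
proof -
 have "Complex 1 0 = 1" by (simp add: complex_eq_iff)
 thus "arc_angle (edge_pt 0) = 0" by (simp add: arc_angle_def edge_pt_def)
 have "Complex (- 1/2) (sqrt 3 / 2) = cis (2 * pi / 3)" using cos_120 sin_120 by (simp add: complex_eq_iff)
 moreover have "arc_angle (edge_pt 1) = Arg (Complex (- 1/2) (sqrt 3 / 2))" by (simp add: arc_angle_def edge_pt_def)
 moreover have "2 * pi / 3 : {- pi<..pi}" using pi_gt_zero by simp
 ultimately show "arc_angle (edge_pt 1) = 2 * pi / 3" by (simp only: Arg_cis)
qed

lemma disk_simplex_faces:
 assumes x: "x : standard_simplex 1"
 shows "singular_face 2 2 disk_simplex x = cis (arc_angle x)"
  "singular_face 2 0 disk_simplex x = cis (2 * pi / 3 + arc_angle x)"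
  "singular_face 2 1 disk_simplex x = cis (- arc_angle x)"
proof -
 let ?z = "Complex (x 0 - x 1 / 2) (x 1 * sqrt 3 / 2)"
 have c: "cis (2 * pi / 3) = Complex (- 1/2) (sqrt 3 / 2)" using cos_120 sin_120 by (simp add: complex_eq_iff)
 have x': "0 <= x 0" "0 <= x 1" "x 0 + x 1 = 1" using x by (auto simp: standard_simplex_1)
 have f: "singular_face 2 k disk_simplex x = disk_simplex (simplical_face k x)" for k using x by (simp add: singular_face_def)
 have d: "disk_simplex (simplical_face k x) = of_real (1 - 3 * min (y 0) (min (y 1) (y 2))) *
   sgn (Complex (y 0 - (y 1 + y 2) / 2) ((y 1 - y 2) * sqrt 3 / 2))" if "y = simplical_face k x" "k <= 2" for k y
  using face_in_simplex_2[OF x that(2)] by (simp add: disk_simplex_def disk_sum Min_triple that(1))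
 show "singular_face 2 2 disk_simplex x = cis (arc_angle x)"
  unfolding f d[OF refl order_refl] using x' by (simp add: arc_angle(2)[OF x] face_2_simps)
 have 0: "sgn (Complex (- (x 0 + x 1) / 2) ((x 0 - x 1) * sqrt 3 / 2)) = cis (2 * pi / 3) * sgn ?z"
 proof -
  have "Complex (- (x 0 + x 1) / 2) ((x 0 - x 1) * sqrt 3 / 2) = cis (2 * pi / 3) * ?z"
   unfolding c by (simp add: complex_eq_iff field_simps)
  thus ?thesis by (simp only: sgn_mult) (simp add: sgn_div_norm)
 qed
 show "singular_face 2 0 disk_simplex x = cis (2 * pi / 3 + arc_angle x)"
  unfolding f d[OF refl le0] using x' 0 by (simp add: face_2_simps One_nat_def arc_angle(2)[OF x] flip: cis_mult)
 have "Complex (x 0 - x 1 / 2) (- x 1 * sqrt 3 / 2) = cnj ?z" by (simp add: complex_eq_iff)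
 hence "sgn (Complex (x 0 - x 1 / 2) (- x 1 * sqrt 3 / 2)) = cnj (sgn ?z)" by (simp add: sgn_div_norm scaleR_conv_of_real)
 hence "sgn (Complex (x 0 - x 1 / 2) (- x 1 * sqrt 3 / 2)) = cis (- arc_angle x)"
  unfolding arc_angle(2)[OF x, symmetric] by (simp add: cis_cnj)
 thus "singular_face 2 1 disk_simplex x = cis (- arc_angle x)" unfolding f d[OF refl one_le_numeral] using x' by (simp add: face_2_simps)
qed

lemma homologous_rel_tetrahedron:
 assumes "tetrahedron X \<Sigma> a b c d"
 shows "homologous_rel 2 X A (frag_of a - frag_of b + frag_of c - frag_of d) 0" using chain_boundary_tetrahedron[OF assms] assms
 unfolding homologous_rel_def singular_relboundary
 by (intro exI[of _ "frag_of \<Sigma>"] exI[of _ 0]) (simp add: tetrahedron_def singular_chain_of numeral_3_eq_3 numeral_2_eq_2)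

section \<open>Integral chains as real chains\<close>

definition real_chain :: "'x chain => 'x real_chain" where
 "real_chain z = Poly_Mapping.map real_of_int z"

lemma lookup_real_chain [simp]: "Poly_Mapping.lookup (real_chain z) \<sigma> = real_of_int (Poly_Mapping.lookup z \<sigma>)"
 by (simp add: real_chain_def Poly_Mapping.map.rep_eq when_def)

lemma real_chain_simps [simp]: "real_chain (y + z) = real_chain y + real_chain z" "real_chain (y - z) = real_chain y - real_chain z"
 "real_chain 0 = 0" "real_chain (frag_of \<sigma>) = Poly_Mapping.single \<sigma> 1"
 by (rule poly_mapping_eqI; simp add: lookup_add lookup_minus lookup_single when_def)+

definition pairing :: "('b => real) => ('b \<Rightarrow>\<^sub>0 real) => real" where
 "pairing d c = (\<Sum>\<sigma>\<in>Poly_Mapping.keys c. Poly_Mapping.lookup c \<sigma> * d \<sigma>)"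

lemma pairing_superset: "finite A ==> Poly_Mapping.keys c <= A ==> pairing d c = (\<Sum>\<sigma>\<in>A. Poly_Mapping.lookup c \<sigma> * d \<sigma>)"
 unfolding pairing_def by (intro sum.mono_neutral_left) (auto simp: in_keys_iff)

lemma pairing_linear [simp]: "pairing d (a + b) = pairing d a + pairing d b" "pairing d (a - b) = pairing d a - pairing d b"
proof -
 let ?A = "Poly_Mapping.keys a Un Poly_Mapping.keys b"
 have "Poly_Mapping.keys (a + b) <= ?A" "Poly_Mapping.keys (a - b) <= ?A" using Poly_Mapping.keys_add[of a b] keys_diff[of a b] by blast+
 thus "pairing d (a + b) = pairing d a + pairing d b" "pairing d (a - b) = pairing d a - pairing d b"
  using pairing_superset[of ?A] by (simp_all add: lookup_add lookup_minus algebra_simps sum.distrib sum_subtractf)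
qed

lemma pairing_single [simp]: "pairing d (Poly_Mapping.single \<sigma> x) = x * d \<sigma>" "pairing d 0 = 0"
 by (simp_all add: pairing_def lookup_single)

lemma l1_superset: "finite A ==> Poly_Mapping.keys c <= A ==> l1_norm c = (\<Sum>\<sigma>\<in>A. \<bar>Poly_Mapping.lookup c \<sigma>\<bar>)"
 unfolding l1_norm_def by (intro sum.mono_neutral_left) (auto simp: in_keys_iff)

lemma l1_norm_triangle: "l1_norm (a + b) <= l1_norm a + l1_norm b" "l1_norm (a - b) <= l1_norm a + l1_norm b"
proof -
 let ?A = "Poly_Mapping.keys a Un Poly_Mapping.keys b"
 have "Poly_Mapping.keys (a + b) <= ?A" "Poly_Mapping.keys (a - b) <= ?A" using Poly_Mapping.keys_add[of a b] keys_diff[of a b] by blast+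
 thus "l1_norm (a + b) <= l1_norm a + l1_norm b" "l1_norm (a - b) <= l1_norm a + l1_norm b"
  using l1_superset[of ?A] by (auto simp: lookup_add lookup_minus simp flip: sum.distrib intro!: sum_mono abs_triangle_ineq abs_triangle_ineq4)
qed

lemma l1_norm_single [simp]: "l1_norm (Poly_Mapping.single \<sigma> x) = \<bar>x\<bar>" by (simp add: l1_norm_def)

section \<open>Multiplicity of the 2-cell in fillings of loops\<close>

locale presentation =
 fixes S :: "'a set" and r :: "'a word"
 assumes letters: "fst ` set r <= S" and reduced_relator: "reduced r" and nontrivial: "r ~= []"
begin

sublocale loop_space "rose S" Vertex by (rule loop_space_rose)

abbreviation "P \<equiv> presentation_complex S r"
abbreviation "R \<equiv> rose S"

definition cell_chain :: "'a cell_point chain" where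
 "cell_chain = frag_of (simplex_map 2 (face_map r) disk_simplex)"

text \<open>The multiplicity of the 2-cell in a triangle, measured modulo boundaries and chains of
  the rose. \<open>ctri\<close> keeps track of it while triangles are exchanged through
  tetrahedra.\<close>

definition cls :: "((nat => real) => 'a cell_point) => int => bool" where
 "cls \<sigma> m \<longleftrightarrow> homologous_rel 2 P (topspace R) (frag_of \<sigma>) (frag_cmul m cell_chain)"

definition ctri where "ctri p q s m \<longleftrightarrow> (\<exists>\<sigma>. triangle P \<sigma> p q s & cls \<sigma> m)"

lemma simplex_rose: "singular_simplex p R \<sigma> ==> singular_simplex p P \<sigma>"
 using presentation_rose(1)[OF letters] by (metis singular_simplex_subtopology)

lemma chain_rose: "singular_chain p R z ==> homologous_rel p P (topspace R) z 0"
 using presentation_rose(1)[OF letters] unfolding homologous_rel_def singular_relboundary by (intro exI[of _ 0] exI[of _ z]) simp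

lemma triangle_rose: "triangle R \<sigma> p q s ==> triangle P \<sigma> p q s" by (simp add: triangle_def simplex_rose)

lemma ctri_rose: "tri R p q s ==> ctri p q s 0" using chain_rose[of 2] triangle_rose unfolding tri_def ctri_def cls_def
 by (fastforce simp: singular_chain_of triangle_def)

text \<open>The alternating sum of the four faces of a tetrahedron bounds, so three multiplicities
  determine the fourth.\<close>

lemma ctri_1:
 assumes "ctri e12 e23 e13 m0" "ctri e01 e13 e03 m2" "ctri e01 e12 e02 m3"
 shows "ctri e02 e23 e03 (m0 + m2 - m3)"
proof -
 obtain a c d where t: "triangle P a e12 e23 e13" "triangle P c e01 e13 e03" "triangle P d e01 e12 e02"
  and cl: "cls a m0" "cls c m2" "cls d m3" using assms unfolding ctri_def by blast
 obtain b \<Sigma> where b: "triangle P b e02 e23 e03" "tetrahedron P \<Sigma> a b c d" by (rule tetrahedron_fill_1[OF t])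
 have "homologous_rel 2 P (topspace R) (frag_of a + frag_of c - frag_of d - (frag_of a - frag_of b + frag_of c - frag_of d))
   (frag_cmul m0 cell_chain + frag_cmul m2 cell_chain - frag_cmul m3 cell_chain - 0)" using cl unfolding cls_def
  by (intro homologous_rel_diff homologous_rel_add homologous_rel_tetrahedron[OF b(2)])
 hence "cls b (m0 + m2 - m3)" by (simp add: cls_def frag_cmul_distrib frag_cmul_diff_distrib)
 with b(1) show ?thesis unfolding ctri_def by blast
qed

lemma ctri_2:
 assumes "ctri e12 e23 e13 m0" "ctri e02 e23 e03 m1" "ctri e01 e12 e02 m3"
 shows "ctri e01 e13 e03 (m1 + m3 - m0)"
proof -
 obtain a b d where t: "triangle P a e12 e23 e13" "triangle P b e02 e23 e03" "triangle P d e01 e12 e02"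
  and cl: "cls a m0" "cls b m1" "cls d m3" using assms unfolding ctri_def by blast
 obtain c \<Sigma> where c: "triangle P c e01 e13 e03" "tetrahedron P \<Sigma> a b c d" by (rule tetrahedron_fill_2[OF t])
 have "homologous_rel 2 P (topspace R) (frag_of b + frag_of d - frag_of a + (frag_of a - frag_of b + frag_of c - frag_of d))
   (frag_cmul m1 cell_chain + frag_cmul m3 cell_chain - frag_cmul m0 cell_chain + 0)" using cl unfolding cls_def
  by (intro homologous_rel_diff homologous_rel_add homologous_rel_tetrahedron[OF c(2)])
 hence "cls c (m1 + m3 - m0)" by (simp add: cls_def frag_cmul_distrib frag_cmul_diff_distrib)
 with c(1) show ?thesis unfolding ctri_def by blast
qed

lemma ctri_K: "loop p ==> ctri p K p 0" "loop p ==> ctri K p p 0" "ctri K K K 0" using ctri_rose tri_K loop_K by blast+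

lemma ctri_shift: "ctri p K K m ==> loop u ==> tri R u p s ==> ctri s K u m" using ctri_1[OF _ ctri_K(1) ctri_rose] by fastforce

text \<open>\<open>ctri p K K m\<close> says that the loop \<open>p\<close> has a filling which
  covers the 2-cell m times, counted with sign. Such fillings are composed, inverted and conjugated
  like relations with their degrees.\<close>

lemma ctri_sum:
 assumes "ctri p K K m" "ctri q K K n" "loop p" "tri R p q s"
 shows "ctri s K K (m + n)" using ctri_2[OF ctri_K(3) assms(1) ctri_shift[OF assms(2-4)]] by simp

lemma ctri_inverse:
 assumes "ctri p K K m" "loop p'" "tri R p' p K"
 shows "ctri p' K K (- m)" using ctri_1[OF ctri_K(3) ctri_K(3) ctri_shift[OF assms]] by simp

lemma ctri_conj:
 assumes "ctri p K K m" "loop u" "loop u'" "tri R u p s" "tri R s u' t" "tri R u u' K"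
 shows "ctri t K K m"
proof -
 have "ctri s u' K m" using ctri_2[OF ctri_K(2)[OF assms(3)] ctri_rose[OF assms(6)] ctri_shift[OF assms(1,2,4)]] by simp
 from ctri_1[OF ctri_K(1)[OF assms(3)] this ctri_rose[OF assms(5)]] show ?thesis by simp
qed

text \<open>The disk simplex is a triangle whose edges are arcs of the boundary circle; mapped to
  \<open>P\<close> it has multiplicity 1. It remains to reassemble the full boundary loop from the
  three arcs, by triangles of the rose that come from the real line.\<close>

lemma ctri_relator: "ctri (loop_of S (ev r)) K K 1"
proof -
 let ?R = "top_of_set (UNIV :: real set)"
 define f where "f = face_map r o cis"
 have f: "continuous_map ?R R f" unfolding f_def by (rule continuous_map_compose[OF _ continuous_map_face_boundary[OF letters]])
   (auto simp: continuous_map_in_subtopology intro!: continuous_intros)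
 define \<alpha> where "\<alpha> c e = restrict (%x. c + e * arc_angle x) (standard_simplex 1)" for c e :: real
 have \<alpha>: "singular_simplex 1 ?R (\<alpha> c e)" for c e
  using continuous_on_arc_angle by (auto simp: singular_simplex_iff \<alpha>_def intro!: continuous_intros)
 have \<alpha>e: "\<alpha> c e (edge_pt 0) = c" "\<alpha> c e (edge_pt 1) = c + e * (2 * pi / 3)" for c e
  using edge_pt_in[of 0] edge_pt_in[of 1] arc_angle_ends by (simp_all add: \<alpha>_def)
 let ?s = "seg (%t :: real. t)"
 have seg: "singular_simplex 1 ?R (?s a b)" for a b by (rule singular_simplex_segment[of UNIV]) auto
 have sege: "?s a b (edge_pt 0) = a" "?s a b (edge_pt 1) = b" for a b
  using edge_pt_in[of 0] edge_pt_in[of 1] by (simp_all add: seg_def edge_pt_def)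
 have segf: "simplex_map 1 f (?s a b) = seg f a b" for a b by (auto simp: simplex_map_def seg_def fun_eq_iff)
 have rt: "tri R (simplex_map 1 f p) (simplex_map 1 f q) (simplex_map 1 f s)"
  if "singular_simplex 1 ?R p" "singular_simplex 1 ?R q" "singular_simplex 1 ?R s"
   "p (edge_pt 1) = q (edge_pt 0)" "p (edge_pt 0) = s (edge_pt 0)" "q (edge_pt 1) = s (edge_pt 1)" for p q s
  by (rule tri_map[OF tri_real[OF that] f])
 let ?E01 = "simplex_map 1 f (\<alpha> 0 1)" and ?E12 = "simplex_map 1 f (\<alpha> (2 * pi / 3) 1)" and ?E02 = "simplex_map 1 f (\<alpha> 0 (- 1))"
  and ?E20 = "simplex_map 1 f (?s (4 * pi / 3) (2 * pi))" and ?M = "simplex_map 1 f (?s (2 * pi / 3) (2 * pi))"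
  and ?L = "simplex_map 1 f (?s 0 (2 * pi))"
 have f0: "f 0 = Vertex" using face_map_cis[of 0 r] by (simp add: f_def)
 have K: "simplex_map 1 f (?s 0 0) = K" unfolding segf by (auto simp: seg_def const_simplex_def f0)
 have per: "f (x + 2 * pi) = f x" for x by (simp add: f_def flip: cis_mult)
 \<comment> \<open>Modulo a full turn \<open>?E20\<close> runs from - 2 pi / 3 to 0, so it is
   inverse to the edge \<open>?E02\<close>, which runs from 0 to - 2 pi / 3.\<close>
 have shift: "?E20 = simplex_map 1 f (?s (- 2 * pi / 3) 0)" unfolding segf unfolding seg_def
 proof (rule restrict_ext)
  fix u :: "nat => real" assume "u : standard_simplex 1"
  hence u: "u 0 + u 1 = 1" by (simp add: standard_simplex_1)
  have e: "u 0 *\<^sub>R (4 * pi / 3) + u 1 *\<^sub>R (2 * pi) = u 0 *\<^sub>R (- 2 * pi / 3) + u 1 *\<^sub>R 0 + (u 0 + u 1) * (2 * pi)"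
   by (simp add: algebra_simps)
  show "f (u 0 *\<^sub>R (4 * pi / 3) + u 1 *\<^sub>R (2 * pi)) = f (u 0 *\<^sub>R (- 2 * pi / 3) + u 1 *\<^sub>R 0)"
   unfolding e u mult_1_left by (rule per)
 qed
 have T1: "tri R ?E12 ?E20 ?M" by (rule rt) (rule \<alpha> seg | simp add: \<alpha>e sege)+
 have T2: "tri R ?E02 ?E20 K" unfolding shift K[symmetric] by (rule rt) (rule \<alpha> seg | simp add: \<alpha>e sege)+
 have T3: "tri R ?E01 ?M ?L" by (rule rt) (rule \<alpha> seg | simp add: \<alpha>e sege)+
 have "triangle (top_of_set (cball 0 1)) disk_simplex (simplex_map 1 cis (\<alpha> 0 1))
   (simplex_map 1 cis (\<alpha> (2 * pi / 3) 1)) (simplex_map 1 cis (\<alpha> 0 (- 1)))"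
  unfolding triangle_def using singular_simplex_disk disk_simplex_faces
  by (auto simp: fun_eq_iff simplex_map_def \<alpha>_def singular_face_def)
 from triangle_simplex_map[OF this continuous_map_face]
 have "triangle P (simplex_map 2 (face_map r) disk_simplex) ?E01 ?E12 ?E02"
  by (simp add: f_def simplex_map_def \<alpha>_def cong: restrict_cong) (simp add: restrict_def comp_def)
 hence D: "ctri ?E01 ?E12 ?E02 1" unfolding ctri_def cls_def cell_chain_def by (intro exI conjI) auto
 have "ctri ?E01 ?M K 1" using ctri_2[OF ctri_rose[OF T1] ctri_rose[OF T2] D] by simp
 moreover have "loop ?L" "tri R ?M K ?M"
 proof -
  have "f (2 * pi) = Vertex" using face_map_cis[of "2 * pi" r] by (simp add: f_def)
  thus "loop ?L" unfolding segf loop_def singular_face_segment using singular_simplex_segment[OF f] f0 by simp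
  show "tri R ?M K ?M" unfolding segf
   using tri_const(1)[OF singular_simplex_segment[OF f], of "2 * pi / 3" "2 * pi" Vertex] \<open>f (2 * pi) = Vertex\<close>
   by (simp add: singular_face_segment)
 qed
 ultimately have L: "ctri ?L K K 1" using ctri_1[OF ctri_rose _ ctri_rose[OF T3]] by fastforce
 have "?L = seg (word_path r) 0 (real (length r))" unfolding segf unfolding seg_def
 proof (rule restrict_ext)
  fix u :: "nat => real" assume "u : standard_simplex 1"
  hence "0 <= u 1" "u 1 <= 1" by (auto simp: standard_simplex_1)
  thus "f (u 0 *\<^sub>R 0 + u 1 *\<^sub>R (2 * pi)) = word_path r (u 0 *\<^sub>R 0 + u 1 *\<^sub>R real (length r))"
   using face_map_cis[of "u 1 * (2 * pi)" r] by (simp add: f_def)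
 qed
 with word_path_loop[OF letters order_refl] have "tri R ?L K (loop_of S (ev r))" using reduced_relator by (simp add: loop_of_def)
 from ctri_1[OF ctri_K(3) L ctri_rose[OF this]] show ?thesis by simp
qed

lemma ctri_loop_of: "Rdeg (ev r) w n ==> ctri (loop_of S w) K K n"
proof (induction rule: Rdeg.induct)
 case zero
 show ?case using ctri_K(3) by (simp add: loop_of_0)
next
 case (pos w n u)
 note t = tri_loop_of[of S]
 have "ctri (loop_of S (u + ev r - u)) K K 1"
  using ctri_conj[OF ctri_relator loop_loop_of loop_loop_of t, of u "- u"] t[of "u + ev r" "- u"] t[of u "- u"] by (simp add: loop_of_0)
 from ctri_sum[OF this pos.IH loop_loop_of t] show ?case by (simp add: add.commute)
next
 case (neg w n u)
 note t = tri_loop_of[of S]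
 have "ctri (loop_of S (- ev r)) K K (- 1)" using ctri_inverse[OF ctri_relator loop_loop_of] t[of "- ev r" "ev r"] by (simp add: loop_of_0)
 hence "ctri (loop_of S (u - ev r - u)) K K (- 1)"
  using ctri_conj[OF _ loop_loop_of loop_loop_of t, of "- ev r" "- 1" u "- u"] t[of "u - ev r" "- u"] t[of u "- u"] by (simp add: loop_of_0)
 from ctri_sum[OF this neg.IH loop_loop_of t] show ?case by simp
qed

text \<open>Later \<open>d\<close> is the degree cochain and \<open>D\<close> a primitive for it on
  loops of the rose. This condition is carried along so that \<open>d\<close> can be evaluated on
  cycles whose simplices are only known to exist.\<close>

abbreviation rose_primitive :: "(((nat => real) => 'a cell_point) => real) => ('a fg => real) => bool"
 where "rose_primitive d D \<equiv> \<forall>\<sigma> u w. triangle R \<sigma> (loop_of S u) (loop_of S w) (loop_of S (u + w)) --> d \<sigma> = D u + D w - D (u + w)"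

text \<open>The product is built up from the right, one factor at a time, and each factor costs one
  triangle, hence four per commutator.\<close>

lemma fan:
 assumes "Comm k y"
 shows "\<exists>F. singular_chain 2 R F & chain_boundary 2 F = frag_of (loop_of S y) - frag_of K &
  l1_norm (real_chain F) <= 4 * real k &
  (\<forall>d D. rose_primitive d D -->
   pairing d (real_chain F) = D y - D 0)" using assms
proof (induction rule: Comm.induct)
 case zero
 show ?case by (intro exI[of _ 0]) (auto simp: loop_of_0 l1_norm_def)
next
 case (Suc k w a b)
 then obtain F where F: "singular_chain 2 R F" "chain_boundary 2 F = frag_of (loop_of S w) - frag_of K"
  "l1_norm (real_chain F) <= 4 * real k"
  "!!d D. rose_primitive d D ==>
   pairing d (real_chain F) = D w - D 0" by blast
 have ex: "\<exists>\<sigma>. triangle R \<sigma> (loop_of S u) (loop_of S v) (loop_of S (u + v))" for u v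
  using tri_loop_of unfolding tri_def .
 \<comment> \<open>Multiplication by - b and - a is undone through triangles with the edges of b and
   a, which enter with the opposite sign to those of the later factors b and a; so these edges
   cancel in the boundary.\<close>
 define v1 v2 v3 v4 where v: "v1 = - b + w" "v2 = - a + v1" "v3 = b + v2" "v4 = a + v3"
 have eq: "b + v1 = w" "a + v2 = v1" "b + v2 = v3" "a + v3 = v4" by (simp_all only: v add_minus_cancel)
 obtain \<sigma>1 \<sigma>2 \<sigma>3 \<sigma>4 where t: "triangle R \<sigma>1 (loop_of S b) (loop_of S v1) (loop_of S (b + v1))"
  "triangle R \<sigma>2 (loop_of S a) (loop_of S v2) (loop_of S (a + v2))"
  "triangle R \<sigma>3 (loop_of S b) (loop_of S v2) (loop_of S (b + v2))"
  "triangle R \<sigma>4 (loop_of S a) (loop_of S v3) (loop_of S (a + v3))" using ex by meson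
 let ?F = "F + frag_of \<sigma>1 + frag_of \<sigma>2 - frag_of \<sigma>3 - frag_of \<sigma>4"
 have s: "singular_simplex 2 R \<sigma>1" "singular_simplex 2 R \<sigma>2" "singular_simplex 2 R \<sigma>3" "singular_simplex 2 R \<sigma>4"
  using t by (simp_all add: triangle_def)
 have y: "a + b - a - b + w = v4" by (simp only: v add.assoc diff_conv_add_uminus)
 have 1: "singular_chain 2 R ?F" using F(1) s by (intro singular_chain_add singular_chain_diff) (simp_all add: singular_chain_of)
 have 2: "chain_boundary 2 ?F = frag_of (loop_of S v4) - frag_of K"
  using t[THEN chain_boundary_triangle] F(2) by (simp add: chain_boundary_add chain_boundary_diff eq)
 have 3: "l1_norm (real_chain ?F) <= 4 * real (Suc k)" using F(3) l1_norm_triangle(1)[of "real_chain F" "Poly_Mapping.single \<sigma>1 1"]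
   l1_norm_triangle(1)[of "real_chain (F + frag_of \<sigma>1)" "Poly_Mapping.single \<sigma>2 1"]
   l1_norm_triangle(2)[of "real_chain (F + frag_of \<sigma>1 + frag_of \<sigma>2)" "Poly_Mapping.single \<sigma>3 1"]
   l1_norm_triangle(2)[of "real_chain (F + frag_of \<sigma>1 + frag_of \<sigma>2 - frag_of \<sigma>3)" "Poly_Mapping.single \<sigma>4 1"]
  by simp
 have 4: "pairing d (real_chain ?F) = D v4 - D 0"
  if d: "rose_primitive d D" for d D using F(4)[OF d] t[THEN d[rule_format]] by (simp add: eq)
 show ?case unfolding y using 1 2 3 4 by blast
qed

text \<open>The fan is closed by a filling of the loop of \<open>y\<close>, which covers the 2-cell
  n times and enters with negative sign. A constant triangle cancels the remaining constant edge;
  these two account for the constant 2.\<close>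

lemma commutator_cycle:
 assumes "Comm k y" "Rdeg (ev r) y n"
 shows "\<exists>z. singular_chain 2 P z & chain_boundary 2 z = 0 &
  homologous_rel 2 P (topspace R) z (frag_cmul (- n) cell_chain) & l1_norm (real_chain z) <= 4 * real k + 2 &
  (\<forall>d D. rose_primitive d D -->
   (\<forall>\<sigma>. triangle P \<sigma> (loop_of S y) K K --> d \<sigma> = 0) --> (\<forall>\<sigma>. triangle P \<sigma> K K K --> d \<sigma> = 0) -->
   pairing d (real_chain z) = D y - D 0)"
proof -
 obtain F where F: "singular_chain 2 R F" "chain_boundary 2 F = frag_of (loop_of S y) - frag_of K"
  "l1_norm (real_chain F) <= 4 * real k"
  "!!d D. rose_primitive d D ==>
   pairing d (real_chain F) = D y - D 0" using fan[OF assms(1)] by blast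
 obtain \<nu> where \<nu>: "triangle P \<nu> (loop_of S y) K K" "cls \<nu> n" using ctri_loop_of[OF assms(2)] unfolding ctri_def by blast
 obtain \<kappa> where \<kappa>: "triangle R \<kappa> K K K" using tri_K[OF loop_K] unfolding tri_def by blast
 let ?z = "F - frag_of \<nu> + frag_of \<kappa>"
 have FP: "singular_chain 2 P F" using F(1) simplex_rose by (auto simp: singular_chain_def)
 have 1: "singular_chain 2 P ?z"
  using FP \<nu>(1) triangle_rose[OF \<kappa>] by (intro singular_chain_add singular_chain_diff) (simp_all add: singular_chain_of triangle_def)
 have 2: "chain_boundary 2 ?z = 0"
  using chain_boundary_triangle[OF \<nu>(1)] chain_boundary_triangle[OF \<kappa>] F(2) by (simp add: chain_boundary_add chain_boundary_diff)
 have "singular_chain 2 R (frag_of \<kappa>)" using \<kappa> by (simp add: singular_chain_of triangle_def)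
 hence "homologous_rel 2 P (topspace R) ?z (0 - frag_cmul n cell_chain + 0)"
  using chain_rose F(1) \<nu>(2) unfolding cls_def by (intro homologous_rel_add homologous_rel_diff) auto
 hence 3: "homologous_rel 2 P (topspace R) ?z (frag_cmul (- n) cell_chain)" by simp
 have 4: "l1_norm (real_chain ?z) <= 4 * real k + 2" using F(3) l1_norm_triangle(2)[of "real_chain F" "Poly_Mapping.single \<nu> 1"]
   l1_norm_triangle(1)[of "real_chain (F - frag_of \<nu>)" "Poly_Mapping.single \<kappa> 1"] by simp
 have 5: "pairing d (real_chain ?z) = D y - D 0"
  if "rose_primitive d D"
   "\<forall>\<sigma>. triangle P \<sigma> (loop_of S y) K K --> d \<sigma> = 0" "\<forall>\<sigma>. triangle P \<sigma> K K K --> d \<sigma> = 0" for d D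
  using F(4)[OF that(1)] that(2)[rule_format, OF \<nu>(1)] that(3)[rule_format, OF triangle_rose[OF \<kappa>]] by simp
 show ?thesis using 1 2 3 4 5 by blast
qed

end

section \<open>Cosets of the relations\<close>

text \<open>Cocycles take values in a type, whereas the quotient by the relations depends on
  \<open>r\<close>; it is therefore embedded into a group of permutations.\<close>

typedef 'b bijection = "{f :: 'b => 'b. bij f}" by (rule exI[of _ id]) simp

lemma bij_Rep_bijection: "bij (Rep_bijection f)" using Rep_bijection by blast

instantiation bijection :: (type) group_add
begin

definition "f + g = Abs_bijection (Rep_bijection f o Rep_bijection g)"
definition "0 = Abs_bijection id"
definition "- f = Abs_bijection (inv_into UNIV (Rep_bijection f))"
definition "f - g = f + - (g :: 'a bijection)"

lemma Rep_bijection_simps: "Rep_bijection (f + g) = Rep_bijection f o Rep_bijection g"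
 "Rep_bijection 0 = id" "Rep_bijection (- f) = inv_into UNIV (Rep_bijection f)"
 by (simp_all add: plus_bijection_def zero_bijection_def uminus_bijection_def Abs_bijection_inverse
   bij_comp bij_imp_bij_inv bij_Rep_bijection)

instance
proof
 fix a b c :: "'a bijection"
 note eqI = Rep_bijection_inject[THEN iffD1]
 show "a + b + c = a + (b + c)" by (rule eqI) (simp add: Rep_bijection_simps comp_assoc)
 show "0 + a = a" "a + 0 = a" by (rule eqI, simp add: Rep_bijection_simps)+
 show "- a + a = 0" by (rule eqI) (simp add: Rep_bijection_simps bij_is_inj bij_Rep_bijection)
qed (simp add: minus_bijection_def)

end

text \<open>The quotient by the relations is realised faithfully by its action on unions of cosets.\<close>

definition saturated :: "'g::group_add => 'g set => bool" where
 "saturated r C \<longleftrightarrow> (\<forall>x\<in>C. \<forall>y n. Rdeg r y n --> x + y : C)"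

text \<open>Sets that are not unions of cosets are fixed, so that \<open>act r w\<close> is a
  permutation of all sets.\<close>

definition act :: "'g::group_add => 'g => 'g set => 'g set" where
 "act r w C = (if saturated r C then (+) w ` C else C)"

lemma act_add: "act r u (act r w C) = act r (u + w) C"
proof (cases "saturated r C")
 case True
 hence "saturated r ((+) w ` C)" by (auto simp: saturated_def add.assoc)
 with True show ?thesis by (simp add: act_def image_image add.assoc)
qed (simp add: act_def)

lemma act_zero: "act r 0 = id" by (auto simp: act_def fun_eq_iff)

lemma bij_act: "bij (act r w)" by (rule o_bij[of "act r (- w)"]) (simp_all add: fun_eq_iff act_add act_zero)

definition perm :: "'g::group_add => 'g => 'g set bijection" where
 "perm r w = Abs_bijection (act r w)"

lemma Rep_perm: "Rep_bijection (perm r w) = act r w" by (simp add: perm_def Abs_bijection_inverse bij_act)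

lemma perm_add: "perm r (u + w) = perm r u + perm r w"
 by (rule Rep_bijection_inject[THEN iffD1]) (simp add: Rep_bijection_simps Rep_perm fun_eq_iff act_add)

lemma perm_zero: "perm r 0 = 0" by (rule Rep_bijection_inject[THEN iffD1]) (simp add: Rep_bijection_simps Rep_perm act_zero)

lemma perm_minus: "perm r (- w) = - perm r w" using perm_add[of r "- w" w] by (simp add: perm_zero eq_neg_iff_add_eq_0)

text \<open>The set of all relations is saturated and contains 0, so it detects whether
  \<open>w\<close> is a relation. Conversely, w + x = x + (- x + w + x), so a relation translates
  elements of a saturated set by relations from the right.\<close>

lemma perm_zero_iff: "perm r w = 0 \<longleftrightarrow> (\<exists>n. Rdeg r w n)"
proof
 assume "perm r w = 0"
 hence "act r w = id" using Rep_perm[of r w] by (simp add: Rep_bijection_simps)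
 hence "act r w {y. \<exists>n. Rdeg r y n} = {y. \<exists>n. Rdeg r y n}" by simp
 moreover have "saturated r {y. \<exists>n. Rdeg r y n}" unfolding saturated_def using Rdeg_add by blast
 ultimately have "(+) w ` {y. \<exists>n. Rdeg r y n} = {y. \<exists>n. Rdeg r y n}" by (simp add: act_def)
 moreover have "w + 0 : (+) w ` {y. \<exists>n. Rdeg r y n}" using Rdeg.zero by blast
 ultimately show "\<exists>n. Rdeg r w n" by auto
next
 assume "\<exists>n. Rdeg r w n"
 then obtain n where n: "Rdeg r w n" ..
 have "(+) w ` C = C" if C: "saturated r C" for C
 proof (intro equalityI subsetI)
  fix z assume "z : (+) w ` C"
  then obtain x where x: "x : C" "z = w + x" by blast
  have "z = x + (- x + w + x)" unfolding x(2) by (simp add: add.assoc[symmetric])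
  thus "z : C" using C x(1) Rdeg_conj'[OF n, of x] unfolding saturated_def by metis
 next
  fix x assume x: "x : C"
  have "x + (- x + - w + x) : C" using C x Rdeg_conj'[OF Rdeg_uminus[OF n], of x] unfolding saturated_def by metis
  moreover have "x = w + (x + (- x + - w + x))" by (simp add: add.assoc del: add_uminus_conv_diff)
  ultimately show "x : (+) w ` C" by (rule rev_image_eqI)
 qed
 hence "act r w = id" unfolding act_def by (auto simp: fun_eq_iff)
 thus "perm r w = 0" by (intro Rep_bijection_inject[THEN iffD1]) (simp add: Rep_bijection_simps Rep_perm)
qed

lemma perm_word: "sum_list (map (letter_value (%s. perm r (ev [(s, True)]))) w) = perm r (ev w)"
proof (induction w)
 case (Cons x w)
 have "letter_value (%s. perm r (ev [(s, True)])) x = perm r (ev [x])"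
 proof (cases "snd x")
  case True
  thus ?thesis by (cases x) (simp add: letter_value_def)
 next
  case False
  hence "x = inverse_letter (fst x, True)" by (cases x) (simp add: inverse_letter_def)
  hence "ev [x] = - ev [(fst x, True)]" using ev_inverse_letter by metis
  thus ?thesis using False by (simp add: letter_value_def perm_minus)
 qed
 thus ?case using Cons ev_append[of "[x]" w] by (simp add: perm_add)
qed (simp add: perm_zero)

text \<open>The retraction of the free group onto the subgroup on \<open>S\<close> that kills all
  other generators. It appears because \<open>fg\<close> contains all letters of the type, while the
  rose has edges for \<open>S\<close> only.\<close>

definition project :: "'a set => 'a fg => 'a fg" where
 "project S w = ev (filter (%x. fst x : S) (Rep_fg w))"

lemma ev_filter_foldr:
 "ev (filter (%x. fst x : S) (foldr cons_letter u w)) = ev (filter (%x. fst x : S) u) + ev (filter (%x. fst x : S) w)"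
proof (induction u)
 case (Cons x u)
 let ?Q = "filter (%x. fst x : S)" and ?w = "foldr cons_letter u w"
 have "ev (?Q (cons_letter x ?w)) = ev (?Q [x]) + ev (?Q ?w)"
 proof (cases "?w ~= [] & hd ?w = inverse_letter x")
  case True
  then obtain t where t: "?w = inverse_letter x # t" by (cases ?w) auto
  thus ?thesis using ev_append[of "[inverse_letter x]" "?Q t"] ev_inverse_letter[of x] by (simp add: cons_letter_def add.assoc[symmetric])
 next
  case False
  hence "cons_letter x ?w = [x] @ ?w" by (auto simp: cons_letter_def)
  thus ?thesis by (simp only: filter_append ev_append)
 qed
 moreover have "?Q (x # u) = ?Q [x] @ ?Q u" by simp
 ultimately show ?case using Cons by (simp only: foldr.simps comp_apply ev_append add.assoc)
qed simp

lemma project_add: "project S (u + w) = project S u + project S w" by (simp add: project_def Rep_plus_fg ev_filter_foldr)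

section \<open>The boundary of real chains\<close>

definition incidence :: "nat => ((nat => real) => 'x) => ((nat => real) => 'x) => real" where
 "incidence p \<tau> \<sigma> = (\<Sum>k\<le>p. (- 1) ^ k * of_bool (singular_face p k \<sigma> = \<tau>))"

lemma pairing_sum: "pairing d (sum f A) = (\<Sum>a\<in>A. pairing d (f a))" by (induction A rule: infinite_finite_induct) simp_all

lemma pairing_boundary:
 "p ~= 0 ==> pairing d (real_chain_boundary p c) = pairing (%\<sigma>. \<Sum>k\<le>p. (- 1) ^ k * d (singular_face p k \<sigma>)) c"
 by (simp add: real_chain_boundary_def pairing_sum) (simp add: pairing_def sum_distrib_left mult_ac)

text \<open>Coefficients are themselves pairings, so identities of real chains follow from the
  formula for pairings with a boundary.\<close>

lemma lookup_pairing: "Poly_Mapping.lookup c \<tau> = pairing (%\<sigma>. of_bool (\<sigma> = \<tau>)) c"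
proof -
 have "pairing (%\<sigma>. of_bool (\<sigma> = \<tau>)) c = (\<Sum>\<sigma>\<in>insert \<tau> (Poly_Mapping.keys c). Poly_Mapping.lookup c \<sigma> * of_bool (\<sigma> = \<tau>))"
  by (rule pairing_superset) auto
 also have "\<dots> = (\<Sum>\<sigma>\<in>insert \<tau> (Poly_Mapping.keys c). if \<sigma> = \<tau> then Poly_Mapping.lookup c \<sigma> else 0)"
  by (rule sum.cong) auto
 finally show ?thesis by (simp add: sum.delta)
qed

lemma lookup_boundary: "p ~= 0 ==> Poly_Mapping.lookup (real_chain_boundary p c) \<tau> = pairing (incidence p \<tau>) c"
 by (simp add: lookup_pairing pairing_boundary incidence_def[abs_def])

lemma real_chain_boundary_real_chain: "p ~= 0 ==> real_chain_boundary p (real_chain z) = real_chain (chain_boundary p z)"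
proof (rule poly_mapping_eqI)
 fix \<tau> assume p: "p ~= 0"
 have "Poly_Mapping.keys z <= UNIV" by simp
 hence "pairing (incidence p \<tau>) (real_chain z) = pairing (%\<sigma>. of_bool (\<sigma> = \<tau>)) (real_chain (chain_boundary p z))"
 proof (induction z rule: frag_induction)
  case (one \<sigma>)
  have "real_chain (frag_cmul ((- 1) ^ k) (frag_of (singular_face p k \<sigma>))) = Poly_Mapping.single (singular_face p k \<sigma>) ((- 1) ^ k)" for k
   by (rule poly_mapping_eqI) (simp add: lookup_single when_def)
  moreover have "real_chain (sum f A) = (\<Sum>a\<in>A. real_chain (f a))" for f :: "nat => 'a chain" and A
   by (induction A rule: infinite_finite_induct) simp_all
  ultimately show ?case using p by (simp add: chain_boundary_def pairing_sum incidence_def)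
 qed (simp_all add: chain_boundary_diff)
 thus "Poly_Mapping.lookup (real_chain_boundary p (real_chain z)) \<tau> = Poly_Mapping.lookup (real_chain (chain_boundary p z)) \<tau>"
  using lookup_boundary[OF p, of "real_chain z" \<tau>] lookup_pairing[of "real_chain (chain_boundary p z)" \<tau>] by simp
qed

definition scale_chain :: "real => ('b \<Rightarrow>\<^sub>0 real) => 'b \<Rightarrow>\<^sub>0 real" where
 "scale_chain a c = Poly_Mapping.map ((*) a) c"

lemma lookup_scale [simp]: "Poly_Mapping.lookup (scale_chain a c) \<sigma> = a * Poly_Mapping.lookup c \<sigma>"
 by (simp add: scale_chain_def Poly_Mapping.map.rep_eq when_def)

lemma keys_scale: "Poly_Mapping.keys (scale_chain a c) <= Poly_Mapping.keys c" by (auto simp: in_keys_iff)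

lemma pairing_scale: "pairing d (scale_chain a c) = a * pairing d c"
 using pairing_superset[OF _ keys_scale[of a c], of d] by (simp add: pairing_def sum_distrib_left mult.assoc)

lemma l1_norm_scale: "l1_norm (scale_chain a c) = \<bar>a\<bar> * l1_norm c"
 using l1_superset[OF _ keys_scale[of a c]] by (simp add: l1_norm_def sum_distrib_left abs_mult)

lemma l1_norm_nonneg: "0 <= l1_norm c" by (simp add: l1_norm_def sum_nonneg)

lemma boundary_scale: "p ~= 0 ==> real_chain_boundary p (scale_chain a c) = scale_chain a (real_chain_boundary p c)"
 by (rule poly_mapping_eqI) (simp add: lookup_boundary pairing_scale)

lemma keys_real_chain: "Poly_Mapping.keys (real_chain z) = Poly_Mapping.keys z" by (auto simp: in_keys_iff)

lemma real_singular_chain_real_chain: "real_singular_chain p X (real_chain z) \<longleftrightarrow> singular_chain p X z"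
 by (simp add: real_singular_chain_def singular_chain_def keys_real_chain)

lemma l1_norm_chain_map: "l1_norm (real_chain (chain_map p f z)) <= l1_norm (real_chain z)"
proof -
 have "l1_norm (real_chain (chain_map p f z)) <= (\<Sum>\<sigma>\<in>A. \<bar>real_of_int (Poly_Mapping.lookup z \<sigma>)\<bar>)"
  if "finite A" "Poly_Mapping.keys z <= A" for z :: "'b chain" and A
 proof -
  have eq: "chain_map p f z = (\<Sum>\<sigma>\<in>A. frag_cmul (Poly_Mapping.lookup z \<sigma>) (frag_of (simplex_map p f \<sigma>)))"
   unfolding chain_map_def frag_extend_def comp_def using that by (intro sum.mono_neutral_left) (auto simp: in_keys_iff)
  have "l1_norm (real_chain (\<Sum>\<sigma>\<in>A. frag_cmul (Poly_Mapping.lookup z \<sigma>) (frag_of (simplex_map p f \<sigma>)))) \<le>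
    (\<Sum>\<sigma>\<in>A. \<bar>real_of_int (Poly_Mapping.lookup z \<sigma>)\<bar>)" using that(1)
  proof (induction A)
   case (insert a A)
   have "real_chain (frag_cmul m (frag_of \<tau>)) = Poly_Mapping.single \<tau> (real_of_int m)" for m and \<tau> :: "(nat => real) => 'a"
    by (rule poly_mapping_eqI) (simp add: lookup_single when_def)
   thus ?case using insert l1_norm_triangle(1) by (simp add: order_trans[OF l1_norm_triangle(1)])
  qed (simp add: l1_norm_def)
  with eq show ?thesis by simp
 qed
 from this[of "Poly_Mapping.keys z" z] show ?thesis by (simp add: l1_norm_def keys_real_chain)
qed

lemma pairing_chain_map: "pairing d (real_chain (chain_map p f z)) = pairing (%\<sigma>. d (simplex_map p f \<sigma>)) (real_chain z)"
proof -
 have "Poly_Mapping.keys z <= UNIV" by simp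
 thus ?thesis by (induction z rule: frag_induction) (simp_all add: chain_map_diff)
qed

section \<open>The two inequalities\<close>

lemma (in presentation) evaluate_loops:
 assumes \<phi>: "cocycle R H \<phi>" and e: "!!s. s : S ==> \<phi> (seg (edge_map s) 0 1) = perm \<rho> (ev [(s, True)])"
 shows "\<phi> (loop_of S w) = perm \<rho> (project S w)"
proof -
 let ?Q = "filter (%x. fst x : S)"
 have K: "\<phi> K = 0" by (rule cocycle_const[OF \<phi> v])
 have l: "\<phi> (letter_edge S x) = perm \<rho> (ev (?Q [x]))" for x
 proof (cases "fst x : S")
  case True
  have "\<phi> (seg (edge_map (fst x)) 1 0) = - perm \<rho> (ev [(fst x, True)])"
   using cocycle_inverse_segment[OF \<phi> continuous_map_edge[OF True], of 0 1] e[OF True] by simp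
  with perm_word[of \<rho> "[x]"] True e[OF True] show ?thesis by (simp add: letter_edge_def letter_value_def split: if_splits)
 qed (simp add: letter_edge_def K perm_zero)
 have "\<phi> (word_simplex S u) = perm \<rho> (ev (?Q u))" for u
 proof (induction u)
  case (Cons x u)
  have "\<phi> (word_simplex S (x # u)) = \<phi> (letter_edge S x) + \<phi> (word_simplex S u)"
   using tri_word_simplex_Cons[of S x u] \<phi> unfolding tri_def cocycle_def by blast
  moreover have "?Q (x # u) = ?Q [x] @ ?Q u" by simp
  ultimately show ?case using l Cons by (simp only: ev_append perm_add)
 qed (simp add: K perm_zero)
 thus ?thesis by (simp add: loop_of_def project_def)
qed

section \<open>Degrees of relations and the class of the 2-cell\<close>

context presentation
begin

definition relator ("\<rho>") where "\<rho> = ev r"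

lemma relator_nonzero: "\<rho> ~= 0"
 using nontrivial reduced_relator unfolding relator_def by (metis Rep_ev Rep_zero_fg reduce_word_reduced)

definition relation_degree :: "'a fg => int" where
 "relation_degree w = (THE n. Rdeg \<rho> w n)"

lemma relation_degree_eq: "Rdeg \<rho> w n ==> relation_degree w = n"
 unfolding relation_degree_def using Rdeg_unique[OF relator_nonzero] by blast

lemma Rdeg_relation_degree: "perm \<rho> w = 0 ==> Rdeg \<rho> w (relation_degree w)"
 using relation_degree_eq unfolding perm_zero_iff by blast

text \<open>A section of the quotient map; the degree cochain measures how far it is from a
  homomorphism. The value at 0 is normalised so that triangles on constant edges get degree
  0.\<close>

definition representative :: "'a fg set bijection => 'a fg" where
 "representative q = (if q = 0 then 0 else SOME w. perm \<rho> w = q)"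

lemma perm_representative: "q : range (perm \<rho>) ==> perm \<rho> (representative q) = q"
 unfolding representative_def by (auto simp: perm_zero intro: someI)

lemma subgroup_perm: "subgroup_set (range (perm \<rho>))" unfolding subgroup_set_def
proof (intro conjI ballI)
 show "0 : range (perm \<rho>)" by (simp flip: perm_zero[of \<rho>])
 fix x y assume "x : range (perm \<rho>)" "y : range (perm \<rho>)"
 then obtain u w where "x = perm \<rho> u" "y = perm \<rho> w" by blast
 thus "x + y : range (perm \<rho>)" by (simp flip: perm_add)
next
 fix x assume "x : range (perm \<rho>)"
 then obtain u where "x = perm \<rho> u" by blast
 thus "- x : range (perm \<rho>)" by (simp flip: perm_minus)
qed

lemma project_relator: "project S \<rho> = \<rho>"
proof -
 have "filter (%x. fst x : S) r = r" using letters by (auto simp: filter_id_conv image_subset_iff)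
 thus ?thesis using reduced_relator by (simp add: project_def relator_def)
qed

text \<open>A cycle that bounds relative to the rose differs from a boundary by a 2-cycle of the
  rose, and this bounds by \<open>rose_cycle_bounds\<close>.\<close>

lemma relative_injective:
 assumes "singular_chain 2 P z" "chain_boundary 2 z = 0" "homologous_rel 2 P (topspace R) z 0"
 shows "\<exists>e. singular_chain 3 P e & chain_boundary 3 e = z"
proof -
 obtain d e where d: "singular_chain (Suc 2) P d" "singular_chain 2 R e" "chain_boundary (Suc 2) d + e = z"
  using assms(3) presentation_rose(1)[OF letters] unfolding homologous_rel_def singular_relboundary by auto
 have S: "S ~= {}" using letters nontrivial by auto
 have "chain_boundary 2 e = 0" using assms(2) chain_boundary_boundary[OF d(1)] unfolding d(3)[symmetric] by (simp add: chain_boundary_add)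
 from rose_cycle_bounds[OF S d(2) this] obtain f where f: "singular_chain 3 R f" "chain_boundary 3 f = e" by blast
 have "singular_chain 3 P f" using f(1) simplex_rose by (auto simp: singular_chain_def)
 moreover have "Suc 2 = 3" by simp
 ultimately show ?thesis using d f(2) by (intro exI[of _ "d + f"]) (simp add: singular_chain_add chain_boundary_add)
qed

text \<open>The cycle \<open>z\<close> witnesses that the class described in the definition exists,
  and \<open>relative_injective\<close> makes it unique.\<close>

lemma two_cell_class_eq:
 assumes z: "singular_chain 2 P z" "chain_boundary 2 z = 0" "homologous_rel 2 P (topspace R) z cell_chain"
 shows "two_cell_class S r = homologous_rel_set 2 P {} z"
proof -
 have id: "hom_induced 2 P {} P (topspace R) id (homologous_rel_set 2 P {} y) = homologous_rel_set 2 P (topspace R) y"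
  if "singular_relcycle 2 P {} y" for y
  using hom_induced_chain_map[of P P id "{}" "topspace R" 2 y] chain_map_id_gen[of 2 P y id] that by (simp add: singular_cycle)
 have bd: "singular_relcycle 2 (top_of_set (cball 0 1)) (sphere 0 1) (frag_of disk_simplex)"
 proof -
  let ?B = "top_of_set (cball 0 1 :: complex set)"
  have "singular_simplex 1 (subtopology ?B (sphere 0 1)) (singular_face 2 k disk_simplex)" if "k <= 2" for k
  proof -
   have "singular_simplex 1 ?B (singular_face 2 k disk_simplex)"
    using singular_simplex_singular_face[OF singular_simplex_disk, of k] that by simp
   moreover have "k = 0 \<or> k = 1 \<or> k = 2" using that by auto
   ultimately show ?thesis using disk_simplex_faces by (auto simp: singular_simplex_subtopology)
  qed
  hence "singular_chain 1 (subtopology ?B (sphere 0 1)) (chain_boundary 2 (frag_of disk_simplex))"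
   by (simp add: chain_boundary_of) (intro singular_chain_sum singular_chain_cmul, simp add: singular_chain_of)
  thus ?thesis using singular_simplex_disk by (simp add: singular_relcycle singular_chain_of One_nat_def)
 qed
 have "face_map r : sphere 0 1 \<rightarrow> topspace R" using continuous_map_face_boundary[OF letters] by (auto simp: continuous_map_def)
 hence face: "hom_induced 2 (top_of_set (cball 0 1)) (sphere 0 1) P (topspace R) (face_map r) disk_class =
   homologous_rel_set 2 P (topspace R) cell_chain"
  using hom_induced_chain_map[OF continuous_map_face _ bd, of r "topspace R" S] by (simp add: disk_class_def cell_chain_def)
 have carrier: "carrier (homology_group 2 P) = homologous_rel_set 2 P {} ` singular_relcycle_set 2 P {}"
  using carrier_relative_homology_group[of 2 P "{}"] by simp
 have zc: "singular_relcycle 2 P {} z" using z by (simp add: singular_cycle)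
 show ?thesis unfolding two_cell_class_def
 proof (rule the_equality, intro conjI)
  show "homologous_rel_set 2 P {} z : carrier (homology_group 2 P)" unfolding carrier using zc by blast
  show "hom_induced 2 P {} P (topspace R) id (homologous_rel_set 2 P {} z) =
    hom_induced 2 (top_of_set (cball 0 1)) (sphere 0 1) P (topspace R) (face_map r) disk_class"
   unfolding face id[OF zc] using z(3) by (simp add: homologous_rel_set_eq)
  fix \<alpha> assume \<alpha>: "\<alpha> : carrier (homology_group 2 P) & hom_induced 2 P {} P (topspace R) id \<alpha> =
    hom_induced 2 (top_of_set (cball 0 1)) (sphere 0 1) P (topspace R) (face_map r) disk_class"
  then obtain y where y: "\<alpha> = homologous_rel_set 2 P {} y" "singular_relcycle 2 P {} y" unfolding carrier by blast
  with \<alpha> have "homologous_rel 2 P (topspace R) y cell_chain" unfolding face by (simp add: id homologous_rel_set_eq)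
  with z(3) have "homologous_rel 2 P (topspace R) (y - z) (cell_chain - cell_chain)" by (intro homologous_rel_diff)
  then obtain e where "singular_chain 3 P e" "chain_boundary 3 e = y - z"
   using relative_injective[of "y - z"] y(2) z by (auto simp: singular_cycle singular_chain_diff chain_boundary_diff)
  hence "homologous_rel 2 P {} y z" unfolding homologous_rel_def singular_boundary
   by (intro exI[of _ e]) (simp add: numeral_3_eq_3 numeral_2_eq_2)
  thus "\<alpha> = homologous_rel_set 2 P {} z" unfolding y(1) homologous_rel_set_eq .
 qed
qed

end

text \<open>Since \<open>[a, b + B] = [a, b] + b + [a, B] - b\<close>, passing to the \<open>d\<close>-fold power of one commutator
  costs no further commutator; this corresponds to a \<open>d\<close>-sheeted covering of the surface.\<close>

lemma commutator_power:
 assumes x: "Rdeg r x n" "Comm (Suc k) x"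
 shows "\<exists>y. Rdeg r y (int d * n) & Comm (Suc (d * k)) y"
proof -
 obtain a b w where w: "x = a + b - a - b + w" "Comm k w" using x(2) by (cases rule: Comm.cases) auto
 have "\<exists>B W. Comm (d * k) W & Rdeg r (a + B - a - B + W) (int d * n)"
 proof (induction d)
  case 0
  show ?case using Comm.zero Rdeg.zero[of r] by (intro exI[of _ 0]) simp
 next
  case (Suc d)
  then obtain B W where B: "Comm (d * k) W" "Rdeg r (a + B - a - B + W) (int d * n)" by blast
  let ?y = "a + B - a - B + W" and ?W = "(b + W - b) + w"
  have "a + (b + B) - a - (b + B) + ?W = x + (- w + (b + ?y - b) + w)"
   by (simp add: w(1) add.assoc minus_add diff_conv_add_uminus del: add_uminus_conv_diff)
  moreover have "Rdeg r (x + (- w + (b + ?y - b) + w)) (n + int d * n)" by (intro Rdeg_add x(1) Rdeg_conj' Rdeg_conj B(2))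
  moreover have "Comm (Suc d * k) ?W" using Comm_add[OF Comm_conj[OF B(1)] w(2)] by (simp add: add.commute)
  ultimately show ?case by (intro exI[of _ "b + B"] exI[of _ ?W]) (simp add: algebra_simps)
 qed
 thus ?thesis using Comm.Suc by blast
qed

text \<open>The relations that compare the representatives with the words u, v and u + v yield a
  primitive for the degree of A + B - C.\<close>

lemma (in presentation) degree_identity:
 assumes "Rdeg \<rho> (A - u) a" "Rdeg \<rho> (B - v) b" "Rdeg \<rho> (C - (u + v)) c"
 shows "Rdeg \<rho> (A + B - C) (a + b - c)"
proof -
 have "A + B - C = (A - u) + (u + (B - v) - u) - (C - (u + v))"
  by (simp add: add.assoc minus_add diff_conv_add_uminus del: add_uminus_conv_diff)
 thus ?thesis using Rdeg_diff[OF Rdeg_add[OF assms(1) Rdeg_conj[OF assms(2)]] assms(3)] by metis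
qed

section \<open>The norm estimates in the classifying space\<close>

locale classified_presentation = presentation S r for S :: "'a set" and r :: "'a word" +
 fixes X :: "'x topology" and c :: "'a cell_point => 'x"
 assumes X: "classifying_extension S r X c" and commutators: "\<exists>k. Comm k \<rho>"
begin

lemma perm_relator: "perm \<rho> \<rho> = 0" using Rdeg_rel(1) perm_zero_iff by blast

lemma relator_value: "sum_list (map (letter_value (%s. perm \<rho> (ev [(s, True)]))) r) = 0"
 unfolding perm_word using perm_relator by (simp add: relator_def)

lemma continuous_map_c: "continuous_map P X c" by (rule classifying_cocycle(1)[OF X subgroup_perm _ letters relator_value]) simp

text \<open>The fan over the relator itself, a relation of degree 1, closes to a cycle that
  represents minus the 2-cell; its negative is the cycle wanted.\<close>

lemma fundamental_cycle:
 obtains z where "singular_chain 2 P z" "chain_boundary 2 z = 0" "homologous_rel 2 P (topspace R) z cell_chain"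
  "!!d D. rose_primitive d D ==>
   (\<forall>\<sigma>. triangle P \<sigma> (loop_of S \<rho>) K K --> d \<sigma> = 0) ==> (\<forall>\<sigma>. triangle P \<sigma> K K K --> d \<sigma> = 0) ==>
   pairing d (real_chain z) = D 0 - D \<rho>"
proof -
 obtain k where "Comm k \<rho>" using commutators ..
 from commutator_cycle[OF this, folded relator_def, OF Rdeg_rel(1)] obtain z where z: "singular_chain 2 P z" "chain_boundary 2 z = 0"
  "homologous_rel 2 P (topspace R) z (frag_cmul (- 1) cell_chain)"
  "\<forall>d D. rose_primitive d D -->
   (\<forall>\<sigma>. triangle P \<sigma> (loop_of S \<rho>) K K --> d \<sigma> = 0) --> (\<forall>\<sigma>. triangle P \<sigma> K K K --> d \<sigma> = 0) -->
   pairing d (real_chain z) = D \<rho> - D 0" by (elim exE conjE)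
 show thesis
 proof (rule that[of "0 - z"])
  have "homologous_rel 2 P (topspace R) (0 - z) (0 - frag_cmul (- 1) cell_chain)" by (intro homologous_rel_diff z(3)) simp
  thus "homologous_rel 2 P (topspace R) (0 - z) cell_chain" by simp
  show "singular_chain 2 P (0 - z)" by (intro singular_chain_diff z(1)) simp
  show "chain_boundary 2 (0 - z) = 0" using z(2) by (simp only: chain_boundary_diff) simp
  fix d :: "((nat => real) => 'a cell_point) => real" and D :: "'a fg => real"
  assume as: "rose_primitive d D"
   "\<forall>\<sigma>. triangle P \<sigma> (loop_of S \<rho>) K K --> d \<sigma> = 0" "\<forall>\<sigma>. triangle P \<sigma> K K K --> d \<sigma> = 0"
  from z(4)[THEN spec, THEN spec, THEN mp, OF as(1), THEN mp, OF as(2), THEN mp, OF as(3)] have "pairing d (real_chain z) = D \<rho> - D 0" .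
  thus "pairing d (real_chain (0 - z)) = D 0 - D \<rho>" by (simp only: real_chain_simps pairing_linear pairing_single)
 qed
qed

lemma fundamental_class_eq:
 assumes z: "singular_chain 2 P z" "chain_boundary 2 z = 0" "homologous_rel 2 P (topspace R) z cell_chain"
 shows "fundamental_class S r X c = homologous_rel_set 2 X {} (chain_map 2 c z)"
 using hom_induced_chain_map[OF continuous_map_c, of "{}" "{}" 2 z] z
 unfolding fundamental_class_def two_cell_class_eq[OF z] by (simp add: singular_cycle)

lemma change_of_coefficients_iff:
 assumes z: "singular_chain 2 P z" "chain_boundary 2 z = 0" "homologous_rel 2 P (topspace R) z cell_chain"
 shows "a : change_of_coefficients 2 X (fundamental_class S r X c) \<longleftrightarrow> real_singular_cycle 2 X a &
  (\<exists>z'. homologous_rel 2 X {} (chain_map 2 c z) z' & real_homologous 2 X a (real_chain z'))"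
 unfolding change_of_coefficients_def fundamental_class_eq[OF z] real_chain_def Bex_def mem_Collect_eq ..

text \<open>The cycle of \<open>commutator_cycle\<close> represents - n times the class of the
  2-cell already in the presentation complex, so its image divided by - n is a real cycle in the
  fundamental class.\<close>

lemma volume_le:
 assumes y: "Rdeg \<rho> y n" "Comm k y" and n: "n ~= 0"
 shows "simplicial_volume S r X c * \<bar>real_of_int n\<bar> <= 4 * real k + 2"
proof -
 obtain z1 where z1: "singular_chain 2 P z1" "chain_boundary 2 z1 = 0" "homologous_rel 2 P (topspace R) z1 cell_chain"
  using fundamental_cycle by metis
 obtain z where z: "singular_chain 2 P z" "chain_boundary 2 z = 0"
  "homologous_rel 2 P (topspace R) z (frag_cmul (- n) cell_chain)" "l1_norm (real_chain z) <= 4 * real k + 2"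
  using commutator_cycle[OF y(2) y(1)[unfolded relator_def]] by blast
 let ?w = "z + frag_cmul n z1"
 have "frag_cmul n (z1 - cell_chain) = frag_cmul n z1 - frag_cmul n cell_chain"
  by (rule poly_mapping_eqI) (simp add: lookup_minus algebra_simps)
 hence "homologous_rel 2 P (topspace R) (frag_cmul n z1) (frag_cmul n cell_chain)"
  using singular_relboundary_cmul[of 2 P "topspace R" "z1 - cell_chain" n] z1(3) by (simp add: homologous_rel_def)
 from homologous_rel_add[OF z(3) this] have "homologous_rel 2 P (topspace R) ?w 0" by (simp flip: frag_cmul_distrib)
 moreover have "singular_chain 2 P ?w" "chain_boundary 2 ?w = 0"
  using z z1 by (simp_all add: singular_chain_add singular_chain_cmul chain_boundary_add chain_boundary_cmul)
 ultimately obtain e where e: "singular_chain 3 P e" "chain_boundary 3 e = ?w" using relative_injective by blast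
 let ?c = "chain_map 2 c"
 define a where "a = scale_chain (- 1 / real_of_int n) (real_chain (?c z))"
 have chain: "singular_chain p X (chain_map p c x)" if "singular_chain p P x" for p x
  using singular_chain_chain_map[OF that continuous_map_c] .
 have scaled: "real_singular_chain p X (scale_chain t (real_chain x))" if "singular_chain p X x" for p t x
  using keys_scale[of t "real_chain x"] that unfolding real_singular_chain_real_chain[symmetric] real_singular_chain_def by blast
 have "chain_boundary 2 (?c z) = 0" using chain_boundary_chain_map[OF z(1), of c] z(2) by simp
 hence "real_singular_cycle 2 X a" unfolding real_singular_cycle_def a_def using scaled[OF chain[OF z(1)]]
  by (simp add: boundary_scale real_chain_boundary_real_chain) (rule poly_mapping_eqI, simp)
 moreover have "real_homologous 2 X a (real_chain (?c z1))" unfolding real_homologous_def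
 proof (intro exI conjI)
  let ?e = "scale_chain (- 1 / real_of_int n) (real_chain (chain_map 3 c e))"
  have 3: "Suc 2 = 3" by simp
  show "real_singular_chain (Suc 2) X ?e" unfolding 3 by (rule scaled[OF chain[OF e(1)]])
  have "chain_boundary 3 (chain_map 3 c e) = ?c z + frag_cmul n (?c z1)"
   using chain_boundary_chain_map[OF e(1), of c] e(2) by (simp add: chain_map_add)
  hence "real_chain_boundary 3 ?e = scale_chain (- 1 / real_of_int n) (real_chain (?c z + frag_cmul n (?c z1)))"
   by (simp add: boundary_scale real_chain_boundary_real_chain del: real_chain_simps)
  also have "\<dots> = a - real_chain (?c z1)" using n by (intro poly_mapping_eqI) (simp add: a_def lookup_add lookup_minus field_simps)
  finally show "real_chain_boundary (Suc 2) ?e = a - real_chain (?c z1)" unfolding 3 .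
 qed
 ultimately have "a : change_of_coefficients 2 X (fundamental_class S r X c)"
  unfolding change_of_coefficients_iff[OF z1] by (intro conjI exI[of _ "?c z1"]) simp_all
 moreover have "bdd_below (l1_norm ` change_of_coefficients 2 X (fundamental_class S r X c))"
  by (rule bdd_belowI[of _ 0]) (auto simp: l1_norm_nonneg)
 ultimately have "simplicial_volume S r X c <= l1_norm a" unfolding simplicial_volume_def l1_seminorm_def by (intro cINF_lower)
 also have "\<dots> <= (4 * real k + 2) / \<bar>real_of_int n\<bar>"
  using order_trans[OF l1_norm_chain_map[of 2 c z] z(4)] by (simp add: a_def l1_norm_scale divide_right_mono)
 finally show ?thesis using n by (simp add: pos_le_divide_eq)
qed

lemma volume_nonneg: "change_of_coefficients 2 X (fundamental_class S r X c) ~= {}" "0 <= simplicial_volume S r X c"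
proof -
 obtain z1 where z1: "singular_chain 2 P z1" "chain_boundary 2 z1 = 0" "homologous_rel 2 P (topspace R) z1 cell_chain"
  using fundamental_cycle by metis
 let ?z = "chain_map 2 c z1"
 have "chain_boundary 2 ?z = 0" using chain_boundary_chain_map[OF z1(1), of c] z1(2) by simp
 hence "real_singular_cycle 2 X (real_chain ?z)" using singular_chain_chain_map[OF z1(1) continuous_map_c]
  by (simp add: real_singular_cycle_def real_singular_chain_real_chain real_chain_boundary_real_chain)
 moreover have "real_homologous 2 X (real_chain ?z) (real_chain ?z)"
  unfolding real_homologous_def by (intro exI[of _ 0]) (simp add: real_singular_chain_def real_chain_boundary_def)
 ultimately have "real_chain ?z : change_of_coefficients 2 X (fundamental_class S r X c)"
  unfolding change_of_coefficients_iff[OF z1] by (intro conjI exI[of _ ?z]) simp_all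
 thus "change_of_coefficients 2 X (fundamental_class S r X c) ~= {}" by blast
 thus "0 <= simplicial_volume S r X c" unfolding simplicial_volume_def l1_seminorm_def by (intro cINF_greatest l1_norm_nonneg)
qed

text \<open>Each component is treated separately. If its relation has degree n and k' + 1
  commutators, there is one of degree d n with d k' + 1 commutators, so the volume times |n| is at
  most 4 k' + 6 / d; here 6 is the constant 2 of the fan plus 4 for the additional commutator. In
  the limit 4 k' remains, which is at most - 2 chi.\<close>

lemma volume_le_diagram:
 assumes D: "D : van_kampen_diagrams r"
 shows "simplicial_volume S r X c * \<bar>real_of_int (diagram_degree r D)\<bar> <= - 2 * real_of_int (chi_minus D)"
proof -
 let ?v = "simplicial_volume S r X c" and ?n = "%K. \<Sum>i\<in>K. disk_sign r (disks D ! i)"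
 have comp: "?v * \<bar>real_of_int (?n K)\<bar> <= - 2 * real_of_int (min 0 (euler_characteristic D K))" if K: "K : components D" for K
 proof (cases "?n K = 0")
  case False
  obtain w k where w: "Rdeg \<rho> w (?n K)" "Comm k w" "2 * int k <= 2 - euler_characteristic D K"
   using component_relation[OF van_kampen_gluing[OF D] K van_kampen_Rdeg[OF D]] unfolding relator_def by blast
  \<comment> \<open>A relation of nonzero degree is nontrivial, so it needs at least one
    commutator.\<close>
  obtain k' where k: "k = Suc k'"
  proof (cases k)
   case 0
   hence "w = 0" using w(2) by (auto elim: Comm.cases)
   thus ?thesis using False Rdeg_unique[OF relator_nonzero w(1)] Rdeg.zero by blast
  qed
  have d: "?v * \<bar>real_of_int (?n K)\<bar> <= 4 * real k' + 6 / real (Suc d)" for d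
  proof -
   obtain y where y: "Rdeg \<rho> y (int (Suc d) * ?n K)" "Comm (Suc (Suc d * k')) y"
    using commutator_power[OF w(1) w(2)[unfolded k]] by blast
   have "?v * \<bar>real_of_int (int (Suc d) * ?n K)\<bar> <= 4 * real (Suc (Suc d * k')) + 2" by (rule volume_le[OF y]) (use False in simp)
   also have "\<dots> = (4 * real k' + 6 / real (Suc d)) * real (Suc d)" by (simp add: field_simps)
   also have "?v * \<bar>real_of_int (int (Suc d) * ?n K)\<bar> = ?v * \<bar>real_of_int (?n K)\<bar> * real (Suc d)"
    by (simp add: abs_mult)
   finally show ?thesis by (simp only: mult_le_cancel_right)
  qed
  have "(%d. 4 * real k' + 6 / real (Suc d)) \<longlonglongrightarrow> 4 * real k' + 0"
   by (intro tendsto_intros LIMSEQ_Suc[OF lim_const_over_n])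
  hence "?v * \<bar>real_of_int (?n K)\<bar> <= 4 * real k' + 0" by (rule Lim_bounded2) (use d in auto)
  also have "\<dots> <= - 2 * real_of_int (min 0 (euler_characteristic D K))" using w(3) unfolding k by simp
  finally show ?thesis .
 qed simp
 have "?v * \<bar>real_of_int (diagram_degree r D)\<bar> <= ?v * (\<Sum>K\<in>components D. \<bar>real_of_int (?n K)\<bar>)"
  unfolding diagram_degree_components[OF D] of_int_sum by (intro mult_left_mono sum_abs volume_nonneg)
 also have "\<dots> <= (\<Sum>K\<in>components D. - 2 * real_of_int (min 0 (euler_characteristic D K)))"
  unfolding sum_distrib_left by (rule sum_mono[OF comp])
 also have "\<dots> = - 2 * real_of_int (chi_minus D)" by (simp add: chi_minus_def sum_distrib_left sum_negf)
 finally show ?thesis .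
qed

text \<open>A cocycle labels the edges of \<open>X\<close> by elements of the quotient, and
  representatives turn each singular triangle into a relation. Its degree \<open>d\<close> is a
  2-cocycle on \<open>X\<close> with the value 1 on the fundamental class, so a real cycle in this
  class is the input that \<open>real_cycle_relation\<close> asks for.\<close>

lemma chain_diagram:
 assumes x: "x : change_of_coefficients 2 X (fundamental_class S r X c)" and \<epsilon>: "\<epsilon> > 0"
 shows "\<exists>D\<in>van_kampen_diagrams r. diagram_degree r D ~= 0 &
  - 2 * real_of_int (chi_minus D) / real_of_int \<bar>diagram_degree r D\<bar> <= (1 + \<epsilon>) * l1_norm x"
proof -
 let ?H = "range (perm \<rho>)" and ?rep = representative
 have "\<exists>\<phi>. cocycle X ?H \<phi> & (\<forall>s\<in>S. \<phi> (simplex_map 1 c (seg (edge_map s) 0 1)) = perm \<rho> (ev [(s, True)]))"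
  by (rule classifying_cocycle(2)[OF X subgroup_perm _ letters relator_value]) simp
 then obtain \<phi> where \<phi>: "cocycle X ?H \<phi>" "\<forall>s\<in>S. \<phi> (simplex_map 1 c (seg (edge_map s) 0 1)) = perm \<rho> (ev [(s, True)])"
  by (elim exE conjE)
 have \<phi>P: "cocycle P ?H (%p. \<phi> (simplex_map 1 c p))" by (rule cocycle_pullback[OF \<phi>(1) continuous_map_c])
 hence \<phi>R: "cocycle R ?H (%p. \<phi> (simplex_map 1 c p))" using triangle_rose simplex_rose unfolding cocycle_def by blast
 have loops: "\<phi> (simplex_map 1 c (loop_of S w)) = perm \<rho> (project S w)" for w
  by (rule evaluate_loops[OF \<phi>R]) (use \<phi>(2) in simp)
 have \<phi>K: "\<phi> (simplex_map 1 c K) = 0" using loops[of 0] by (simp add: loop_of_0 project_def perm_zero)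
 have rep0: "?rep 0 = 0" by (simp add: representative_def)
 define val where "val p q s = ?rep (\<phi> p) + ?rep (\<phi> q) - ?rep (\<phi> s)" for p q s
 define d where "d \<sigma> = relation_degree (val (singular_face 2 2 \<sigma>) (singular_face 2 0 \<sigma>) (singular_face 2 1 \<sigma>))" for \<sigma>
 have d: "Rdeg \<rho> (val p q s) (d \<sigma>)" if t: "triangle X \<sigma> p q s" for \<sigma> p q s
 proof -
  have "\<phi> s = \<phi> p + \<phi> q" "\<phi> p : ?H" "\<phi> q : ?H" "\<phi> s : ?H"
   using t \<phi>(1) triangle_edges[OF t] unfolding cocycle_def by blast+
  hence "perm \<rho> (val p q s) = 0"
   unfolding val_def diff_conv_add_uminus by (simp add: perm_add perm_minus perm_representative del: add_uminus_conv_diff)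
  with Rdeg_relation_degree t show ?thesis unfolding d_def triangle_def by metis
 qed
 have face: "triangle X \<sigma> (singular_face 2 2 \<sigma>) (singular_face 2 0 \<sigma>) (singular_face 2 1 \<sigma>)" if "singular_simplex 2 X \<sigma>" for \<sigma>
  using that by (simp add: triangle_def)
 \<comment> \<open>The two ways of composing the edges 01, 12 and 23 give the same word once one
   face is conjugated, and conjugation does not change degrees. This is where the centrality of the
   extension enters.\<close>
 have closed: "d (singular_face 3 0 \<Sigma>) - d (singular_face 3 1 \<Sigma>) + d (singular_face 3 2 \<Sigma>) - d (singular_face 3 3 \<Sigma>) = 0"
  if \<Sigma>: "singular_simplex 3 X \<Sigma>" for \<Sigma>
 proof -
  note f = tetrahedron_faces[OF \<Sigma>]
  let ?f = "%i. singular_face 3 i \<Sigma>"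
  let ?A01 = "singular_face 2 2 (?f 2)" and ?A12 = "singular_face 2 2 (?f 0)" and ?A23 = "singular_face 2 0 (?f 0)"
   and ?A02 = "singular_face 2 2 (?f 1)" and ?A13 = "singular_face 2 1 (?f 0)" and ?A03 = "singular_face 2 1 (?f 1)"
  have t: "triangle X (?f 0) ?A12 ?A23 ?A13" "triangle X (?f 1) ?A02 ?A23 ?A03"
   "triangle X (?f 2) ?A01 ?A13 ?A03" "triangle X (?f 3) ?A01 ?A12 ?A02" using f by (simp_all add: triangle_def)
  have "val ?A01 ?A12 ?A02 + val ?A02 ?A23 ?A03 =
    (?rep (\<phi> ?A01) + val ?A12 ?A23 ?A13 - ?rep (\<phi> ?A01)) + val ?A01 ?A13 ?A03"
   unfolding val_def by (simp add: add.assoc diff_conv_add_uminus minus_add del: add_uminus_conv_diff)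
  moreover note Rdeg_add[OF d[OF t(4)] d[OF t(2)]] Rdeg_add[OF Rdeg_conj[OF d[OF t(1)]] d[OF t(3)]]
  ultimately have "d (?f 3) + d (?f 1) = d (?f 0) + d (?f 2)" using Rdeg_unique[OF relator_nonzero] by metis
  thus ?thesis by simp
 qed
 let ?d = "%\<sigma>. real_of_int (d \<sigma>)"
 have s3: "(\<Sum>k\<le>3. (- 1) ^ k * g k) = g 0 - g 1 + g 2 - g 3" for g :: "nat => real"
  by (simp add: numeral_3_eq_3 numeral_2_eq_2 One_nat_def)
 have s2: "(\<Sum>k\<le>2. (- 1) ^ k * g k) = g 0 - g 1 + g 2" for g :: "nat => real" by (simp add: numeral_2_eq_2 One_nat_def)
 have bdry: "pairing ?d (real_chain_boundary 3 e) = 0" if e: "real_singular_chain 3 X e" for e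
 proof -
  have "?d (singular_face 3 0 \<Sigma>) - ?d (singular_face 3 1 \<Sigma>) + ?d (singular_face 3 2 \<Sigma>) - ?d (singular_face 3 3 \<Sigma>) = 0"
   if "\<Sigma> : Poly_Mapping.keys e" for \<Sigma>
   using closed[of \<Sigma>] e that unfolding real_singular_chain_def by (simp flip: of_int_add of_int_diff) blast
  thus ?thesis by (simp add: pairing_boundary s3) (simp add: pairing_def)
 qed
 obtain z where z: "singular_chain 2 P z" "chain_boundary 2 z = 0" "homologous_rel 2 P (topspace R) z cell_chain"
  and pz: "!!d D. rose_primitive d D ==>
   (\<forall>\<sigma>. triangle P \<sigma> (loop_of S \<rho>) K K --> d \<sigma> = 0) ==> (\<forall>\<sigma>. triangle P \<sigma> K K K --> d \<sigma> = 0) ==>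
   pairing d (real_chain z) = D 0 - D \<rho>" by (rule fundamental_cycle) (rule that)
 \<comment> \<open>The chosen representative of the value of a loop differs from the projected word
   by a relation, and the degree of this relation is a primitive of \<open>d\<close> in the
   rose.\<close>
 define D where "D w = relation_degree (?rep (perm \<rho> (project S w)) - project S w)" for w
 have D: "Rdeg \<rho> (?rep (perm \<rho> (project S w)) - project S w) (D w)" for w unfolding D_def by (rule Rdeg_relation_degree)
   (simp add: diff_conv_add_uminus perm_add perm_minus perm_representative del: add_uminus_conv_diff)
 let ?d' = "%\<sigma>. ?d (simplex_map 2 c \<sigma>)"
 have tc: "Rdeg \<rho> (val (simplex_map 1 c p) (simplex_map 1 c q) (simplex_map 1 c s)) (d (simplex_map 2 c \<sigma>))"
  if "triangle P \<sigma> p q s" for \<sigma> p q s by (rule d[OF triangle_simplex_map[OF that continuous_map_c]])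
 have zero: "?d' \<sigma> = 0" if "triangle P \<sigma> p K K" "\<phi> (simplex_map 1 c p) = 0" for \<sigma> p
  using tc[OF that(1)] that(2) Rdeg_unique[OF relator_nonzero _ Rdeg.zero] by (simp add: val_def \<phi>K rep0)
 have "pairing ?d' (real_chain z) = real_of_int (D 0) - real_of_int (D \<rho>)"
 proof (rule pz[of ?d' "%w. real_of_int (D w)"], intro allI impI)
  fix \<sigma> u w assume "triangle R \<sigma> (loop_of S u) (loop_of S w) (loop_of S (u + w))"
  from tc[OF triangle_rose[OF this]] have "Rdeg \<rho> (?rep (perm \<rho> (project S u)) + ?rep (perm \<rho> (project S w)) - ?rep (perm \<rho> (project S (u + w)))) (d (simplex_map 2 c \<sigma>))"
   by (simp add: val_def loops)
  moreover have "Rdeg \<rho> (?rep (perm \<rho> (project S u)) + ?rep (perm \<rho> (project S w)) - ?rep (perm \<rho> (project S (u + w)))) (D u + D w - D (u + w))"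
   using degree_identity[OF D[of u] D[of w] D[of "u + w", unfolded project_add]] by (simp add: project_add)
  ultimately have "d (simplex_map 2 c \<sigma>) = D u + D w - D (u + w)" by (rule Rdeg_unique[OF relator_nonzero])
  thus "?d' \<sigma> = real_of_int (D u) + real_of_int (D w) - real_of_int (D (u + w))" by simp
 qed (use zero \<phi>K loops[of \<rho>] perm_relator project_relator in auto)
 moreover have "Rdeg \<rho> 0 (D 0)" "Rdeg \<rho> (- \<rho>) (D \<rho>)"
  using D[of 0] D[of \<rho>] by (simp_all add: project_relator perm_relator rep0 perm_zero project_def[of S 0])
 \<comment> \<open>The value of the relator is represented by 0, so the difference 0 - \<rho> has
   degree - 1. This makes the value on the fundamental cycle equal to 1.\<close>
 hence "D 0 = 0" "D \<rho> = - 1" using Rdeg_unique[OF relator_nonzero _ Rdeg.zero] Rdeg_unique[OF relator_nonzero _ Rdeg_rel(2)] by blast+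
 ultimately have pz1: "pairing ?d (real_chain (chain_map 2 c z)) = 1" by (simp add: pairing_chain_map)
 obtain z' where xc: "real_singular_cycle 2 X x" and z': "homologous_rel 2 X {} (chain_map 2 c z) z'" "real_homologous 2 X x (real_chain z')"
  using x unfolding change_of_coefficients_iff[OF z] by (elim exE conjE)
 have "Suc 2 = 3" by simp
 with z' obtain e e' where e: "singular_chain 3 X e" "chain_boundary 3 e = chain_map 2 c z - z'"
  and e': "real_singular_chain 3 X e'" "real_chain_boundary 3 e' = x - real_chain z'"
  unfolding homologous_rel_def singular_boundary real_homologous_def by metis
 have "pairing ?d x = pairing ?d (real_chain z')" using bdry[OF e'(1)] unfolding e'(2) by simp
 moreover have "pairing ?d (real_chain (chain_map 2 c z)) = pairing ?d (real_chain z')"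
  using bdry[of "real_chain e"] e by (simp add: real_singular_chain_real_chain real_chain_boundary_real_chain)
 ultimately have px: "pairing ?d x = 1" using pz1 by simp
 let ?I = "Poly_Mapping.keys x" and ?f = "%k \<sigma>. \<phi> (singular_face 2 k \<sigma>)"
 have simp_keys: "singular_simplex 2 X \<sigma>" if "\<sigma> : ?I" for \<sigma>
  using that xc unfolding real_singular_cycle_def real_singular_chain_def by blast
 \<comment> \<open>Edges are identified when \<phi> gives them the same label, and the boundary
   still vanishes after this identification.\<close>
 have cyc: "(\<Sum>\<sigma>\<in>?I. Poly_Mapping.lookup x \<sigma> * (of_bool (?f 2 \<sigma> = q) + of_bool (?f 0 \<sigma> = q) - of_bool (?f 1 \<sigma> = q))) = 0" for q
 proof -
  have "pairing (%\<tau>. of_bool (\<phi> \<tau> = q)) (real_chain_boundary 2 x) = 0" using xc by (simp add: real_singular_cycle_def)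
  thus ?thesis by (simp add: pairing_boundary s2) (simp add: pairing_def algebra_simps)
 qed
 have deg: "Rdeg \<rho> (?rep (?f 2 \<sigma>) + ?rep (?f 0 \<sigma>) - ?rep (?f 1 \<sigma>)) (d \<sigma>)" if "\<sigma> : ?I" for \<sigma>
  using d[OF face[OF simp_keys[OF that]]] by (simp add: val_def)
 have one: "(\<Sum>\<sigma>\<in>?I. Poly_Mapping.lookup x \<sigma> * of_int (d \<sigma>)) = 1" using px by (simp add: pairing_def)
 obtain y k n where y: "n ~= 0" "Rdeg \<rho> y n" "Comm k y"
  "max 0 (4 * real k - 4) <= (1 + \<epsilon>) * (\<Sum>\<sigma>\<in>?I. \<bar>Poly_Mapping.lookup x \<sigma>\<bar>) * \<bar>of_int n\<bar>"
  using real_cycle_relation[OF finite_keys cyc deg one \<epsilon>] by blast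
 obtain E where E: "E : van_kampen_diagrams r" "diagram_degree r E = - n" "chi_minus E >= min 0 (2 - 2 * int k)"
  using relation_diagram[OF y(2,3)[unfolded relator_def]] relator_nonzero unfolding relator_def by blast
 have "- 2 * real_of_int (chi_minus E) <= max 0 (4 * real k - 4)"
 proof -
  have "real_of_int (min 0 (2 - 2 * int k)) <= real_of_int (chi_minus E)" using E(3) by (simp only: of_int_le_iff)
  thus ?thesis by (simp add: min_def max_def split: if_splits)
 qed
 also note y(4)
 finally have "- 2 * real_of_int (chi_minus E) / \<bar>real_of_int n\<bar> <= (1 + \<epsilon>) * l1_norm x"
  using y(1) by (subst pos_divide_le_eq) (simp_all add: l1_norm_def)
 thus ?thesis using E y(1) by (intro bexI[of _ E]) auto
qed

end

theorem proposition4p2: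
  fixes S :: "'a set" and r :: "'a word"
    and X :: "'x topology" and c :: "'a cell_point \<Rightarrow> 'x"
  assumes "r \<in> derived (free_group S) (carrier (free_group S)) - {\<one>\<^bsub>free_group S\<^esub>}"
    and "cyclically_reduced r"
    and "classifying_extension S r X c"
  shows "simplicial_volume S r X c =
    (INF D \<in> {D \<in> van_kampen_diagrams r. diagram_degree r D \<noteq> 0}.
       - 2 * real_of_int (chi_minus D) / real_of_int \<bar>diagram_degree r D\<bar>)"
    (is "_ = (INF D \<in> ?T. ?q D)")
proof -
 have "r : carrier (free_group S)" using group.derived_in_carrier[OF group_free_group, of "carrier (free_group S)" S] assms(1) by blast
 hence p: "presentation S r" using assms(1) by unfold_locales (auto simp: free_group_def)
 obtain k where "Comm k (ev r)" using derived_imp_Comm assms(1) by blast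
 then interpret classified_presentation S r X c by (intro classified_presentation.intro p classified_presentation_axioms.intro assms(3))
   (auto simp: presentation.relator_def[OF p])
 have ne: "?T ~= {}" using volume_nonneg(1) chain_diagram[of _ 1] by fastforce
 have "?q D >= 0" if "D : ?T" for D
 proof -
  have "chi_minus D <= 0" unfolding chi_minus_def by (rule sum_nonpos) simp
  thus ?thesis by (simp add: divide_nonpos_nonneg)
 qed
 hence bdd: "bdd_below (?q ` ?T)" by (intro bdd_belowI[of _ 0]) blast
 show ?thesis
 proof (rule antisym)
  show "simplicial_volume S r X c <= (INF D \<in> ?T. ?q D)"
  proof (rule cINF_greatest[OF ne])
   fix D assume D: "D : ?T"
   hence "D : van_kampen_diagrams r" "diagram_degree r D ~= 0" by auto
   with volume_le_diagram[of D] show "simplicial_volume S r X c <= ?q D" unfolding of_int_abs by (subst pos_le_divide_eq) auto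
  qed
  have "(INF D \<in> ?T. ?q D) <= l1_norm x" if x: "x : change_of_coefficients 2 X (fundamental_class S r X c)" for x
  proof (rule field_le_epsilon)
   fix e :: real assume "e > 0"
   \<comment> \<open>The added 1 keeps the denominator positive when the norm is 0.\<close>
   define \<epsilon> where "\<epsilon> = e / (l1_norm x + 1)"
   have pos: "l1_norm x + 1 > 0" using l1_norm_nonneg[of x] by linarith
   hence "\<epsilon> > 0" using \<open>e > 0\<close> by (simp add: \<epsilon>_def)
   from chain_diagram[OF x this] obtain D where D: "D : ?T" "?q D <= (1 + \<epsilon>) * l1_norm x" by blast
   have "(INF D \<in> ?T. ?q D) <= ?q D" by (rule cINF_lower[OF bdd D(1)])
   also note D(2)
   also have "(1 + \<epsilon>) * l1_norm x <= l1_norm x + \<epsilon> * (l1_norm x + 1)"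
    using \<open>\<epsilon> > 0\<close> by (simp add: algebra_simps)
   also have "\<epsilon> * (l1_norm x + 1) = e" using pos by (simp add: \<epsilon>_def)
   finally show "(INF D \<in> ?T. ?q D) <= l1_norm x + e" .
  qed
  thus "(INF D \<in> ?T. ?q D) <= simplicial_volume S r X c"
   unfolding simplicial_volume_def l1_seminorm_def by (intro cINF_greatest volume_nonneg(1))
 qed
qed

end
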